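(* Let $\mathbf{C}$ be a compact dagger category and let $\mathbf{P}$ be a compact dagger subcategory of $\mathbf{C}$. If there is a decoherence structure with purification on $(\mathbf{C},\mathbf{P})$, then there is an isomorphism $\mathrm{CP}^*[\mathbf{P}]\simeq\mathbf{C}$ of compact dagger categories.
   Context: Compact dagger categories: symmetric monoidal dagger categories (with unitary coherence isomorphisms) in which every object $A$ has a dual $A^*$ with a unit $\eta_A\colon I\to A^*\otimes A$ and a counit $\varepsilon_A:=\eta_A^\dagger\colon A^*\otimes A\to I$, where $\varepsilon_A\circ\sigma_{A,A^*}=:\mathrm{cap}_A\colon A\otimes A^*\to I$ (with $\sigma$ the symmetry) and $\eta_A$ satisfy the snake equations. Duals are chosen so that $(A\otimes B)^*=B^*\otimes A^*$. For $f\colon A\to B$, write $f_*:=(f^\dagger)^*\colon A^*\to B^*$; since $(-)_*$ reverses tensor products, $f\colon A\to X\otimes B$ gives $f_*\colon A^*\to B^*\otimes X^*$. Coherence isomorphisms are suppressed in formulas. An isomorphism of compact dagger categories is an invertible monoidal dagger functor, i.e. a (symmetric) monoidal functor preserving daggers with unitary coherence maps. A compact dagger subcategory inherits tensor products, unit, dagger and duals; it need not contain every object. For $f\colon A\to X\otimes B$ in $\mathbf{P}$, put $$\mathrm{Dbl}(f):=(\mathrm{id}_{B^*}\otimes\varepsilon_X\otimes\mathrm{id}_B)\circ(f_*\otimes f)\colon A^*\otimes A\to B^*\otimes B .$$ An environment structure on $(\mathbf{C},\mathbf{P})$ consists of a morphism $\top_A\colon A\to I$ of $\mathbf{C}$ for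 each object $A$ of $\mathbf{P}$ such that: $\top_{A\otimes B}=\top_A\otimes\top_B$; $\top_I=\mathrm{id}_I$; $\top_A=\mathrm{cap}_A\circ(\mathrm{id}_A\otimes\top_{A^*}^\dagger)$; and for all $f\colon A\to X\otimes B$ and $g\colon A\to Y\otimes B$ in $\mathbf{P}$, $\mathrm{Dbl}(f)=\mathrm{Dbl}(g)$ if and only if $(\top_X\otimes\mathrm{id}_B)\circ f=(\top_Y\otimes\mathrm{id}_B)\circ g$. A special dagger Frobenius structure in $\mathbf{P}$ is a triple $\mathcal{A}=(A,\mu,u)$ of an object $A$ and morphisms $\mu\colon A\otimes A\to A$, $u\colon I\to A$ in $\mathbf{P}$ such that $\mu$ is associative with two-sided unit $u$, $\mu\circ\mu^\dagger=\mathrm{id}_A$, and $(\mu\otimes\mathrm{id}_A)\circ(\mathrm{id}_A\otimes\mu^\dagger)=(\mathrm{id}_A\otimes\mu)\circ(\mu^\dagger\otimes\mathrm{id}_A)$. The trivial one $\mathcal{I}$ is $I$ with its coherence isomorphism $I\otimes I\to I$ and $\mathrm{id}_I$. The tensor product $\mathcal{A}\otimes\mathcal{B}$ is $A\otimes B$ with the usual tensor product multiplication (using the symmetry) and unit. A decoherence structure on $(\mathbf{C},\mathbf{P})$ is an environment structure together with an object $F_{\mathcal{A}}$ of $\mathbf{C}$ and a morphism $t_{\mathcal{A}}\colon A\to F_{\mathcal{A}}$ of $\mathbf{C}$ for each special dagger Frobenius structure $\mathcal{A}=(A,\mu,u)$ in $\mathbf{P}$, such that: $F_{\mathcal{A}\otimes\mathcal{B}}=F_{\mathcal{A}}\otimes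 F_{\mathcal{B}}$ and $t_{\mathcal{A}\otimes\mathcal{B}}=t_{\mathcal{A}}\otimes t_{\mathcal{B}}$; $F_{\mathcal{I}}=I$ and $t_{\mathcal{I}}=\mathrm{id}_I$; $t_{\mathcal{A}}^\dagger\circ t_{\mathcal{A}}=(\top_A\otimes\mathrm{id}_A)\circ\mu^\dagger$; and $t_{\mathcal{A}}\circ t_{\mathcal{A}}^\dagger=\mathrm{id}_{F_{\mathcal{A}}}$. It is a decoherence structure with purification if every morphism of $\mathbf{C}$ is of the form $t_{\mathcal{B}}\circ(\top_X\otimes\mathrm{id}_B)\circ f\circ t_{\mathcal{A}}^\dagger\colon F_{\mathcal{A}}\to F_{\mathcal{B}}$ for some special dagger Frobenius structures $\mathcal{A}$ on $A$ and $\mathcal{B}$ on $B$ in $\mathbf{P}$ and some $f\colon A\to X\otimes B$ in $\mathbf{P}$ (so each object of $\mathbf{C}$ is of the form $F_{\mathcal{A}}$). Given $\mathcal{A}=(A,\mu,u)$, put $\kappa_{\mathcal{A}}:=(\varepsilon_A\otimes\mathrm{id}_A)\circ(\mathrm{id}_{A^*}\otimes\mu^\dagger)\colon A^*\otimes A\to A$, so that $\kappa_{\mathcal{A}}^\dagger=(\mathrm{id}_{A^*}\otimes\mu)\circ(\eta_A\otimes\mathrm{id}_A)$. The category $\mathrm{CP}^*[\mathbf{P}]$ is the compact dagger category whose objects are the special dagger Frobenius structures in $\mathbf{P}$, and whose morphisms $\mathcal{A}=(A,\mu,u)\to\mathcal{B}=(B,\nu,v)$ are the morphisms $A\to B$ of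 $\mathbf{P}$ of the form $\kappa_{\mathcal{B}}\circ\mathrm{Dbl}(f)\circ\kappa_{\mathcal{A}}^\dagger$ for some object $X$ and some $f\colon A\to X\otimes B$ in $\mathbf{P}$. Identities, composition, tensor product of morphisms and dagger are those of $\mathbf{P}$; the tensor unit is $\mathcal{I}$ and the tensor product of objects $\mathcal{A}=(A,\mu,u)$ and $\mathcal{B}=(B,\nu,v)$ is the special dagger Frobenius structure $\mathcal{A}\otimes\mathcal{B}=\bigl(A\otimes B,\ (\mu\otimes\nu)\circ(\mathrm{id}_A\otimes\sigma_{B,A}\otimes\mathrm{id}_B),\ u\otimes v\bigr)$.
   Formalization: The formal theorem additionally assumes that distinct special dagger Frobenius structures in P have distinct objects F_A; without this the statement fails, since two structures may share F_A and purification then need not respect the chosen endpoints. *)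

theory Defs
  imports Main
begin

section \<open>Compact dagger categories\<close>

text \<open>
  The data of a compact dagger category, presented by sets of objects and arrows with domain and
  codomain maps.  Nothing is assumed to be strict: the coherence isomorphisms are part of the data,
  and formulas in which they are customarily suppressed are written out in full.  As they are
  unitary, their inverses are written as daggers.
    \<^item> \<open>\<alpha> A B D : (A \<boxtimes> B) \<boxtimes> D \<rightarrow> A \<boxtimes> (B \<boxtimes> D)\<close>
    \<^item> \<open>\<l> A : \<one> \<boxtimes> A \<rightarrow> A\<close>, \<open>\<r> A : A \<boxtimes> \<one> \<rightarrow> A\<close>
    \<^item> \<open>\<sigma> A B : A \<boxtimes> B \<rightarrow> B \<boxtimes> A\<close>
    \<^item> \<open>\<eta> A : \<one> \<rightarrow> A\<^sup>\<star> \<boxtimes> A\<close>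
\<close>

record ('o, 'a) cdc =
  Ob    :: "'o set"
  Arr   :: "'a set"
  Dom   :: "'a \<Rightarrow> 'o"
  Cod   :: "'a \<Rightarrow> 'o"
  Idn   :: "'o \<Rightarrow> 'a"  ("\<i>\<index>")
  Comp  :: "'a \<Rightarrow> 'a \<Rightarrow> 'a"  (infixl "\<cdot>\<index>" 70)
  Dag   :: "'a \<Rightarrow> 'a"  ("_\<^sup>\<dagger>\<index>" [1000] 999)
  TenO  :: "'o \<Rightarrow> 'o \<Rightarrow> 'o"  (infixr "\<boxtimes>\<index>" 75)
  TenA  :: "'a \<Rightarrow> 'a \<Rightarrow> 'a"  (infixr "\<otimes>\<index>" 75)
  Unt   :: "'o"  ("\<one>\<index>")
  Assoc :: "'o \<Rightarrow> 'o \<Rightarrow> 'o \<Rightarrow> 'a"  ("\<alpha>\<index>")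
  LUnit :: "'o \<Rightarrow> 'a"  ("\<l>\<index>")
  RUnit :: "'o \<Rightarrow> 'a"  ("\<r>\<index>")
  Swap  :: "'o \<Rightarrow> 'o \<Rightarrow> 'a"  ("\<sigma>\<index>")
  Dual  :: "'o \<Rightarrow> 'o"  ("_\<^sup>\<star>\<index>" [1000] 999)
  Eta   :: "'o \<Rightarrow> 'a"  ("\<eta>\<index>")

context
  fixes C :: "('o, 'a) cdc" (structure)
begin

definition hom :: "'o \<Rightarrow> 'o \<Rightarrow> 'a set" where
  "hom A B = {f \<in> Arr C. Dom C f = A \<and> Cod C f = B}"

definition unitary :: "'a \<Rightarrow> bool" where
  "unitary f \<longleftrightarrow> f \<in> Arr C \<and> f\<^sup>\<dagger> \<cdot> f = \<i> (Dom C f) \<and> f \<cdot> f\<^sup>\<dagger> = \<i> (Cod C f)"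

definition counit :: "'o \<Rightarrow> 'a" where
  "counit A = (\<eta> A)\<^sup>\<dagger>"

definition cap :: "'o \<Rightarrow> 'a" where
  "cap A = counit A \<cdot> \<sigma> A (A\<^sup>\<star>)"

end

locale dagger_category =
  fixes C :: "('o, 'a) cdc" (structure)
  assumes dom_ob: "f \<in> Arr C \<Longrightarrow> Dom C f \<in> Ob C"
    and cod_ob: "f \<in> Arr C \<Longrightarrow> Cod C f \<in> Ob C"
    and id_hom: "A \<in> Ob C \<Longrightarrow> \<i> A \<in> hom C A A"
    and comp_hom: "\<lbrakk>f \<in> hom C A B; g \<in> hom C B D\<rbrakk> \<Longrightarrow> g \<cdot> f \<in> hom C A D"
    and comp_id_right: "f \<in> hom C A B \<Longrightarrow> f \<cdot> \<i> A = f"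
    and comp_id_left: "f \<in> hom C A B \<Longrightarrow> \<i> B \<cdot> f = f"
    and comp_assoc: "\<lbrakk>f \<in> hom C A B; g \<in> hom C B D; h \<in> hom C D E\<rbrakk>
      \<Longrightarrow> (h \<cdot> g) \<cdot> f = h \<cdot> (g \<cdot> f)"
    and dag_hom: "f \<in> hom C A B \<Longrightarrow> f\<^sup>\<dagger> \<in> hom C B A"
    and dag_dag: "f \<in> Arr C \<Longrightarrow> (f\<^sup>\<dagger>)\<^sup>\<dagger> = f"
    and dag_id: "A \<in> Ob C \<Longrightarrow> (\<i> A)\<^sup>\<dagger> = \<i> A"
    and dag_comp: "\<lbrakk>f \<in> hom C A B; g \<in> hom C B D\<rbrakk> \<Longrightarrow> (g \<cdot> f)\<^sup>\<dagger> = f\<^sup>\<dagger> \<cdot> g\<^sup>\<dagger>"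

locale symmetric_monoidal_dagger_category = dagger_category +
  assumes unit_ob: "\<one> \<in> Ob C"
    and ten_ob: "\<lbrakk>A \<in> Ob C; B \<in> Ob C\<rbrakk> \<Longrightarrow> A \<boxtimes> B \<in> Ob C"
    and ten_hom: "\<lbrakk>f \<in> hom C A B; g \<in> hom C A' B'\<rbrakk> \<Longrightarrow> f \<otimes> g \<in> hom C (A \<boxtimes> A') (B \<boxtimes> B')"
    and ten_id: "\<lbrakk>A \<in> Ob C; B \<in> Ob C\<rbrakk> \<Longrightarrow> \<i> A \<otimes> \<i> B = \<i> (A \<boxtimes> B)"
    and ten_comp: "\<lbrakk>f \<in> hom C A B; g \<in> hom C B D; f' \<in> hom C A' B'; g' \<in> hom C B' D'\<rbrakk>
      \<Longrightarrow> (g \<cdot> f) \<otimes> (g' \<cdot> f') = (g \<otimes> g') \<cdot> (f \<otimes> f')"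
    and ten_dag: "\<lbrakk>f \<in> Arr C; g \<in> Arr C\<rbrakk> \<Longrightarrow> (f \<otimes> g)\<^sup>\<dagger> = f\<^sup>\<dagger> \<otimes> g\<^sup>\<dagger>"
    and assoc_hom: "\<lbrakk>A \<in> Ob C; B \<in> Ob C; D \<in> Ob C\<rbrakk>
      \<Longrightarrow> \<alpha> A B D \<in> hom C ((A \<boxtimes> B) \<boxtimes> D) (A \<boxtimes> (B \<boxtimes> D))"
    and lunit_hom: "A \<in> Ob C \<Longrightarrow> \<l> A \<in> hom C (\<one> \<boxtimes> A) A"
    and runit_hom: "A \<in> Ob C \<Longrightarrow> \<r> A \<in> hom C (A \<boxtimes> \<one>) A"
    and swap_hom: "\<lbrakk>A \<in> Ob C; B \<in> Ob C\<rbrakk> \<Longrightarrow> \<sigma> A B \<in> hom C (A \<boxtimes> B) (B \<boxtimes> A)"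
    and assoc_unitary: "\<lbrakk>A \<in> Ob C; B \<in> Ob C; D \<in> Ob C\<rbrakk> \<Longrightarrow> unitary C (\<alpha> A B D)"
    and lunit_unitary: "A \<in> Ob C \<Longrightarrow> unitary C (\<l> A)"
    and runit_unitary: "A \<in> Ob C \<Longrightarrow> unitary C (\<r> A)"
    and swap_unitary: "\<lbrakk>A \<in> Ob C; B \<in> Ob C\<rbrakk> \<Longrightarrow> unitary C (\<sigma> A B)"
    and assoc_natural: "\<lbrakk>f \<in> hom C A A'; g \<in> hom C B B'; h \<in> hom C D D'\<rbrakk>
      \<Longrightarrow> \<alpha> A' B' D' \<cdot> ((f \<otimes> g) \<otimes> h) = (f \<otimes> (g \<otimes> h)) \<cdot> \<alpha> A B D"
    and lunit_natural: "f \<in> hom C A B \<Longrightarrow> \<l> B \<cdot> (\<i> \<one> \<otimes> f) = f \<cdot> \<l> A"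
    and runit_natural: "f \<in> hom C A B \<Longrightarrow> \<r> B \<cdot> (f \<otimes> \<i> \<one>) = f \<cdot> \<r> A"
    and swap_natural: "\<lbrakk>f \<in> hom C A A'; g \<in> hom C B B'\<rbrakk>
      \<Longrightarrow> \<sigma> A' B' \<cdot> (f \<otimes> g) = (g \<otimes> f) \<cdot> \<sigma> A B"
    and triangle: "\<lbrakk>A \<in> Ob C; B \<in> Ob C\<rbrakk>
      \<Longrightarrow> (\<i> A \<otimes> \<l> B) \<cdot> \<alpha> A \<one> B = \<r> A \<otimes> \<i> B"
    and pentagon: "\<lbrakk>A \<in> Ob C; B \<in> Ob C; D \<in> Ob C; E \<in> Ob C\<rbrakk>
      \<Longrightarrow> (\<i> A \<otimes> \<alpha> B D E) \<cdot> \<alpha> A (B \<boxtimes> D) E \<cdot> (\<alpha> A B D \<otimes> \<i> E)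
          = \<alpha> A B (D \<boxtimes> E) \<cdot> \<alpha> (A \<boxtimes> B) D E"
    and hexagon: "\<lbrakk>A \<in> Ob C; B \<in> Ob C; D \<in> Ob C\<rbrakk>
      \<Longrightarrow> \<alpha> B D A \<cdot> \<sigma> A (B \<boxtimes> D) \<cdot> \<alpha> A B D
          = (\<i> B \<otimes> \<sigma> A D) \<cdot> \<alpha> B A D \<cdot> (\<sigma> A B \<otimes> \<i> D)"
    and swap_swap: "\<lbrakk>A \<in> Ob C; B \<in> Ob C\<rbrakk> \<Longrightarrow> \<sigma> B A \<cdot> \<sigma> A B = \<i> (A \<boxtimes> B)"

text \<open>
  Duals are chosen coherently: not only is \<open>(A \<boxtimes> B)\<^sup>\<star> = B\<^sup>\<star> \<boxtimes> A\<^sup>\<star>\<close>, but the unit of \<open>A \<boxtimes> B\<close> is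
  the nested unit \<open>\<one> \<rightarrow> B\<^sup>\<star> \<boxtimes> B \<rightarrow> B\<^sup>\<star> \<boxtimes> ((A\<^sup>\<star> \<boxtimes> A) \<boxtimes> B) \<rightarrow> (B\<^sup>\<star> \<boxtimes> A\<^sup>\<star>) \<boxtimes> (A \<boxtimes> B)\<close>.  The
  latter is what makes the functor \<open>star\<close> below reverse tensor products.
\<close>

locale compact_dagger_category = symmetric_monoidal_dagger_category +
  assumes dual_ob: "A \<in> Ob C \<Longrightarrow> A\<^sup>\<star> \<in> Ob C"
    and eta_hom: "A \<in> Ob C \<Longrightarrow> \<eta> A \<in> hom C \<one> (A\<^sup>\<star> \<boxtimes> A)"
    and snake: "A \<in> Ob C
      \<Longrightarrow> \<l> A \<cdot> (cap C A \<otimes> \<i> A) \<cdot> (\<alpha> A (A\<^sup>\<star>) A)\<^sup>\<dagger> \<cdot> (\<i> A \<otimes> \<eta> A) \<cdot> (\<r> A)\<^sup>\<dagger> = \<i> A"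
    and snake_dual: "A \<in> Ob C
      \<Longrightarrow> \<r> (A\<^sup>\<star>) \<cdot> (\<i> (A\<^sup>\<star>) \<otimes> cap C A) \<cdot> \<alpha> (A\<^sup>\<star>) A (A\<^sup>\<star>) \<cdot> (\<eta> A \<otimes> \<i> (A\<^sup>\<star>)) \<cdot> (\<l> (A\<^sup>\<star>))\<^sup>\<dagger>
          = \<i> (A\<^sup>\<star>)"
    and dual_ten: "\<lbrakk>A \<in> Ob C; B \<in> Ob C\<rbrakk> \<Longrightarrow> (A \<boxtimes> B)\<^sup>\<star> = B\<^sup>\<star> \<boxtimes> A\<^sup>\<star>"
    and eta_ten: "\<lbrakk>A \<in> Ob C; B \<in> Ob C\<rbrakk>
      \<Longrightarrow> \<eta> (A \<boxtimes> B) = (\<alpha> (B\<^sup>\<star>) (A\<^sup>\<star>) (A \<boxtimes> B))\<^sup>\<dagger> \<cdot> (\<i> (B\<^sup>\<star>) \<otimes> \<alpha> (A\<^sup>\<star>) A B)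
            \<cdot> (\<i> (B\<^sup>\<star>) \<otimes> (\<eta> A \<otimes> \<i> B)) \<cdot> (\<i> (B\<^sup>\<star>) \<otimes> (\<l> B)\<^sup>\<dagger>) \<cdot> \<eta> B"

locale compact_dagger_subcategory =
  C: compact_dagger_category C + P: compact_dagger_category P
  for C :: "('o, 'a) cdc" and P :: "('o, 'a) cdc" +
  assumes Ob_sub: "Ob P \<subseteq> Ob C"
    and Arr_sub: "Arr P \<subseteq> Arr C"
    and Dom_eq: "f \<in> Arr P \<Longrightarrow> Dom P f = Dom C f"
    and Cod_eq: "f \<in> Arr P \<Longrightarrow> Cod P f = Cod C f"
    and Idn_eq: "A \<in> Ob P \<Longrightarrow> Idn P A = Idn C A"
    and Comp_eq: "\<lbrakk>f \<in> hom P A B; g \<in> hom P B D\<rbrakk> \<Longrightarrow> Comp P g f = Comp C g f"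
    and Dag_eq: "f \<in> Arr P \<Longrightarrow> Dag P f = Dag C f"
    and TenO_eq: "\<lbrakk>A \<in> Ob P; B \<in> Ob P\<rbrakk> \<Longrightarrow> TenO P A B = TenO C A B"
    and TenA_eq: "\<lbrakk>f \<in> Arr P; g \<in> Arr P\<rbrakk> \<Longrightarrow> TenA P f g = TenA C f g"
    and Unt_eq: "Unt P = Unt C"
    and Assoc_eq: "\<lbrakk>A \<in> Ob P; B \<in> Ob P; D \<in> Ob P\<rbrakk> \<Longrightarrow> Assoc P A B D = Assoc C A B D"
    and LUnit_eq: "A \<in> Ob P \<Longrightarrow> LUnit P A = LUnit C A"
    and RUnit_eq: "A \<in> Ob P \<Longrightarrow> RUnit P A = RUnit C A"
    and Swap_eq: "\<lbrakk>A \<in> Ob P; B \<in> Ob P\<rbrakk> \<Longrightarrow> Swap P A B = Swap C A B"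
    and Dual_eq: "A \<in> Ob P \<Longrightarrow> Dual P A = Dual C A"
    and Eta_eq: "A \<in> Ob P \<Longrightarrow> Eta P A = Eta C A"


section \<open>Doubling\<close>

context
  fixes C :: "('o, 'a) cdc" (structure)
begin

definition dual_arr :: "'a \<Rightarrow> 'a" where
  "dual_arr f = (let A = Dom C f; B = Cod C f in
     \<r> (A\<^sup>\<star>) \<cdot> (\<i> (A\<^sup>\<star>) \<otimes> cap C B) \<cdot> (\<i> (A\<^sup>\<star>) \<otimes> (f \<otimes> \<i> (B\<^sup>\<star>)))
       \<cdot> \<alpha> (A\<^sup>\<star>) A (B\<^sup>\<star>) \<cdot> (\<eta> A \<otimes> \<i> (B\<^sup>\<star>)) \<cdot> (\<l> (B\<^sup>\<star>))\<^sup>\<dagger>)"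

definition star :: "'a \<Rightarrow> 'a" where
  "star f = dual_arr (f\<^sup>\<dagger>)"

text \<open>
  For \<open>f : A \<rightarrow> X \<boxtimes> B\<close> the morphism \<open>star f\<close> has type \<open>A\<^sup>\<star> \<rightarrow> B\<^sup>\<star> \<boxtimes> X\<^sup>\<star>\<close>.  The objects \<open>X\<close> and
  \<open>B\<close> are arguments because they are not determined by \<open>X \<boxtimes> B\<close>.
\<close>

definition Dbl :: "'o \<Rightarrow> 'o \<Rightarrow> 'a \<Rightarrow> 'a" where
  "Dbl X B f =
     (\<i> (B\<^sup>\<star>) \<otimes> \<l> B) \<cdot> (\<i> (B\<^sup>\<star>) \<otimes> (counit C X \<otimes> \<i> B))
       \<cdot> (\<i> (B\<^sup>\<star>) \<otimes> (\<alpha> (X\<^sup>\<star>) X B)\<^sup>\<dagger>) \<cdot> \<alpha> (B\<^sup>\<star>) (X\<^sup>\<star>) (X \<boxtimes> B) \<cdot> (star f \<otimes> f)"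

text \<open>\<open>(gnd X \<otimes> \<i> B) \<cdot> f\<close>, followed by the coherence isomorphism \<open>\<one> \<boxtimes> B \<rightarrow> B\<close>.\<close>

definition discard :: "('o \<Rightarrow> 'a) \<Rightarrow> 'o \<Rightarrow> 'o \<Rightarrow> 'a \<Rightarrow> 'a" where
  "discard gnd X B f = \<l> B \<cdot> (gnd X \<otimes> \<i> B) \<cdot> f"

end


section \<open>Special dagger Frobenius structures\<close>

type_synonym ('o, 'a) frob = "'o \<times> 'a \<times> 'a"

context
  fixes P :: "('o, 'a) cdc" (structure)
begin

definition special_dagger_frobenius :: "('o, 'a) frob \<Rightarrow> bool" where
  "special_dagger_frobenius = (\<lambda>(A, m, u).
     A \<in> Ob P \<and> m \<in> hom P (A \<boxtimes> A) A \<and> u \<in> hom P \<one> A \<and>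
     m \<cdot> (m \<otimes> \<i> A) = m \<cdot> (\<i> A \<otimes> m) \<cdot> \<alpha> A A A \<and>
     m \<cdot> (u \<otimes> \<i> A) = \<l> A \<and>
     m \<cdot> (\<i> A \<otimes> u) = \<r> A \<and>
     m \<cdot> m\<^sup>\<dagger> = \<i> A \<and>
     (m \<otimes> \<i> A) \<cdot> (\<alpha> A A A)\<^sup>\<dagger> \<cdot> (\<i> A \<otimes> m\<^sup>\<dagger>) = (\<i> A \<otimes> m) \<cdot> \<alpha> A A A \<cdot> (m\<^sup>\<dagger> \<otimes> \<i> A))"

definition frob_unit :: "('o, 'a) frob" where
  "frob_unit = (\<one>, \<l> \<one>, \<i> \<one>)"

text \<open>The permutation \<open>(A \<boxtimes> B) \<boxtimes> (D \<boxtimes> E) \<rightarrow> (A \<boxtimes> D) \<boxtimes> (B \<boxtimes> E)\<close>.\<close>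

definition middle_swap :: "'o \<Rightarrow> 'o \<Rightarrow> 'o \<Rightarrow> 'o \<Rightarrow> 'a" where
  "middle_swap A B D E =
     (\<alpha> A D (B \<boxtimes> E))\<^sup>\<dagger> \<cdot> (\<i> A \<otimes> \<alpha> D B E) \<cdot> (\<i> A \<otimes> (\<sigma> B D \<otimes> \<i> E))
       \<cdot> (\<i> A \<otimes> (\<alpha> B D E)\<^sup>\<dagger>) \<cdot> \<alpha> A B (D \<boxtimes> E)"

definition frob_tensor :: "('o, 'a) frob \<Rightarrow> ('o, 'a) frob \<Rightarrow> ('o, 'a) frob" where
  "frob_tensor = (\<lambda>(A, m, u) (B, n, v).
     (A \<boxtimes> B, (m \<otimes> n) \<cdot> middle_swap A B A B, (u \<otimes> v) \<cdot> (\<l> \<one>)\<^sup>\<dagger>))"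

text \<open>
  The conjugate structure on \<open>A\<^sup>\<star>\<close>.  As \<open>star\<close> reverses tensor products,
  \<open>star m : A\<^sup>\<star> \<boxtimes> A\<^sup>\<star> \<rightarrow> A\<^sup>\<star>\<close> multiplies in the opposite order; the swap undoes this, and with it
  the unit \<open>\<eta> A\<close> of the ambient category is a morphism of \<open>CP\<^sup>*\<close>.  The last component is
  \<open>star u : \<one>\<^sup>\<star> \<rightarrow> A\<^sup>\<star>\<close> preceded by the canonical isomorphism \<open>\<one> \<rightarrow> \<one>\<^sup>\<star>\<close>.
\<close>

definition frob_dual :: "('o, 'a) frob \<Rightarrow> ('o, 'a) frob" where
  "frob_dual = (\<lambda>(A, m, u).
     (A\<^sup>\<star>, star P m \<cdot> \<sigma> (A\<^sup>\<star>) (A\<^sup>\<star>), star P u \<cdot> \<r> (\<one>\<^sup>\<star>) \<cdot> \<eta> \<one>))"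

definition kappa :: "('o, 'a) frob \<Rightarrow> 'a" where
  "kappa = (\<lambda>(A, m, u).
     \<l> A \<cdot> (counit P A \<otimes> \<i> A) \<cdot> (\<alpha> (A\<^sup>\<star>) A A)\<^sup>\<dagger> \<cdot> (\<i> (A\<^sup>\<star>) \<otimes> m\<^sup>\<dagger>))"

text \<open>
  Arrows of \<open>CP\<^sup>*\<close> carry their domain and codomain, since one and the same morphism of \<open>P\<close> may
  be a morphism between several pairs of Frobenius structures.
\<close>

definition CPstar ::
  "(('o, 'a) frob, ('o, 'a) frob \<times> 'a \<times> ('o, 'a) frob) cdc" where
  "CPstar = \<lparr>
     Ob = {\<A>. special_dagger_frobenius \<A>},
     Arr = {(\<A>, kappa \<B> \<cdot> Dbl P X (fst \<B>) f \<cdot> (kappa \<A>)\<^sup>\<dagger>, \<B>) | \<A> \<B> X f.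
              special_dagger_frobenius \<A> \<and> special_dagger_frobenius \<B> \<and>
              X \<in> Ob P \<and> f \<in> hom P (fst \<A>) (X \<boxtimes> fst \<B>)},
     Dom = (\<lambda>(\<A>, h, \<B>). \<A>),
     Cod = (\<lambda>(\<A>, h, \<B>). \<B>),
     Idn = (\<lambda>\<A>. (\<A>, \<i> (fst \<A>), \<A>)),
     Comp = (\<lambda>(\<B>', k, \<D>) (\<A>, h, \<B>). (\<A>, k \<cdot> h, \<D>)),
     Dag = (\<lambda>(\<A>, h, \<B>). (\<B>, h\<^sup>\<dagger>, \<A>)),
     TenO = frob_tensor,
     TenA = (\<lambda>(\<A>, h, \<B>) (\<A>', h', \<B>'). (frob_tensor \<A> \<A>', h \<otimes> h', frob_tensor \<B> \<B>')),
     Unt = frob_unit,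
     Assoc = (\<lambda>\<A> \<B> \<D>. (frob_tensor (frob_tensor \<A> \<B>) \<D>, \<alpha> (fst \<A>) (fst \<B>) (fst \<D>),
                          frob_tensor \<A> (frob_tensor \<B> \<D>))),
     LUnit = (\<lambda>\<A>. (frob_tensor frob_unit \<A>, \<l> (fst \<A>), \<A>)),
     RUnit = (\<lambda>\<A>. (frob_tensor \<A> frob_unit, \<r> (fst \<A>), \<A>)),
     Swap = (\<lambda>\<A> \<B>. (frob_tensor \<A> \<B>, \<sigma> (fst \<A>) (fst \<B>), frob_tensor \<B> \<A>)),
     Dual = frob_dual,
     Eta = (\<lambda>\<A>. (frob_unit, \<eta> (fst \<A>), frob_tensor (frob_dual \<A>) \<A>)) \<rparr>"

end


section \<open>Environment and decoherence structures\<close>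

locale environment_structure = compact_dagger_subcategory C P
  for C :: "('o, 'a) cdc" (structure) and P :: "('o, 'a) cdc" +
  fixes gnd :: "'o \<Rightarrow> 'a"
  assumes gnd_hom: "A \<in> Ob P \<Longrightarrow> gnd A \<in> hom C A \<one>"
    and gnd_ten: "\<lbrakk>A \<in> Ob P; B \<in> Ob P\<rbrakk> \<Longrightarrow> gnd (A \<boxtimes> B) = \<l> \<one> \<cdot> (gnd A \<otimes> gnd B)"
    and gnd_unit: "gnd \<one> = \<i> \<one>"
    and gnd_dual: "A \<in> Ob P \<Longrightarrow> gnd A = cap C A \<cdot> (\<i> A \<otimes> (gnd (A\<^sup>\<star>))\<^sup>\<dagger>) \<cdot> (\<r> A)\<^sup>\<dagger>"
    and Dbl_eq_iff: "\<lbrakk>A \<in> Ob P; B \<in> Ob P; X \<in> Ob P; Y \<in> Ob P;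
        f \<in> hom P A (X \<boxtimes> B); g \<in> hom P A (Y \<boxtimes> B)\<rbrakk>
      \<Longrightarrow> Dbl P X B f = Dbl P Y B g \<longleftrightarrow> discard C gnd X B f = discard C gnd Y B g"

text \<open>
  The axioms below do not make \<open>F\<close> injective: distinct Frobenius structures may share the object
  \<open>F \<A>\<close>, and then the endpoints in \<open>purification\<close> need not be the ones a morphism was given with.
  Injectivity has to be assumed separately where distinct structures are to give distinct objects.
\<close>

locale decoherence_structure = environment_structure C P gnd
  for C :: "('o, 'a) cdc" (structure) and P :: "('o, 'a) cdc" and gnd :: "'o \<Rightarrow> 'a" +
  fixes F :: "('o, 'a) frob \<Rightarrow> 'o"
    and t :: "('o, 'a) frob \<Rightarrow> 'a"
  assumes F_ob: "special_dagger_frobenius P \<A> \<Longrightarrow> F \<A> \<in> Ob C"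
    and t_hom: "special_dagger_frobenius P (A, m, u) \<Longrightarrow> t (A, m, u) \<in> hom C A (F (A, m, u))"
    and F_ten: "\<lbrakk>special_dagger_frobenius P \<A>; special_dagger_frobenius P \<B>\<rbrakk>
      \<Longrightarrow> F (frob_tensor P \<A> \<B>) = F \<A> \<boxtimes> F \<B>"
    and t_ten: "\<lbrakk>special_dagger_frobenius P \<A>; special_dagger_frobenius P \<B>\<rbrakk>
      \<Longrightarrow> t (frob_tensor P \<A> \<B>) = t \<A> \<otimes> t \<B>"
    and F_unit: "F (frob_unit P) = \<one>"
    and t_unit: "t (frob_unit P) = \<i> \<one>"
    and t_dag_t: "special_dagger_frobenius P (A, m, u)
      \<Longrightarrow> (t (A, m, u))\<^sup>\<dagger> \<cdot> t (A, m, u) = discard C gnd A A (m\<^sup>\<dagger>)"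
    and t_t_dag: "special_dagger_frobenius P \<A> \<Longrightarrow> t \<A> \<cdot> (t \<A>)\<^sup>\<dagger> = \<i> (F \<A>)"

locale decoherence_structure_with_purification = decoherence_structure +
  assumes purification: "h \<in> Arr C \<Longrightarrow>
      \<exists>\<A> \<B> X f. special_dagger_frobenius P \<A> \<and> special_dagger_frobenius P \<B> \<and>
        X \<in> Ob P \<and> f \<in> hom P (fst \<A>) (X \<boxtimes> fst \<B>) \<and>
        h = t \<B> \<cdot> discard C gnd X (fst \<B>) f \<cdot> (t \<A>)\<^sup>\<dagger>"


section \<open>Isomorphisms of compact dagger categories\<close>

text \<open>
  The coherence maps of a monoidal functor \<open>G\<close> from \<open>C\<close> to \<open>D\<close> are
  \<open>fmul G A B : G A \<boxtimes> G B \<rightarrow> G (A \<boxtimes> B)\<close> and \<open>funit G : \<one> \<rightarrow> G \<one>\<close>.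
\<close>

record ('o, 'a, 'p, 'b) monoidal_functor =
  fob   :: "'o \<Rightarrow> 'p"
  farr  :: "'a \<Rightarrow> 'b"
  fmul  :: "'o \<Rightarrow> 'o \<Rightarrow> 'b"
  funit :: "'b"

locale monoidal_dagger_functor =
  C: compact_dagger_category C + D: compact_dagger_category D
  for C :: "('o, 'a) cdc" (structure) and D :: "('p, 'b) cdc" (structure)
    and G :: "('o, 'a, 'p, 'b) monoidal_functor" +
  assumes fob_ob: "A \<in> Ob C \<Longrightarrow> fob G A \<in> Ob D"
    and farr_hom: "f \<in> hom C A B \<Longrightarrow> farr G f \<in> hom D (fob G A) (fob G B)"
    and farr_id: "A \<in> Ob C \<Longrightarrow> farr G (\<i> A) = \<i>\<^bsub>D\<^esub> (fob G A)"
    and farr_comp: "\<lbrakk>f \<in> hom C A B; g \<in> hom C B E\<rbrakk> \<Longrightarrow> farr G (g \<cdot> f) = farr G g \<cdot>\<^bsub>D\<^esub> farr G f"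
    and farr_dag: "f \<in> Arr C \<Longrightarrow> farr G (f\<^sup>\<dagger>) = (farr G f)\<^sup>\<dagger>\<^bsub>D\<^esub>"
    and fmul_hom: "\<lbrakk>A \<in> Ob C; B \<in> Ob C\<rbrakk>
      \<Longrightarrow> fmul G A B \<in> hom D (fob G A \<boxtimes>\<^bsub>D\<^esub> fob G B) (fob G (A \<boxtimes> B))"
    and fmul_unitary: "\<lbrakk>A \<in> Ob C; B \<in> Ob C\<rbrakk> \<Longrightarrow> unitary D (fmul G A B)"
    and fmul_natural: "\<lbrakk>f \<in> hom C A A'; g \<in> hom C B B'\<rbrakk>
      \<Longrightarrow> fmul G A' B' \<cdot>\<^bsub>D\<^esub> (farr G f \<otimes>\<^bsub>D\<^esub> farr G g) = farr G (f \<otimes> g) \<cdot>\<^bsub>D\<^esub> fmul G A B"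
    and funit_hom: "funit G \<in> hom D \<one>\<^bsub>D\<^esub> (fob G \<one>)"
    and funit_unitary: "unitary D (funit G)"
    and fmul_assoc: "\<lbrakk>A \<in> Ob C; B \<in> Ob C; E \<in> Ob C\<rbrakk>
      \<Longrightarrow> farr G (\<alpha> A B E) \<cdot>\<^bsub>D\<^esub> fmul G (A \<boxtimes> B) E \<cdot>\<^bsub>D\<^esub> (fmul G A B \<otimes>\<^bsub>D\<^esub> \<i>\<^bsub>D\<^esub> (fob G E))
          = fmul G A (B \<boxtimes> E) \<cdot>\<^bsub>D\<^esub> (\<i>\<^bsub>D\<^esub> (fob G A) \<otimes>\<^bsub>D\<^esub> fmul G B E)
              \<cdot>\<^bsub>D\<^esub> \<alpha>\<^bsub>D\<^esub> (fob G A) (fob G B) (fob G E)"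
    and fmul_lunit: "A \<in> Ob C
      \<Longrightarrow> farr G (\<l> A) \<cdot>\<^bsub>D\<^esub> fmul G \<one> A \<cdot>\<^bsub>D\<^esub> (funit G \<otimes>\<^bsub>D\<^esub> \<i>\<^bsub>D\<^esub> (fob G A)) = \<l>\<^bsub>D\<^esub> (fob G A)"
    and fmul_runit: "A \<in> Ob C
      \<Longrightarrow> farr G (\<r> A) \<cdot>\<^bsub>D\<^esub> fmul G A \<one> \<cdot>\<^bsub>D\<^esub> (\<i>\<^bsub>D\<^esub> (fob G A) \<otimes>\<^bsub>D\<^esub> funit G) = \<r>\<^bsub>D\<^esub> (fob G A)"
    and fmul_swap: "\<lbrakk>A \<in> Ob C; B \<in> Ob C\<rbrakk>
      \<Longrightarrow> farr G (\<sigma> A B) \<cdot>\<^bsub>D\<^esub> fmul G A B = fmul G B A \<cdot>\<^bsub>D\<^esub> \<sigma>\<^bsub>D\<^esub> (fob G A) (fob G B)"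

definition is_inverse_functor ::
  "('o, 'a) cdc \<Rightarrow> ('p, 'b) cdc \<Rightarrow> ('o, 'a, 'p, 'b) monoidal_functor
    \<Rightarrow> ('p, 'b, 'o, 'a) monoidal_functor \<Rightarrow> bool" where
  "is_inverse_functor C D G H \<longleftrightarrow>
     (\<forall>A \<in> Ob C. fob H (fob G A) = A) \<and>
     (\<forall>f \<in> Arr C. farr H (farr G f) = f) \<and>
     (\<forall>A \<in> Ob C. \<forall>B \<in> Ob C.
        farr H (fmul G A B) \<cdot>\<^bsub>C\<^esub> fmul H (fob G A) (fob G B) = \<i>\<^bsub>C\<^esub> (A \<boxtimes>\<^bsub>C\<^esub> B)) \<and>
     farr H (funit G) \<cdot>\<^bsub>C\<^esub> funit H = \<i>\<^bsub>C\<^esub> \<one>\<^bsub>C\<^esub>"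

definition compact_dagger_isomorphism ::
  "('o, 'a) cdc \<Rightarrow> ('p, 'b) cdc \<Rightarrow> ('o, 'a, 'p, 'b) monoidal_functor \<Rightarrow> bool" where
  "compact_dagger_isomorphism C D G \<longleftrightarrow>
     monoidal_dagger_functor C D G \<and>
     (\<exists>H. monoidal_dagger_functor D C H \<and> is_inverse_functor C D G H \<and> is_inverse_functor D C H G)"

end

theory Submission
  imports Defs "HOL-Library.Multiset"
begin

text \<open>
  Every equation between diagrams is proved by comparing networks. A formula in the ambient category is
  evaluated between trees of labelled wires; coherence isomorphisms become the empty network, composition and
  tensor product concatenate lists of boxes, and the value of a network does not depend on the order of its
  boxes. An equation thus follows once both sides have the same boxes, up to local steps such as the snake
  equations and the Frobenius laws.

  With the wire of the environment straightened, \<open>Dbl X B f\<close> consists of \<open>f\<close>, \<open>f\<^sup>\<dagger>\<close>, a unit and a counit. Both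
  \<open>Dbl\<close> and \<open>discard\<close> respect the composition, the dagger and the tensor product of morphisms with an
  environment. Writing \<open>\<kappa>\<close> for \<open>kappa \<A>\<close> and \<open>m\<close> for the multiplication of \<open>\<A>\<close>, the crucial point is
  \<open>\<kappa>\<^sup>\<dagger> \<cdot> \<kappa> = Dbl A A (m\<^sup>\<dagger>)\<close>, the counterpart of the axiom on \<open>(t \<A>)\<^sup>\<dagger> \<cdot> t \<A>\<close>. It holds for symmetric Frobenius
  structures only, and symmetry follows from the fact that \<open>(t \<A>)\<^sup>\<dagger> \<cdot> t \<A>\<close> is self-adjoint: this forces
  \<open>Dbl (A\<^sup>\<star>) A (\<kappa>\<^sup>\<dagger>) = Dbl A A (m\<^sup>\<dagger>)\<close>. Hence \<open>\<kappa>\<close> and \<open>t \<A>\<close> split corresponding idempotents, and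
  \<open>\<kappa>' \<cdot> Dbl X B f \<cdot> \<kappa>\<^sup>\<dagger>\<close> corresponds bijectively to \<open>t \<B> \<cdot> discard X B f \<cdot> (t \<A>)\<^sup>\<dagger>\<close>, where \<open>\<kappa>'\<close> is \<open>kappa \<B>\<close>.
\<close>

section \<open>Typed rewriting\<close>

text \<open>Nothing is strict here: formulas that draw the same diagram differ by associators,
  unitors and symmetries, and several wires of a diagram may carry the same object. Labels address
  both points. They tell apart wires of equal type, and their numerical order selects one bracketed
  tensor product for every finite set of wires. A tree of labels is compared with that product by a
  canonical unitary, and coherence is proved once, in the form that these unitaries absorb every
  coherence isomorphism. As no label is ever used twice, boxes may be reordered whenever each still
  finds its inputs.

  On the categorical side, \<open>special_dagger_frobenius\<close> does not include symmetry, and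
  identities of \<open>CPstar P\<close> require
  \<open>kappa \<A> \<cdot> (kappa \<A>)\<^sup>\<dagger>\<close> to be an identity. This is derived
  from \<open>t \<A> \<cdot> (t \<A>)\<^sup>\<dagger> = \<i> (F \<A>)\<close> through idempotency of
  a double. Hence even the fact that \<open>CPstar P\<close> is a category is proved from the
  decoherence structure. Closure of \<open>CPstar P\<close> under its operations and functoriality
  of the comparison are therefore obtained together, from a relation between morphisms of
  \<open>P\<close> and of \<open>C\<close>.\<close>

context dagger_category
begin

lemma hom_iff: "f \<in> hom C A B \<longleftrightarrow> f \<in> Arr C \<and> Dom C f = A \<and> Cod C f = B"
  by (simp add: hom_def)

lemma dom_cod_ob [simp, intro]:
  "f \<in> Arr C \<Longrightarrow> Dom C f \<in> Ob C" "f \<in> Arr C \<Longrightarrow> Cod C f \<in> Ob C"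
  by (fact dom_ob cod_ob)+

lemma idn_simps [simp]:
  assumes "A \<in> Ob C"
  shows "\<i> A \<in> Arr C" "Dom C (\<i> A) = A" "Cod C (\<i> A) = A" "(\<i> A)\<^sup>\<dagger> = \<i> A"
  using id_hom[OF assms] dag_id[OF assms] by (simp_all add: hom_iff)

lemma comp_simps [simp]:
  assumes "f \<in> Arr C" "g \<in> Arr C" "Dom C g = Cod C f"
  shows "g \<cdot> f \<in> Arr C" "Dom C (g \<cdot> f) = Dom C f" "Cod C (g \<cdot> f) = Cod C g"
    "(g \<cdot> f)\<^sup>\<dagger> = f\<^sup>\<dagger> \<cdot> g\<^sup>\<dagger>"
  using comp_hom[of f "Dom C f" "Cod C f" g "Cod C g"] dag_comp[of f "Dom C f" "Cod C f" g "Cod C g"] assms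
  by (simp_all add: hom_iff)

lemma comp_idn [simp]:
  "f \<in> Arr C \<Longrightarrow> Dom C f = A \<Longrightarrow> f \<cdot> \<i> A = f"
  "f \<in> Arr C \<Longrightarrow> Cod C f = A \<Longrightarrow> \<i> A \<cdot> f = f"
  using comp_id_right[of f A "Cod C f"] comp_id_left[of f "Dom C f" A] by (simp_all add: hom_iff)

lemma assoc_comp [simp]:
  assumes "f \<in> Arr C" "g \<in> Arr C" "h \<in> Arr C" "Dom C g = Cod C f" "Dom C h = Cod C g"
  shows "(h \<cdot> g) \<cdot> f = h \<cdot> (g \<cdot> f)"
  using comp_assoc[of f "Dom C f" "Cod C f" g "Cod C g" h "Cod C h"] assms by (simp add: hom_iff)

lemma dag_simps [simp]:
  assumes "f \<in> Arr C"
  shows "f\<^sup>\<dagger> \<in> Arr C" "Dom C (f\<^sup>\<dagger>) = Cod C f" "Cod C (f\<^sup>\<dagger>) = Dom C f" "(f\<^sup>\<dagger>)\<^sup>\<dagger> = f"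
  using dag_hom[of f "Dom C f" "Cod C f"] dag_dag assms by (simp_all add: hom_iff)

text \<open>The last two rules carry a tail \<open>g\<close>: composites are kept bracketed to the
  right by \<open>assoc_comp\<close>, and the rules for two factors do not match inside
  them.\<close>

lemma unitary_simps:
  assumes "unitary C f" "Dom C f = A" "Cod C f = B"
  shows "f\<^sup>\<dagger> \<cdot> f = \<i> A" "f \<cdot> f\<^sup>\<dagger> = \<i> B"
    "g \<in> Arr C \<Longrightarrow> Cod C g = A \<Longrightarrow> f\<^sup>\<dagger> \<cdot> (f \<cdot> g) = g"
    "g \<in> Arr C \<Longrightarrow> Cod C g = B \<Longrightarrow> f \<cdot> (f\<^sup>\<dagger> \<cdot> g) = g"
proof -
  have f: "f \<in> Arr C" and 1: "f\<^sup>\<dagger> \<cdot> f = \<i> A" and 2: "f \<cdot> f\<^sup>\<dagger> = \<i> B"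
    using assms by (auto simp: unitary_def)
  show "f\<^sup>\<dagger> \<cdot> f = \<i> A" "f \<cdot> f\<^sup>\<dagger> = \<i> B" by (fact 1 2)+
  show "g \<in> Arr C \<Longrightarrow> Cod C g = A \<Longrightarrow> f\<^sup>\<dagger> \<cdot> (f \<cdot> g) = g"
    using f 1 assms assoc_comp[of g f "f\<^sup>\<dagger>"] by simp
  show "g \<in> Arr C \<Longrightarrow> Cod C g = B \<Longrightarrow> f \<cdot> (f\<^sup>\<dagger> \<cdot> g) = g"
    using f 2 assms assoc_comp[of g "f\<^sup>\<dagger>" f] by simp
qed

text \<open>The version with a tail of an arbitrary equation between composites of two
  factors.\<close>

lemma comp_rewrite:
  assumes "g \<cdot> f = k" "f \<in> Arr C" "g \<in> Arr C" "h \<in> Arr C" "Dom C g = Cod C f" "Dom C f = Cod C h"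
  shows "g \<cdot> (f \<cdot> h) = k \<cdot> h"
  using assms(2-) assoc_comp[of h f g] assms(1) by simp

lemma unitary_comp:
  "unitary C f \<Longrightarrow> unitary C g \<Longrightarrow> Dom C g = Cod C f \<Longrightarrow> unitary C (g \<cdot> f)"
  unfolding unitary_def
  by (auto simp del: assoc_comp simp: assoc_comp[symmetric])
     (simp_all add: comp_rewrite[of "g\<^sup>\<dagger>" g "\<i> (Cod C f)"] comp_rewrite[of f "f\<^sup>\<dagger>" "\<i> (Cod C f)"])

lemma unitary_dag: "unitary C f \<Longrightarrow> unitary C (f\<^sup>\<dagger>)"
  by (auto simp: unitary_def)

lemma unitary_idn: "A \<in> Ob C \<Longrightarrow> unitary C (\<i> A)"
  by (simp add: unitary_def)

lemma unitary_cancel_left: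
  assumes "unitary C u" "u \<cdot> f = u \<cdot> g" "f \<in> Arr C" "g \<in> Arr C" "Cod C f = Dom C u" "Cod C g = Dom C u"
  shows "f = g"
  using assms unitary_simps(3)[OF assms(1) refl refl] by metis

lemma unitary_cancel_right:
  assumes "unitary C u" "f \<cdot> u = g \<cdot> u" "f \<in> Arr C" "g \<in> Arr C" "Dom C f = Cod C u" "Dom C g = Cod C u"
  shows "f = g"
proof -
  have u: "u \<in> Arr C" using assms by (simp add: unitary_def)
  have "k = (k \<cdot> u) \<cdot> u\<^sup>\<dagger>" if "k \<in> Arr C" "Dom C k = Cod C u" for k
    using that u by (simp add: unitary_simps(2)[OF assms(1) refl refl])
  from this[of f] this[of g] show ?thesis using assms by simp
qed

end

context symmetric_monoidal_dagger_category
begin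

lemma ob_simps [simp]: "\<one> \<in> Ob C" "A \<in> Ob C \<Longrightarrow> B \<in> Ob C \<Longrightarrow> A \<boxtimes> B \<in> Ob C"
  by (fact unit_ob ten_ob)+

lemma ten_simps [simp]:
  assumes "f \<in> Arr C" "g \<in> Arr C"
  shows "f \<otimes> g \<in> Arr C" "Dom C (f \<otimes> g) = Dom C f \<boxtimes> Dom C g"
    "Cod C (f \<otimes> g) = Cod C f \<boxtimes> Cod C g" "(f \<otimes> g)\<^sup>\<dagger> = f\<^sup>\<dagger> \<otimes> g\<^sup>\<dagger>"
  using ten_hom[of f "Dom C f" "Cod C f" g "Dom C g" "Cod C g"] ten_dag assms by (simp_all add: hom_iff)

lemma ten_idn [simp]: "A \<in> Ob C \<Longrightarrow> B \<in> Ob C \<Longrightarrow> \<i> A \<otimes> \<i> B = \<i> (A \<boxtimes> B)"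
  by (fact ten_id)

lemma interchange [simp]:
  assumes "f \<in> Arr C" "g \<in> Arr C" "f' \<in> Arr C" "g' \<in> Arr C" "Dom C g = Cod C f" "Dom C g' = Cod C f'"
  shows "(g \<otimes> g') \<cdot> (f \<otimes> f') = (g \<cdot> f) \<otimes> (g' \<cdot> f')"
  using ten_comp[of f "Dom C f" "Cod C f" g "Cod C g" f' "Dom C f'" "Cod C f'" g' "Cod C g'"] assms
  by (simp add: hom_iff)

lemma interchange_assoc [simp]:
  assumes "f \<in> Arr C" "g \<in> Arr C" "f' \<in> Arr C" "g' \<in> Arr C" "Dom C g = Cod C f" "Dom C g' = Cod C f'"
    "h \<in> Arr C" "Cod C h = Dom C f \<boxtimes> Dom C f'"
  shows "(g \<otimes> g') \<cdot> ((f \<otimes> f') \<cdot> h) = ((g \<cdot> f) \<otimes> (g' \<cdot> f')) \<cdot> h"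
  using assms interchange[of f g f' g'] by (intro comp_rewrite) simp_all

lemma coherence_simps [simp]:
  "A \<in> Ob C \<Longrightarrow> \<l> A \<in> Arr C" "A \<in> Ob C \<Longrightarrow> Dom C (\<l> A) = \<one> \<boxtimes> A" "A \<in> Ob C \<Longrightarrow> Cod C (\<l> A) = A"
  "A \<in> Ob C \<Longrightarrow> \<r> A \<in> Arr C" "A \<in> Ob C \<Longrightarrow> Dom C (\<r> A) = A \<boxtimes> \<one>" "A \<in> Ob C \<Longrightarrow> Cod C (\<r> A) = A"
  "A \<in> Ob C \<Longrightarrow> B \<in> Ob C \<Longrightarrow> \<sigma> A B \<in> Arr C"
  "A \<in> Ob C \<Longrightarrow> B \<in> Ob C \<Longrightarrow> Dom C (\<sigma> A B) = A \<boxtimes> B"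
  "A \<in> Ob C \<Longrightarrow> B \<in> Ob C \<Longrightarrow> Cod C (\<sigma> A B) = B \<boxtimes> A"
  "A \<in> Ob C \<Longrightarrow> B \<in> Ob C \<Longrightarrow> D \<in> Ob C \<Longrightarrow> \<alpha> A B D \<in> Arr C"
  "A \<in> Ob C \<Longrightarrow> B \<in> Ob C \<Longrightarrow> D \<in> Ob C \<Longrightarrow> Dom C (\<alpha> A B D) = (A \<boxtimes> B) \<boxtimes> D"
  "A \<in> Ob C \<Longrightarrow> B \<in> Ob C \<Longrightarrow> D \<in> Ob C \<Longrightarrow> Cod C (\<alpha> A B D) = A \<boxtimes> (B \<boxtimes> D)"
  using lunit_hom runit_hom swap_hom assoc_hom by (simp_all add: hom_iff)

lemmas assoc_inv [simp] = unitary_simps[OF assoc_unitary coherence_simps(11,12)]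
lemmas lunit_inv [simp] = unitary_simps[OF lunit_unitary coherence_simps(2,3)]
lemmas runit_inv [simp] = unitary_simps[OF runit_unitary coherence_simps(5,6)]

lemma swap_inv [simp]:
  assumes "A \<in> Ob C" "B \<in> Ob C"
  shows "\<sigma> B A \<cdot> \<sigma> A B = \<i> (A \<boxtimes> B)" "(\<sigma> A B)\<^sup>\<dagger> = \<sigma> B A"
    "h \<in> Arr C \<Longrightarrow> Cod C h = A \<boxtimes> B \<Longrightarrow> \<sigma> B A \<cdot> (\<sigma> A B \<cdot> h) = h"
proof -
  show 1: "\<sigma> B A \<cdot> \<sigma> A B = \<i> (A \<boxtimes> B)" using assms swap_swap by simp
  show "(\<sigma> A B)\<^sup>\<dagger> = \<sigma> B A"
    by (rule unitary_cancel_right[OF swap_unitary[OF assms]])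
       (use assms 1 unitary_simps(1)[OF swap_unitary[OF assms] refl refl] in simp_all)
  show "h \<in> Arr C \<Longrightarrow> Cod C h = A \<boxtimes> B \<Longrightarrow> \<sigma> B A \<cdot> (\<sigma> A B \<cdot> h) = h"
    using assms 1 comp_rewrite[of "\<sigma> B A" "\<sigma> A B" _ h] by simp
qed

lemma unitary_ten: "unitary C f \<Longrightarrow> unitary C g \<Longrightarrow> unitary C (f \<otimes> g)"
  by (auto simp: unitary_def)

lemma naturality:
  "\<lbrakk>f \<in> Arr C; g \<in> Arr C; h \<in> Arr C\<rbrakk>
    \<Longrightarrow> \<alpha> (Cod C f) (Cod C g) (Cod C h) \<cdot> ((f \<otimes> g) \<otimes> h)
      = (f \<otimes> (g \<otimes> h)) \<cdot> \<alpha> (Dom C f) (Dom C g) (Dom C h)"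
  "f \<in> Arr C \<Longrightarrow> \<l> (Cod C f) \<cdot> (\<i> \<one> \<otimes> f) = f \<cdot> \<l> (Dom C f)"
  "f \<in> Arr C \<Longrightarrow> \<r> (Cod C f) \<cdot> (f \<otimes> \<i> \<one>) = f \<cdot> \<r> (Dom C f)"
  "\<lbrakk>f \<in> Arr C; g \<in> Arr C\<rbrakk>
    \<Longrightarrow> \<sigma> (Cod C f) (Cod C g) \<cdot> (f \<otimes> g) = (g \<otimes> f) \<cdot> \<sigma> (Dom C f) (Dom C g)"
  using assoc_natural[of f "Dom C f" _ g "Dom C g" _ h "Dom C h"] lunit_natural[of f "Dom C f"]
    runit_natural[of f "Dom C f"] swap_natural[of f "Dom C f" _ g "Dom C g"]
  by (simp_all add: hom_iff)

section \<open>Coherence\<close>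

text \<open>Tensoring with \<open>\<one>\<close> is naturally isomorphic to the identity functor
  through \<open>\<l>\<close>, hence faithful. The unit coherence equations below are proved by
  tensoring with \<open>\<one>\<close> and cancelling it again.\<close>

lemma unit_ten_cancel:
  assumes "\<i> \<one> \<otimes> f = \<i> \<one> \<otimes> g" "f \<in> Arr C" "g \<in> Arr C" "Dom C f = Dom C g" "Cod C f = Cod C g"
  shows "f = g"
  by (rule unitary_cancel_right[of "\<l> (Dom C f)"])
     (use assms lunit_unitary naturality(2)[of f] naturality(2)[of g] in simp_all)

lemma ten_unit_cancel:
  assumes "f \<otimes> \<i> \<one> = g \<otimes> \<i> \<one>" "f \<in> Arr C" "g \<in> Arr C" "Dom C f = Dom C g" "Cod C f = Cod C g"
  shows "f = g"
  by (rule unitary_cancel_right[of "\<r> (Dom C f)"])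
     (use assms runit_unitary naturality(3)[of f] naturality(3)[of g] in simp_all)

text \<open>Kelly's argument from pentagon and triangle. After tensoring with \<open>\<one>\<close>,
  both sides are compared on \<open>?u\<close>, the first two arrows of the longer side of the
  pentagon for \<open>\<one>\<close>, \<open>\<one>\<close>, \<open>A\<close>,
  \<open>B\<close>.\<close>

lemma lunit_ten:
  assumes "A \<in> Ob C" "B \<in> Ob C"
  shows "\<l> (A \<boxtimes> B) \<cdot> \<alpha> \<one> A B = \<l> A \<otimes> \<i> B"
proof (rule unit_ten_cancel)
  let ?I = "\<one>"
  let ?u = "\<alpha> ?I (?I \<boxtimes> A) B \<cdot> (\<alpha> ?I ?I A \<otimes> \<i> B)"
  have u: "unitary C ?u" using assms by (intro unitary_comp unitary_ten assoc_unitary unitary_idn) simp_all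
  have "(\<i> ?I \<otimes> (\<l> (A \<boxtimes> B) \<cdot> \<alpha> ?I A B)) \<cdot> ?u
      = (\<i> ?I \<otimes> \<l> (A \<boxtimes> B)) \<cdot> ((\<i> ?I \<otimes> \<alpha> ?I A B) \<cdot> \<alpha> ?I (?I \<boxtimes> A) B \<cdot> (\<alpha> ?I ?I A \<otimes> \<i> B))"
    using assms by simp
  also have "\<dots> = ((\<i> ?I \<otimes> \<l> (A \<boxtimes> B)) \<cdot> \<alpha> ?I ?I (A \<boxtimes> B)) \<cdot> \<alpha> (?I \<boxtimes> ?I) A B"
    using assms pentagon[of ?I ?I A B] by simp
  also have "\<dots> = (\<r> ?I \<otimes> \<i> (A \<boxtimes> B)) \<cdot> \<alpha> (?I \<boxtimes> ?I) A B"
    using assms triangle[of ?I "A \<boxtimes> B"] by simp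
  also have "\<dots> = \<alpha> ?I A B \<cdot> ((\<r> ?I \<otimes> \<i> A) \<otimes> \<i> B)"
    using assms naturality(1)[of "\<r> ?I" "\<i> A" "\<i> B"] by simp
  also have "\<dots> = \<alpha> ?I A B \<cdot> ((\<i> ?I \<otimes> \<l> A) \<otimes> \<i> B) \<cdot> (\<alpha> ?I ?I A \<otimes> \<i> B)"
    using assms triangle[of ?I A] by simp
  also have "\<alpha> ?I A B \<cdot> ((\<i> ?I \<otimes> \<l> A) \<otimes> \<i> B) = (\<i> ?I \<otimes> (\<l> A \<otimes> \<i> B)) \<cdot> \<alpha> ?I (?I \<boxtimes> A) B"
    using assms naturality(1)[of "\<i> ?I" "\<l> A" "\<i> B"] by simp
  finally have "(\<i> ?I \<otimes> (\<l> (A \<boxtimes> B) \<cdot> \<alpha> ?I A B)) \<cdot> ?u = (\<i> ?I \<otimes> (\<l> A \<otimes> \<i> B)) \<cdot> ?u"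
    using assms by simp
  from unitary_cancel_right[OF u this] show "\<i> ?I \<otimes> (\<l> (A \<boxtimes> B) \<cdot> \<alpha> ?I A B) = \<i> ?I \<otimes> (\<l> A \<otimes> \<i> B)"
    using assms by simp
qed (use assms in simp_all)

lemma runit_ten:
  assumes "A \<in> Ob C" "B \<in> Ob C"
  shows "(\<i> A \<otimes> \<r> B) \<cdot> \<alpha> A B \<one> = \<r> (A \<boxtimes> B)"
proof (rule ten_unit_cancel)
  let ?I = "\<one>"
  have u: "unitary C (\<alpha> A B ?I)" using assms by (intro assoc_unitary) simp_all
  have "\<alpha> A B ?I \<cdot> (((\<i> A \<otimes> \<r> B) \<cdot> \<alpha> A B ?I) \<otimes> \<i> ?I)
      = (\<alpha> A B ?I \<cdot> ((\<i> A \<otimes> \<r> B) \<otimes> \<i> ?I)) \<cdot> (\<alpha> A B ?I \<otimes> \<i> ?I)"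
    using assms by simp
  also have "\<dots> = (\<i> A \<otimes> (\<r> B \<otimes> \<i> ?I)) \<cdot> \<alpha> A (B \<boxtimes> ?I) ?I \<cdot> (\<alpha> A B ?I \<otimes> \<i> ?I)"
    using assms naturality(1)[of "\<i> A" "\<r> B" "\<i> ?I"] by simp
  also have "\<i> A \<otimes> (\<r> B \<otimes> \<i> ?I) = (\<i> A \<otimes> (\<i> B \<otimes> \<l> ?I)) \<cdot> (\<i> A \<otimes> \<alpha> B ?I ?I)"
    using assms triangle[of B ?I] by simp
  also have "(\<i> A \<otimes> (\<i> B \<otimes> \<l> ?I)) \<cdot> (\<i> A \<otimes> \<alpha> B ?I ?I) \<cdot> \<alpha> A (B \<boxtimes> ?I) ?I \<cdot> (\<alpha> A B ?I \<otimes> \<i> ?I)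
     = (\<i> A \<otimes> (\<i> B \<otimes> \<l> ?I)) \<cdot> ((\<i> A \<otimes> \<alpha> B ?I ?I) \<cdot> \<alpha> A (B \<boxtimes> ?I) ?I \<cdot> (\<alpha> A B ?I \<otimes> \<i> ?I))"
    using assms by simp
  also have "\<dots> = ((\<i> A \<otimes> (\<i> B \<otimes> \<l> ?I)) \<cdot> \<alpha> A B (?I \<boxtimes> ?I)) \<cdot> \<alpha> (A \<boxtimes> B) ?I ?I"
    using assms pentagon[of A B ?I ?I] by simp
  also have "(\<i> A \<otimes> (\<i> B \<otimes> \<l> ?I)) \<cdot> \<alpha> A B (?I \<boxtimes> ?I) = \<alpha> A B ?I \<cdot> (\<i> (A \<boxtimes> B) \<otimes> \<l> ?I)"
    using assms naturality(1)[of "\<i> A" "\<i> B" "\<l> ?I"] by simp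
  finally have "\<alpha> A B ?I \<cdot> (((\<i> A \<otimes> \<r> B) \<cdot> \<alpha> A B ?I) \<otimes> \<i> ?I)
     = \<alpha> A B ?I \<cdot> ((\<i> (A \<boxtimes> B) \<otimes> \<l> ?I) \<cdot> \<alpha> (A \<boxtimes> B) ?I ?I)"
    using assms by simp
  also have "\<dots> = \<alpha> A B ?I \<cdot> (\<r> (A \<boxtimes> B) \<otimes> \<i> ?I)"
    using assms triangle[of "A \<boxtimes> B" ?I] by simp
  finally show "((\<i> A \<otimes> \<r> B) \<cdot> \<alpha> A B ?I) \<otimes> \<i> ?I = \<r> (A \<boxtimes> B) \<otimes> \<i> ?I"
    by (rule unitary_cancel_left[OF u]) (use assms in simp_all)
qed (use assms in simp_all)

text \<open>Naturality of \<open>\<l>\<close> at the arrow \<open>\<l> \<one>\<close> gives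
  \<open>\<l> (\<one> \<boxtimes> \<one>) = \<i> \<one> \<otimes> \<l> \<one>\<close>. With
  \<open>lunit_ten\<close> and the triangle, the two sides agree after tensoring with
  \<open>\<one>\<close>.\<close>

lemma lunit_unit: "\<l> \<one> = \<r> \<one>"
proof (rule ten_unit_cancel)
  let ?I = "\<one>"
  have 1: "\<l> (?I \<boxtimes> ?I) = \<i> ?I \<otimes> \<l> ?I"
    by (rule unitary_cancel_left[OF lunit_unitary[of ?I]]) (use naturality(2)[of "\<l> ?I"] in simp_all)
  have "\<l> ?I \<otimes> \<i> ?I = (\<i> ?I \<otimes> \<l> ?I) \<cdot> \<alpha> ?I ?I ?I"
    using lunit_ten[of ?I ?I] 1 by simp
  then show "\<l> ?I \<otimes> \<i> ?I = \<r> ?I \<otimes> \<i> ?I" using triangle[of ?I ?I] by simp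
qed simp_all

text \<open>The hexagon with two unit objects gives the mirror equation
  \<open>\<l> A \<cdot> \<sigma> A \<one> = \<r> A\<close> after tensoring with
  \<open>\<one>\<close>; as the symmetry is an involution, the claim follows.\<close>

lemma runit_swap:
  assumes "A \<in> Ob C" shows "\<r> A \<cdot> \<sigma> \<one> A = \<l> A"
proof -
  let ?I = "\<one>"
  have "\<l> A \<cdot> \<sigma> A ?I = \<r> A"
  proof (rule ten_unit_cancel)
    have "(\<l> A \<cdot> \<sigma> A ?I) \<otimes> \<i> ?I = (\<l> A \<otimes> \<i> ?I) \<cdot> (\<sigma> A ?I \<otimes> \<i> ?I)" using assms by simp
    also have "\<dots> = \<l> (A \<boxtimes> ?I) \<cdot> \<alpha> ?I A ?I \<cdot> (\<sigma> A ?I \<otimes> \<i> ?I)" using assms lunit_ten[of A ?I] by simp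
    also have "\<dots> = \<sigma> ?I A \<cdot> (\<sigma> A ?I \<cdot> (\<l> (A \<boxtimes> ?I) \<cdot> \<alpha> ?I A ?I \<cdot> (\<sigma> A ?I \<otimes> \<i> ?I)))"
      using assms by (subst swap_inv(3)) simp_all
    also have "\<sigma> A ?I \<cdot> (\<l> (A \<boxtimes> ?I) \<cdot> \<alpha> ?I A ?I \<cdot> (\<sigma> A ?I \<otimes> \<i> ?I))
       = (\<sigma> A ?I \<cdot> \<l> (A \<boxtimes> ?I)) \<cdot> \<alpha> ?I A ?I \<cdot> (\<sigma> A ?I \<otimes> \<i> ?I)"
      using assms by simp
    also have "\<sigma> A ?I \<cdot> \<l> (A \<boxtimes> ?I) = \<l> (?I \<boxtimes> A) \<cdot> (\<i> ?I \<otimes> \<sigma> A ?I)"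
      using assms naturality(2)[of "\<sigma> A ?I"] by simp
    also have "(\<l> (?I \<boxtimes> A) \<cdot> (\<i> ?I \<otimes> \<sigma> A ?I)) \<cdot> \<alpha> ?I A ?I \<cdot> (\<sigma> A ?I \<otimes> \<i> ?I)
       = \<l> (?I \<boxtimes> A) \<cdot> ((\<i> ?I \<otimes> \<sigma> A ?I) \<cdot> \<alpha> ?I A ?I \<cdot> (\<sigma> A ?I \<otimes> \<i> ?I))"
      using assms by simp
    also have "\<dots> = (\<l> (?I \<boxtimes> A) \<cdot> \<alpha> ?I ?I A) \<cdot> \<sigma> A (?I \<boxtimes> ?I) \<cdot> \<alpha> A ?I ?I"
      using assms hexagon[of A ?I ?I] by simp
    also have "\<dots> = (\<l> ?I \<otimes> \<i> A) \<cdot> \<sigma> A (?I \<boxtimes> ?I) \<cdot> \<alpha> A ?I ?I"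
      using assms lunit_ten[of ?I A] by simp
    also have "(\<l> ?I \<otimes> \<i> A) \<cdot> \<sigma> A (?I \<boxtimes> ?I) = \<sigma> A ?I \<cdot> (\<i> A \<otimes> \<l> ?I)"
      using assms naturality(4)[of "\<i> A" "\<l> ?I"] by simp
    also have "\<sigma> ?I A \<cdot> (\<sigma> A ?I \<cdot> (\<i> A \<otimes> \<l> ?I) \<cdot> \<alpha> A ?I ?I) = (\<i> A \<otimes> \<l> ?I) \<cdot> \<alpha> A ?I ?I"
      using assms by simp
    also have "\<dots> = \<r> A \<otimes> \<i> ?I" using assms triangle[of A ?I] by simp
    finally show "(\<l> A \<cdot> \<sigma> A ?I) \<otimes> \<i> ?I = \<r> A \<otimes> \<i> ?I" .
  qed (use assms in simp_all)
  then have "\<r> A \<cdot> \<sigma> ?I A = (\<l> A \<cdot> \<sigma> A ?I) \<cdot> \<sigma> ?I A" by simp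
  then show ?thesis using assms by simp
qed

text \<open>The other hexagon, for moving a tensor product past \<open>Z\<close>. It is
  \<open>hexagon\<close> inverted, by means of \<open>swap_swap\<close>.\<close>

lemma swap_ten:
  assumes "X \<in> Ob C" "Y \<in> Ob C" "Z \<in> Ob C"
  shows "\<alpha> X Z Y \<cdot> (\<sigma> Z X \<otimes> \<i> Y) \<cdot> (\<alpha> Z X Y)\<^sup>\<dagger> \<cdot> \<sigma> (X \<boxtimes> Y) Z = (\<i> X \<otimes> \<sigma> Y Z) \<cdot> \<alpha> X Y Z"
proof -
  have "(\<i> X \<otimes> \<sigma> Y Z) \<cdot> \<alpha> X Y Z
     = (\<i> X \<otimes> \<sigma> Y Z) \<cdot> (\<alpha> X Y Z \<cdot> \<sigma> Z (X \<boxtimes> Y) \<cdot> \<alpha> Z X Y) \<cdot> (\<alpha> Z X Y)\<^sup>\<dagger> \<cdot> \<sigma> (X \<boxtimes> Y) Z"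
    using assms by simp
  also have "\<dots> = (\<i> X \<otimes> \<sigma> Y Z) \<cdot> ((\<i> X \<otimes> \<sigma> Z Y) \<cdot> \<alpha> X Z Y \<cdot> (\<sigma> Z X \<otimes> \<i> Y)) \<cdot> (\<alpha> Z X Y)\<^sup>\<dagger> \<cdot> \<sigma> (X \<boxtimes> Y) Z"
    using hexagon[of Z X Y] assms by simp
  also have "\<dots> = \<alpha> X Z Y \<cdot> (\<sigma> Z X \<otimes> \<i> Y) \<cdot> (\<alpha> Z X Y)\<^sup>\<dagger> \<cdot> \<sigma> (X \<boxtimes> Y) Z"
    using assms by simp
  finally show ?thesis by simp
qed

end

section \<open>Shuffles of label lists and their coherence\<close>

fun mrg :: "nat list \<Rightarrow> nat list \<Rightarrow> nat list" where
  "mrg [] ys = ys"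
| "mrg (x # xs) [] = x # xs"
| "mrg (x # xs) (y # ys) = (if x < y then x # mrg xs (y # ys) else y # mrg (x # xs) ys)"

lemma mrg_Nil2 [simp]: "mrg xs [] = xs"
  by (cases xs) auto

lemma set_mrg [simp]: "set (mrg xs ys) = set xs \<union> set ys"
  by (induction xs ys rule: mrg.induct) auto

lemma sorted_mrg:
  "sorted xs \<Longrightarrow> sorted ys \<Longrightarrow> sorted (mrg xs ys)"
  by (induction xs ys rule: mrg.induct) (auto simp: less_le_not_le)

lemma distinct_mrg:
  "distinct xs \<Longrightarrow> distinct ys \<Longrightarrow> set xs \<inter> set ys = {} \<Longrightarrow> distinct (mrg xs ys)"
  by (induction xs ys rule: mrg.induct) auto

lemma mrg_sorted_list_of_set:
  assumes "finite S" "finite R" "S \<inter> R = {}"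
  shows "mrg (sorted_list_of_set S) (sorted_list_of_set R) = sorted_list_of_set (S \<union> R)"
  using assms
  by (intro sorted_distinct_set_unique) (simp_all add: sorted_mrg distinct_mrg)

text \<open>Merging compares heads only, so it suffices to look at the head of
  \<open>ys\<close>.\<close>

definition before :: "nat \<Rightarrow> nat list \<Rightarrow> bool" where
  "before x ys \<longleftrightarrow> ys = [] \<or> x < hd ys"

lemma mrg_before: "before x ys \<Longrightarrow> mrg (x # xs) ys = x # mrg xs ys"
  by (cases ys) (auto simp: before_def)

lemma before_mrg: "before x ys \<Longrightarrow> before x zs \<Longrightarrow> before x (mrg ys zs)"
  by (cases ys; cases zs) (auto simp: before_def)

lemma mrg_comm: "set xs \<inter> set ys = {} \<Longrightarrow> mrg ys xs = mrg xs ys"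
  by (induction xs ys rule: mrg.induct) auto

text \<open>A label is the name of a wire and \<open>ty\<close> gives the object on it; different
  wires may carry the same object.\<close>

locale labelling = symmetric_monoidal_dagger_category +
  fixes ty :: "nat \<Rightarrow> 'a"
  assumes ty_ob [simp]: "ty n \<in> Ob C"
begin

fun lob :: "nat list \<Rightarrow> 'a" where
  "lob [] = \<one>"
| "lob (x # xs) = ty x \<boxtimes> lob xs"

lemma lob_ob [simp]: "lob xs \<in> Ob C"
  by (induction xs) auto

text \<open>The shuffle isomorphism. A head of the left list is split off by reassociating; a head
  of the right list is first moved across the whole left block by one symmetry.\<close>

fun mg :: "nat list \<Rightarrow> nat list \<Rightarrow> 'b" where
  "mg [] ys = \<l> (lob ys)"
| "mg (x # xs) [] = \<r> (lob (x # xs))"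
| "mg (x # xs) (y # ys) =
    (if x < y then (\<i> (ty x) \<otimes> mg xs (y # ys)) \<cdot> \<alpha> (ty x) (lob xs) (lob (y # ys))
     else (\<i> (ty y) \<otimes> mg (x # xs) ys) \<cdot> \<alpha> (ty y) (lob (x # xs)) (lob ys)
       \<cdot> (\<sigma> (lob (x # xs)) (ty y) \<otimes> \<i> (lob ys)) \<cdot> (\<alpha> (lob (x # xs)) (ty y) (lob ys))\<^sup>\<dagger>)"

lemma mg_simps [simp]:
  "mg xs ys \<in> Arr C" "Dom C (mg xs ys) = lob xs \<boxtimes> lob ys" "Cod C (mg xs ys) = lob (mrg xs ys)"
  by (induction xs ys rule: mg.induct) (auto simp del: assoc_comp)

lemma mg_unitary: "unitary C (mg xs ys)"
  by (induction xs ys rule: mg.induct)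
     (auto intro!: lunit_unitary runit_unitary unitary_comp unitary_ten unitary_idn assoc_unitary
        swap_unitary unitary_dag)

text \<open>For nonempty \<open>ys\<close> this is the defining clause; for empty \<open>ys\<close>
  the definition has \<open>\<r>\<close> instead, and \<open>runit_ten\<close> reconciles the
  two.\<close>

lemma mg_before:
  assumes "before x ys"
  shows "mg (x # xs) ys = (\<i> (ty x) \<otimes> mg xs ys) \<cdot> \<alpha> (ty x) (lob xs) (lob ys)"
proof (cases ys)
  case Nil
  have "mg xs [] = \<r> (lob xs)" by (cases xs) (simp_all add: lunit_unit)
  then show ?thesis using Nil runit_ten[of "ty x" "lob xs"] by simp
qed (use assms in \<open>auto simp: before_def\<close>)

text \<open>Both shuffles split off the smaller head, and \<open>swap_ten\<close> carries the
  symmetry past it. When that head belongs to \<open>ys\<close>, the same computation is made with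
  the lists exchanged, and the two symmetries cancel.\<close>

lemma mg_comm: "set xs \<inter> set ys = {} \<Longrightarrow> mg ys xs \<cdot> \<sigma> (lob xs) (lob ys) = mg xs ys"
proof (induction xs ys rule: mg.induct)
  case (1 ys)
  have "mg ys [] = \<r> (lob ys)" by (cases ys) (simp_all add: lunit_unit)
  then show ?case using runit_swap by simp
next
  case (2 x xs)
  have "\<l> (lob (x # xs)) = \<r> (lob (x # xs)) \<cdot> \<sigma> \<one> (lob (x # xs))"
    using runit_swap[of "lob (x # xs)"] by simp
  then show ?case by simp
next
  case (3 x xs y ys)
  have *: "mg (b # bs) (a # as) \<cdot> \<sigma> (lob (a # as)) (lob (b # bs)) = mg (a # as) (b # bs)"
    if "a < b" "mg (b # bs) as \<cdot> \<sigma> (lob as) (lob (b # bs)) = mg as (b # bs)" for a as b bs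
  proof -
    have "mg (b # bs) (a # as) \<cdot> \<sigma> (lob (a # as)) (lob (b # bs)) =
      (\<i> (ty a) \<otimes> mg (b # bs) as) \<cdot> (\<alpha> (ty a) (lob (b # bs)) (lob as)
       \<cdot> (\<sigma> (lob (b # bs)) (ty a) \<otimes> \<i> (lob as)) \<cdot> (\<alpha> (lob (b # bs)) (ty a) (lob as))\<^sup>\<dagger>
       \<cdot> \<sigma> (ty a \<boxtimes> lob as) (lob (b # bs)))"
      using that by simp
    also have "\<dots> = (\<i> (ty a) \<otimes> mg as (b # bs)) \<cdot> \<alpha> (ty a) (lob as) (lob (b # bs))"
      unfolding swap_ten[OF ty_ob lob_ob lob_ob]
      unfolding that(2)[symmetric] by simp
    finally show ?thesis using that by simp
  qed
  show ?case
  proof (cases "x < y")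
    case True
    then show ?thesis using 3 by (intro *) auto
  next
    case False
    then have "y < x" using 3 by auto
    have ih: "mg ys (x # xs) \<cdot> \<sigma> (lob (x # xs)) (lob ys) = mg (x # xs) ys" using 3 False by auto
    have "mg (x # xs) ys \<cdot> \<sigma> (lob ys) (lob (x # xs)) = mg ys (x # xs)"
      unfolding ih[symmetric] by simp
    from *[OF \<open>y < x\<close> this] show ?thesis
      by (metis lob_ob mg_simps(1) mg_simps(2) coherence_simps(7,8,9) assoc_comp comp_idn(1) swap_inv(1))
  qed
qed

text \<open>The equation of lists is included because without it the two morphisms need not have the
  same codomain, and the induction has to deliver both at once.\<close>

definition mg_assoc :: "nat list \<Rightarrow> nat list \<Rightarrow> nat list \<Rightarrow> bool" where
  "mg_assoc xs ys zs \<longleftrightarrow> mrg (mrg xs ys) zs = mrg xs (mrg ys zs) \<and>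
     mg (mrg xs ys) zs \<cdot> (mg xs ys \<otimes> \<i> (lob zs))
      = mg xs (mrg ys zs) \<cdot> (\<i> (lob xs) \<otimes> mg ys zs) \<cdot> \<alpha> (lob xs) (lob ys) (lob zs)"

lemma mg_assoc_Nil: "mg_assoc [] ys zs"
proof -
  have "mg ys zs \<cdot> (\<l> (lob ys) \<otimes> \<i> (lob zs)) = (mg ys zs \<cdot> \<l> (lob ys \<boxtimes> lob zs)) \<cdot> \<alpha> \<one> (lob ys) (lob zs)"
    using lunit_ten[of "lob ys" "lob zs"] by simp
  also have "mg ys zs \<cdot> \<l> (lob ys \<boxtimes> lob zs) = \<l> (lob (mrg ys zs)) \<cdot> (\<i> \<one> \<otimes> mg ys zs)"
    using naturality(2)[of "mg ys zs"] by simp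
  finally show ?thesis by (simp add: mg_assoc_def)
qed

text \<open>The case where the smallest head sits in the first list: the pentagon moves it out on
  both sides.\<close>

lemma mg_assoc_Cons:
  assumes "before x ys" "before x zs" "mg_assoc xs ys zs"
  shows "mg_assoc (x # xs) ys zs"
proof -
  let ?x = "ty x" and ?X = "lob xs" and ?Y = "lob ys" and ?Z = "lob zs"
  have l: "mrg (mrg xs ys) zs = mrg xs (mrg ys zs)"
    and m: "mg (mrg xs ys) zs \<cdot> (mg xs ys \<otimes> \<i> ?Z) = mg xs (mrg ys zs) \<cdot> (\<i> ?X \<otimes> mg ys zs) \<cdot> \<alpha> ?X ?Y ?Z"
    using assms by (auto simp: mg_assoc_def)
  have "mg (mrg (x # xs) ys) zs \<cdot> (mg (x # xs) ys \<otimes> \<i> ?Z)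
    = (\<i> ?x \<otimes> mg (mrg xs ys) zs) \<cdot> (\<alpha> ?x (lob (mrg xs ys)) ?Z \<cdot> ((\<i> ?x \<otimes> mg xs ys) \<otimes> \<i> ?Z)) \<cdot> (\<alpha> ?x ?X ?Y \<otimes> \<i> ?Z)"
    using assms by (simp add: mg_before mrg_before)
  also have "\<alpha> ?x (lob (mrg xs ys)) ?Z \<cdot> ((\<i> ?x \<otimes> mg xs ys) \<otimes> \<i> ?Z)
    = (\<i> ?x \<otimes> (mg xs ys \<otimes> \<i> ?Z)) \<cdot> \<alpha> ?x (?X \<boxtimes> ?Y) ?Z"
    using naturality(1)[of "\<i> ?x" "mg xs ys" "\<i> ?Z"] by simp
  also have "(\<i> ?x \<otimes> mg (mrg xs ys) zs) \<cdot> ((\<i> ?x \<otimes> (mg xs ys \<otimes> \<i> ?Z)) \<cdot> \<alpha> ?x (?X \<boxtimes> ?Y) ?Z) \<cdot> (\<alpha> ?x ?X ?Y \<otimes> \<i> ?Z)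
    = (\<i> ?x \<otimes> (mg (mrg xs ys) zs \<cdot> (mg xs ys \<otimes> \<i> ?Z))) \<cdot> (\<alpha> ?x (?X \<boxtimes> ?Y) ?Z \<cdot> (\<alpha> ?x ?X ?Y \<otimes> \<i> ?Z))"
    by simp
  also have "\<dots> = (\<i> ?x \<otimes> mg xs (mrg ys zs)) \<cdot> (\<i> ?x \<otimes> (\<i> ?X \<otimes> mg ys zs))
      \<cdot> ((\<i> ?x \<otimes> \<alpha> ?X ?Y ?Z) \<cdot> \<alpha> ?x (?X \<boxtimes> ?Y) ?Z \<cdot> (\<alpha> ?x ?X ?Y \<otimes> \<i> ?Z))"
    unfolding m by simp
  also have "\<dots> = (\<i> ?x \<otimes> mg xs (mrg ys zs)) \<cdot> ((\<i> ?x \<otimes> (\<i> ?X \<otimes> mg ys zs)) \<cdot> \<alpha> ?x ?X (?Y \<boxtimes> ?Z)) \<cdot> \<alpha> (?x \<boxtimes> ?X) ?Y ?Z"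
    using pentagon[of ?x ?X ?Y ?Z] by simp
  also have "(\<i> ?x \<otimes> (\<i> ?X \<otimes> mg ys zs)) \<cdot> \<alpha> ?x ?X (?Y \<boxtimes> ?Z)
    = \<alpha> ?x ?X (lob (mrg ys zs)) \<cdot> (\<i> (?x \<boxtimes> ?X) \<otimes> mg ys zs)"
    using naturality(1)[of "\<i> ?x" "\<i> ?X" "mg ys zs"] by simp
  finally show ?thesis using assms l
    by (simp add: mg_assoc_def mg_before mrg_before before_mrg)
qed

text \<open>Reduces to instances with \<open>ys\<close> in front: \<open>mg_comm\<close> introduces
  symmetries, and the hexagon distributes them over the two remaining lists.\<close>

lemma mg_assoc_middle:
  assumes "mg_assoc ys xs zs" "mg_assoc ys zs xs"
    "set xs \<inter> set ys = {}" "set ys \<inter> set zs = {}" "set xs \<inter> set zs = {}"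
  shows "mg_assoc xs ys zs"
proof -
  let ?X = "lob xs" and ?Y = "lob ys" and ?Z = "lob zs"
  have c: "mrg ys xs = mrg xs ys" "mrg zs xs = mrg xs zs" "mrg (mrg ys zs) xs = mrg xs (mrg ys zs)"
    using assms by (intro mrg_comm; auto)+
  have l: "mrg (mrg xs ys) zs = mrg xs (mrg ys zs)"
    using assms c by (simp add: mg_assoc_def)
  have 1: "mg (mrg xs ys) zs \<cdot> (mg ys xs \<otimes> \<i> ?Z) = mg ys (mrg xs zs) \<cdot> (\<i> ?Y \<otimes> mg xs zs) \<cdot> \<alpha> ?Y ?X ?Z"
    and 2: "mg (mrg ys zs) xs \<cdot> (mg ys zs \<otimes> \<i> ?X) = mg ys (mrg xs zs) \<cdot> (\<i> ?Y \<otimes> mg zs xs) \<cdot> \<alpha> ?Y ?Z ?X"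
    using assms c by (auto simp: mg_assoc_def)
  have m1: "mg ys xs \<cdot> \<sigma> ?X ?Y = mg xs ys" and m2: "mg zs xs \<cdot> \<sigma> ?X ?Z = mg xs zs"
    and m3: "mg (mrg ys zs) xs \<cdot> \<sigma> ?X (lob (mrg ys zs)) = mg xs (mrg ys zs)"
    using assms by (intro mg_comm; auto)+
  have t: "lob (mrg (mrg ys zs) xs) = lob (mrg ys (mrg xs zs))" "lob (mrg (mrg xs ys) zs) = lob (mrg ys (mrg xs zs))"
    using assms c by (auto simp: mg_assoc_def)
  have "mg xs (mrg ys zs) \<cdot> (\<i> ?X \<otimes> mg ys zs) \<cdot> \<alpha> ?X ?Y ?Z
    = mg (mrg ys zs) xs \<cdot> (\<sigma> ?X (lob (mrg ys zs)) \<cdot> (\<i> ?X \<otimes> mg ys zs)) \<cdot> \<alpha> ?X ?Y ?Z"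
    unfolding m3[symmetric] by simp
  also have "\<sigma> ?X (lob (mrg ys zs)) \<cdot> (\<i> ?X \<otimes> mg ys zs) = (mg ys zs \<otimes> \<i> ?X) \<cdot> \<sigma> ?X (?Y \<boxtimes> ?Z)"
    using naturality(4)[of "\<i> ?X" "mg ys zs"] by simp
  also have "mg (mrg ys zs) xs \<cdot> ((mg ys zs \<otimes> \<i> ?X) \<cdot> \<sigma> ?X (?Y \<boxtimes> ?Z)) \<cdot> \<alpha> ?X ?Y ?Z
    = (mg (mrg ys zs) xs \<cdot> (mg ys zs \<otimes> \<i> ?X)) \<cdot> \<sigma> ?X (?Y \<boxtimes> ?Z) \<cdot> \<alpha> ?X ?Y ?Z"
    by simp
  also have "\<dots> = mg ys (mrg xs zs) \<cdot> (\<i> ?Y \<otimes> mg zs xs) \<cdot> (\<alpha> ?Y ?Z ?X \<cdot> \<sigma> ?X (?Y \<boxtimes> ?Z) \<cdot> \<alpha> ?X ?Y ?Z)"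
    unfolding 2 using c by simp
  also have "\<dots> = mg ys (mrg xs zs) \<cdot> (\<i> ?Y \<otimes> (mg zs xs \<cdot> \<sigma> ?X ?Z)) \<cdot> \<alpha> ?Y ?X ?Z \<cdot> (\<sigma> ?X ?Y \<otimes> \<i> ?Z)"
    unfolding hexagon[OF lob_ob lob_ob lob_ob] using c by simp
  also have "\<dots> = (mg (mrg xs ys) zs \<cdot> (mg ys xs \<otimes> \<i> ?Z)) \<cdot> (\<sigma> ?X ?Y \<otimes> \<i> ?Z)"
    unfolding m2 1 by simp
  also have "\<dots> = mg (mrg xs ys) zs \<cdot> (mg xs ys \<otimes> \<i> ?Z)"
    unfolding m1[symmetric] using c by simp
  finally show ?thesis using l by (simp add: mg_assoc_def)
qed

text \<open>The mirror reduction, with \<open>zs\<close> brought forward and \<open>swap_ten\<close>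
  in place of the hexagon.\<close>

lemma mg_assoc_last:
  assumes "mg_assoc zs xs ys" "mg_assoc xs zs ys"
    "set xs \<inter> set ys = {}" "set ys \<inter> set zs = {}" "set xs \<inter> set zs = {}"
  shows "mg_assoc xs ys zs"
proof -
  let ?X = "lob xs" and ?Y = "lob ys" and ?Z = "lob zs"
  have c: "mrg zs ys = mrg ys zs" "mrg zs xs = mrg xs zs" "mrg zs (mrg xs ys) = mrg (mrg xs ys) zs"
    using assms by (intro mrg_comm; auto)+
  have l: "mrg (mrg xs ys) zs = mrg xs (mrg ys zs)"
    using assms c by (simp add: mg_assoc_def)
  have 1: "mg (mrg xs zs) ys \<cdot> (mg zs xs \<otimes> \<i> ?Y) = mg zs (mrg xs ys) \<cdot> (\<i> ?Z \<otimes> mg xs ys) \<cdot> \<alpha> ?Z ?X ?Y"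
    and 2: "mg (mrg xs zs) ys \<cdot> (mg xs zs \<otimes> \<i> ?Y) = mg xs (mrg ys zs) \<cdot> (\<i> ?X \<otimes> mg zs ys) \<cdot> \<alpha> ?X ?Z ?Y"
    using assms c by (auto simp: mg_assoc_def)
  have m1: "mg zs ys \<cdot> \<sigma> ?Y ?Z = mg ys zs" and m2: "mg xs zs \<cdot> \<sigma> ?Z ?X = mg zs xs"
    and m3: "mg zs (mrg xs ys) \<cdot> \<sigma> (lob (mrg xs ys)) ?Z = mg (mrg xs ys) zs"
    using assms by (intro mg_comm; auto)+
  have "mg (mrg xs ys) zs \<cdot> (mg xs ys \<otimes> \<i> ?Z)
    = mg zs (mrg xs ys) \<cdot> (\<sigma> (lob (mrg xs ys)) ?Z \<cdot> (mg xs ys \<otimes> \<i> ?Z))"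
    unfolding m3[symmetric] by simp
  also have "\<sigma> (lob (mrg xs ys)) ?Z \<cdot> (mg xs ys \<otimes> \<i> ?Z) = (\<i> ?Z \<otimes> mg xs ys) \<cdot> \<sigma> (?X \<boxtimes> ?Y) ?Z"
    using naturality(4)[of "mg xs ys" "\<i> ?Z"] by simp
  also have "mg zs (mrg xs ys) \<cdot> ((\<i> ?Z \<otimes> mg xs ys) \<cdot> \<sigma> (?X \<boxtimes> ?Y) ?Z)
    = (mg zs (mrg xs ys) \<cdot> (\<i> ?Z \<otimes> mg xs ys) \<cdot> \<alpha> ?Z ?X ?Y) \<cdot> (\<alpha> ?Z ?X ?Y)\<^sup>\<dagger> \<cdot> \<sigma> (?X \<boxtimes> ?Y) ?Z"
    by simp
  also have "\<dots> = mg (mrg xs zs) ys \<cdot> (mg zs xs \<otimes> \<i> ?Y) \<cdot> (\<alpha> ?Z ?X ?Y)\<^sup>\<dagger> \<cdot> \<sigma> (?X \<boxtimes> ?Y) ?Z"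
    unfolding 1[symmetric] using c by simp
  also have "\<dots> = (mg (mrg xs zs) ys \<cdot> (mg xs zs \<otimes> \<i> ?Y)) \<cdot> (\<sigma> ?Z ?X \<otimes> \<i> ?Y) \<cdot> (\<alpha> ?Z ?X ?Y)\<^sup>\<dagger> \<cdot> \<sigma> (?X \<boxtimes> ?Y) ?Z"
    unfolding m2[symmetric] by simp
  also have "\<dots> = mg xs (mrg ys zs) \<cdot> (\<i> ?X \<otimes> mg zs ys) \<cdot>
      (\<alpha> ?X ?Z ?Y \<cdot> (\<sigma> ?Z ?X \<otimes> \<i> ?Y) \<cdot> (\<alpha> ?Z ?X ?Y)\<^sup>\<dagger> \<cdot> \<sigma> (?X \<boxtimes> ?Y) ?Z)"
    unfolding 2 using c by simp
  also have "\<dots> = mg xs (mrg ys zs) \<cdot> (\<i> ?X \<otimes> (mg zs ys \<cdot> \<sigma> ?Y ?Z)) \<cdot> \<alpha> ?X ?Y ?Z"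
    unfolding swap_ten[OF lob_ob lob_ob lob_ob] using c by simp
  finally show ?thesis using l m1 by (simp add: mg_assoc_def)
qed

text \<open>Induction on the total length, split according to which list starts with the smallest
  label.\<close>

lemma mg_assoc:
  "set xs \<inter> set ys = {} \<Longrightarrow> set ys \<inter> set zs = {} \<Longrightarrow> set xs \<inter> set zs = {} \<Longrightarrow> mg_assoc xs ys zs"
proof (induction "length xs + length ys + length zs" arbitrary: xs ys zs rule: less_induct)
  case less
  let ?d = "\<lambda>xs ys zs. set xs \<inter> set ys = {} \<and> set ys \<inter> set zs = {} \<and> set xs \<inter> set zs = {}"
  \<comment> \<open>Stated for all lists of the same total length, since the other two cases apply
    it to permutations of \<open>xs\<close>, \<open>ys\<close>, \<open>zs\<close>, which are not
    shorter.\<close>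
  have first: "mg_assoc as bs cs"
    if "?d as bs cs" "length as + length bs + length cs = length xs + length ys + length zs"
      "as = [] \<or> before (hd as) bs \<and> before (hd as) cs" for as bs cs
  proof (cases as)
    case Nil
    then show ?thesis by (simp add: mg_assoc_Nil)
  next
    case (Cons a as')
    have "mg_assoc as' bs cs" by (rule less.hyps) (use that Cons in auto)
    then show ?thesis unfolding Cons by (rule mg_assoc_Cons[rotated 2]) (use that Cons in auto)
  qed
  have middle: "mg_assoc as bs cs"
    if "?d as bs cs" "length as + length bs + length cs = length xs + length ys + length zs"
      "bs = [] \<or> before (hd bs) as \<and> before (hd bs) cs" for as bs cs
  proof -
    have d: "set bs \<inter> set as = {}" "set cs \<inter> set bs = {}" "set cs \<inter> set as = {}"
      "set bs \<inter> set cs = {}" "set as \<inter> set cs = {}" "set as \<inter> set bs = {}"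
      using that by blast+
    have l: "length bs + length as + length cs = length xs + length ys + length zs"
      "length bs + length cs + length as = length xs + length ys + length zs" using that(2) by simp_all
    have h: "bs = [] \<or> before (hd bs) cs \<and> before (hd bs) as" using that(3) by blast
    have "mg_assoc bs as cs" by (rule first[OF _ l(1)]; (intro conjI d | fact that))
    moreover have "mg_assoc bs cs as" by (rule first[OF _ l(2)]; (intro conjI d | fact h))
    ultimately show ?thesis using d by (metis mg_assoc_middle)
  qed
  have tri: "(xs = [] \<or> before (hd xs) ys \<and> before (hd xs) zs) \<or>
    (ys = [] \<or> before (hd ys) xs \<and> before (hd ys) zs) \<or>
    (zs = [] \<or> before (hd zs) xs \<and> before (hd zs) ys)"
  proof (cases "xs = [] \<or> ys = [] \<or> zs = []")
    case False
    then obtain x xs' y ys' z zs' where "xs = x # xs'" "ys = y # ys'" "zs = z # zs'"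
      by (meson neq_Nil_conv)
    then show ?thesis using less.prems by (auto simp: before_def)
  qed auto
  then consider "xs = [] \<or> before (hd xs) ys \<and> before (hd xs) zs"
    | "ys = [] \<or> before (hd ys) xs \<and> before (hd ys) zs"
    | "zs = [] \<or> before (hd zs) xs \<and> before (hd zs) ys"
    by argo
  moreover have d: "set ys \<inter> set xs = {}" "set zs \<inter> set ys = {}" "set zs \<inter> set xs = {}"
    using less.prems by blast+
  note d = d less.prems
  ultimately show ?case
  proof cases
    case 1 show ?thesis by (rule first) (use 1 d in simp_all)
  next
    case 2 show ?thesis by (rule middle) (use 2 d in simp_all)
  next
    case 3
    have l: "length zs + length xs + length ys = length xs + length ys + length zs"
      "length xs + length zs + length ys = length xs + length ys + length zs" by simp_all
    have "mg_assoc zs xs ys" by (rule first[OF _ l(1)]; (intro conjI d | fact 3))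
    moreover have "mg_assoc xs zs ys" by (rule middle[OF _ l(2)]; (intro conjI d | fact 3))
    ultimately show ?thesis using d by (metis mg_assoc_last)
  qed
qed

end

section \<open>Networks of labelled boxes\<close>

datatype tr = Emp | Lf nat | Br tr tr (infixr "\<star>" 75)

primrec lv :: "tr \<Rightarrow> nat set" where
  "lv Emp = {}"
| "lv (Lf n) = {n}"
| "lv (T \<star> U) = lv T \<union> lv U"

primrec dst :: "tr \<Rightarrow> bool" where
  "dst Emp \<longleftrightarrow> True"
| "dst (Lf n) \<longleftrightarrow> True"
| "dst (T \<star> U) \<longleftrightarrow> dst T \<and> dst U \<and> lv T \<inter> lv U = {}"

lemma finite_lv [simp]: "finite (lv T)"
  by (induction T) auto

text \<open>A box \<open>(T, f, U)\<close> consumes the wires \<open>lv T\<close> and produces the wires \<open>lv U\<close>.\<close>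

type_synonym 'a box = "tr \<times> 'a \<times> tr"

fun fin :: "nat set \<Rightarrow> 'a box list \<Rightarrow> nat set" where
  "fin S [] = S"
| "fin S ((T, f, U) # L) = fin (S - lv T \<union> lv U) L"

text \<open>Every label that is ever produced, including those consumed later on. Freshness refers
  to this set, while \<open>fin\<close> keeps only the wires still open at the end.\<close>

fun ol :: "'a box list \<Rightarrow> nat set" where
  "ol [] = {}"
| "ol ((T, f, U) # L) = lv U \<union> ol L"

lemma fin_append [simp]: "fin S (L @ K) = fin (fin S L) K"
  by (induction S L rule: fin.induct) auto

lemma ol_append [simp]: "ol (L @ K) = ol L \<union> ol K"
  by (induction L rule: ol.induct) auto

lemma fin_subset: "fin S L \<subseteq> S \<union> ol L"
  by (induction S L rule: fin.induct) auto

context labelling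
begin

text \<open>The order on labels fixes the arrangement of the factors, so the object depends on the
  set of wires alone.\<close>

definition N :: "nat set \<Rightarrow> 'a" where
  "N S = lob (sorted_list_of_set S)"

definition M :: "nat set \<Rightarrow> nat set \<Rightarrow> 'b" where
  "M S R = mg (sorted_list_of_set S) (sorted_list_of_set R)"

lemma N_ob [simp]: "N S \<in> Ob C"
  by (simp add: N_def)

lemma N_empty [simp]: "N {} = \<one>"
  by (simp add: N_def)

lemma M_simps [simp]:
  "M S R \<in> Arr C" "Dom C (M S R) = N S \<boxtimes> N R"
  "finite S \<Longrightarrow> finite R \<Longrightarrow> S \<inter> R = {} \<Longrightarrow> Cod C (M S R) = N (S \<union> R)"
  by (simp_all add: M_def N_def mrg_sorted_list_of_set)

lemma M_unitary: "unitary C (M S R)"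
  by (simp add: M_def mg_unitary)

lemmas M_inv [simp] = unitary_simps[OF M_unitary M_simps(2,3)]

lemma M_comm: "finite S \<Longrightarrow> finite R \<Longrightarrow> S \<inter> R = {} \<Longrightarrow> M R S \<cdot> \<sigma> (N S) (N R) = M S R"
  unfolding M_def N_def by (rule mg_comm) simp

lemma M_assoc:
  assumes "finite S" "finite R" "finite Q" "S \<inter> R = {}" "R \<inter> Q = {}" "S \<inter> Q = {}"
  shows "M (S \<union> R) Q \<cdot> (M S R \<otimes> \<i> (N Q)) = M S (R \<union> Q) \<cdot> (\<i> (N S) \<otimes> M R Q) \<cdot> \<alpha> (N S) (N R) (N Q)"
  using mg_assoc[of "sorted_list_of_set S" "sorted_list_of_set R" "sorted_list_of_set Q"] assms
  by (simp add: mg_assoc_def mrg_sorted_list_of_set M_def N_def)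

lemma M_empty: "M {} S = \<l> (N S)" "M S {} = \<r> (N S)"
proof -
  show 1: "M {} S = \<l> (N S)" by (simp add: M_def N_def)
  show "M S {} = \<r> (N S)" by (cases "sorted_list_of_set S") (simp_all add: M_def N_def lunit_unit)
qed

definition typed :: "nat set \<Rightarrow> nat set \<Rightarrow> 'b \<Rightarrow> bool" where
  "typed S R f \<longleftrightarrow> finite S \<and> finite R \<and> f \<in> Arr C \<and> Dom C f = N S \<and> Cod C f = N R"

text \<open>Unlike \<open>\<otimes>\<close>, the tensor product on label sets is strictly associative, commutative and unital.\<close>

definition tn :: "nat set \<Rightarrow> nat set \<Rightarrow> nat set \<Rightarrow> nat set \<Rightarrow> 'b \<Rightarrow> 'b \<Rightarrow> 'b" where
  "tn S S' R R' f g = M S' R' \<cdot> (f \<otimes> g) \<cdot> (M S R)\<^sup>\<dagger>"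

lemma tn_typed:
  "typed S S' f \<Longrightarrow> typed R R' g \<Longrightarrow> S \<inter> R = {} \<Longrightarrow> S' \<inter> R' = {} \<Longrightarrow> typed (S \<union> R) (S' \<union> R') (tn S S' R R' f g)"
  by (simp add: typed_def tn_def)

lemma typed_idn [simp]: "finite S \<Longrightarrow> typed S S (\<i> (N S))"
  by (simp add: typed_def)

lemma typed_comp: "typed S R f \<Longrightarrow> typed R Q g \<Longrightarrow> typed S Q (g \<cdot> f)"
  by (simp add: typed_def)

lemma tn_idn: "finite S \<Longrightarrow> finite R \<Longrightarrow> S \<inter> R = {} \<Longrightarrow> tn S S R R (\<i> (N S)) (\<i> (N R)) = \<i> (N (S \<union> R))"
  by (simp add: tn_def)

lemma tn_comp:
  assumes "typed S S' f" "typed S' S'' f'" "typed R R' g" "typed R' R'' g'"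
    "S \<inter> R = {}" "S' \<inter> R' = {}" "S'' \<inter> R'' = {}"
  shows "tn S' S'' R' R'' f' g' \<cdot> tn S S' R R' f g = tn S S'' R R'' (f' \<cdot> f) (g' \<cdot> g)"
  using assms by (simp add: tn_def typed_def)

text \<open>Naturality turns \<open>g \<otimes> f\<close> into \<open>f \<otimes> g\<close> between
  two symmetries, and \<open>M_comm\<close> absorbs one of them at each end.\<close>

lemma tn_comm:
  assumes "typed S S' f" "typed R R' g" "S \<inter> R = {}" "S' \<inter> R' = {}"
  shows "tn S S' R R' f g = tn R R' S S' g f"
proof -
  have *: "R \<inter> S = {}" "R' \<inter> S' = {}" using assms by auto
  have "tn R R' S S' g f = M R' S' \<cdot> ((g \<otimes> f) \<cdot> \<sigma> (N S) (N R)) \<cdot> (\<sigma> (N R) (N S) \<cdot> (M R S)\<^sup>\<dagger>)"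
    using assms * by (simp add: tn_def typed_def)
  also have "(g \<otimes> f) \<cdot> \<sigma> (N S) (N R) = \<sigma> (N S') (N R') \<cdot> (f \<otimes> g)"
    using naturality(4)[of f g] assms by (simp add: typed_def)
  also have "M R' S' \<cdot> (\<sigma> (N S') (N R') \<cdot> (f \<otimes> g)) = (M R' S' \<cdot> \<sigma> (N S') (N R')) \<cdot> (f \<otimes> g)"
    using assms * by (simp add: typed_def)
  also have "\<dots> = M S' R' \<cdot> (f \<otimes> g)"
    using assms by (simp add: M_comm typed_def)
  also have "\<sigma> (N R) (N S) \<cdot> (M R S)\<^sup>\<dagger> = (M R S \<cdot> \<sigma> (N S) (N R))\<^sup>\<dagger>"
    using assms by (simp add: typed_def)
  also have "\<dots> = (M S R)\<^sup>\<dagger>" using assms by (simp add: M_comm typed_def)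
  finally show ?thesis by (simp add: tn_def)
qed

lemma tn_empty:
  assumes "typed S S' f" shows "tn S S' {} {} f (\<i> \<one>) = f"
  using naturality(3)[of f] assms assoc_comp[of "(\<r> (N S))\<^sup>\<dagger>" "f \<otimes> \<i> \<one>" "\<r> (N S')"]
  by (simp add: tn_def M_empty typed_def)

lemma tn_assoc:
  assumes "typed S S' f" "typed R R' g" "typed Q Q' h"
    "S \<inter> R = {}" "R \<inter> Q = {}" "S \<inter> Q = {}" "S' \<inter> R' = {}" "R' \<inter> Q' = {}" "S' \<inter> Q' = {}"
  shows "tn (S \<union> R) (S' \<union> R') Q Q' (tn S S' R R' f g) h = tn S S' (R \<union> Q) (R' \<union> Q') f (tn R R' Q Q' g h)"
proof -
  note t = assms(1-3)[unfolded typed_def] assms(4-)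
  have u: "(S \<union> R) \<inter> Q = {}" "(S' \<union> R') \<inter> Q' = {}" "S \<inter> (R \<union> Q) = {}" "S' \<inter> (R' \<union> Q') = {}" using assms by auto
  have "tn (S \<union> R) (S' \<union> R') Q Q' (tn S S' R R' f g) h
    = (M (S' \<union> R') Q' \<cdot> (M S' R' \<otimes> \<i> (N Q'))) \<cdot> ((f \<otimes> g) \<otimes> h) \<cdot> (M (S \<union> R) Q \<cdot> (M S R \<otimes> \<i> (N Q)))\<^sup>\<dagger>"
    using t u by (simp add: tn_def)
  also have "\<dots> = M S' (R' \<union> Q') \<cdot> (\<i> (N S') \<otimes> M R' Q') \<cdot> (\<alpha> (N S') (N R') (N Q') \<cdot> ((f \<otimes> g) \<otimes> h))
      \<cdot> ((\<alpha> (N S) (N R) (N Q))\<^sup>\<dagger> \<cdot> (\<i> (N S) \<otimes> (M R Q)\<^sup>\<dagger>) \<cdot> (M S (R \<union> Q))\<^sup>\<dagger>)"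
    using t u by (simp add: M_assoc)
  also have "\<alpha> (N S') (N R') (N Q') \<cdot> ((f \<otimes> g) \<otimes> h) = (f \<otimes> (g \<otimes> h)) \<cdot> \<alpha> (N S) (N R) (N Q)"
    using naturality(1)[of f g h] t by simp
  finally show ?thesis using t u by (simp add: tn_def)
qed

text \<open>The morphism \<open>f\<close> acting beside the idle wires \<open>R\<close>.\<close>

definition fr :: "nat set \<Rightarrow> nat set \<Rightarrow> nat set \<Rightarrow> 'b \<Rightarrow> 'b" where
  "fr R S S' f = tn S S' R R f (\<i> (N R))"

lemma fr_typed:
  "typed S S' f \<Longrightarrow> finite R \<Longrightarrow> S \<inter> R = {} \<Longrightarrow> S' \<inter> R = {} \<Longrightarrow> typed (S \<union> R) (S' \<union> R) (fr R S S' f)"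
  unfolding fr_def by (rule tn_typed) auto

lemma fr_idn: "finite S \<Longrightarrow> finite R \<Longrightarrow> S \<inter> R = {} \<Longrightarrow> fr R S S (\<i> (N S)) = \<i> (N (S \<union> R))"
  by (simp add: fr_def tn_idn)

lemma fr_comp:
  assumes "typed S S' f" "typed S' S'' g" "finite R" "S \<inter> R = {}" "S' \<inter> R = {}" "S'' \<inter> R = {}"
  shows "fr R S S'' (g \<cdot> f) = fr R S' S'' g \<cdot> fr R S S' f"
  using assms by (simp add: fr_def tn_comp[of _ S' _ _ _ _ R])

lemma fr_fr:
  assumes "typed S S' f" "finite R" "finite Q" "S \<inter> R = {}" "R \<inter> Q = {}" "S \<inter> Q = {}" "S' \<inter> R = {}" "S' \<inter> Q = {}"
  shows "fr Q (S \<union> R) (S' \<union> R) (fr R S S' f) = fr (R \<union> Q) S S' f"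
  using assms by (simp add: fr_def tn_assoc tn_idn)

lemma fr_empty: "typed S S' f \<Longrightarrow> fr {} S S' f = f"
  by (simp add: fr_def tn_empty)

lemma fr_tn:
  assumes "typed S S' f" "typed R R' g" "S \<inter> R = {}" "S' \<inter> R' = {}" "S' \<inter> R = {}"
  shows "fr S' R R' g \<cdot> fr R S S' f = tn S S' R R' f g"
proof -
  have fin: "finite S" "finite S'" "finite R" using assms by (auto simp: typed_def)
  have "fr S' R R' g = tn S' S' R R' (\<i> (N S')) g"
    unfolding fr_def by (rule tn_comm) (use assms fin in auto)
  then show ?thesis unfolding fr_def using assms fin
    by (simp add: tn_comp[of S S' f S' "\<i> (N S')" R R "\<i> (N R)" R' g]) (simp add: typed_def)
qed

text \<open>Bifunctoriality: either order equals the parallel product \<open>tn\<close> of the two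
  boxes framed by \<open>Q\<close>, and \<open>tn\<close> is commutative.\<close>

lemma fr_commute:
  assumes b: "typed S S' f" and c: "typed R R' g" and q: "finite Q"
    and d: "S \<inter> R = {}" "S' \<inter> R = {}" "S \<inter> R' = {}" "S' \<inter> R' = {}"
      "S \<inter> Q = {}" "S' \<inter> Q = {}" "R \<inter> Q = {}" "R' \<inter> Q = {}"
  shows "fr (S' \<union> Q) R R' g \<cdot> fr (R \<union> Q) S S' f = fr (R' \<union> Q) S S' f \<cdot> fr (S \<union> Q) R R' g"
proof -
  have *: "fr (S' \<union> Q) R R' g \<cdot> fr (R \<union> Q) S S' f = fr Q (S \<union> R) (S' \<union> R') (tn S S' R R' f g)"
    if "typed S S' f" "typed R R' g"
      "S \<inter> R = {}" "S' \<inter> R = {}" "S' \<inter> R' = {}" "S \<inter> Q = {}" "S' \<inter> Q = {}" "R \<inter> Q = {}" "R' \<inter> Q = {}"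
    for S S' R R' f g
  proof -
    have fin: "finite S" "finite S'" "finite R" "finite R'" using that by (auto simp: typed_def)
    have i: "R \<inter> S' = {}" "R' \<inter> S' = {}" using that by auto
    have 1: "fr (S' \<union> Q) R R' g = fr Q (S' \<union> R) (S' \<union> R') (fr S' R R' g)"
      using fr_fr[of R R' g S' Q] that fin q i by (simp add: Un_commute)
    have 2: "fr (R \<union> Q) S S' f = fr Q (S \<union> R) (S' \<union> R) (fr R S S' f)"
      using fr_fr[of S S' f R Q] that fin q by simp
    have t1: "typed (S' \<union> R) (S' \<union> R') (fr S' R R' g)" 
      using fr_typed[of R R' g S'] that fin i by (simp add: Un_commute)
    have t2: "typed (S \<union> R) (S' \<union> R) (fr R S S' f)" 
      using fr_typed[of S S' f R] that fin by simp
    show ?thesis unfolding 1 2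
      by (subst fr_comp[symmetric, OF t2 t1]) (use that fin q in \<open>auto simp: fr_tn\<close>)
  qed
  have "fr (S' \<union> Q) R R' g \<cdot> fr (R \<union> Q) S S' f = fr Q (S \<union> R) (S' \<union> R') (tn S S' R R' f g)"
    by (rule *) (use assms in auto)
  also have "\<dots> = fr Q (R \<union> S) (R' \<union> S') (tn R R' S S' g f)"
    using tn_comm[OF b c] d by (simp add: Un_commute)
  also have "\<dots> = fr (R' \<union> Q) S S' f \<cdot> fr (S \<union> Q) R R' g"
    by (rule *[symmetric]) (use assms in auto)
  finally show ?thesis .
qed

primrec tob :: "tr \<Rightarrow> 'a" where
  "tob Emp = \<one>"
| "tob (Lf n) = ty n"
| "tob (T \<star> U) = tob T \<boxtimes> tob U"

text \<open>The canonical unitary from the object of a tree to that of its set of leaves. A leaf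
  picks up a unit factor because \<open>lob [n]\<close> is
  \<open>ty n \<boxtimes> \<one>\<close>.\<close>

primrec nf :: "tr \<Rightarrow> 'b" where
  "nf Emp = \<i> \<one>"
| "nf (Lf n) = (\<r> (ty n))\<^sup>\<dagger>"
| "nf (T \<star> U) = M (lv T) (lv U) \<cdot> (nf T \<otimes> nf U)"

lemma tob_ob [simp]: "tob T \<in> Ob C"
  by (induction T) auto

lemma nf_props: "dst T \<Longrightarrow> nf T \<in> Arr C \<and> Dom C (nf T) = tob T \<and> Cod C (nf T) = N (lv T) \<and> unitary C (nf T)"
proof (induction T)
  case (Lf n)
  have "unitary C ((\<r> (ty n))\<^sup>\<dagger>)" by (intro unitary_dag runit_unitary ty_ob)
  then show ?case by (simp add: N_def)
qed (auto intro!: unitary_idn unitary_comp unitary_ten M_unitary)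

lemma nf_simps [simp]:
  assumes "dst T"
  shows "nf T \<in> Arr C" "Dom C (nf T) = tob T" "Cod C (nf T) = N (lv T)"
  using nf_props[OF assms] by auto

lemma nf_unitary: "dst T \<Longrightarrow> unitary C (nf T)"
  using nf_props by auto

lemmas nf_inv [simp] = unitary_simps[OF nf_unitary nf_simps(2,3)]

text \<open>With \<open>nf_swap\<close> and \<open>nf_unit\<close> this is the coherence theorem in
  the form used below: an associator, symmetry or unitor disappears once both of its ends are
  normalised.\<close>

lemma nf_assoc:
  assumes "dst ((T \<star> U) \<star> V)"
  shows "nf (T \<star> (U \<star> V)) \<cdot> \<alpha> (tob T) (tob U) (tob V) = nf ((T \<star> U) \<star> V)"
proof -
  let ?T = "lv T" and ?U = "lv U" and ?V = "lv V"
  have d: "?T \<inter> ?U = {}" "?U \<inter> ?V = {}" "?T \<inter> ?V = {}" "dst T" "dst U" "dst V"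
    "?T \<inter> (?U \<union> ?V) = {}" "(?T \<union> ?U) \<inter> ?V = {}" using assms by auto
  have "nf ((T \<star> U) \<star> V) = (M (?T \<union> ?U) ?V \<cdot> (M ?T ?U \<otimes> \<i> (N ?V))) \<cdot> ((nf T \<otimes> nf U) \<otimes> nf V)"
    using d by simp
  also have "\<dots> = M ?T (?U \<union> ?V) \<cdot> (\<i> (N ?T) \<otimes> M ?U ?V) \<cdot> (\<alpha> (N ?T) (N ?U) (N ?V) \<cdot> ((nf T \<otimes> nf U) \<otimes> nf V))"
    using d by (simp add: M_assoc)
  also have "\<alpha> (N ?T) (N ?U) (N ?V) \<cdot> ((nf T \<otimes> nf U) \<otimes> nf V)
     = (nf T \<otimes> (nf U \<otimes> nf V)) \<cdot> \<alpha> (tob T) (tob U) (tob V)"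
    using naturality(1)[of "nf T" "nf U" "nf V"] d by simp
  finally show ?thesis using d by simp
qed

lemma nf_swap:
  assumes "dst (T \<star> U)"
  shows "nf (U \<star> T) \<cdot> \<sigma> (tob T) (tob U) = nf (T \<star> U)"
proof -
  have d: "lv T \<inter> lv U = {}" "lv U \<inter> lv T = {}" "dst T" "dst U" using assms by auto
  have "nf (U \<star> T) \<cdot> \<sigma> (tob T) (tob U) = (M (lv U) (lv T) \<cdot> \<sigma> (N (lv T)) (N (lv U))) \<cdot> (nf T \<otimes> nf U)"
    using d naturality(4)[of "nf T" "nf U"] by simp
  also have "\<dots> = nf (T \<star> U)" using d by (simp add: M_comm)
  finally show ?thesis .
qed

lemma nf_unit:
  assumes "dst T"
  shows "nf T \<cdot> \<l> (tob T) = nf (Emp \<star> T)" "nf T \<cdot> \<r> (tob T) = nf (T \<star> Emp)"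
  using assms naturality(2,3)[of "nf T"] by (simp_all add: M_empty)

definition good :: "'b box \<Rightarrow> bool" where
  "good = (\<lambda>(T, f, U). dst T \<and> dst U \<and> f \<in> Arr C \<and> Dom C f = tob T \<and> Cod C f = tob U)"

definition bar :: "tr \<Rightarrow> 'b \<Rightarrow> tr \<Rightarrow> 'b" where
  "bar T f U = nf U \<cdot> f \<cdot> (nf T)\<^sup>\<dagger>"

lemma bar_typed: "good (T, f, U) \<Longrightarrow> typed (lv T) (lv U) (bar T f U)"
  by (simp add: good_def typed_def bar_def)

text \<open>Boxes act in the order of the list, each framed by the wires that it does not
  consume.\<close>

fun run :: "nat set \<Rightarrow> 'b box list \<Rightarrow> 'b" where
  "run S [] = \<i> (N S)"
| "run S ((T, f, U) # L) = run (S - lv T \<union> lv U) L \<cdot> fr (S - lv T) (lv T) (lv U) (bar T f U)"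

text \<open>No label is ever reused, not even after it has been consumed.\<close>

fun wf :: "nat set \<Rightarrow> 'b box list \<Rightarrow> bool" where
  "wf S [] \<longleftrightarrow> finite S"
| "wf S ((T, f, U) # L) \<longleftrightarrow> good (T, f, U) \<and> lv T \<subseteq> S \<and> S \<inter> (lv U \<union> ol L) = {} \<and> lv U \<inter> ol L = {}
     \<and> wf (S - lv T \<union> lv U) L"

lemma wf_finite: "wf S L \<Longrightarrow> finite S"
  by (induction S L rule: wf.induct) (auto dest: finite_subset)

lemma wf_disjoint: "wf S L \<Longrightarrow> S \<inter> ol L = {}"
  by (cases L) (auto)

lemma box_typed:
  assumes "good (T, f, U)" "lv T \<subseteq> S" "S \<inter> lv U = {}" "finite S"
  shows "typed S (S - lv T \<union> lv U) (fr (S - lv T) (lv T) (lv U) (bar T f U))"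
proof -
  have "typed (lv T \<union> (S - lv T)) (lv U \<union> (S - lv T)) (fr (S - lv T) (lv T) (lv U) (bar T f U))"
    by (rule fr_typed) (use assms bar_typed in auto)
  moreover have "lv T \<union> (S - lv T) = S" "lv U \<union> (S - lv T) = S - lv T \<union> lv U" using assms by auto
  ultimately show ?thesis by simp
qed

lemma run_typed: "wf S L \<Longrightarrow> typed S (fin S L) (run S L)"
proof (induction S L rule: run.induct)
  case (2 S T f U L)
  have "typed S (S - lv T \<union> lv U) (fr (S - lv T) (lv T) (lv U) (bar T f U))"
    using 2 wf_finite[of S "(T, f, U) # L"] by (intro box_typed) auto
  then show ?case using 2 by (auto intro: typed_comp)
qed simp

lemma wf_append: "wf S (L @ K) \<longleftrightarrow> wf S L \<and> wf (fin S L) K \<and> S \<inter> ol K = {} \<and> ol L \<inter> ol K = {}"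
proof (induction S L rule: wf.induct)
  case (1 S)
  then show ?case using wf_finite[of S K] wf_disjoint[of S K] by auto
next
  case (2 S T f U L)
  then show ?case by auto
qed

lemma run_append: "wf S (L @ K) \<Longrightarrow> run S (L @ K) = run (fin S L) K \<cdot> run S L"
proof (induction S L rule: run.induct)
  case (1 S)
  then show ?case using run_typed[of S K] by (simp add: typed_def)
next
  case (2 S T f U L)
  let ?S = "S - lv T \<union> lv U"
  have t: "typed S ?S (fr (S - lv T) (lv T) (lv U) (bar T f U))"
    using 2 wf_finite[of S "(T, f, U) # L @ K"] by (intro box_typed) auto
  have "wf ?S (L @ K)" using 2 by simp
  then have "typed ?S (fin ?S L) (run ?S L)" "typed (fin ?S L) (fin (fin ?S L) K) (run (fin ?S L) K)"
    using run_typed[of ?S L] run_typed[of "fin ?S L" K] by (auto simp: wf_append)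
  then show ?case using 2 t by (simp add: typed_def)
qed

text \<open>A frame rule: wires untouched by the network can be carried along. It makes parallel
  composition and local replacement possible.\<close>

lemma run_frame:
  assumes "wf S L" "finite R" "R \<inter> S = {}" "R \<inter> ol L = {}"
  shows "wf (S \<union> R) L \<and> fin (S \<union> R) L = fin S L \<union> R \<and> run (S \<union> R) L = fr R S (fin S L) (run S L)"
  using assms
proof (induction S L rule: run.induct)
  case (1 S)
  have "S \<inter> R = {}" using 1 by auto
  then show ?case using 1 by (simp add: fr_idn)
next
  case (2 S T f U L)
  let ?S = "S - lv T \<union> lv U" and ?b = "bar T f U"
  have fS: "finite S" using 2 wf_finite by blast
  have e: "S \<union> R - lv T = (S - lv T) \<union> R" "(S - lv T) \<union> R \<union> lv U = ?S \<union> R" using 2 by auto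
  have ih: "wf (?S \<union> R) L \<and> fin (?S \<union> R) L = fin ?S L \<union> R \<and> run (?S \<union> R) L = fr R ?S (fin ?S L) (run ?S L)"
    using 2 by (intro 2) auto
  have g: "typed (lv T) (lv U) ?b" using 2 bar_typed by auto
  have t: "typed S ?S (fr (S - lv T) (lv T) (lv U) ?b)"
    using 2 fS by (intro box_typed) auto
  have r: "typed ?S (fin ?S L) (run ?S L)" using 2 run_typed by auto
  have s: "lv T \<union> (S - lv T) = S" "lv U \<union> (S - lv T) = ?S" using 2 by auto
  have "fr R (lv T \<union> (S - lv T)) (lv U \<union> (S - lv T)) (fr (S - lv T) (lv T) (lv U) ?b)
     = fr ((S - lv T) \<union> R) (lv T) (lv U) ?b"
    by (rule fr_fr[OF g]) (use 2 fS in auto)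
  then have "run (S \<union> R) ((T, f, U) # L) = fr R ?S (fin ?S L) (run ?S L) \<cdot> fr R S ?S (fr (S - lv T) (lv T) (lv U) ?b)"
    using ih unfolding s by (simp add: e)
  also have "\<dots> = fr R S (fin ?S L) (run S ((T, f, U) # L))"
    unfolding run.simps by (rule fr_comp[symmetric, OF t r]) (use 2 fin_subset[of ?S L] in auto)
  finally show ?case using 2 ih by (auto simp: e)
qed

text \<open>The second box finds all its inputs in \<open>S\<close>, so none of them comes from the
  first box; the two act on disjoint wires and \<open>fr_commute\<close> applies.\<close>

lemma run_swap:
  assumes "wf S ((T, f, U) # (T', g, U') # L)" "lv T' \<subseteq> S"
  shows "wf S ((T', g, U') # (T, f, U) # L) \<and>
    fin S ((T', g, U') # (T, f, U) # L) = fin S ((T, f, U) # (T', g, U') # L) \<and>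
    run S ((T', g, U') # (T, f, U) # L) = run S ((T, f, U) # (T', g, U') # L)"
proof -
  let ?Q = "S - lv T - lv T'"
  have fS: "finite S" using assms wf_finite by blast
  have d: "lv T \<subseteq> S" "lv T \<inter> lv T' = {}" "S \<inter> lv U = {}" "S \<inter> lv U' = {}" "lv U \<inter> lv U' = {}"
    using assms by auto
  have g: "good (T, f, U)" "good (T', g, U')" using assms by auto
  have s: "S - lv T = lv T' \<union> ?Q" "S - lv T' = lv T \<union> ?Q"
    "S - lv T \<union> lv U - lv T' = lv U \<union> ?Q" "S - lv T' \<union> lv U' - lv T = lv U' \<union> ?Q" using d assms(2) by auto
  have s': "S - lv T' \<union> lv U' - lv T \<union> lv U = S - lv T \<union> lv U - lv T' \<union> lv U'" (is "?S' = ?S") using d assms(2) by auto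
  have w: "wf ?S L" using assms by simp
  have 1: "fr (lv U \<union> ?Q) (lv T') (lv U') (bar T' g U') \<cdot> fr (lv T' \<union> ?Q) (lv T) (lv U) (bar T f U)
     = fr (lv U' \<union> ?Q) (lv T) (lv U) (bar T f U) \<cdot> fr (lv T \<union> ?Q) (lv T') (lv U') (bar T' g U')"
    by (rule fr_commute) (use g bar_typed d assms(2) fS in auto)
  have t1: "typed S (S - lv T \<union> lv U) (fr (S - lv T) (lv T) (lv U) (bar T f U))"
    by (rule box_typed) (use g d fS in auto)
  have t2: "typed (S - lv T \<union> lv U) ?S (fr (S - lv T \<union> lv U - lv T') (lv T') (lv U') (bar T' g U'))"
    by (rule box_typed) (use assms g d fS in auto)
  have t3: "typed S (S - lv T' \<union> lv U') (fr (S - lv T') (lv T') (lv U') (bar T' g U'))"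
    by (rule box_typed) (use assms(2) g d fS in auto)
  have t4: "typed (S - lv T' \<union> lv U') ?S' (fr (S - lv T' \<union> lv U' - lv T) (lv T) (lv U) (bar T f U))"
    by (rule box_typed) (use assms(2) g d fS in auto)
  have r: "typed ?S (fin ?S L) (run ?S L)" using w run_typed by auto
  have "run S ((T', g, U') # (T, f, U) # L)
    = run ?S L \<cdot> (fr (S - lv T' \<union> lv U' - lv T) (lv T) (lv U) (bar T f U) \<cdot> fr (S - lv T') (lv T') (lv U') (bar T' g U'))"
    unfolding run.simps s' using t3 t4 r unfolding s' by (intro assoc_comp) (auto simp: typed_def)
  also have "\<dots> = run ?S L \<cdot> (fr (S - lv T \<union> lv U - lv T') (lv T') (lv U') (bar T' g U') \<cdot> fr (S - lv T) (lv T) (lv U) (bar T f U))"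
    unfolding 1[folded s] ..
  also have "\<dots> = run S ((T, f, U) # (T', g, U') # L)"
    unfolding run.simps using t1 t2 r by (intro assoc_comp[symmetric]) (auto simp: typed_def)
  finally have run: "run S ((T', g, U') # (T, f, U) # L) = run S ((T, f, U) # (T', g, U') # L)" .
  have "wf S ((T', g, U') # (T, f, U) # L)"
    using assms s' by auto
  then show ?thesis using run s' by simp
qed

lemma run_bubble:
  assumes "wf S (L @ (T, f, U) # K)" "lv T \<subseteq> S"
  shows "wf S ((T, f, U) # L @ K) \<and> fin S ((T, f, U) # L @ K) = fin S (L @ (T, f, U) # K)
    \<and> run S ((T, f, U) # L @ K) = run S (L @ (T, f, U) # K)"
  using assms
proof (induction L arbitrary: S)
  case (Cons b L)
  obtain T' g U' where b: "b = (T', g, U')" by (cases b)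
  let ?S = "S - lv T' \<union> lv U'"
  have "lv T \<subseteq> fin ?S L" using Cons.prems by (auto simp: b wf_append)
  moreover have "fin ?S L \<subseteq> ?S \<union> ol L" by (rule fin_subset)
  moreover have "S \<inter> ol L = {}" "S \<inter> lv U' = {}" using Cons.prems by (auto simp: b wf_append)
  ultimately have "lv T \<subseteq> ?S" using Cons.prems(2) by blast
  then have ih: "wf ?S ((T, f, U) # L @ K)" "fin ?S ((T, f, U) # L @ K) = fin ?S (L @ (T, f, U) # K)"
    "run ?S ((T, f, U) # L @ K) = run ?S (L @ (T, f, U) # K)"
    using Cons by (auto simp: b)
  have w: "wf S ((T', g, U') # (T, f, U) # L @ K)"
    using Cons.prems(1) ih(1) by (auto simp: b)
  show ?case
    using run_swap[OF w Cons.prems(2)] ih unfolding b append_Cons by (simp del: wf.simps add: wf.simps(2)[of S])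
qed simp

text \<open>Two well-formed lists with the same boxes are two schedules of one graph. The first box
  of \<open>K\<close> has its inputs in \<open>S\<close>, so \<open>run_bubble\<close> brings it to
  the front of \<open>L\<close>, and induction treats the rest.\<close>

theorem run_perm:
  "wf S L \<Longrightarrow> wf S K \<Longrightarrow> mset L = mset K \<Longrightarrow> run S L = run S K \<and> fin S L = fin S K"
proof (induction K arbitrary: S L)
  case (Cons b K)
  obtain T f U where b: "b = (T, f, U)" by (cases b)
  have "b \<in> set L" using Cons.prems(3) by (metis list.set_intros(1) set_mset_mset)
  then obtain L1 L2 where L: "L = L1 @ b # L2" by (meson split_list)
  have *: "wf S ((T, f, U) # L1 @ L2) \<and> fin S ((T, f, U) # L1 @ L2) = fin S L
    \<and> run S ((T, f, U) # L1 @ L2) = run S L"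
    using Cons.prems unfolding L b by (intro run_bubble) auto
  have "mset (L1 @ L2) = mset K" using Cons.prems(3) by (simp add: L)
  then have "run (S - lv T \<union> lv U) (L1 @ L2) = run (S - lv T \<union> lv U) K
      \<and> fin (S - lv T \<union> lv U) (L1 @ L2) = fin (S - lv T \<union> lv U) K"
    using Cons.prems * by (intro Cons.IH) (auto simp: b)
  then show ?case using * by (simp add: b)
qed simp

text \<open>
  \<open>rep T L U f\<close>: the network \<open>L\<close> evaluates to \<open>f\<close>, with inputs and outputs arranged as in \<open>T\<close> and \<open>U\<close>.
\<close>

definition rep :: "tr \<Rightarrow> 'b box list \<Rightarrow> tr \<Rightarrow> 'b \<Rightarrow> bool" where
  "rep T L U f \<longleftrightarrow> good (T, f, U) \<and> wf (lv T) L \<and> fin (lv T) L = lv U \<and> nf U \<cdot> f = run (lv T) L \<cdot> nf T"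

lemma repD:
  assumes "rep T L U f"
  shows "f \<in> Arr C" "Dom C f = tob T" "Cod C f = tob U" "dst T" "dst U" "wf (lv T) L" "fin (lv T) L = lv U"
    "lv T \<inter> ol L = {}" "lv U \<subseteq> lv T \<union> ol L"
proof -
  show 1: "f \<in> Arr C" "Dom C f = tob T" "Cod C f = tob U" "dst T" "dst U" "wf (lv T) L" "fin (lv T) L = lv U"
    using assms by (auto simp: rep_def good_def)
  show "lv T \<inter> ol L = {}" using 1 wf_disjoint by blast
  show "lv U \<subseteq> lv T \<union> ol L" using 1 fin_subset by metis
qed

lemma rep_run:
  assumes "rep T L U f"
  shows "nf U \<cdot> f = run (lv T) L \<cdot> nf T" "f = (nf U)\<^sup>\<dagger> \<cdot> (run (lv T) L \<cdot> nf T)"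
    "run (lv T) L = nf U \<cdot> f \<cdot> (nf T)\<^sup>\<dagger>"
proof -
  note f = repD[OF assms]
  show 1: "nf U \<cdot> f = run (lv T) L \<cdot> nf T" using assms by (simp add: rep_def)
  show "f = (nf U)\<^sup>\<dagger> \<cdot> (run (lv T) L \<cdot> nf T)" unfolding 1[symmetric] using f by simp
  have t: "typed (lv T) (lv U) (run (lv T) L)" using run_typed[of "lv T" L] f by simp
  show "run (lv T) L = nf U \<cdot> f \<cdot> (nf T)\<^sup>\<dagger>"
    unfolding 1 using f(1-5) t by (simp add: typed_def)
qed

text \<open>The last step of the diagrammatic proofs: the trees fix the normalising unitaries and
  the boxes fix the value of the network.\<close>

theorem rep_unique:
  assumes "rep T L U f" "rep T K U g" "mset L = mset K"
  shows "f = g"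
proof -
  have "run (lv T) L = run (lv T) K"
    using run_perm repD(6)[OF assms(1)] repD(6)[OF assms(2)] assms(3) by blast
  then show ?thesis using rep_run(2)[OF assms(1)] rep_run(2)[OF assms(2)] by simp
qed

lemma rep_perm:
  assumes "rep T L U f" "mset L = mset K" "wf (lv T) K"
  shows "rep T K U f"
  using assms run_perm[of "lv T" L K] by (simp add: rep_def)

lemma rep_comp:
  assumes f: "rep T L U f" and g: "rep U K V g" and d: "lv T \<inter> ol K = {}" "ol L \<inter> ol K = {}"
  shows "rep T (L @ K) V (g \<cdot> f)"
proof -
  note f8 = rep_run(1)[OF f] and g8 = rep_run(1)[OF g]
  note f = repD[OF f] and g = repD[OF g]
  have w: "wf (lv T) (L @ K)" using f g d by (simp add: wf_append)
  have t: "typed (lv T) (lv U) (run (lv T) L)" "typed (lv U) (lv V) (run (lv U) K)"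
    using run_typed f g by metis+
  have "nf V \<cdot> (g \<cdot> f) = (nf V \<cdot> g) \<cdot> f" using f g by simp
  also have "\<dots> = run (lv U) K \<cdot> (nf U \<cdot> f)" using f g t by (simp add: g8 typed_def)
  also have "\<dots> = run (lv T) (L @ K) \<cdot> nf T"
    using f t f8 by (simp add: run_append[OF w] typed_def)
  finally show ?thesis using f g w by (simp add: rep_def good_def)
qed

lemma rep_ten:
  assumes f: "rep T L U f" and g: "rep T' K U' g"
    and d: "(lv T \<union> ol L) \<inter> (lv T' \<union> ol K) = {}"
  shows "rep (T \<star> T') (L @ K) (U \<star> U') (f \<otimes> g)"
proof -
  note f8 = rep_run(1)[OF f] and g8 = rep_run(1)[OF g]
  note f = repD[OF f] and g = repD[OF g]
  have d': "lv T \<inter> lv T' = {}" "lv U \<inter> lv U' = {}" "lv T' \<inter> lv T = {}" "lv U \<inter> lv T' = {}" "lv T' \<inter> lv U = {}"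
    using d f(9) g(9) by auto
  have t: "typed (lv T) (lv U) (run (lv T) L)" "typed (lv T') (lv U') (run (lv T') K)"
    using run_typed f g by metis+
  have dd: "lv U \<inter> ol K = {}" "lv T' \<inter> ol L = {}" using d f(9) by auto
  have 1: "wf (lv T \<union> lv T') L \<and> fin (lv T \<union> lv T') L = lv U \<union> lv T'
    \<and> run (lv T \<union> lv T') L = fr (lv T') (lv T) (lv U) (run (lv T) L)"
    using run_frame[OF f(6) finite_lv d'(3) dd(2)] f(7) by simp
  have 2: "wf (lv U \<union> lv T') K \<and> fin (lv U \<union> lv T') K = lv U \<union> lv U'
    \<and> run (lv U \<union> lv T') K = fr (lv U) (lv T') (lv U') (run (lv T') K)"
    using run_frame[OF g(6) finite_lv d'(4) dd(1)] g(7) by (simp add: Un_commute)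
  have w: "wf (lv T \<union> lv T') (L @ K)"
    using 1 2 d g(8) by (auto simp: wf_append)
  have r: "run (lv T \<union> lv T') (L @ K) = tn (lv T) (lv U) (lv T') (lv U') (run (lv T) L) (run (lv T') K)"
    unfolding run_append[OF w] using 1 2 by (simp add: fr_tn[OF t] d')
  have "run (lv T \<union> lv T') (L @ K) \<cdot> nf (T \<star> T')
     = M (lv U) (lv U') \<cdot> ((run (lv T) L \<cdot> nf T) \<otimes> (run (lv T') K \<cdot> nf T'))"
    unfolding r tn_def using t f g d' by (simp add: typed_def)
  also have "\<dots> = nf (U \<star> U') \<cdot> (f \<otimes> g)"
    unfolding f8[symmetric] g8[symmetric] using f g d' by simp
  finally show ?thesis using f g w 1 2 d' by (simp add: rep_def good_def)
qed

lemma rep_box: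
  assumes "f \<in> Arr C" "Dom C f = tob T" "Cod C f = tob U" "dst T" "dst U" "lv T \<inter> lv U = {}"
  shows "rep T [(T, f, U)] U f"
proof -
  have g: "good (T, f, U)" using assms by (simp add: good_def)
  show ?thesis using assms g bar_typed[OF g] fr_empty[OF bar_typed[OF g]]
    by (simp add: rep_def) (simp add: bar_def)
qed

lemma rep_idn: "dst T \<Longrightarrow> A = tob T \<Longrightarrow> rep T [] T (\<i> A)"
  by (simp add: rep_def good_def)

lemma rep_assoc:
  assumes "dst ((T \<star> U) \<star> V)" "A = tob T" "B = tob U" "D = tob V"
  shows "rep ((T \<star> U) \<star> V) [] (T \<star> (U \<star> V)) (\<alpha> A B D)"
  using nf_assoc[OF assms(1)] assms by (auto simp: rep_def good_def simp del: nf.simps)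

lemma rep_swap:
  assumes "dst (T \<star> U)" "A = tob T" "B = tob U"
  shows "rep (T \<star> U) [] (U \<star> T) (\<sigma> A B)"
  using nf_swap[OF assms(1)] assms by (auto simp: rep_def good_def simp del: nf.simps)

lemma rep_lunit: "dst T \<Longrightarrow> A = tob T \<Longrightarrow> rep (Emp \<star> T) [] T (\<l> A)"
  using nf_unit(1)[of T] by (auto simp: rep_def good_def simp del: nf.simps)

lemma rep_runit: "dst T \<Longrightarrow> A = tob T \<Longrightarrow> rep (T \<star> Emp) [] T (\<r> A)"
  using nf_unit(2)[of T] by (auto simp: rep_def good_def simp del: nf.simps)

text \<open>A morphism with empty network is \<open>(nf U)\<^sup>\<dagger> \<cdot> nf T\<close>,
  whose dagger has the same form with the trees exchanged. This covers the inverses of the coherence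
  isomorphisms.\<close>

lemma rep_Nil_dag:
  assumes "rep T [] U f" shows "rep U [] T (f\<^sup>\<dagger>)"
proof -
  note f = repD[OF assms]
  have s: "lv U = lv T" using f by simp
  have "f = (nf U)\<^sup>\<dagger> \<cdot> nf T" using rep_run(2)[OF assms] f s by simp
  then have "f\<^sup>\<dagger> = (nf T)\<^sup>\<dagger> \<cdot> nf U" using f s by simp
  then have "nf T \<cdot> f\<^sup>\<dagger> = nf U" using f s by simp
  then show ?thesis using f s by (simp add: rep_def good_def)
qed

lemmas rep_coherence = rep_idn rep_assoc rep_swap rep_lunit rep_runit
  rep_assoc[THEN rep_Nil_dag] rep_swap[THEN rep_Nil_dag] rep_lunit[THEN rep_Nil_dag] rep_runit[THEN rep_Nil_dag]

text \<open>Local rewriting: \<open>K\<close> and \<open>K'\<close> have the same value on their own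
  wires, and \<open>run_frame\<close> extends this to all wires open after
  \<open>L1\<close>.\<close>

theorem rep_subst:
  assumes r: "rep T (L1 @ K @ L2) U f" and k: "rep V K W k" and k': "rep V K' W k"
    and s: "lv V \<subseteq> fin (lv T) L1" and w: "wf (lv T) (L1 @ K' @ L2)"
  shows "rep T (L1 @ K' @ L2) U f"
proof -
  let ?S = "fin (lv T) L1" let ?R = "?S - lv V"
  note kr = rep_run(3)[OF k] and k'r = rep_run(3)[OF k'] and rr = rep_run(1)[OF r]
  note r = repD[OF r] and k = repD[OF k] and k' = repD[OF k']
  have S: "lv V \<union> ?R = ?S" using s by auto
  have w1: "wf (lv T) L1" "wf ?S (K @ L2)" "wf ?S (K' @ L2)" "wf ?S K" "wf ?S K'" "wf (fin ?S K) L2"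
    using r w by (auto simp: wf_append)
  have fS: "finite ?R" using w1 wf_finite by blast
  have d: "?S \<inter> ol K = {}" "?S \<inter> ol K' = {}" using w1 wf_disjoint by blast+
  have rk: "run (lv V) K = run (lv V) K'" using kr k'r by simp
  have R: "?R \<inter> lv V = {}" "?R \<inter> ol K = {}" "?R \<inter> ol K' = {}" using d by auto
  have "run ?S K = fr ?R (lv V) (lv W) (run (lv V) K) \<and> fin ?S K = lv W \<union> ?R"
    using run_frame[OF k(6) fS R(1,2)] k(7) unfolding S by simp
  moreover have "run ?S K' = fr ?R (lv V) (lv W) (run (lv V) K') \<and> fin ?S K' = lv W \<union> ?R"
    using run_frame[OF k'(6) fS R(1,3)] k'(7) unfolding S by simp
  ultimately have e: "run ?S K = run ?S K'" "fin ?S K' = fin ?S K" using rk by simp_all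
  have "run (lv T) (L1 @ K @ L2) = run (lv T) (L1 @ K' @ L2)"
    using r(6) w w1 e by (simp add: run_append)
  then show ?thesis using r w e rr by (simp add: rep_def good_def)
qed

end

section \<open>Renaming labels and removing identity wires\<close>

primrec ren :: "nat \<Rightarrow> nat \<Rightarrow> tr \<Rightarrow> tr" where
  "ren j i Emp = Emp"
| "ren j i (Lf n) = (if n = j then Lf i else Lf n)"
| "ren j i (T \<star> U) = ren j i T \<star> ren j i U"

definition renb :: "nat \<Rightarrow> nat \<Rightarrow> 'a box \<Rightarrow> 'a box" where
  "renb j i = (\<lambda>(T, f, U). (ren j i T, f, ren j i U))"

lemma renb_simp [simp]: "renb j i (T, f, U) = (ren j i T, f, ren j i U)"
  by (simp add: renb_def)

lemma ren_id: "j \<notin> lv T \<Longrightarrow> ren j i T = T"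
  by (induction T) auto

lemma lv_ren: "lv (ren j i T) = (if j \<in> lv T then insert i (lv T - {j}) else lv T)"
  by (induction T) auto

lemma dst_ren: "dst T \<Longrightarrow> i \<notin> lv T \<Longrightarrow> dst (ren j i T)"
  by (induction T) (auto simp: lv_ren)

context labelling
begin

lemma tob_ren: "ty i = ty j \<Longrightarrow> tob (ren j i T) = tob T"
  by (induction T) auto

text \<open>Supplies the morphism of a network that has not been written as a formula;
  \<open>rep_wire_end\<close> needs it for the shortened network.\<close>

lemma rep_exists:
  assumes "wf (lv T) L" "fin (lv T) L = lv U" "dst T" "dst U"
  shows "rep T L U ((nf U)\<^sup>\<dagger> \<cdot> (run (lv T) L \<cdot> nf T))"
  using assms run_typed[OF assms(1)] by (simp add: rep_def good_def typed_def)

lemma rep_wire: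
  assumes "ty i = ty j"
  shows "dst T \<Longrightarrow> j \<in> lv T \<Longrightarrow> i \<notin> lv T \<Longrightarrow> rep (ren j i T) [(Lf i, \<i> (ty j), Lf j)] T (\<i> (tob T))"
proof (induction T)
  case (Lf n)
  then show ?case using assms by (auto intro!: rep_box)
next
  case (Br T U)
  have r: "lv (ren j i V) \<inter> lv W = {}" if "lv V \<inter> lv W = {}" "i \<notin> lv W" for V W
    using that by (auto simp: lv_ren)
  show ?case
  proof (cases "j \<in> lv T")
    case True
    then have j: "j \<notin> lv U" using Br by auto
    have "rep (ren j i T \<star> U) ([(Lf i, \<i> (ty j), Lf j)] @ []) (T \<star> U) (\<i> (tob T) \<otimes> \<i> (tob U))"
      by (rule rep_ten) (use Br True j in \<open>auto intro!: rep_idn simp: lv_ren\<close>)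
    then show ?thesis using j by (simp add: ren_id)
  next
    case False
    then have j: "j \<in> lv U" using Br by auto
    have "rep (T \<star> ren j i U) ([] @ [(Lf i, \<i> (ty j), Lf j)]) (T \<star> U) (\<i> (tob T) \<otimes> \<i> (tob U))"
      by (rule rep_ten) (use Br False j in \<open>auto intro!: rep_idn simp: lv_ren\<close>)
    then show ?thesis using False by (simp add: ren_id)
  qed
qed simp

text \<open>The network without the final identity box represents some \<open>?g\<close>; appending
  the box again gives the network of \<open>f\<close>, so \<open>?g\<close> and \<open>f\<close>
  coincide by uniqueness.\<close>

lemma rep_wire_end:
  assumes r: "rep T (L @ [(Lf i, \<i> (ty j), Lf j)]) U f" and ij: "ty i = ty j"
  shows "rep T L (ren j i U) f"
proof -
  note d = repD[OF r]
  have w: "wf (lv T) L" "i \<in> fin (lv T) L" "j \<notin> fin (lv T) L" "i \<noteq> j"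
    and U: "lv U = fin (lv T) L - {i} \<union> {j}"
    using d by (auto simp: wf_append)
  have i: "i \<notin> lv U" "j \<in> lv U" using U w by auto
  have l: "fin (lv T) L = lv (ren j i U)" using U w by (auto simp: lv_ren)
  let ?g = "(nf (ren j i U))\<^sup>\<dagger> \<cdot> (run (lv T) L \<cdot> nf T)"
  have g: "rep T L (ren j i U) ?g"
    by (rule rep_exists) (use w d i l dst_ren in auto)
  have "rep T (L @ [(Lf i, \<i> (ty j), Lf j)]) U (\<i> (tob U) \<cdot> ?g)"
    by (rule rep_comp[OF g rep_wire]) (use d i ij in \<open>auto simp: wf_append\<close>)
  then have "\<i> (tob U) \<cdot> ?g = f" using rep_unique[OF _ r] by blast
  then show ?thesis using g repD[OF g] tob_ren[OF ij] by simp
qed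

lemma rep_wire_absorb:
  assumes r: "rep T (L1 @ (Lf i, \<i> (ty j), Lf j) # (V, g, W) # L2) U f" and ij: "ty i = ty j" and j: "j \<in> lv V"
  shows "rep T (L1 @ (ren j i V, g, W) # L2) U f"
proof -
  let ?S = "fin (lv T) L1" and ?w = "(Lf i, \<i> (ty j), Lf j)"
  note d = repD[OF r]
  have w: "wf (lv T) L1" "wf ?S (?w # (V, g, W) # L2)" "(lv T \<union> ol L1) \<inter> ({j} \<union> (lv W \<union> ol L2)) = {}"
    using d by (auto simp: wf_append)
  have i: "i \<in> ?S" "j \<notin> ?S" "i \<noteq> j" "lv V \<subseteq> ?S - {i} \<union> {j}" "i \<notin> lv V" "i \<notin> lv W" "j \<notin> lv W" "?S \<inter> lv W = {}"
    using w(2) by auto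
  have g: "good (V, g, W)" using w by auto
  have VW: "lv V \<inter> lv W = {}" "lv (ren j i V) \<inter> lv W = {}" "i \<notin> lv V" "dst (ren j i V)"
    using i j g dst_ren by (auto simp: lv_ren good_def)
  have S: "?S - lv (ren j i V) = ?S - {i} \<union> {j} - lv V" using i j by (auto simp: lv_ren)
  have "rep T (L1 @ [(ren j i V, g, W)] @ L2) U f"
  proof (rule rep_subst[of _ _ "[?w, (V, g, W)]"])
    show "rep T (L1 @ [?w, (V, g, W)] @ L2) U f" using r by simp
    have "rep (ren j i V) ([?w] @ [(V, g, W)]) W (g \<cdot> \<i> (tob V))"
      by (rule rep_comp[OF rep_wire rep_box]) (use ij i j g VW in \<open>auto simp: good_def\<close>)
    then show "rep (ren j i V) [?w, (V, g, W)] W g" using g by (simp add: good_def)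
    show "rep (ren j i V) [(ren j i V, g, W)] W g"
      by (rule rep_box) (use g VW ij in \<open>auto simp: good_def tob_ren\<close>)
    show "lv (ren j i V) \<subseteq> ?S" using i by (auto simp: lv_ren)
    have "wf ?S ((ren j i V, g, W) # L2)"
      unfolding wf.simps S using w(2) g VW i by (auto simp: good_def tob_ren[OF ij] lv_ren)
    then show "wf (lv T) (L1 @ [(ren j i V, g, W)] @ L2)"
      using w(1,3) by (simp add: wf_append) blast
  qed
  then show ?thesis by simp
qed

lemma map_renb_id: "wf S L \<Longrightarrow> j \<notin> S \<Longrightarrow> j \<notin> ol L \<Longrightarrow> map (renb j i) L = L"
  by (induction S L rule: wf.induct) (auto simp: ren_id subset_eq)

text \<open>The identity box is pushed to the right until a box that consumes \<open>j\<close>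
  absorbs it, or until the end of the list.\<close>

theorem rep_wire_elim:
  assumes "rep T (L1 @ (Lf i, \<i> (ty j), Lf j) # L2) U f" "ty i = ty j"
  shows "rep T (L1 @ map (renb j i) L2) (ren j i U) f"
  using assms(1)
proof (induction L2 arbitrary: L1)
  case Nil
  then show ?case using rep_wire_end assms(2) by simp
next
  case (Cons b L2)
  let ?S = "fin (lv T) L1" and ?w = "(Lf i, \<i> (ty j), Lf j)"
  obtain V g W where b: "b = (V, g, W)" by (cases b)
  note d = repD[OF Cons.prems]
  have w: "wf (lv T) L1" "wf ?S (?w # (V, g, W) # L2)" "(lv T \<union> ol L1) \<inter> ({j} \<union> (lv W \<union> ol L2)) = {}"
    using d by (auto simp: wf_append b)
  have i: "i \<in> ?S" "j \<notin> ?S" "i \<noteq> j" "lv V \<subseteq> ?S - {i} \<union> {j}" "j \<notin> lv W" "j \<notin> ol L2"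
    using w(2) by auto
  show ?case
  proof (cases "j \<in> lv V")
    case True
    have r: "rep T (L1 @ (ren j i V, g, W) # L2) U f"
      by (rule rep_wire_absorb) (use Cons.prems assms(2) True b in auto)
    have "j \<notin> lv T \<union> ol L1" using w by auto
    moreover have "j \<notin> lv (ren j i V)" using i by (auto simp: lv_ren)
    ultimately have "j \<notin> lv U" using repD(9)[OF r] i by auto
    \<comment> \<open>After its consumption the label \<open>j\<close> never returns, so renaming
      the remaining boxes changes nothing.\<close>
    moreover have "map (renb j i) L2 = L2"
      using w(2) i True by (intro map_renb_id[of "?S - {i} \<union> {j} - lv V \<union> lv W"]) auto
    ultimately show ?thesis using r i by (simp add: b ren_id)
  next
    case False
    have V: "lv V \<subseteq> ?S" using i False by auto
    have "wf ?S ((V, g, W) # ?w # L2)"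
      using run_swap[OF w(2) V] by blast
    then have "wf (lv T) ((L1 @ [b]) @ ?w # L2)" using w(1,3) by (simp add: wf_append b) blast
    then have "rep T ((L1 @ [b]) @ ?w # L2) U f"
      by (intro rep_perm[OF Cons.prems]) auto
    from Cons.IH[OF this] show ?thesis using False i by (simp add: b ren_id)
  qed
qed

lemma rep_middle_swap:
  assumes "dst ((T \<star> U) \<star> (V \<star> W))" "A = tob T" "B = tob U" "D = tob V" "E = tob W"
  shows "rep ((T \<star> U) \<star> (V \<star> W)) [] ((T \<star> V) \<star> (U \<star> W)) (middle_swap C A B D E)"
  unfolding middle_swap_def
  by (rule rep_perm, (rule rep_comp rep_ten rep_coherence | (use assms in \<open>auto; fail\<close>))+)

text \<open>
  The target list \<open>L\<^sub>0\<close> serves only to guide the derivation of \<open>rep T L U f\<close>: it supplies the labels of the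
  boxes in \<open>f\<close>.
\<close>

definition net_from :: "'b box list \<Rightarrow> tr \<Rightarrow> 'b box list \<Rightarrow> tr \<Rightarrow> 'b \<Rightarrow> bool" where
  "net_from L\<^sub>0 T L U f \<longleftrightarrow> rep T L U f"

lemma net_fromI: "rep T L U f \<Longrightarrow> net_from L\<^sub>0 T L U f"
  by (simp add: net_from_def)

lemma net_fromD: "net_from L\<^sub>0 T L U f \<Longrightarrow> mset L = mset L\<^sub>0 \<Longrightarrow> wf (lv T) L\<^sub>0 \<Longrightarrow> rep T L\<^sub>0 U f"
  unfolding net_from_def by (rule rep_perm)

lemma net_from_comp:
  "\<lbrakk>net_from L\<^sub>0 T L U f; net_from L\<^sub>0 U K V g; lv T \<inter> ol K = {}; ol L \<inter> ol K = {}\<rbrakk>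
    \<Longrightarrow> net_from L\<^sub>0 T (L @ K) V (g \<cdot> f)"
  unfolding net_from_def by (rule rep_comp)

lemma net_from_ten:
  "\<lbrakk>net_from L\<^sub>0 T L U f; net_from L\<^sub>0 T' K U' g; (lv T \<union> ol L) \<inter> (lv T' \<union> ol K) = {}\<rbrakk>
    \<Longrightarrow> net_from L\<^sub>0 (T \<star> T') (L @ K) (U \<star> U') (f \<otimes> g)"
  unfolding net_from_def by (rule rep_ten)

lemma net_from_box:
  "\<lbrakk>(T, f, U) \<in> set L\<^sub>0; f \<in> Arr C; Dom C f = tob T; Cod C f = tob U; dst T; dst U; lv T \<inter> lv U = {}\<rbrakk>
    \<Longrightarrow> net_from L\<^sub>0 T [(T, f, U)] U f"
  unfolding net_from_def by (rule rep_box)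

text \<open>The rules \<open>list.set_intros\<close> search the target list: unifying a box of the
  formula with one of its entries instantiates the unknown trees on both sides of that box.\<close>

lemmas net_rules = net_from_comp net_from_ten rep_coherence[THEN net_fromI] rep_middle_swap[THEN net_fromI]
  net_from_box list.set_intros

end

context compact_dagger_category
begin

lemma dual_simps [simp]:
  "A \<in> Ob C \<Longrightarrow> A\<^sup>\<star> \<in> Ob C" "A \<in> Ob C \<Longrightarrow> \<eta> A \<in> Arr C" "A \<in> Ob C \<Longrightarrow> Dom C (\<eta> A) = \<one>"
  "A \<in> Ob C \<Longrightarrow> Cod C (\<eta> A) = A\<^sup>\<star> \<boxtimes> A"
  using dual_ob eta_hom[of A] by (auto simp: hom_iff)

lemma counit_simps [simp]:
  "A \<in> Ob C \<Longrightarrow> counit C A \<in> Arr C" "A \<in> Ob C \<Longrightarrow> Dom C (counit C A) = A\<^sup>\<star> \<boxtimes> A"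
  "A \<in> Ob C \<Longrightarrow> Cod C (counit C A) = \<one>" "A \<in> Ob C \<Longrightarrow> (counit C A)\<^sup>\<dagger> = \<eta> A"
  by (auto simp: counit_def)

lemma eta_dag [simp]: "(\<eta> A)\<^sup>\<dagger> = counit C A"
  by (simp add: counit_def)

end

locale compact_labelling = labelling + compact_dagger_category
begin

text \<open>The cup creates \<open>s\<close> and \<open>j\<close>, the cap consumes \<open>s\<close>
  together with \<open>i\<close>: the wire that enters as \<open>i\<close> leaves as
  \<open>j\<close>. The symmetry inside \<open>cap\<close> contributes no box.\<close>

lemma snake_net:
  assumes "ty i = A" "ty j = A" "ty s = A\<^sup>\<star>" "distinct [i, j, s]"
  shows "rep (Lf i) [(Emp, \<eta> A, Lf s \<star> Lf j), (Lf s \<star> Lf i, counit C A, Emp)] (Lf j) (\<i> A)"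
proof -
  have A: "A \<in> Ob C" using ty_ob[of i] assms by simp
  have "rep (Lf i) [(Emp, \<eta> A, Lf s \<star> Lf j), (Lf s \<star> Lf i, counit C A, Emp)] (Lf j) (\<l> A \<cdot> (cap C A \<otimes> \<i> A) \<cdot> (\<alpha> A (A\<^sup>\<star>) A)\<^sup>\<dagger> \<cdot> (\<i> A \<otimes> \<eta> A) \<cdot> (\<r> A)\<^sup>\<dagger>)"
    unfolding cap_def
    by (rule net_fromD, (rule net_rules | (use assms A in \<open>simp; fail\<close>))+)
       (use assms A in \<open>auto simp: good_def\<close>)
  then show ?thesis by (simp only: snake[OF A])
qed

lemma snake_dual_net:
  assumes "ty i = A" "ty j = A\<^sup>\<star>" "ty s = A\<^sup>\<star>" "distinct [i, j, s]"
  shows "rep (Lf j) [(Emp, \<eta> A, Lf s \<star> Lf i), (Lf j \<star> Lf i, counit C A, Emp)] (Lf s) (\<i> (A\<^sup>\<star>))"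
proof -
  have A: "A \<in> Ob C" using ty_ob[of i] assms by simp
  have "rep (Lf j) [(Emp, \<eta> A, Lf s \<star> Lf i), (Lf j \<star> Lf i, counit C A, Emp)] (Lf s) (\<r> (A\<^sup>\<star>) \<cdot> (\<i> (A\<^sup>\<star>) \<otimes> cap C A) \<cdot> \<alpha> (A\<^sup>\<star>) A (A\<^sup>\<star>) \<cdot> (\<eta> A \<otimes> \<i> (A\<^sup>\<star>)) \<cdot> (\<l> (A\<^sup>\<star>))\<^sup>\<dagger>)"
    unfolding cap_def
    by (rule net_fromD, (rule net_rules | (use assms A in \<open>simp; fail\<close>))+)
       (use assms A in \<open>auto simp: good_def\<close>)
  then show ?thesis by (simp only: snake_dual[OF A])
qed

end

section \<open>Doubling\<close>

context compact_labelling
begin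

text \<open>Yanking inside a larger network. The list is reordered until cup and cap are adjacent,
  with the producer of \<open>i\<close>, if any, in \<open>La\<close> and the consumer of
  \<open>j\<close>, if any, in \<open>Lb\<close>; the resulting identity wire is removed by
  renaming.\<close>

lemma net_snake:
  assumes r: "rep T L U f"
    and L: "mset L = mset (La @ (Emp, e, Lf s \<star> Lf j) # (Lf s \<star> Lf i, c, Emp) # Lb)"
    and w: "wf (lv T) (La @ (Emp, e, Lf s \<star> Lf j) # (Lf s \<star> Lf i, c, Emp) # Lb)"
    and t: "e = \<eta> (ty i)" "c = counit C (ty i)" "ty j = ty i" "ty s = (ty i)\<^sup>\<star>"
    and K: "mset K = mset (La @ map (renb j i) Lb)" "wf (lv T) K" "V = ren j i U" and ij: "i \<noteq> j"
  shows "rep T K V f"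
proof -
  have r1: "rep T (La @ [(Emp, e, Lf s \<star> Lf j), (Lf s \<star> Lf i, c, Emp)] @ Lb) U f"
    using rep_perm[OF r] L w by simp
  have W: "wf (fin (lv T) La) ((Emp, e, Lf s \<star> Lf j) # (Lf s \<star> Lf i, c, Emp) # Lb)"
    "(lv T \<union> ol La) \<inter> ({s, j} \<union> ol Lb) = {}" "wf (lv T) La"
    using w by (auto simp: wf_append)
  have i: "i \<in> fin (lv T) La" "s \<notin> fin (lv T) La" "j \<notin> fin (lv T) La" "distinct [i, j, s]"
    using W(1) ij by (auto simp: good_def)
  have w': "wf (fin (lv T) La) ((Lf i, \<i> (ty i), Lf j) # Lb)"
    proof -
    have "fin (lv T) La - lv Emp \<union> lv (Lf s \<star> Lf j) - lv (Lf s \<star> Lf i) \<union> lv Emp = fin (lv T) La - lv (Lf i) \<union> lv (Lf j)"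
      using i by auto
    then have "wf (fin (lv T) La - lv (Lf i) \<union> lv (Lf j)) Lb" using W(1) unfolding wf.simps by metis
    then show ?thesis unfolding wf.simps using W(1) i t by (simp add: good_def)
  qed
  have "rep T (La @ [(Lf i, \<i> (ty i), Lf j)] @ Lb) U f"
  proof (rule rep_subst[OF r1])
    show "rep (Lf i) [(Emp, e, Lf s \<star> Lf j), (Lf s \<star> Lf i, c, Emp)] (Lf j) (\<i> (ty i))"
      unfolding t(1,2) by (rule snake_net) (use t i in auto)
    show "rep (Lf i) [(Lf i, \<i> (ty i), Lf j)] (Lf j) (\<i> (ty i))"
      by (rule rep_box) (use t i in auto)
    show "wf (lv T) (La @ [(Lf i, \<i> (ty i), Lf j)] @ Lb)"
      unfolding wf_append using W(2,3) w' wf_finite[OF W(1)] by auto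
  qed (use i in auto)
  then have "rep T (La @ (Lf i, \<i> (ty j), Lf j) # Lb) U f" by (simp add: t(3))
  then have "rep T (La @ map (renb j i) Lb) (ren j i U) f"
    by (rule rep_wire_elim) (fact t(3)[symmetric])
  then show ?thesis unfolding K(3) by (rule rep_perm[OF _ K(1)[symmetric] K(2)])
qed

text \<open>The same for a wire of type \<open>A\<^sup>\<star>\<close>: here cup and cap share
  \<open>i\<close>, and the starred label \<open>s\<close> is renamed to \<open>j\<close>.\<close>

lemma net_snake_dual:
  assumes r: "rep T L U f"
    and L: "mset L = mset (La @ (Emp, e, Lf s \<star> Lf i) # (Lf j \<star> Lf i, c, Emp) # Lb)"
    and w: "wf (lv T) (La @ (Emp, e, Lf s \<star> Lf i) # (Lf j \<star> Lf i, c, Emp) # Lb)"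
    and t: "e = \<eta> (ty i)" "c = counit C (ty i)" "ty j = ty s" "ty s = (ty i)\<^sup>\<star>"
    and K: "mset K = mset (La @ map (renb s j) Lb)" "wf (lv T) K" "V = ren s j U" and ij: "j \<noteq> s"
  shows "rep T K V f"
proof -
  have r1: "rep T (La @ [(Emp, e, Lf s \<star> Lf i), (Lf j \<star> Lf i, c, Emp)] @ Lb) U f"
    using rep_perm[OF r] L w by simp
  have W: "wf (fin (lv T) La) ((Emp, e, Lf s \<star> Lf i) # (Lf j \<star> Lf i, c, Emp) # Lb)"
    "(lv T \<union> ol La) \<inter> ({s, i} \<union> ol Lb) = {}" "wf (lv T) La"
    using w by (auto simp: wf_append)
  have i: "j \<in> fin (lv T) La" "s \<notin> fin (lv T) La" "i \<notin> fin (lv T) La" "distinct [i, j, s]"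
    using W(1) ij by (auto simp: good_def)
  have w': "wf (fin (lv T) La) ((Lf j, \<i> (ty s), Lf s) # Lb)"
    proof -
    have "fin (lv T) La - lv Emp \<union> lv (Lf s \<star> Lf i) - lv (Lf j \<star> Lf i) \<union> lv Emp = fin (lv T) La - lv (Lf j) \<union> lv (Lf s)"
      using i by auto
    then have "wf (fin (lv T) La - lv (Lf j) \<union> lv (Lf s)) Lb" using W(1) unfolding wf.simps by metis
    then show ?thesis unfolding wf.simps using W(1) i t by (simp add: good_def)
  qed
  have "rep T (La @ [(Lf j, \<i> (ty s), Lf s)] @ Lb) U f"
  proof (rule rep_subst[OF r1])
    show "rep (Lf j) [(Emp, e, Lf s \<star> Lf i), (Lf j \<star> Lf i, c, Emp)] (Lf s) (\<i> (ty s))"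
      unfolding t(1,2,4) by (rule snake_dual_net) (use t i in auto)
    show "rep (Lf j) [(Lf j, \<i> (ty s), Lf s)] (Lf s) (\<i> (ty s))"
      by (rule rep_box) (use t i in auto)
    show "wf (lv T) (La @ [(Lf j, \<i> (ty s), Lf s)] @ Lb)"
      unfolding wf_append using W(2,3) w' wf_finite[OF W(1)] by auto
  qed (use i in auto)
  then have "rep T (La @ (Lf j, \<i> (ty s), Lf s) # Lb) U f" by simp
  then have "rep T (La @ map (renb s j) Lb) (ren s j U) f"
    by (rule rep_wire_elim) (fact t(3))
  then show ?thesis unfolding K(3) by (rule rep_perm[OF _ K(1)[symmetric] K(2)])
qed

end

context symmetric_monoidal_dagger_category
begin

text \<open>Labels beyond the list default to \<open>\<one>\<close>, so that every label has an
  object.\<close>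

definition tyl :: "'a list \<Rightarrow> nat \<Rightarrow> 'a" where
  "tyl os n = (if n < length os then os ! n else \<one>)"

lemma tyl_simps [simp]:
  "tyl (A # os) 0 = A" "tyl (A # os) (Suc n) = tyl os n"
  "tyl (A # os) (numeral k) = tyl os (pred_numeral k)"
  by (simp_all add: tyl_def numeral_eq_Suc)

end

context compact_dagger_category
begin

lemma compact_labelling_tyl: "set os \<subseteq> Ob C \<Longrightarrow> compact_labelling C (tyl os)"
  by unfold_locales (auto simp: tyl_def)

text \<open>
  The network of \<open>Dbl X B f\<close> after straightening the wire \<open>X\<close>: it then leads directly from \<open>f\<close> to \<open>f\<^sup>\<dagger>\<close>.
\<close>

lemma Dbl_straight:
  assumes f: "f \<in> hom C A (X \<boxtimes> B)" and X: "X \<in> Ob C" "B \<in> Ob C"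
  shows "Dbl C X B f = (\<i> (B\<^sup>\<star>) \<otimes> (\<l> B \<cdot> (counit C A \<otimes> \<i> B) \<cdot> (\<alpha> (A\<^sup>\<star>) A B)\<^sup>\<dagger>)) \<cdot> \<alpha> (B\<^sup>\<star>) (A\<^sup>\<star>) (A \<boxtimes> B)
    \<cdot> (\<i> (B\<^sup>\<star> \<boxtimes> A\<^sup>\<star>) \<otimes> ((f\<^sup>\<dagger> \<otimes> \<i> B) \<cdot> (\<sigma> B X \<otimes> \<i> B) \<cdot> (\<alpha> B X B)\<^sup>\<dagger>))
    \<cdot> middle_swap C (B\<^sup>\<star>) B (A\<^sup>\<star>) (X \<boxtimes> B) \<cdot> (\<eta> B \<otimes> (\<i> (A\<^sup>\<star>) \<otimes> f)) \<cdot> (\<l> (A\<^sup>\<star> \<boxtimes> A))\<^sup>\<dagger>" (is "_ = ?R")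
proof -
  have A: "A \<in> Ob C" using f by (auto simp: hom_iff)
  have f: "f \<in> Arr C" "Dom C f = A" "Cod C f = X \<boxtimes> B" using f by (auto simp: hom_iff)
  \<comment> \<open>Entry \<open>n\<close> of the list is the object on wire \<open>n\<close>. Wires
    7 and 8 carry the cup of \<open>X\<close> which \<open>eta_ten\<close> extracts from the unit of
    \<open>X \<boxtimes> B\<close> in \<open>star f\<close>; yanking removes both.\<close>
  interpret compact_labelling C "tyl [A\<^sup>\<star>, A, X, B, B\<^sup>\<star>, B, A, X\<^sup>\<star>, X]"
    by (rule compact_labelling_tyl) (use A X dual_ob in auto)
  let ?f = "(Lf 1, f, Lf 2 \<star> Lf 3)" and ?g = "(Lf 2 \<star> Lf 5, f\<^sup>\<dagger>, Lf 6)"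
    and ?h = "(Emp, \<eta> B, Lf 4 \<star> Lf 5)" and ?e = "(Lf 0 \<star> Lf 6, counit C A, Emp)"
    and ?x = "(Emp, \<eta> X, Lf 7 \<star> Lf 8)" and ?y = "(Lf 7 \<star> Lf 2, counit C X, Emp)"
    and ?g' = "(Lf 8 \<star> Lf 5, f\<^sup>\<dagger>, Lf 6)"
  note s = A X f good_def
  have 1: "rep (Lf 0 \<star> Lf 1) [?f, ?h, ?g, ?e] (Lf 4 \<star> Lf 3) ?R"
    unfolding middle_swap_def
    by (rule net_fromD, (rule net_rules | (simp add: s; fail))+)
  have "rep (Lf 0 \<star> Lf 1) [?f, ?h, ?x, ?y, ?g', ?e] (Lf 4 \<star> Lf 3) (Dbl C X B f)"
    unfolding Dbl_def star_def dual_arr_def Let_def cap_def dag_simps[OF f(1)] f(2,3) dual_ten[OF X] eta_ten[OF X]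
    by (rule net_fromD, (rule net_rules | (simp add: s; fail))+)
  then have "rep (Lf 0 \<star> Lf 1) [?f, ?h, ?g, ?e] (Lf 4 \<star> Lf 3) (Dbl C X B f)"
    by (rule net_snake[where s = 7 and j = 8 and i = 2 and La = "[?f, ?h]" and Lb = "[?g', ?e]"])
       (simp_all add: s)
  from rep_unique[OF this 1] show ?thesis by simp
qed

end

context compact_labelling
begin

text \<open>The straightened network with arbitrary labels, so that a double can be a part of larger
  formulas.\<close>

lemma rep_Dbl:
  assumes "f \<in> Arr C" "Dom C f = ty a" "Cod C f = ty x \<boxtimes> ty b" "X = ty x" "B = ty b"
    "ty s = (ty a)\<^sup>\<star>" "ty t = (ty b)\<^sup>\<star>" "ty c = ty b" "ty d = ty a" "A = ty a" "distinct [s, a, x, b, t, c, d]"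
  shows "rep (Lf s \<star> Lf a) [(Lf a, f, Lf x \<star> Lf b), (Emp, \<eta> B, Lf t \<star> Lf c), (Lf x \<star> Lf c, f\<^sup>\<dagger>, Lf d),
    (Lf s \<star> Lf d, counit C A, Emp)] (Lf t \<star> Lf b) (Dbl C X B f)"
proof -
  have f: "f \<in> hom C A (X \<boxtimes> B)" "X \<in> Ob C" "B \<in> Ob C" "A \<in> Ob C" using assms by (auto simp: hom_iff)
  \<comment> \<open>The reversed list provides the inequations between labels in their other
    orientation.\<close>
  have d: "distinct [d, c, t, b, x, a, s]" using assms(11) by auto
  show ?thesis
    unfolding Dbl_straight[OF f(1-3)] middle_swap_def
    by (rule net_fromD, (rule net_rules | (use assms d in \<open>simp add: good_def; fail\<close>))+)
qed

lemma rep_kappa: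
  assumes "m \<in> Arr C" "Dom C m = ty p \<boxtimes> ty q" "Cod C m = ty a" "A = ty a"
    "ty p = ty a" "ty q = ty a" "ty s = (ty a)\<^sup>\<star>" "distinct [s, a, p, q]"
  shows "rep (Lf s \<star> Lf a) [(Lf a, m\<^sup>\<dagger>, Lf p \<star> Lf q), (Lf s \<star> Lf p, counit C A, Emp)] (Lf q) (kappa C (A, m, u))"
proof -
  show ?thesis
    unfolding kappa_def split_conv
    by (rule net_fromD, (rule net_rules | (use assms in \<open>simp add: good_def; fail\<close>))+)
qed

lemma rep_kappa_dag:
  assumes "m \<in> Arr C" "Dom C m = ty p \<boxtimes> ty q" "Cod C m = ty a" "A = ty a"
    "ty p = ty a" "ty q = ty a" "ty s = (ty a)\<^sup>\<star>" "distinct [s, a, p, q]"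
  shows "rep (Lf q) [(Emp, \<eta> A, Lf s \<star> Lf p), (Lf p \<star> Lf q, m, Lf a)] (Lf s \<star> Lf a) ((kappa C (A, m, u))\<^sup>\<dagger>)"
proof -
  have A: "A \<in> Ob C" using assms by simp
  have e: "(kappa C (A, m, u))\<^sup>\<dagger> = (\<i> (A\<^sup>\<star>) \<otimes> m) \<cdot> (\<alpha> (A\<^sup>\<star>) A A) \<cdot> (\<eta> A \<otimes> \<i> A) \<cdot> (\<l> A)\<^sup>\<dagger>"
    using assms by (simp add: kappa_def)
  show ?thesis
    unfolding e
    by (rule net_fromD, (rule net_rules | (use assms in \<open>simp add: good_def; fail\<close>))+)
qed

end

context compact_dagger_category
begin

text \<open>The cup on \<open>B\<close> in the first double meets the cap on \<open>B\<close> in the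
  second. Yanking them connects \<open>g\<^sup>\<dagger>\<close> with
  \<open>f\<^sup>\<dagger>\<close> directly, which leaves the double of the composite with
  environments side by side.\<close>

lemma Dbl_comp:
  assumes f: "f \<in> hom C A (X \<boxtimes> B)" and g: "g \<in> hom C B (Y \<boxtimes> E)" and ob: "X \<in> Ob C" "B \<in> Ob C" "Y \<in> Ob C" "E \<in> Ob C"
  shows "Dbl C Y E g \<cdot> Dbl C X B f = Dbl C (X \<boxtimes> Y) E ((\<alpha> X Y E)\<^sup>\<dagger> \<cdot> (\<i> X \<otimes> g) \<cdot> f)"
proof -
  have A: "A \<in> Ob C" using f by (auto simp: hom_iff)
  have f: "f \<in> Arr C" "Dom C f = A" "Cod C f = X \<boxtimes> B" and g: "g \<in> Arr C" "Dom C g = B" "Cod C g = Y \<boxtimes> E"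
    using f g by (auto simp: hom_iff)
  interpret compact_labelling C "tyl [A\<^sup>\<star>, A, X, B, B\<^sup>\<star>, B, A, Y, E, E\<^sup>\<star>, E, B]"
    by (rule compact_labelling_tyl) (use A ob dual_ob in auto)
  note s = A ob f g good_def
  let ?f = "(Lf 1, f, Lf 2 \<star> Lf 3)" and ?f' = "(Lf 2 \<star> Lf 11, f\<^sup>\<dagger>, Lf 6)" and ?fo = "(Lf 2 \<star> Lf 5, f\<^sup>\<dagger>, Lf 6)"
    and ?g = "(Lf 3, g, Lf 7 \<star> Lf 8)" and ?g' = "(Lf 7 \<star> Lf 10, g\<^sup>\<dagger>, Lf 11)"
    and ?h = "(Emp, \<eta> E, Lf 9 \<star> Lf 10)" and ?e = "(Lf 0 \<star> Lf 6, counit C A, Emp)"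
  have "rep (Lf 0 \<star> Lf 1) ([?f, (Emp, \<eta> B, Lf 4 \<star> Lf 5), ?fo, ?e] @ [?g, ?h, ?g', (Lf 4 \<star> Lf 11, counit C B, Emp)])
    (Lf 9 \<star> Lf 8) (Dbl C Y E g \<cdot> Dbl C X B f)"
    by (rule rep_comp[OF rep_Dbl rep_Dbl]) (simp_all add: s)
  then have 1: "rep (Lf 0 \<star> Lf 1) [?f, ?g, ?h, ?g', ?f', ?e] (Lf 9 \<star> Lf 8) (Dbl C Y E g \<cdot> Dbl C X B f)"
    by (rule net_snake[where s = 4 and j = 5 and i = 11 and La = "[?f, ?g, ?h, ?g']" and Lb = "[?fo, ?e]"])
       (simp_all add: s)
  let ?k = "(\<alpha> X Y E)\<^sup>\<dagger> \<cdot> (\<i> X \<otimes> g) \<cdot> f"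
  have k: "?k \<in> hom C A ((X \<boxtimes> Y) \<boxtimes> E)" "?k\<^sup>\<dagger> = f\<^sup>\<dagger> \<cdot> (\<i> X \<otimes> g\<^sup>\<dagger>) \<cdot> \<alpha> X Y E" 
    by (simp_all add: s hom_iff)
  have "rep (Lf 0 \<star> Lf 1) [?f, ?g, ?h, ?g', ?f', ?e] (Lf 9 \<star> Lf 8) (Dbl C (X \<boxtimes> Y) E ?k)"
    unfolding Dbl_straight[OF k(1) ten_ob[OF ob(1,3)] ob(4)] k(2) middle_swap_def
    by (rule net_fromD, (rule net_rules | (simp add: s; fail))+)
  with 1 show ?thesis by (rule rep_unique) simp
qed

text \<open>In \<open>f\<^sup>\<dagger>\<close> the environment is an input; \<open>\<eta> X\<close>
  bends it into an output of type \<open>X\<^sup>\<star>\<close>, and this bend is yanked straight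
  in the double.\<close>

lemma Dbl_dag:
  assumes f: "f \<in> hom C A (X \<boxtimes> B)" and ob: "X \<in> Ob C" "B \<in> Ob C"
  shows "(Dbl C X B f)\<^sup>\<dagger> = Dbl C (X\<^sup>\<star>) A ((\<i> (X\<^sup>\<star>) \<otimes> f\<^sup>\<dagger>) \<cdot> \<alpha> (X\<^sup>\<star>) X B \<cdot> (\<eta> X \<otimes> \<i> B) \<cdot> (\<l> B)\<^sup>\<dagger>)"
proof -
  have A: "A \<in> Ob C" using f by (auto simp: hom_iff)
  note Df = Dbl_straight[OF f ob]
  have f: "f \<in> Arr C" "Dom C f = A" "Cod C f = X \<boxtimes> B"
    using f by (auto simp: hom_iff)
  interpret compact_labelling C "tyl [B\<^sup>\<star>, B, X, A, A\<^sup>\<star>, A, B, X\<^sup>\<star>, X, X]"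
    by (rule compact_labelling_tyl) (use A ob dual_ob in auto)
  note s = A ob f good_def
  let ?f' = "(Lf 9 \<star> Lf 1, f\<^sup>\<dagger>, Lf 3)" and ?f = "(Lf 5, f, Lf 9 \<star> Lf 6)" and ?fo = "(Lf 8 \<star> Lf 1, f\<^sup>\<dagger>, Lf 3)"
    and ?h = "(Emp, \<eta> A, Lf 4 \<star> Lf 5)" and ?e = "(Lf 0 \<star> Lf 6, counit C B, Emp)"
    and ?x = "(Emp, \<eta> X, Lf 7 \<star> Lf 8)" and ?y = "(Lf 7 \<star> Lf 9, counit C X, Emp)"
  let ?k = "(\<i> (X\<^sup>\<star>) \<otimes> f\<^sup>\<dagger>) \<cdot> \<alpha> (X\<^sup>\<star>) X B \<cdot> (\<eta> X \<otimes> \<i> B) \<cdot> (\<l> B)\<^sup>\<dagger>"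
  have k: "?k \<in> hom C B (X\<^sup>\<star> \<boxtimes> A)"
    "?k\<^sup>\<dagger> = \<l> B \<cdot> (counit C X \<otimes> \<i> B) \<cdot> (\<alpha> (X\<^sup>\<star>) X B)\<^sup>\<dagger> \<cdot> (\<i> (X\<^sup>\<star>) \<otimes> f)"
    by (simp_all add: s hom_iff)
  have "rep (Lf 0 \<star> Lf 1) [?x, ?fo, ?h, ?f, ?y, ?e] (Lf 4 \<star> Lf 3) (Dbl C (X\<^sup>\<star>) A ?k)"
    unfolding Dbl_straight[OF k(1) dual_ob[OF ob(1)] A] k(2) middle_swap_def
    by (rule net_fromD, (rule net_rules | (simp add: s; fail))+)
  then have 1: "rep (Lf 0 \<star> Lf 1) [?h, ?f, ?f', ?e] (Lf 4 \<star> Lf 3) (Dbl C (X\<^sup>\<star>) A ?k)"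
    by (rule net_snake[where s = 7 and j = 8 and i = 9 and La = "[?h, ?f]" and Lb = "[?fo, ?e]"])
       (simp_all add: s)
  have e: "(Dbl C X B f)\<^sup>\<dagger> = \<l> (A\<^sup>\<star> \<boxtimes> A) \<cdot> (counit C B \<otimes> (\<i> (A\<^sup>\<star>) \<otimes> f\<^sup>\<dagger>)) \<cdot> (middle_swap C (B\<^sup>\<star>) B (A\<^sup>\<star>) (X \<boxtimes> B))\<^sup>\<dagger>
      \<cdot> (\<i> (B\<^sup>\<star> \<boxtimes> A\<^sup>\<star>) \<otimes> (\<alpha> B X B \<cdot> (\<sigma> X B \<otimes> \<i> B) \<cdot> (f \<otimes> \<i> B)))
      \<cdot> (\<alpha> (B\<^sup>\<star>) (A\<^sup>\<star>) (A \<boxtimes> B))\<^sup>\<dagger> \<cdot> (\<i> (B\<^sup>\<star>) \<otimes> (\<alpha> (A\<^sup>\<star>) A B \<cdot> (\<eta> A \<otimes> \<i> B) \<cdot> (\<l> B)\<^sup>\<dagger>))"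
    unfolding Df by (simp add: s middle_swap_def)
  \<comment> \<open>The network rules do not treat the dagger of a composite, so the dagger is
    written out as the middle swap with its two inner arguments exchanged.\<close>
  have m: "(middle_swap C (B\<^sup>\<star>) B (A\<^sup>\<star>) (X \<boxtimes> B))\<^sup>\<dagger> = 
     (\<alpha> (B\<^sup>\<star>) B (A\<^sup>\<star> \<boxtimes> (X \<boxtimes> B)))\<^sup>\<dagger> \<cdot> (\<i> (B\<^sup>\<star>) \<otimes> \<alpha> B (A\<^sup>\<star>) (X \<boxtimes> B)) \<cdot> (\<i> (B\<^sup>\<star>) \<otimes> (\<sigma> (A\<^sup>\<star>) B \<otimes> \<i> (X \<boxtimes> B)))
       \<cdot> (\<i> (B\<^sup>\<star>) \<otimes> (\<alpha> (A\<^sup>\<star>) B (X \<boxtimes> B))\<^sup>\<dagger>) \<cdot> \<alpha> (B\<^sup>\<star>) (A\<^sup>\<star>) (B \<boxtimes> (X \<boxtimes> B))"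
    by (simp add: s middle_swap_def)
  have "rep (Lf 0 \<star> Lf 1) [?h, ?f, ?f', ?e] (Lf 4 \<star> Lf 3) ((Dbl C X B f)\<^sup>\<dagger>)"
    unfolding e m
    by (rule net_fromD, (rule net_rules | (simp add: s; fail))+)
  from this 1 show ?thesis by (rule rep_unique) simp
qed

text \<open>The partial trace of \<open>K : A \<boxtimes> A \<rightarrow> A \<boxtimes> B\<close> over the first factor.\<close>

definition trc :: "'a \<Rightarrow> 'a \<Rightarrow> 'b \<Rightarrow> 'b" where
  "trc A B K = \<l> B \<cdot> (counit C A \<otimes> \<i> B) \<cdot> (\<alpha> (A\<^sup>\<star>) A B)\<^sup>\<dagger> \<cdot> (\<i> (A\<^sup>\<star>) \<otimes> K) \<cdot> \<alpha> (A\<^sup>\<star>) A A \<cdot> (\<eta> A \<otimes> \<i> A) \<cdot> (\<l> A)\<^sup>\<dagger>"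

text \<open>\<open>kappa \<B> \<cdot> Dbl X B f \<cdot> (kappa \<A>)\<^sup>\<dagger>\<close> is the partial trace of this morphism.\<close>

definition core :: "'a \<Rightarrow> 'a \<Rightarrow> 'b \<Rightarrow> 'b \<Rightarrow> 'b \<Rightarrow> 'b" where
  "core X B f m n = (f\<^sup>\<dagger> \<otimes> \<i> B) \<cdot> (\<alpha> X B B)\<^sup>\<dagger> \<cdot> (\<i> X \<otimes> n\<^sup>\<dagger>) \<cdot> f \<cdot> m"

text \<open>The cup on \<open>B\<close> in the double and the cap in the outer \<open>kappa\<close>
  cancel. Only the cup and the cap on \<open>A\<close> survive, and they form the trace.\<close>

lemma kappa_Dbl_kappa:
  assumes f: "f \<in> hom C A (X \<boxtimes> B)" and m: "m \<in> hom C (A \<boxtimes> A) A" and n: "n \<in> hom C (B \<boxtimes> B) B"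
    and ob: "X \<in> Ob C" "A \<in> Ob C" "B \<in> Ob C"
  shows "kappa C (B, n, v) \<cdot> Dbl C X B f \<cdot> (kappa C (A, m, u))\<^sup>\<dagger> = trc A B (core X B f m n)"
proof -
  have f: "f \<in> Arr C" "Dom C f = A" "Cod C f = X \<boxtimes> B" and m: "m \<in> Arr C" "Dom C m = A \<boxtimes> A" "Cod C m = A"
    and n: "n \<in> Arr C" "Dom C n = B \<boxtimes> B" "Cod C n = B"
    using f m n by (auto simp: hom_iff)
  interpret compact_labelling C "tyl [A, A\<^sup>\<star>, A, A, X, B, B\<^sup>\<star>, B, A, B, B]"
    by (rule compact_labelling_tyl) (use ob dual_ob in auto)
  note s = ob f m n good_def
  let ?f = "(Lf 3, f, Lf 4 \<star> Lf 5)" and ?f' = "(Lf 4 \<star> Lf 9, f\<^sup>\<dagger>, Lf 8)" and ?fo = "(Lf 4 \<star> Lf 7, f\<^sup>\<dagger>, Lf 8)"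
    and ?m = "(Lf 2 \<star> Lf 0, m, Lf 3)" and ?n = "(Lf 5, n\<^sup>\<dagger>, Lf 9 \<star> Lf 10)"
    and ?h = "(Emp, \<eta> A, Lf 1 \<star> Lf 2)" and ?e = "(Lf 1 \<star> Lf 8, counit C A, Emp)"
  have 1: "rep (Lf 0) [?h, ?m, ?f, ?n, ?f', ?e] (Lf 10) (trc A B (core X B f m n))"
    unfolding trc_def core_def
    by (rule net_fromD, (rule net_rules | (simp add: s; fail))+)
  have "rep (Lf 0) ([?h, ?m] @ ([?f, (Emp, \<eta> B, Lf 6 \<star> Lf 7), ?fo, ?e] @ [?n, (Lf 6 \<star> Lf 9, counit C B, Emp)])) (Lf 10)
     (kappa C (B, n, v) \<cdot> Dbl C X B f \<cdot> (kappa C (A, m, u))\<^sup>\<dagger>)"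
    by (rule rep_comp[OF rep_kappa_dag rep_comp[OF rep_Dbl rep_kappa]]) (simp_all add: s)
  then have "rep (Lf 0) [?h, ?m, ?f, ?n, ?f', ?e] (Lf 10) (kappa C (B, n, v) \<cdot> Dbl C X B f \<cdot> (kappa C (A, m, u))\<^sup>\<dagger>)"
    by (rule net_snake[where s = 6 and j = 7 and i = 9 and La = "[?h, ?m, ?f, ?n]" and Lb = "[?fo, ?e]"])
       (simp_all add: s)
  from this 1 show ?thesis by (rule rep_unique) simp
qed

text \<open>The morphism \<open>g\<close> sits on the wire that leaves the loop, so both formulas
  have the same network.\<close>

lemma trc_comp:
  assumes K: "K \<in> hom C (A \<boxtimes> A) (A \<boxtimes> B)" and g: "g \<in> hom C B E" and ob: "A \<in> Ob C" "B \<in> Ob C" "E \<in> Ob C"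
  shows "trc A E ((\<i> A \<otimes> g) \<cdot> K) = g \<cdot> trc A B K"
proof -
  have K: "K \<in> Arr C" "Dom C K = A \<boxtimes> A" "Cod C K = A \<boxtimes> B" and g: "g \<in> Arr C" "Dom C g = B" "Cod C g = E"
    using K g by (auto simp: hom_iff)
  interpret compact_labelling C "tyl [A, A\<^sup>\<star>, A, A, B, E]"
    by (rule compact_labelling_tyl) (use ob dual_ob in auto)
  note s = ob K g good_def
  let ?L = "[(Emp, \<eta> A, Lf 1 \<star> Lf 2), (Lf 2 \<star> Lf 0, K, Lf 3 \<star> Lf 4), (Lf 4, g, Lf 5), (Lf 1 \<star> Lf 3, counit C A, Emp)]"
  have "rep (Lf 0) ?L (Lf 5) (trc A E ((\<i> A \<otimes> g) \<cdot> K))"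
    unfolding trc_def by (rule net_fromD, (rule net_rules | (simp add: s; fail))+)
  moreover have "rep (Lf 0) ?L (Lf 5) (g \<cdot> trc A B K)"
    unfolding trc_def by (rule net_fromD, (rule net_rules | (simp add: s; fail))+)
  ultimately show ?thesis by (rule rep_unique) simp
qed

lemma kappa_kappa_dag:
  assumes m: "m \<in> hom C (A \<boxtimes> A) A" and A: "A \<in> Ob C"
  shows "kappa C (A, m, u) \<cdot> (kappa C (A, m, u))\<^sup>\<dagger> = trc A A (m\<^sup>\<dagger> \<cdot> m)"
proof -
  have m: "m \<in> Arr C" "Dom C m = A \<boxtimes> A" "Cod C m = A"
    using m by (auto simp: hom_iff)
  interpret compact_labelling C "tyl [A, A\<^sup>\<star>, A, A, A, A]"
    by (rule compact_labelling_tyl) (use A dual_ob in auto)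
  note s = A m good_def
  let ?m = "(Lf 2 \<star> Lf 0, m, Lf 3)" and ?n = "(Lf 3, m\<^sup>\<dagger>, Lf 4 \<star> Lf 5)"
    and ?h = "(Emp, \<eta> A, Lf 1 \<star> Lf 2)" and ?e = "(Lf 1 \<star> Lf 4, counit C A, Emp)"
  have 1: "rep (Lf 0) [?h, ?m, ?n, ?e] (Lf 5) (trc A A (m\<^sup>\<dagger> \<cdot> m))"
    unfolding trc_def by (rule net_fromD, (rule net_rules | (simp add: s; fail))+)
  have "rep (Lf 0) ([?h, ?m] @ [?n, ?e]) (Lf 5) (kappa C (A, m, u) \<cdot> (kappa C (A, m, u))\<^sup>\<dagger>)"
    by (rule rep_comp[OF rep_kappa_dag rep_kappa]) (simp_all add: s)
  from this 1 show ?thesis by (rule rep_unique) simp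
qed

end

section \<open>Symmetry of Frobenius structures\<close>

context labelling
begin

text \<open>The common value is hidden because a rewriting step depends on the two networks
  only.\<close>

definition eqv :: "tr \<Rightarrow> 'b box list \<Rightarrow> tr \<Rightarrow> 'b box list \<Rightarrow> bool" where
  "eqv V K W K' \<longleftrightarrow> (\<exists>k. rep V K W k \<and> rep V K' W k)"

lemma eqvI: "rep V K W k \<Longrightarrow> rep V K' W k \<Longrightarrow> eqv V K W K'"
  by (auto simp: eqv_def)

lemma eqv_sym: "eqv V K W K' \<Longrightarrow> eqv V K' W K"
  by (auto simp: eqv_def)

lemma net_step:
  assumes "rep T L U f" "eqv V K W K'" "mset L = mset (La @ K @ Lb)" "wf (lv T) (La @ K @ Lb)"
    "lv V \<subseteq> fin (lv T) La" "wf (lv T) (La @ K' @ Lb)" "mset L' = mset (La @ K' @ Lb)" "wf (lv T) L'"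
  shows "rep T L' U f"
proof -
  obtain k where k: "rep V K W k" "rep V K' W k" using assms(2) by (auto simp: eqv_def)
  have "rep T (La @ K @ Lb) U f" using rep_perm assms(1,3,4) by blast
  then have "rep T (La @ K' @ Lb) U f" by (rule rep_subst) (use k assms in auto)
  then show ?thesis by (rule rep_perm) (use assms in auto)
qed

text \<open>For the unit laws and speciality, whose right-hand side is a bare wire: it is removed at
  once, at the price of renaming \<open>j\<close> to \<open>i\<close> in what follows.\<close>

lemma net_step_wire:
  assumes r: "rep T L U f" and e: "eqv (Lf i) K (Lf j) [(Lf i, \<i> (ty i), Lf j)]"
    and L: "mset L = mset (La @ K @ Lb)" and w: "wf (lv T) (La @ K @ Lb)"
    and i: "i \<in> fin (lv T) La" and t: "ty j = ty i"
    and L': "mset L' = mset (La @ map (renb j i) Lb)" "wf (lv T) L'" "V = ren j i U"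
  shows "rep T L' V f"
proof -
  let ?S = "fin (lv T) La" let ?R = "?S - {i}" and ?w = "(Lf i, \<i> (ty i), Lf j)"
  obtain k where k: "rep (Lf i) K (Lf j) k" "rep (Lf i) [?w] (Lf j) k" using e by (auto simp: eqv_def)
  have S: "{i} \<union> ?R = ?S" using i by auto
  have w1: "wf (lv T) La" "wf ?S (K @ Lb)" "wf ?S K" "wf (fin ?S K) Lb" "finite ?S"
    "(lv T \<union> ol La) \<inter> (ol K \<union> ol Lb) = {}" "ol K \<inter> ol Lb = {}"
    using w wf_finite[of ?S K] by (auto simp: wf_append)
  have R: "?R \<inter> {i} = {}" "?R \<inter> ol K = {}" "finite ?R" using wf_disjoint[OF w1(3)] w1 by auto
  have ij: "i \<noteq> j" using repD(6)[OF k(2)] by auto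
  then have j: "j \<in> ol K" using repD(9)[OF k(1)] by auto
  have "fin ({i} \<union> ?R) K = fin {i} K \<union> ?R"
    using run_frame[of "{i}" K ?R] repD(6)[OF k(1)] R by auto
  then have fS: "fin ?S K = {j} \<union> ?R" using repD(7)[OF k(1)] unfolding S by simp
  have jS: "j \<notin> ?S" "j \<notin> ol Lb" "?S \<inter> ol Lb = {}" using j R ij w1 wf_disjoint[OF w1(2)] by auto
  have e: "?S - lv (Lf i) \<union> lv (Lf j) = {j} \<union> ?R" by auto
  have "wf ?S (?w # Lb)"
    unfolding wf.simps e using w1 fS jS i t by (auto simp: good_def)
  then have w': "wf (lv T) (La @ ?w # Lb)"
    unfolding wf_append using w1 j by auto
  have "rep T (La @ [?w] @ Lb) U f"
    by (rule net_step[OF r assms(2) L w]) (use i w' in auto)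
  then have "rep T (La @ (Lf i, \<i> (ty j), Lf j) # Lb) U f" by (simp add: t)
  then have "rep T (La @ map (renb j i) Lb) (ren j i U) f"
    by (rule rep_wire_elim) (fact t[symmetric])
  then show ?thesis unfolding L'(3) by (rule rep_perm[OF _ L'(1)[symmetric] L'(2)])
qed

lemma eqv_wire:
  assumes "rep (Lf i) K (Lf j) (\<i> (ty i))" "ty j = ty i" "i \<noteq> j"
  shows "eqv (Lf i) K (Lf j) [(Lf i, \<i> (ty i), Lf j)]"
  by (rule eqvI[OF assms(1) rep_box]) (use assms in auto)

end

locale frobenius_structure = compact_dagger_category +
  fixes A :: 'a and m :: 'b and u :: 'b
  assumes frobenius: "special_dagger_frobenius C (A, m, u)"
begin

lemma frob_simps [simp]:
  "A \<in> Ob C" "m \<in> Arr C" "Dom C m = A \<boxtimes> A" "Cod C m = A" "u \<in> Arr C" "Dom C u = \<one>" "Cod C u = A"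
  using frobenius by (auto simp: special_dagger_frobenius_def hom_iff)

lemma frob_laws:
  "m \<cdot> (m \<otimes> \<i> A) = m \<cdot> (\<i> A \<otimes> m) \<cdot> \<alpha> A A A"
  "m \<cdot> (u \<otimes> \<i> A) = \<l> A" "m \<cdot> (\<i> A \<otimes> u) = \<r> A" "m \<cdot> m\<^sup>\<dagger> = \<i> A"
  "(m \<otimes> \<i> A) \<cdot> (\<alpha> A A A)\<^sup>\<dagger> \<cdot> (\<i> A \<otimes> m\<^sup>\<dagger>) = (\<i> A \<otimes> m) \<cdot> \<alpha> A A A \<cdot> (m\<^sup>\<dagger> \<otimes> \<i> A)"
  using frobenius unfolding special_dagger_frobenius_def by blast+

lemma cofrob_laws:
  "(m\<^sup>\<dagger> \<otimes> \<i> A) \<cdot> m\<^sup>\<dagger> = (\<alpha> A A A)\<^sup>\<dagger> \<cdot> (\<i> A \<otimes> m\<^sup>\<dagger>) \<cdot> m\<^sup>\<dagger>"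
  "(u\<^sup>\<dagger> \<otimes> \<i> A) \<cdot> m\<^sup>\<dagger> = (\<l> A)\<^sup>\<dagger>" "(\<i> A \<otimes> u\<^sup>\<dagger>) \<cdot> m\<^sup>\<dagger> = (\<r> A)\<^sup>\<dagger>"
proof -
  have "(m \<cdot> (m \<otimes> \<i> A))\<^sup>\<dagger> = (m \<cdot> (\<i> A \<otimes> m) \<cdot> \<alpha> A A A)\<^sup>\<dagger>" using frob_laws(1) by simp
  then show "(m\<^sup>\<dagger> \<otimes> \<i> A) \<cdot> m\<^sup>\<dagger> = (\<alpha> A A A)\<^sup>\<dagger> \<cdot> (\<i> A \<otimes> m\<^sup>\<dagger>) \<cdot> m\<^sup>\<dagger>" by simp
  have "(m \<cdot> (u \<otimes> \<i> A))\<^sup>\<dagger> = (\<l> A)\<^sup>\<dagger>" using frob_laws(2) by simp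
  then show "(u\<^sup>\<dagger> \<otimes> \<i> A) \<cdot> m\<^sup>\<dagger> = (\<l> A)\<^sup>\<dagger>" by simp
  have "(m \<cdot> (\<i> A \<otimes> u))\<^sup>\<dagger> = (\<r> A)\<^sup>\<dagger>" using frob_laws(3) by simp
  then show "(\<i> A \<otimes> u\<^sup>\<dagger>) \<cdot> m\<^sup>\<dagger> = (\<r> A)\<^sup>\<dagger>" by simp
qed

end

locale frobenius_labelling = compact_labelling + frobenius_structure
begin

lemma net_unit:
  assumes "ty a = A" "ty b = A" "ty v = A" "distinct [a, b, v]"
  shows "eqv (Lf a) [(Emp, u, Lf v), (Lf v \<star> Lf a, m, Lf b)] (Lf b) [(Lf a, \<i> (ty a), Lf b)]" (is ?P)
    and "eqv (Lf a) [(Emp, u, Lf v), (Lf a \<star> Lf v, m, Lf b)] (Lf b) [(Lf a, \<i> (ty a), Lf b)]" (is ?Q)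
    and "eqv (Lf a) [(Lf a, m\<^sup>\<dagger>, Lf v \<star> Lf b), (Lf v, u\<^sup>\<dagger>, Emp)] (Lf b) [(Lf a, \<i> (ty a), Lf b)]" (is ?R)
    and "eqv (Lf a) [(Lf a, m\<^sup>\<dagger>, Lf b \<star> Lf v), (Lf v, u\<^sup>\<dagger>, Emp)] (Lf b) [(Lf a, \<i> (ty a), Lf b)]" (is ?S)
proof -
  have d: "distinct [v, b, a]" using assms by auto
  have "rep (Lf a) [(Emp, u, Lf v), (Lf v \<star> Lf a, m, Lf b)] (Lf b) (m \<cdot> (u \<otimes> \<i> A) \<cdot> (\<l> A)\<^sup>\<dagger>)"
    by (rule net_fromD, (rule net_rules | (use assms d in \<open>simp add: good_def; fail\<close>))+)
  then show ?P using assms by (intro eqv_wire) (simp_all add: frob_laws)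
  have "rep (Lf a) [(Emp, u, Lf v), (Lf a \<star> Lf v, m, Lf b)] (Lf b) (m \<cdot> (\<i> A \<otimes> u) \<cdot> (\<r> A)\<^sup>\<dagger>)"
    by (rule net_fromD, (rule net_rules | (use assms d in \<open>simp add: good_def; fail\<close>))+)
  then show ?Q using assms by (intro eqv_wire) (simp_all add: frob_laws)
  have "rep (Lf a) [(Lf a, m\<^sup>\<dagger>, Lf v \<star> Lf b), (Lf v, u\<^sup>\<dagger>, Emp)] (Lf b) (\<l> A \<cdot> ((u\<^sup>\<dagger> \<otimes> \<i> A) \<cdot> m\<^sup>\<dagger>))"
    by (rule net_fromD, (rule net_rules | (use assms d in \<open>simp add: good_def; fail\<close>))+)
  then show ?R using assms by (intro eqv_wire) (simp_all add: cofrob_laws)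
  have "rep (Lf a) [(Lf a, m\<^sup>\<dagger>, Lf b \<star> Lf v), (Lf v, u\<^sup>\<dagger>, Emp)] (Lf b) (\<r> A \<cdot> ((\<i> A \<otimes> u\<^sup>\<dagger>) \<cdot> m\<^sup>\<dagger>))"
    by (rule net_fromD, (rule net_rules | (use assms d in \<open>simp add: good_def; fail\<close>))+)
  then show ?S using assms by (intro eqv_wire) (simp_all add: cofrob_laws)
qed

lemma net_assoc:
  assumes "ty p = A" "ty q = A" "ty r = A" "ty a = A" "ty b = A" "ty c = A" "distinct [p, q, r, a, b, c]"
  shows "eqv ((Lf p \<star> Lf q) \<star> Lf r) [(Lf p \<star> Lf q, m, Lf a), (Lf a \<star> Lf r, m, Lf b)] (Lf b)
    [(Lf q \<star> Lf r, m, Lf c), (Lf p \<star> Lf c, m, Lf b)]"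
proof (rule eqvI)
  have d: "distinct [c, b, a, r, q, p]" using assms by auto
  show "rep ((Lf p \<star> Lf q) \<star> Lf r) [(Lf p \<star> Lf q, m, Lf a), (Lf a \<star> Lf r, m, Lf b)] (Lf b) (m \<cdot> (m \<otimes> \<i> A))"
    by (rule net_fromD, (rule net_rules | (use assms d in \<open>simp add: good_def; fail\<close>))+)
  show "rep ((Lf p \<star> Lf q) \<star> Lf r) [(Lf q \<star> Lf r, m, Lf c), (Lf p \<star> Lf c, m, Lf b)] (Lf b) (m \<cdot> (m \<otimes> \<i> A))"
    unfolding frob_laws(1)
    by (rule net_fromD, (rule net_rules | (use assms d in \<open>simp add: good_def; fail\<close>))+)
qed

lemma net_frob:
  assumes "ty p = A" "ty q = A" "ty r = A" "ty a = A" "ty b = A" "ty c = A" "distinct [p, q, r, a, b, c]"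
  shows "eqv (Lf p \<star> Lf q) [(Lf q, m\<^sup>\<dagger>, Lf r \<star> Lf b), (Lf p \<star> Lf r, m, Lf a)] (Lf a \<star> Lf b)
    [(Lf p, m\<^sup>\<dagger>, Lf a \<star> Lf c), (Lf c \<star> Lf q, m, Lf b)]"
proof (rule eqvI)
  have d: "distinct [c, b, a, r, q, p]" using assms by auto
  show "rep (Lf p \<star> Lf q) [(Lf q, m\<^sup>\<dagger>, Lf r \<star> Lf b), (Lf p \<star> Lf r, m, Lf a)] (Lf a \<star> Lf b)
    ((m \<otimes> \<i> A) \<cdot> (\<alpha> A A A)\<^sup>\<dagger> \<cdot> (\<i> A \<otimes> m\<^sup>\<dagger>))"
    by (rule net_fromD, (rule net_rules | (use assms d in \<open>simp add: good_def; fail\<close>))+)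
  show "rep (Lf p \<star> Lf q) [(Lf p, m\<^sup>\<dagger>, Lf a \<star> Lf c), (Lf c \<star> Lf q, m, Lf b)] (Lf a \<star> Lf b)
    ((m \<otimes> \<i> A) \<cdot> (\<alpha> A A A)\<^sup>\<dagger> \<cdot> (\<i> A \<otimes> m\<^sup>\<dagger>))"
    unfolding frob_laws(5)
    by (rule net_fromD, (rule net_rules | (use assms d in \<open>simp add: good_def; fail\<close>))+)
qed

lemma net_coassoc:
  assumes "ty p = A" "ty q = A" "ty r = A" "ty a = A" "ty b = A" "ty c = A" "distinct [p, q, r, a, b, c]"
  shows "eqv (Lf b) [(Lf b, m\<^sup>\<dagger>, Lf a \<star> Lf r), (Lf a, m\<^sup>\<dagger>, Lf p \<star> Lf q)] ((Lf p \<star> Lf q) \<star> Lf r)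
    [(Lf b, m\<^sup>\<dagger>, Lf p \<star> Lf c), (Lf c, m\<^sup>\<dagger>, Lf q \<star> Lf r)]"
proof (rule eqvI)
  have d: "distinct [c, b, a, r, q, p]" using assms by auto
  show "rep (Lf b) [(Lf b, m\<^sup>\<dagger>, Lf a \<star> Lf r), (Lf a, m\<^sup>\<dagger>, Lf p \<star> Lf q)] ((Lf p \<star> Lf q) \<star> Lf r) ((m\<^sup>\<dagger> \<otimes> \<i> A) \<cdot> m\<^sup>\<dagger>)"
    by (rule net_fromD, (rule net_rules | (use assms d in \<open>simp add: good_def; fail\<close>))+)
  show "rep (Lf b) [(Lf b, m\<^sup>\<dagger>, Lf p \<star> Lf c), (Lf c, m\<^sup>\<dagger>, Lf q \<star> Lf r)] ((Lf p \<star> Lf q) \<star> Lf r) ((m\<^sup>\<dagger> \<otimes> \<i> A) \<cdot> m\<^sup>\<dagger>)"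
    unfolding cofrob_laws(1)
    by (rule net_fromD, (rule net_rules | (use assms d in \<open>simp add: good_def; fail\<close>))+)
qed

end

context frobenius_structure
begin

lemma frobenius_labelling_tyl: "set os \<subseteq> Ob C \<Longrightarrow> frobenius_labelling C (tyl os) A m u"
  by unfold_locales (auto simp: tyl_def)

text \<open>The Frobenius law with a unit plugged into one input; the unit law then removes the
  multiplication on the other side. So \<open>m\<^sup>\<dagger>\<close> is recovered from
  \<open>m\<close> and the cup \<open>m\<^sup>\<dagger> \<cdot> u\<close>.\<close>

lemma comult_cup:
  "m\<^sup>\<dagger> = (m \<otimes> \<i> A) \<cdot> (\<alpha> A A A)\<^sup>\<dagger> \<cdot> (\<i> A \<otimes> (m\<^sup>\<dagger> \<cdot> u)) \<cdot> (\<r> A)\<^sup>\<dagger>" (is "_ = ?R")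
  "m\<^sup>\<dagger> = (\<i> A \<otimes> m) \<cdot> \<alpha> A A A \<cdot> ((m\<^sup>\<dagger> \<cdot> u) \<otimes> \<i> A) \<cdot> (\<l> A)\<^sup>\<dagger>" (is "_ = ?L")
proof -
  interpret frobenius_labelling C "tyl [A, A, A, A, A, A]" by (rule frobenius_labelling_tyl) simp
  note s = good_def
  have "rep (Lf 0) [(Emp, u, Lf 3), (Lf 3, m\<^sup>\<dagger>, Lf 4 \<star> Lf 2), (Lf 0 \<star> Lf 4, m, Lf 1)] (Lf 1 \<star> Lf 2) ?R"
    by (rule net_fromD, (rule net_rules | (simp add: s; fail))+)
  then have "rep (Lf 0) [(Lf 0, m\<^sup>\<dagger>, Lf 1 \<star> Lf 5), (Emp, u, Lf 3), (Lf 5 \<star> Lf 3, m, Lf 2)] (Lf 1 \<star> Lf 2) ?R"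
    by (rule net_step[OF _ net_frob[of 0 3 4 1 2 5], where La = "[(Emp, u, Lf 3)]" and Lb = "[]"]) (simp_all add: s)
  then have "rep (Lf 0) [(Lf 0, m\<^sup>\<dagger>, Lf 1 \<star> Lf 5)] (Lf 1 \<star> Lf 5) ?R"
    by (rule net_step_wire[OF _ net_unit(2)[of 5 2 3], where La = "[(Lf 0, m\<^sup>\<dagger>, Lf 1 \<star> Lf 5)]" and Lb = "[]"])
       (simp_all add: s)
  moreover have "rep (Lf 0) [(Lf 0, m\<^sup>\<dagger>, Lf 1 \<star> Lf 5)] (Lf 1 \<star> Lf 5) (m\<^sup>\<dagger>)" by (rule rep_box) simp_all
  ultimately show "m\<^sup>\<dagger> = ?R" using rep_unique by blast
  have "rep (Lf 0) [(Emp, u, Lf 3), (Lf 3, m\<^sup>\<dagger>, Lf 1 \<star> Lf 4), (Lf 4 \<star> Lf 0, m, Lf 2)] (Lf 1 \<star> Lf 2) ?L"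
    by (rule net_fromD, (rule net_rules | (simp add: s; fail))+)
  then have "rep (Lf 0) [(Lf 0, m\<^sup>\<dagger>, Lf 5 \<star> Lf 2), (Emp, u, Lf 3), (Lf 3 \<star> Lf 5, m, Lf 1)] (Lf 1 \<star> Lf 2) ?L"
    by (rule net_step[OF _ net_frob[of 3 0 5 1 2 4, THEN eqv_sym], where La = "[(Emp, u, Lf 3)]" and Lb = "[]"]) (simp_all add: s)
  then have "rep (Lf 0) [(Lf 0, m\<^sup>\<dagger>, Lf 5 \<star> Lf 2)] (Lf 5 \<star> Lf 2) ?L"
    by (rule net_step_wire[OF _ net_unit(1)[of 5 1 3], where La = "[(Lf 0, m\<^sup>\<dagger>, Lf 5 \<star> Lf 2)]" and Lb = "[]"])
       (simp_all add: s)
  moreover have "rep (Lf 0) [(Lf 0, m\<^sup>\<dagger>, Lf 5 \<star> Lf 2)] (Lf 5 \<star> Lf 2) (m\<^sup>\<dagger>)" by (rule rep_box) simp_all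
  ultimately show "m\<^sup>\<dagger> = ?L" using rep_unique by blast
qed

text \<open>The cup \<open>m\<^sup>\<dagger> \<cdot> u\<close> and the form
  \<open>u\<^sup>\<dagger> \<cdot> m\<close> make \<open>A\<close> its own dual:
  \<open>comult_cup\<close> reduces their composite to a comultiplication followed by a
  counit.\<close>

lemma cup_snake:
  "\<r> A \<cdot> (\<i> A \<otimes> (u\<^sup>\<dagger> \<cdot> m)) \<cdot> \<alpha> A A A \<cdot> ((m\<^sup>\<dagger> \<cdot> u) \<otimes> \<i> A) \<cdot> (\<l> A)\<^sup>\<dagger> = \<i> A"
proof -
  have "\<r> A \<cdot> (\<i> A \<otimes> (u\<^sup>\<dagger> \<cdot> m)) \<cdot> \<alpha> A A A \<cdot> ((m\<^sup>\<dagger> \<cdot> u) \<otimes> \<i> A) \<cdot> (\<l> A)\<^sup>\<dagger>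
    = \<r> A \<cdot> (\<i> A \<otimes> u\<^sup>\<dagger>) \<cdot> ((\<i> A \<otimes> m) \<cdot> \<alpha> A A A \<cdot> ((m\<^sup>\<dagger> \<cdot> u) \<otimes> \<i> A) \<cdot> (\<l> A)\<^sup>\<dagger>)"
    by simp
  also have "\<dots> = \<r> A \<cdot> ((\<i> A \<otimes> u\<^sup>\<dagger>) \<cdot> m\<^sup>\<dagger>)"
    unfolding comult_cup(2)[symmetric] by simp
  also have "\<dots> = \<i> A" by (simp add: cofrob_laws)
  finally show ?thesis .
qed

text \<open>Evaluated on the units and bent into an endomorphism of \<open>A\<close>, the right-hand
  double becomes the Nakayama automorphism (or its inverse) and the left-hand double becomes the
  identity. With a trivial Nakayama automorphism the form \<open>u\<^sup>\<dagger> \<cdot> m\<close>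
  is symmetric, and so is its dagger, the cup.\<close>

lemma cup_symmetric:
  assumes D: "Dbl C (A\<^sup>\<star>) A ((kappa C (A, m, u))\<^sup>\<dagger>) = Dbl C A A (m\<^sup>\<dagger>)"
  shows "\<sigma> A A \<cdot> (m\<^sup>\<dagger> \<cdot> u) = m\<^sup>\<dagger> \<cdot> u"
proof -
  interpret frobenius_labelling C "tyl [A, A\<^sup>\<star>, A, A, A, A, A\<^sup>\<star>, A, A, A, A, A\<^sup>\<star>]"
    by (rule frobenius_labelling_tyl) simp
  note s = good_def
  \<comment> \<open>The double \<open>D\<close> is fed with the unit and its conjugate, and its
    starred output is bent round to become the input of an endomorphism of \<open>A\<close>.\<close>
  let ?X = "\<lambda>D. \<l> A \<cdot> ((counit C A \<cdot> \<sigma> A (A\<^sup>\<star>)) \<otimes> \<i> A) \<cdot> (\<alpha> A (A\<^sup>\<star>) A)\<^sup>\<dagger>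
      \<cdot> (\<i> A \<otimes> (D \<cdot> ((\<r> (A\<^sup>\<star>) \<cdot> (\<i> (A\<^sup>\<star>) \<otimes> u\<^sup>\<dagger>) \<cdot> \<eta> A) \<otimes> u) \<cdot> (\<l> \<one>)\<^sup>\<dagger>)) \<cdot> (\<r> A)\<^sup>\<dagger>"
  \<comment> \<open>The Nakayama automorphism: the cup closed off by the form with its arguments
    exchanged.\<close>
  let ?D = "\<l> A \<cdot> ((u\<^sup>\<dagger> \<cdot> m \<cdot> \<sigma> A A) \<otimes> \<i> A) \<cdot> (\<alpha> A A A)\<^sup>\<dagger> \<cdot> (\<i> A \<otimes> (m\<^sup>\<dagger> \<cdot> u)) \<cdot> (\<r> A)\<^sup>\<dagger>"
  let ?a = "(Emp, \<eta> A, Lf 1 \<star> Lf 2)" and ?b = "(Emp, u, Lf 3)" and ?c = "(Lf 3, m\<^sup>\<dagger>, Lf 4 \<star> Lf 5)"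
    and ?d = "(Emp, \<eta> A, Lf 6 \<star> Lf 7)" and ?e = "(Lf 4 \<star> Lf 7, m, Lf 8)" and ?f = "(Lf 1 \<star> Lf 8, counit C A, Emp)"
    and ?g = "(Lf 6 \<star> Lf 0, counit C A, Emp)" and ?h = "(Lf 2, u\<^sup>\<dagger>, Emp)" and ?i = "(Lf 8, u\<^sup>\<dagger>, Emp)"
    and ?j = "(Lf 4 \<star> Lf 0, m, Lf 8)"
  have 1: "rep (Lf 1 \<star> Lf 3) [?c, ?d, (Lf 4 \<star> Lf 7, (m\<^sup>\<dagger>)\<^sup>\<dagger>, Lf 8), ?f] (Lf 6 \<star> Lf 5) (Dbl C A A (m\<^sup>\<dagger>))"
    by (rule rep_Dbl) simp_all
  then have 1: "rep (Lf 1 \<star> Lf 3) [?c, ?d, ?e, ?f] (Lf 6 \<star> Lf 5) (Dbl C A A (m\<^sup>\<dagger>))" by simp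
  have "rep (Lf 0) [?a, ?h, ?b, ?c, ?d, ?e, ?f, ?g] (Lf 5) (?X (Dbl C A A (m\<^sup>\<dagger>)))"
    by (rule net_fromD, (rule net_rules 1[THEN net_fromI] | (simp add: s; fail))+)
  then have "rep (Lf 0) [?b, ?c, ?d, ?e, ?i, ?g] (Lf 5) (?X (Dbl C A A (m\<^sup>\<dagger>)))"
    by (rule net_snake[where s = 1 and j = 2 and i = 8 and La = "[?b, ?c, ?d, ?e]" and Lb = "[?h, ?g]"])
       (simp_all add: s)
  then have 2: "rep (Lf 0) [?b, ?c, ?j, ?i] (Lf 5) (?X (Dbl C A A (m\<^sup>\<dagger>)))"
    by (rule net_snake[where s = 6 and j = 7 and i = 0 and La = "[?b, ?c]" and Lb = "[?e, ?i]"])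
       (simp_all add: s)
  let ?k = "(\<i> (A\<^sup>\<star>) \<otimes> m) \<cdot> \<alpha> (A\<^sup>\<star>) A A \<cdot> (\<eta> A \<otimes> \<i> A) \<cdot> (\<l> A)\<^sup>\<dagger>"
  let ?k' = "\<l> A \<cdot> (counit C A \<otimes> \<i> A) \<cdot> (\<alpha> (A\<^sup>\<star>) A A)\<^sup>\<dagger> \<cdot> (\<i> (A\<^sup>\<star>) \<otimes> m\<^sup>\<dagger>)"
  have k: "(kappa C (A, m, u))\<^sup>\<dagger> = ?k" "?k\<^sup>\<dagger> = ?k'" by (simp_all add: kappa_def)
  have k_hom: "?k \<in> hom C A (A\<^sup>\<star> \<boxtimes> A)" by (simp add: hom_iff)
  let ?l = "(Emp, \<eta> A, Lf 11 \<star> Lf 9)" and ?n = "(Lf 9 \<star> Lf 3, m, Lf 5)" and ?o = "(Lf 7, m\<^sup>\<dagger>, Lf 10 \<star> Lf 8)"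
    and ?p = "(Lf 11 \<star> Lf 10, counit C A, Emp)" and ?q = "(Lf 0, m\<^sup>\<dagger>, Lf 10 \<star> Lf 8)" and ?r = "(Lf 10 \<star> Lf 3, m, Lf 5)"
    and ?t = "(Lf 0 \<star> Lf 3, m, Lf 5)"
  have 3: "rep (Lf 1 \<star> Lf 3) [?l, ?n, ?d, ?o, ?p, ?f] (Lf 6 \<star> Lf 5) (Dbl C (A\<^sup>\<star>) A ?k)"
    unfolding Dbl_straight[OF k_hom dual_ob[OF frob_simps(1)] frob_simps(1)] k(2) middle_swap_def
    by (rule net_fromD, (rule net_rules | (simp add: s; fail))+)
  have "rep (Lf 0) [?a, ?h, ?b, ?l, ?n, ?d, ?o, ?p, ?f, ?g] (Lf 5) (?X (Dbl C (A\<^sup>\<star>) A ?k))"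
    by (rule net_fromD, (rule net_rules 3[THEN net_fromI] | (simp add: s; fail))+)
  then have "rep (Lf 0) [?b, ?l, ?n, ?d, ?o, ?i, ?p, ?g] (Lf 5) (?X (Dbl C (A\<^sup>\<star>) A ?k))"
    by (rule net_snake[where s = 1 and j = 2 and i = 8 and La = "[?b, ?l, ?n, ?d, ?o]" and Lb = "[?h, ?p, ?g]"])
       (simp_all add: s)
  then have "rep (Lf 0) [?b, ?l, ?n, ?q, ?i, ?p] (Lf 5) (?X (Dbl C (A\<^sup>\<star>) A ?k))"
    by (rule net_snake[where s = 6 and j = 7 and i = 0 and La = "[?b, ?l, ?n]" and Lb = "[?o, ?i, ?p]"])
       (simp_all add: s)
  then have "rep (Lf 0) [?q, ?i, ?b, ?r] (Lf 5) (?X (Dbl C (A\<^sup>\<star>) A ?k))"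
    by (rule net_snake[where s = 11 and j = 9 and i = 10 and La = "[?q, ?i, ?b]" and Lb = "[?n]"])
       (simp_all add: s)
  then have "rep (Lf 0) [?b, ?t] (Lf 5) (?X (Dbl C (A\<^sup>\<star>) A ?k))"
    by (rule net_step_wire[OF _ net_unit(4)[of 0 10 8], where La = "[]" and Lb = "[?b, ?r]"]) (simp_all add: s)
  then have "rep (Lf 0) [] (Lf 0) (?X (Dbl C (A\<^sup>\<star>) A ?k))"
    by (rule net_step_wire[OF _ net_unit(2)[of 0 5 3], where La = "[]" and Lb = "[]"]) (simp_all add: s)
  then have "?X (Dbl C (A\<^sup>\<star>) A ?k) = \<i> A" by (rule rep_unique[OF _ rep_idn]) simp_all
  then have X: "?X (Dbl C A A (m\<^sup>\<dagger>)) = \<i> A" using D k(1) by simp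
  have "rep (Lf 0) [?b, ?c, ?j, ?i] (Lf 5) ?D"
    by (rule net_fromD, (rule net_rules | (simp add: s; fail))+)
  then have Dl: "?D = \<i> A" using rep_unique[OF _ 2] X by simp
  let ?e' = "u\<^sup>\<dagger> \<cdot> m"
  let ?S = "\<r> A \<cdot> (\<i> A \<otimes> (u\<^sup>\<dagger> \<cdot> m)) \<cdot> \<alpha> A A A \<cdot> ((m\<^sup>\<dagger> \<cdot> u) \<otimes> \<i> A) \<cdot> (\<l> A)\<^sup>\<dagger>"
  \<comment> \<open>One network with two readings: the form after \<open>?D\<close>, and the
    exchanged form after the snake \<open>?S\<close>. As \<open>?D\<close> and \<open>?S\<close> are
    identities, the two forms agree.\<close>
  let ?L = "[?b, ?c, ?j, ?i, (Lf 5 \<star> Lf 2, m, Lf 7), (Lf 7, u\<^sup>\<dagger>, Emp)]"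
  have "rep (Lf 0 \<star> Lf 2) ?L Emp (?e' \<cdot> (?D \<otimes> \<i> A))"
    by (rule net_fromD, (rule net_rules | (simp add: s; fail))+)
  moreover have "rep (Lf 0 \<star> Lf 2) ?L Emp ((?e' \<cdot> \<sigma> A A) \<cdot> (\<i> A \<otimes> ?S))"
    by (rule net_fromD, (rule net_rules | (simp add: s; fail))+)
  ultimately have "?e' \<cdot> (?D \<otimes> \<i> A) = (?e' \<cdot> \<sigma> A A) \<cdot> (\<i> A \<otimes> ?S)"
    by (rule rep_unique) simp
  then have "?e' = ?e' \<cdot> \<sigma> A A" unfolding Dl cup_snake by simp
  then have "(?e')\<^sup>\<dagger> = (?e' \<cdot> \<sigma> A A)\<^sup>\<dagger>" by simp
  then show ?thesis by simp
qed

end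

context frobenius_labelling
begin

lemma net_cup:
  assumes "ty a = A" "ty p = A" "ty q = A" "ty r = A" "ty v = A" "distinct [a, p, q, r, v]"
  shows "eqv (Lf a) [(Lf a, m\<^sup>\<dagger>, Lf p \<star> Lf q)] (Lf p \<star> Lf q) [(Emp, u, Lf v), (Lf v, m\<^sup>\<dagger>, Lf r \<star> Lf q), (Lf a \<star> Lf r, m, Lf p)]"
    and "eqv (Lf a) [(Lf a, m\<^sup>\<dagger>, Lf p \<star> Lf q)] (Lf p \<star> Lf q) [(Emp, u, Lf v), (Lf v, m\<^sup>\<dagger>, Lf p \<star> Lf r), (Lf r \<star> Lf a, m, Lf q)]"
proof -
  have d: "distinct [v, r, q, p, a]" using assms by auto
  have 1: "rep (Lf a) [(Lf a, m\<^sup>\<dagger>, Lf p \<star> Lf q)] (Lf p \<star> Lf q) (m\<^sup>\<dagger>)"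
    by (rule rep_box) (use assms d in simp_all)
  have "rep (Lf a) [(Emp, u, Lf v), (Lf v, m\<^sup>\<dagger>, Lf r \<star> Lf q), (Lf a \<star> Lf r, m, Lf p)] (Lf p \<star> Lf q)
    ((m \<otimes> \<i> A) \<cdot> (\<alpha> A A A)\<^sup>\<dagger> \<cdot> (\<i> A \<otimes> (m\<^sup>\<dagger> \<cdot> u)) \<cdot> (\<r> A)\<^sup>\<dagger>)"
    by (rule net_fromD, (rule net_rules | (use assms d in \<open>simp add: good_def; fail\<close>))+)
  with 1 show "eqv (Lf a) [(Lf a, m\<^sup>\<dagger>, Lf p \<star> Lf q)] (Lf p \<star> Lf q) [(Emp, u, Lf v), (Lf v, m\<^sup>\<dagger>, Lf r \<star> Lf q), (Lf a \<star> Lf r, m, Lf p)]"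
    unfolding comult_cup(1)[symmetric] by (rule eqvI)
  have "rep (Lf a) [(Emp, u, Lf v), (Lf v, m\<^sup>\<dagger>, Lf p \<star> Lf r), (Lf r \<star> Lf a, m, Lf q)] (Lf p \<star> Lf q)
    ((\<i> A \<otimes> m) \<cdot> \<alpha> A A A \<cdot> ((m\<^sup>\<dagger> \<cdot> u) \<otimes> \<i> A) \<cdot> (\<l> A)\<^sup>\<dagger>)"
    by (rule net_fromD, (rule net_rules | (use assms d in \<open>simp add: good_def; fail\<close>))+)
  with 1 show "eqv (Lf a) [(Lf a, m\<^sup>\<dagger>, Lf p \<star> Lf q)] (Lf p \<star> Lf q) [(Emp, u, Lf v), (Lf v, m\<^sup>\<dagger>, Lf p \<star> Lf r), (Lf r \<star> Lf a, m, Lf q)]"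
    unfolding comult_cup(2)[symmetric] by (rule eqvI)
qed

lemma net_symmetric:
  assumes "\<sigma> A A \<cdot> (m\<^sup>\<dagger> \<cdot> u) = m\<^sup>\<dagger> \<cdot> u" "ty p = A" "ty q = A" "ty v = A" "distinct [p, q, v]"
  shows "eqv Emp [(Emp, u, Lf v), (Lf v, m\<^sup>\<dagger>, Lf p \<star> Lf q)] (Lf q \<star> Lf p) [(Emp, u, Lf v), (Lf v, m\<^sup>\<dagger>, Lf q \<star> Lf p)]"
proof -
  have d: "distinct [v, q, p]" using assms by auto
  have "rep Emp [(Emp, u, Lf v), (Lf v, m\<^sup>\<dagger>, Lf p \<star> Lf q)] (Lf q \<star> Lf p) (\<sigma> A A \<cdot> (m\<^sup>\<dagger> \<cdot> u))"
    by (rule net_fromD, (rule net_rules | (use assms(2-) d in \<open>simp add: good_def; fail\<close>))+)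
  moreover have "rep Emp [(Emp, u, Lf v), (Lf v, m\<^sup>\<dagger>, Lf q \<star> Lf p)] (Lf q \<star> Lf p) (m\<^sup>\<dagger> \<cdot> u)"
    by (rule net_fromD, (rule net_rules | (use assms(2-) d in \<open>simp add: good_def; fail\<close>))+)
  ultimately show ?thesis unfolding assms(1) by (rule eqvI)
qed

end

context frobenius_structure
begin

lemma kappa_simps [simp]:
  "kappa C (A, m, u) \<in> Arr C" "Dom C (kappa C (A, m, u)) = A\<^sup>\<star> \<boxtimes> A" "Cod C (kappa C (A, m, u)) = A"
  by (simp_all add: kappa_def)

text \<open>Symmetry is used twice. Each time a comultiplication is expanded into the cup and a
  multiplication, the cup is turned around, and it is folded with another multiplication into a new
  comultiplication. Associativity prepares the first folding.\<close>

lemma kappa_dag_kappa: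
  assumes sym: "\<sigma> A A \<cdot> (m\<^sup>\<dagger> \<cdot> u) = m\<^sup>\<dagger> \<cdot> u"
  shows "(kappa C (A, m, u))\<^sup>\<dagger> \<cdot> kappa C (A, m, u) = Dbl C A A (m\<^sup>\<dagger>)" (is "?k = _")
proof -
  interpret frobenius_labelling C "tyl [A\<^sup>\<star>, A, A, A, A\<^sup>\<star>, A, A, A, A, A, A, A]"
    by (rule frobenius_labelling_tyl) simp
  note s = good_def
  let ?T = "Lf 0 \<star> Lf 1" and ?U = "Lf 4 \<star> Lf 6"
  let ?h = "(Emp, \<eta> A, Lf 4 \<star> Lf 5)" and ?e = "(Lf 0 \<star> Lf 2, counit C A, Emp)" and ?u = "(Emp, u, Lf 8)"
  have "rep ?T ([(Lf 1, m\<^sup>\<dagger>, Lf 2 \<star> Lf 3), ?e] @ [?h, (Lf 5 \<star> Lf 3, m, Lf 6)]) ?U ?k"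
    by (rule rep_comp[OF rep_kappa rep_kappa_dag]) simp_all
  then have "rep ?T [?u, (Lf 8, m\<^sup>\<dagger>, Lf 2 \<star> Lf 9), (Lf 9 \<star> Lf 1, m, Lf 3), ?h, (Lf 5 \<star> Lf 3, m, Lf 6), ?e] ?U ?k"
    by (rule net_step[OF _ net_cup(2)[of 1 2 3 9 8], where La = "[]" and Lb = "[?h, (Lf 5 \<star> Lf 3, m, Lf 6), ?e]"])
       (simp_all add: s)
  then have "rep ?T [?u, (Lf 8, m\<^sup>\<dagger>, Lf 2 \<star> Lf 9), ?h, (Lf 5 \<star> Lf 9, m, Lf 10), (Lf 10 \<star> Lf 1, m, Lf 6), ?e] ?U ?k"
    by (rule net_step[OF _ net_assoc[of 5 9 1 10 6 3, THEN eqv_sym],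
        where La = "[?u, (Lf 8, m\<^sup>\<dagger>, Lf 2 \<star> Lf 9), ?h]" and Lb = "[?e]"]) (simp_all add: s)
  then have "rep ?T [?u, (Lf 8, m\<^sup>\<dagger>, Lf 9 \<star> Lf 2), ?h, (Lf 5 \<star> Lf 9, m, Lf 10), (Lf 10 \<star> Lf 1, m, Lf 6), ?e] ?U ?k"
    by (rule net_step[OF _ net_symmetric[OF sym, of 2 9 8],
        where La = "[]" and Lb = "[?h, (Lf 5 \<star> Lf 9, m, Lf 10), (Lf 10 \<star> Lf 1, m, Lf 6), ?e]"]) (simp_all add: s)
  then have "rep ?T [?h, (Lf 5, m\<^sup>\<dagger>, Lf 10 \<star> Lf 2), (Lf 10 \<star> Lf 1, m, Lf 6), ?e] ?U ?k"
    by (rule net_step[OF _ net_cup(1)[of 5 10 2 9 8, THEN eqv_sym],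
        where La = "[?h]" and Lb = "[(Lf 10 \<star> Lf 1, m, Lf 6), ?e]"]) (simp_all add: s)
  then have "rep ?T [?h, ?u, (Lf 8, m\<^sup>\<dagger>, Lf 10 \<star> Lf 11), (Lf 11 \<star> Lf 5, m, Lf 2), (Lf 10 \<star> Lf 1, m, Lf 6), ?e] ?U ?k"
    by (rule net_step[OF _ net_cup(2)[of 5 10 2 11 8],
        where La = "[?h]" and Lb = "[(Lf 10 \<star> Lf 1, m, Lf 6), ?e]"]) (simp_all add: s)
  then have "rep ?T [?h, ?u, (Lf 8, m\<^sup>\<dagger>, Lf 11 \<star> Lf 10), (Lf 11 \<star> Lf 5, m, Lf 2), (Lf 10 \<star> Lf 1, m, Lf 6), ?e] ?U ?k"
    by (rule net_step[OF _ net_symmetric[OF sym, of 10 11 8],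
        where La = "[?h]" and Lb = "[(Lf 11 \<star> Lf 5, m, Lf 2), (Lf 10 \<star> Lf 1, m, Lf 6), ?e]"]) (simp_all add: s)
  then have "rep ?T [(Lf 1, m\<^sup>\<dagger>, Lf 11 \<star> Lf 6), ?h, (Lf 11 \<star> Lf 5, m, Lf 2), ?e] ?U ?k"
    by (rule net_step[OF _ net_cup(2)[of 1 11 6 10 8, THEN eqv_sym],
        where La = "[?h]" and Lb = "[(Lf 11 \<star> Lf 5, m, Lf 2), ?e]"]) (simp_all add: s)
  moreover have "rep ?T [(Lf 1, m\<^sup>\<dagger>, Lf 11 \<star> Lf 6), ?h, (Lf 11 \<star> Lf 5, (m\<^sup>\<dagger>)\<^sup>\<dagger>, Lf 2), ?e] ?U (Dbl C A A (m\<^sup>\<dagger>))"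
    by (rule rep_Dbl) simp_all
  ultimately show ?thesis using rep_unique by simp
qed

text \<open>The conjugate of the unit, inserted at the starred input, is yanked into a counit on a
  leg of the comultiplication. Thus \<open>kappa\<close> is a split epimorphism.\<close>

lemma kappa_split:
  "kappa C (A, m, u) \<cdot> (((\<r> (A\<^sup>\<star>) \<cdot> (\<i> (A\<^sup>\<star>) \<otimes> u\<^sup>\<dagger>) \<cdot> \<eta> A) \<otimes> \<i> A) \<cdot> (\<l> A)\<^sup>\<dagger>) = \<i> A" (is "?k = _")
proof -
  interpret frobenius_labelling C "tyl [A, A\<^sup>\<star>, A, A, A]"
    by (rule frobenius_labelling_tyl) simp
  note s = good_def
  let ?m = "(Lf 0, m\<^sup>\<dagger>, Lf 3 \<star> Lf 4)"
  have "rep (Lf 0) [(Emp, \<eta> A, Lf 1 \<star> Lf 2), (Lf 2, u\<^sup>\<dagger>, Emp), ?m, (Lf 1 \<star> Lf 3, counit C A, Emp)] (Lf 4) ?k"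
    unfolding kappa_def split_conv by (rule net_fromD, (rule net_rules | (simp add: s; fail))+)
  then have "rep (Lf 0) [?m, (Lf 3, u\<^sup>\<dagger>, Emp)] (Lf 4) ?k"
    by (rule net_snake[where s = 1 and j = 2 and i = 3 and La = "[?m]" and Lb = "[(Lf 2, u\<^sup>\<dagger>, Emp)]"]) (simp_all add: s)
  then have "rep (Lf 0) [] (Lf 0) ?k"
    by (rule net_step_wire[OF _ net_unit(3)[of 0 4 3], where La = "[]" and Lb = "[]"]) (simp_all add: s)
  then show ?thesis by (rule rep_unique[OF _ rep_idn]) simp_all
qed

text \<open>With \<open>e\<close> a section of \<open>kappa\<close>, the equation for the idempotent
  \<open>kappa\<^sup>\<dagger> \<cdot> kappa\<close> can be stripped of its outer factors by
  composing with \<open>e\<^sup>\<dagger>\<close> on the left and \<open>e\<close> on the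
  right.\<close>

lemma kappa_kappa_dag_idn:
  assumes sym: "\<sigma> A A \<cdot> (m\<^sup>\<dagger> \<cdot> u) = m\<^sup>\<dagger> \<cdot> u"
    and idem: "Dbl C A A (m\<^sup>\<dagger>) \<cdot> Dbl C A A (m\<^sup>\<dagger>) = Dbl C A A (m\<^sup>\<dagger>)"
  shows "kappa C (A, m, u) \<cdot> (kappa C (A, m, u))\<^sup>\<dagger> = \<i> A"
proof -
  let ?k = "kappa C (A, m, u)"
  define e where "e = ((\<r> (A\<^sup>\<star>) \<cdot> (\<i> (A\<^sup>\<star>) \<otimes> u\<^sup>\<dagger>) \<cdot> \<eta> A) \<otimes> \<i> A) \<cdot> (\<l> A)\<^sup>\<dagger>"
  have e: "e \<in> Arr C" "Dom C e = A" "Cod C e = A\<^sup>\<star> \<boxtimes> A" by (simp_all add: e_def)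
  have ke: "?k \<cdot> e = \<i> A" unfolding e_def by (rule kappa_split)
  have ek: "e\<^sup>\<dagger> \<cdot> ?k\<^sup>\<dagger> = \<i> A" using arg_cong[OF ke, of "Dag C"] e by simp
  have "(?k\<^sup>\<dagger> \<cdot> ?k) \<cdot> (?k\<^sup>\<dagger> \<cdot> ?k) = ?k\<^sup>\<dagger> \<cdot> ?k" using idem kappa_dag_kappa[OF sym] by simp
  then have "e\<^sup>\<dagger> \<cdot> ((?k\<^sup>\<dagger> \<cdot> ?k) \<cdot> (?k\<^sup>\<dagger> \<cdot> ?k)) \<cdot> e = e\<^sup>\<dagger> \<cdot> (?k\<^sup>\<dagger> \<cdot> ?k) \<cdot> e" by simp
  then have "(e\<^sup>\<dagger> \<cdot> ?k\<^sup>\<dagger>) \<cdot> (?k \<cdot> ?k\<^sup>\<dagger>) \<cdot> (?k \<cdot> e) = (e\<^sup>\<dagger> \<cdot> ?k\<^sup>\<dagger>) \<cdot> (?k \<cdot> e)" using e by simp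
  then show ?thesis unfolding ke ek by simp
qed

text \<open>For a unitary that respects multiplications, \<open>g\<^sup>\<dagger>\<close> cancels
  one copy of \<open>g\<close> in \<open>core\<close>; the other copy leaves the trace, and what
  remains is \<open>kappa \<cdot> kappa\<^sup>\<dagger>\<close>. This is how coherence isomorphisms
  become arrows of \<open>CPstar\<close>.\<close>

lemma iso_CPstar:
  assumes n: "n \<in> hom C (B \<boxtimes> B) B" and g: "g \<in> hom C A B" "unitary C g" "g \<cdot> m = n \<cdot> (g \<otimes> g)"
    and k: "kappa C (A, m, u) \<cdot> (kappa C (A, m, u))\<^sup>\<dagger> = \<i> A"
  shows "kappa C (B, n, v) \<cdot> Dbl C \<one> B ((\<l> B)\<^sup>\<dagger> \<cdot> g) \<cdot> (kappa C (A, m, u))\<^sup>\<dagger> = g"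
proof -
  have B: "B \<in> Ob C" using g by (auto simp: hom_iff)
  note n_hom = n and g_hom = g(1)
  have m_hom: "m \<in> hom C (A \<boxtimes> A) A" by (simp add: hom_iff)
  have g': "g \<in> Arr C" "Dom C g = A" "Cod C g = B" and n: "n \<in> Arr C" "Dom C n = B \<boxtimes> B" "Cod C n = B"
    using g n by (auto simp: hom_iff)
  note gu = unitary_simps[OF g(2) g'(2,3)]
  interpret frobenius_labelling C "tyl [A, A, A, B, B, B, A]"
    by (rule frobenius_labelling_tyl) (use B in simp)
  note s = good_def B g' n
  have lg: "(\<l> B)\<^sup>\<dagger> \<cdot> g \<in> hom C A (\<one> \<boxtimes> B)" "((\<l> B)\<^sup>\<dagger> \<cdot> g)\<^sup>\<dagger> = g\<^sup>\<dagger> \<cdot> \<l> B" using s by (simp_all add: hom_iff)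
  let ?L = "[(Lf 0 \<star> Lf 1, m, Lf 2), (Lf 2, g, Lf 3), (Lf 3, n\<^sup>\<dagger>, Lf 4 \<star> Lf 5), (Lf 4, g\<^sup>\<dagger>, Lf 6)]"
  have "rep (Lf 0 \<star> Lf 1) ?L (Lf 6 \<star> Lf 5) (core \<one> B ((\<l> B)\<^sup>\<dagger> \<cdot> g) m n)"
    unfolding core_def lg(2) by (rule net_fromD, (rule net_rules | (simp add: s; fail))+)
  moreover have "rep (Lf 0 \<star> Lf 1) ?L (Lf 6 \<star> Lf 5) ((g\<^sup>\<dagger> \<otimes> \<i> B) \<cdot> (n\<^sup>\<dagger> \<cdot> g) \<cdot> m)"
    by (rule net_fromD, (rule net_rules | (simp add: s; fail))+)
  ultimately have 1: "core \<one> B ((\<l> B)\<^sup>\<dagger> \<cdot> g) m n = (g\<^sup>\<dagger> \<otimes> \<i> B) \<cdot> (n\<^sup>\<dagger> \<cdot> g) \<cdot> m"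
    by (rule rep_unique) simp
  have "g\<^sup>\<dagger> \<cdot> (g \<cdot> m) \<cdot> (g\<^sup>\<dagger> \<otimes> g\<^sup>\<dagger>) = g\<^sup>\<dagger> \<cdot> (n \<cdot> (g \<otimes> g)) \<cdot> (g\<^sup>\<dagger> \<otimes> g\<^sup>\<dagger>)" unfolding g(3) ..
  then have "m \<cdot> (g\<^sup>\<dagger> \<otimes> g\<^sup>\<dagger>) = g\<^sup>\<dagger> \<cdot> n" using s gu by simp
  \<comment> \<open>Unitarity has moved \<open>g\<close> to the other side of the multiplicativity
    equation; the dagger makes it comultiplicativity.\<close>
  from arg_cong[OF this, of "Dag C"] have 2: "n\<^sup>\<dagger> \<cdot> g = (g \<otimes> g) \<cdot> m\<^sup>\<dagger>" using s by simp
  have "core \<one> B ((\<l> B)\<^sup>\<dagger> \<cdot> g) m n = (\<i> A \<otimes> g) \<cdot> (m\<^sup>\<dagger> \<cdot> m)"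
    unfolding 1 2 using s gu by simp
  then have "kappa C (B, n, v) \<cdot> Dbl C \<one> B ((\<l> B)\<^sup>\<dagger> \<cdot> g) \<cdot> (kappa C (A, m, u))\<^sup>\<dagger>
      = trc A B ((\<i> A \<otimes> g) \<cdot> (m\<^sup>\<dagger> \<cdot> m))"
    using kappa_Dbl_kappa[OF lg(1) m_hom n_hom] B by simp
  also have "\<dots> = g \<cdot> (kappa C (A, m, u) \<cdot> (kappa C (A, m, u))\<^sup>\<dagger>)"
    using trc_comp[of "m\<^sup>\<dagger> \<cdot> m" A A g B] kappa_kappa_dag[OF m_hom] g_hom B by (simp add: hom_iff)
  also have "\<dots> = g" unfolding k using s by simp
  finally show ?thesis .
qed

end

section \<open>Tensor products and conjugates of Frobenius structures\<close>

context symmetric_monoidal_dagger_category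
begin

lemma middle_swap_simps [simp]:
  assumes "A \<in> Ob C" "B \<in> Ob C" "D \<in> Ob C" "E \<in> Ob C"
  shows "middle_swap C A B D E \<in> Arr C" "Dom C (middle_swap C A B D E) = (A \<boxtimes> B) \<boxtimes> (D \<boxtimes> E)"
    "Cod C (middle_swap C A B D E) = (A \<boxtimes> D) \<boxtimes> (B \<boxtimes> E)"
    "(middle_swap C A B D E)\<^sup>\<dagger> = middle_swap C A D B E"
  using assms by (simp_all add: middle_swap_def)

lemma frob_unit_frobenius: "special_dagger_frobenius C (frob_unit C)"
proof -
  interpret labelling C "tyl []" by unfold_locales (simp add: tyl_def)
  let ?I = "\<one>"
  have 1: "rep ((Emp \<star> Emp) \<star> Emp) [] Emp (\<l> ?I \<cdot> (\<l> ?I \<otimes> \<i> ?I))"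
    "rep ((Emp \<star> Emp) \<star> Emp) [] Emp (\<l> ?I \<cdot> (\<i> ?I \<otimes> \<l> ?I) \<cdot> \<alpha> ?I ?I ?I)"
    "rep (Emp \<star> Emp) [] (Emp \<star> Emp) ((\<l> ?I \<otimes> \<i> ?I) \<cdot> (\<alpha> ?I ?I ?I)\<^sup>\<dagger> \<cdot> (\<i> ?I \<otimes> (\<l> ?I)\<^sup>\<dagger>))"
    "rep (Emp \<star> Emp) [] (Emp \<star> Emp) ((\<i> ?I \<otimes> \<l> ?I) \<cdot> \<alpha> ?I ?I ?I \<cdot> ((\<l> ?I)\<^sup>\<dagger> \<otimes> \<i> ?I))"
    by (rule rep_perm, (rule rep_comp rep_ten rep_coherence | (simp; fail))+)+
  have "\<l> ?I \<cdot> (\<l> ?I \<otimes> \<i> ?I) = \<l> ?I \<cdot> (\<i> ?I \<otimes> \<l> ?I) \<cdot> \<alpha> ?I ?I ?I"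
    by (rule rep_unique[OF 1(1,2)]) simp
  moreover have "(\<l> ?I \<otimes> \<i> ?I) \<cdot> (\<alpha> ?I ?I ?I)\<^sup>\<dagger> \<cdot> (\<i> ?I \<otimes> (\<l> ?I)\<^sup>\<dagger>)
      = (\<i> ?I \<otimes> \<l> ?I) \<cdot> \<alpha> ?I ?I ?I \<cdot> ((\<l> ?I)\<^sup>\<dagger> \<otimes> \<i> ?I)"
    by (rule rep_unique[OF 1(3,4)]) simp
  ultimately show ?thesis
    unfolding special_dagger_frobenius_def frob_unit_def split_conv
    by (intro conjI) (simp_all add: hom_iff lunit_unit[symmetric] del: assoc_comp interchange interchange_assoc)
qed

end

context compact_dagger_category
begin

lemma counit_ten:
  assumes "A \<in> Ob C" "B \<in> Ob C"
  shows "counit C (A \<boxtimes> B) = counit C B \<cdot> (\<i> (B\<^sup>\<star>) \<otimes> \<l> B) \<cdot> (\<i> (B\<^sup>\<star>) \<otimes> (counit C A \<otimes> \<i> B))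
    \<cdot> (\<i> (B\<^sup>\<star>) \<otimes> (\<alpha> (A\<^sup>\<star>) A B)\<^sup>\<dagger>) \<cdot> \<alpha> (B\<^sup>\<star>) (A\<^sup>\<star>) (A \<boxtimes> B)"
  using assms by (simp add: counit_def[of C "A \<boxtimes> B"] eta_ten)

text \<open>By \<open>eta_ten\<close> and \<open>counit_ten\<close> the loop for
  \<open>A \<boxtimes> A'\<close> consists of one loop for each factor; the middle swaps only
  collect the wires of each.\<close>

lemma trc_ten:
  assumes K: "K \<in> hom C (A \<boxtimes> A) (A \<boxtimes> B)" and K': "K' \<in> hom C (A' \<boxtimes> A') (A' \<boxtimes> B')"
    and ob: "A \<in> Ob C" "B \<in> Ob C" "A' \<in> Ob C" "B' \<in> Ob C"
  shows "trc A B K \<otimes> trc A' B' K'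
    = trc (A \<boxtimes> A') (B \<boxtimes> B') (middle_swap C A B A' B' \<cdot> (K \<otimes> K') \<cdot> middle_swap C A A' A A')"
proof -
  have K: "K \<in> Arr C" "Dom C K = A \<boxtimes> A" "Cod C K = A \<boxtimes> B"
    and K': "K' \<in> Arr C" "Dom C K' = A' \<boxtimes> A'" "Cod C K' = A' \<boxtimes> B'"
    using K K' by (auto simp: hom_iff)
  interpret compact_labelling C "tyl [A, A', A\<^sup>\<star>, A, A, B, A'\<^sup>\<star>, A', A', B']"
    by (rule compact_labelling_tyl) (use ob dual_ob in auto)
  note s = ob K K' good_def
  let ?L = "[(Emp, \<eta> A, Lf 2 \<star> Lf 3), (Lf 3 \<star> Lf 0, K, Lf 4 \<star> Lf 5), (Lf 2 \<star> Lf 4, counit C A, Emp),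
    (Emp, \<eta> A', Lf 6 \<star> Lf 7), (Lf 7 \<star> Lf 1, K', Lf 8 \<star> Lf 9), (Lf 6 \<star> Lf 8, counit C A', Emp)]"
  have "rep (Lf 0 \<star> Lf 1) ?L (Lf 5 \<star> Lf 9) (trc A B K \<otimes> trc A' B' K')"
    unfolding trc_def by (rule net_fromD, (rule net_rules | (simp add: s; fail))+)
  moreover have "rep (Lf 0 \<star> Lf 1) ?L (Lf 5 \<star> Lf 9)
      (trc (A \<boxtimes> A') (B \<boxtimes> B') (middle_swap C A B A' B' \<cdot> (K \<otimes> K') \<cdot> middle_swap C A A' A A'))"
    unfolding trc_def eta_ten[OF ob(1,3)] counit_ten[OF ob(1,3)] dual_ten[OF ob(1,3)]
    by (rule net_fromD, (rule net_rules | (simp add: s; fail))+)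
  ultimately show ?thesis by (rule rep_unique) simp
qed

lemma core_hom:
  "\<lbrakk>f \<in> hom C A (X \<boxtimes> B); m \<in> hom C (A \<boxtimes> A) A; n \<in> hom C (B \<boxtimes> B) B; X \<in> Ob C; B \<in> Ob C\<rbrakk>
    \<Longrightarrow> core X B f m n \<in> hom C (A \<boxtimes> A) (A \<boxtimes> B)"
  by (simp add: hom_iff core_def)

text \<open>Tensor products are compared on the trace form and not on \<open>Dbl\<close>, where the
  reversed factors of \<open>(A \<boxtimes> A')\<^sup>\<star>\<close> would have to be permuted.
  Both sides are a disjoint union of one network per factor.\<close>

lemma core_ten:
  assumes f: "f \<in> hom C A (X \<boxtimes> B)" and g: "g \<in> hom C A' (Y \<boxtimes> B')"
    and m: "m \<in> hom C (A \<boxtimes> A) A" "m' \<in> hom C (A' \<boxtimes> A') A'"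
    and n: "n \<in> hom C (B \<boxtimes> B) B" "n' \<in> hom C (B' \<boxtimes> B') B'"
    and ob: "A \<in> Ob C" "B \<in> Ob C" "X \<in> Ob C" "A' \<in> Ob C" "B' \<in> Ob C" "Y \<in> Ob C"
  shows "core (X \<boxtimes> Y) (B \<boxtimes> B') (middle_swap C X B Y B' \<cdot> (f \<otimes> g))
      ((m \<otimes> m') \<cdot> middle_swap C A A' A A') ((n \<otimes> n') \<cdot> middle_swap C B B' B B')
    = middle_swap C A B A' B' \<cdot> (core X B f m n \<otimes> core Y B' g m' n') \<cdot> middle_swap C A A' A A'"
    (is "core _ _ ?F ?M ?N = _")
proof -
  have f: "f \<in> Arr C" "Dom C f = A" "Cod C f = X \<boxtimes> B" and g: "g \<in> Arr C" "Dom C g = A'" "Cod C g = Y \<boxtimes> B'"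
    and m: "m \<in> Arr C" "Dom C m = A \<boxtimes> A" "Cod C m = A" and m': "m' \<in> Arr C" "Dom C m' = A' \<boxtimes> A'" "Cod C m' = A'"
    and n: "n \<in> Arr C" "Dom C n = B \<boxtimes> B" "Cod C n = B" and n': "n' \<in> Arr C" "Dom C n' = B' \<boxtimes> B'" "Cod C n' = B'"
    using f g m n by (auto simp: hom_iff)
  interpret compact_labelling C "tyl [A, A', A, A', A, X, B, B, B, A, A', Y, B', B', B', A']"
    by (rule compact_labelling_tyl) (use ob in auto)
  note s = ob f g m m' n n' good_def
  have F: "?F\<^sup>\<dagger> = (f\<^sup>\<dagger> \<otimes> g\<^sup>\<dagger>) \<cdot> middle_swap C X Y B B'" "?N\<^sup>\<dagger> = middle_swap C B B B' B' \<cdot> (n\<^sup>\<dagger> \<otimes> n'\<^sup>\<dagger>)"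
    using s by simp_all
  let ?L = "[(Lf 0 \<star> Lf 2, m, Lf 4), (Lf 4, f, Lf 5 \<star> Lf 6), (Lf 6, n\<^sup>\<dagger>, Lf 7 \<star> Lf 8), (Lf 5 \<star> Lf 7, f\<^sup>\<dagger>, Lf 9),
    (Lf 1 \<star> Lf 3, m', Lf 10), (Lf 10, g, Lf 11 \<star> Lf 12), (Lf 12, n'\<^sup>\<dagger>, Lf 13 \<star> Lf 14), (Lf 11 \<star> Lf 13, g\<^sup>\<dagger>, Lf 15)]"
  have "rep ((Lf 0 \<star> Lf 1) \<star> (Lf 2 \<star> Lf 3)) ?L ((Lf 9 \<star> Lf 15) \<star> (Lf 8 \<star> Lf 14)) (core (X \<boxtimes> Y) (B \<boxtimes> B') ?F ?M ?N)"
    unfolding core_def F by (rule net_fromD, (rule net_rules | (simp add: s; fail))+)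
  moreover have "rep ((Lf 0 \<star> Lf 1) \<star> (Lf 2 \<star> Lf 3)) ?L ((Lf 9 \<star> Lf 15) \<star> (Lf 8 \<star> Lf 14))
    (middle_swap C A B A' B' \<cdot> (core X B f m n \<otimes> core Y B' g m' n') \<cdot> middle_swap C A A' A A')"
    unfolding core_def by (rule net_fromD, (rule net_rules | (simp add: s; fail))+)
  ultimately show ?thesis by (rule rep_unique) simp
qed

end

context frobenius_labelling
begin

lemma net_special:
  assumes "ty a = A" "ty b = A" "ty p = A" "ty q = A" "distinct [a, b, p, q]"
  shows "eqv (Lf a) [(Lf a, m\<^sup>\<dagger>, Lf p \<star> Lf q), (Lf p \<star> Lf q, m, Lf b)] (Lf b) [(Lf a, \<i> (ty a), Lf b)]"
proof -
  have d: "distinct [q, p, b, a]" using assms by auto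
  have "rep (Lf a) [(Lf a, m\<^sup>\<dagger>, Lf p \<star> Lf q), (Lf p \<star> Lf q, m, Lf b)] (Lf b) (m \<cdot> m\<^sup>\<dagger>)"
    by (rule net_fromD, (rule net_rules | (use assms d in \<open>simp add: good_def; fail\<close>))+)
  then show ?thesis using assms by (intro eqv_wire) (simp_all add: frob_laws)
qed

end

locale frobenius_pair =
  X: frobenius_structure C A m u + Y: frobenius_structure C B n v
  for C (structure) and A m u B n v
begin

abbreviation mult :: 'b where "mult \<equiv> (m \<otimes> n) \<cdot> middle_swap C A B A B"
abbreviation unit :: 'b where "unit \<equiv> (u \<otimes> v) \<cdot> (\<l> \<one>)\<^sup>\<dagger>"

lemma frobenius_tensor: "special_dagger_frobenius C (A \<boxtimes> B, mult, unit)"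
proof -
  \<comment> \<open>Even labels carry \<open>A\<close>, odd labels \<open>B\<close>. Both structures
    are interpreted over this one labelling, so that their laws act on the same networks.\<close>
  let ?ty = "X.tyl [A, B, A, B, A, B, A, B, A, B, A, B]"
  interpret X: frobenius_labelling C ?ty A m u by (rule X.frobenius_labelling_tyl) simp
  interpret Y: frobenius_labelling C ?ty B n v by (rule Y.frobenius_labelling_tyl) simp
  note s = X.good_def
  have M: "mult\<^sup>\<dagger> = middle_swap C A A B B \<cdot> (m\<^sup>\<dagger> \<otimes> n\<^sup>\<dagger>)" by simp
  let ?I = "\<i> (A \<boxtimes> B)" and ?\<alpha> = "\<alpha> (A \<boxtimes> B) (A \<boxtimes> B) (A \<boxtimes> B)"
  let ?T = "((Lf 0 \<star> Lf 1) \<star> (Lf 2 \<star> Lf 3)) \<star> (Lf 4 \<star> Lf 5)" and ?U = "Lf 8 \<star> Lf 9"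
  have "X.rep ?T [(Lf 0 \<star> Lf 2, m, Lf 6), (Lf 6 \<star> Lf 4, m, Lf 8), (Lf 1 \<star> Lf 3, n, Lf 7), (Lf 7 \<star> Lf 5, n, Lf 9)] ?U
    (mult \<cdot> (mult \<otimes> ?I))"
    by (rule X.net_fromD, (rule X.net_rules | (simp add: s; fail))+)
  then have "X.rep ?T [(Lf 2 \<star> Lf 4, m, Lf 10), (Lf 0 \<star> Lf 10, m, Lf 8), (Lf 1 \<star> Lf 3, n, Lf 7), (Lf 7 \<star> Lf 5, n, Lf 9)] ?U
    (mult \<cdot> (mult \<otimes> ?I))"
    by (rule X.net_step[OF _ X.net_assoc[of 0 2 4 6 8 10], where La = "[]"
      and Lb = "[(Lf 1 \<star> Lf 3, n, Lf 7), (Lf 7 \<star> Lf 5, n, Lf 9)]"]) (simp_all add: s)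
  then have 1: "X.rep ?T [(Lf 2 \<star> Lf 4, m, Lf 10), (Lf 0 \<star> Lf 10, m, Lf 8), (Lf 3 \<star> Lf 5, n, Lf 11), (Lf 1 \<star> Lf 11, n, Lf 9)] ?U
    (mult \<cdot> (mult \<otimes> ?I))"
    by (rule X.net_step[OF _ Y.net_assoc[of 1 3 5 7 9 11], where Lb = "[]"
      and La = "[(Lf 2 \<star> Lf 4, m, Lf 10), (Lf 0 \<star> Lf 10, m, Lf 8)]"]) (simp_all add: s)
  have "X.rep ?T [(Lf 2 \<star> Lf 4, m, Lf 10), (Lf 0 \<star> Lf 10, m, Lf 8), (Lf 3 \<star> Lf 5, n, Lf 11), (Lf 1 \<star> Lf 11, n, Lf 9)] ?U
    (mult \<cdot> (?I \<otimes> mult) \<cdot> ?\<alpha>)"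
    by (rule X.net_fromD, (rule X.net_rules | (simp add: s; fail))+)
  from X.rep_unique[OF 1 this] have assoc: "mult \<cdot> (mult \<otimes> ?I) = mult \<cdot> (?I \<otimes> mult) \<cdot> ?\<alpha>" by simp

  let ?T = "Emp \<star> (Lf 0 \<star> Lf 1)"
  have "X.rep ?T [(Emp, u, Lf 2), (Lf 2 \<star> Lf 0, m, Lf 4), (Emp, v, Lf 3), (Lf 3 \<star> Lf 1, n, Lf 5)] (Lf 4 \<star> Lf 5)
    (mult \<cdot> (unit \<otimes> ?I))"
    by (rule X.net_fromD, (rule X.net_rules | (simp add: s; fail))+)
  then have "X.rep ?T [(Emp, v, Lf 3), (Lf 3 \<star> Lf 1, n, Lf 5)] (Lf 0 \<star> Lf 5) (mult \<cdot> (unit \<otimes> ?I))"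
    by (rule X.net_step_wire[OF _ X.net_unit(1)[of 0 4 2], where La = "[]"
      and Lb = "[(Emp, v, Lf 3), (Lf 3 \<star> Lf 1, n, Lf 5)]"]) (simp_all add: s)
  then have 1: "X.rep ?T [] (Lf 0 \<star> Lf 1) (mult \<cdot> (unit \<otimes> ?I))"
    by (rule X.net_step_wire[OF _ Y.net_unit(1)[of 1 5 3], where La = "[]" and Lb = "[]"]) (simp_all add: s)
  have unitl: "mult \<cdot> (unit \<otimes> ?I) = \<l> (A \<boxtimes> B)"
    by (rule X.rep_unique[OF 1 X.rep_lunit]) simp_all
  let ?T = "(Lf 0 \<star> Lf 1) \<star> Emp"
  have "X.rep ?T [(Emp, u, Lf 2), (Lf 0 \<star> Lf 2, m, Lf 4), (Emp, v, Lf 3), (Lf 1 \<star> Lf 3, n, Lf 5)] (Lf 4 \<star> Lf 5)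
    (mult \<cdot> (?I \<otimes> unit))"
    by (rule X.net_fromD, (rule X.net_rules | (simp add: s; fail))+)
  then have "X.rep ?T [(Emp, v, Lf 3), (Lf 1 \<star> Lf 3, n, Lf 5)] (Lf 0 \<star> Lf 5) (mult \<cdot> (?I \<otimes> unit))"
    by (rule X.net_step_wire[OF _ X.net_unit(2)[of 0 4 2], where La = "[]"
      and Lb = "[(Emp, v, Lf 3), (Lf 1 \<star> Lf 3, n, Lf 5)]"]) (simp_all add: s)
  then have 1: "X.rep ?T [] (Lf 0 \<star> Lf 1) (mult \<cdot> (?I \<otimes> unit))"
    by (rule X.net_step_wire[OF _ Y.net_unit(2)[of 1 5 3], where La = "[]" and Lb = "[]"]) (simp_all add: s)
  have unitr: "mult \<cdot> (?I \<otimes> unit) = \<r> (A \<boxtimes> B)"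
    by (rule X.rep_unique[OF 1 X.rep_runit]) simp_all

  let ?L = "[(Lf 0, m\<^sup>\<dagger>, Lf 2 \<star> Lf 4), (Lf 2 \<star> Lf 4, m, Lf 6), (Lf 1, n\<^sup>\<dagger>, Lf 3 \<star> Lf 5), (Lf 3 \<star> Lf 5, n, Lf 7)]"
  have "X.rep (Lf 0 \<star> Lf 1) ?L (Lf 6 \<star> Lf 7) (mult \<cdot> mult\<^sup>\<dagger>)"
    unfolding M by (rule X.net_fromD, (rule X.net_rules | (simp add: s; fail))+)
  moreover have "X.rep (Lf 0 \<star> Lf 1) ?L (Lf 6 \<star> Lf 7) ((m \<cdot> m\<^sup>\<dagger>) \<otimes> (n \<cdot> n\<^sup>\<dagger>))"
    by (rule X.net_fromD, (rule X.net_rules | (simp add: s; fail))+)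
  ultimately have "mult \<cdot> mult\<^sup>\<dagger> = (m \<cdot> m\<^sup>\<dagger>) \<otimes> (n \<cdot> n\<^sup>\<dagger>)" by (rule X.rep_unique) simp
  then have special: "mult \<cdot> mult\<^sup>\<dagger> = ?I" unfolding X.frob_laws Y.frob_laws by simp

  let ?T = "(Lf 0 \<star> Lf 1) \<star> (Lf 2 \<star> Lf 3)" and ?U = "(Lf 8 \<star> Lf 9) \<star> (Lf 4 \<star> Lf 7)"
  let ?F = "(mult \<otimes> ?I) \<cdot> ?\<alpha>\<^sup>\<dagger> \<cdot> (?I \<otimes> mult\<^sup>\<dagger>)"
  have "X.rep ?T [(Lf 2, m\<^sup>\<dagger>, Lf 6 \<star> Lf 4), (Lf 0 \<star> Lf 6, m, Lf 8), (Lf 3, n\<^sup>\<dagger>, Lf 5 \<star> Lf 7), (Lf 1 \<star> Lf 5, n, Lf 9)] ?U ?F"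
    unfolding M by (rule X.net_fromD, (rule X.net_rules | (simp add: s; fail))+)
  then have "X.rep ?T [(Lf 0, m\<^sup>\<dagger>, Lf 8 \<star> Lf 10), (Lf 10 \<star> Lf 2, m, Lf 4), (Lf 3, n\<^sup>\<dagger>, Lf 5 \<star> Lf 7), (Lf 1 \<star> Lf 5, n, Lf 9)] ?U ?F"
    by (rule X.net_step[OF _ X.net_frob[of 0 2 6 8 4 10], where La = "[]"
      and Lb = "[(Lf 3, n\<^sup>\<dagger>, Lf 5 \<star> Lf 7), (Lf 1 \<star> Lf 5, n, Lf 9)]"]) (simp_all add: s)
  then have 1: "X.rep ?T [(Lf 0, m\<^sup>\<dagger>, Lf 8 \<star> Lf 10), (Lf 10 \<star> Lf 2, m, Lf 4), (Lf 1, n\<^sup>\<dagger>, Lf 9 \<star> Lf 11), (Lf 11 \<star> Lf 3, n, Lf 7)] ?U ?F"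
    by (rule X.net_step[OF _ Y.net_frob[of 1 3 5 9 7 11], where Lb = "[]"
      and La = "[(Lf 0, m\<^sup>\<dagger>, Lf 8 \<star> Lf 10), (Lf 10 \<star> Lf 2, m, Lf 4)]"]) (simp_all add: s)
  have "X.rep ?T [(Lf 0, m\<^sup>\<dagger>, Lf 8 \<star> Lf 10), (Lf 10 \<star> Lf 2, m, Lf 4), (Lf 1, n\<^sup>\<dagger>, Lf 9 \<star> Lf 11), (Lf 11 \<star> Lf 3, n, Lf 7)] ?U
    ((?I \<otimes> mult) \<cdot> ?\<alpha> \<cdot> (mult\<^sup>\<dagger> \<otimes> ?I))"
    unfolding M by (rule X.net_fromD, (rule X.net_rules | (simp add: s; fail))+)
  from X.rep_unique[OF 1 this] have frob: "?F = (?I \<otimes> mult) \<cdot> ?\<alpha> \<cdot> (mult\<^sup>\<dagger> \<otimes> ?I)" by simp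
  have t: "A \<boxtimes> B \<in> Ob C" "mult \<in> hom C ((A \<boxtimes> B) \<boxtimes> (A \<boxtimes> B)) (A \<boxtimes> B)" "unit \<in> hom C \<one> (A \<boxtimes> B)"
    by (simp_all add: X.hom_iff)
  show ?thesis
    unfolding special_dagger_frobenius_def split_conv
    by (intro conjI; fact t assoc unitl unitr special frob)
qed

end

context compact_dagger_category
begin

text \<open>With \<open>assoc_mult\<close> and \<open>unit_mult\<close>, the multiplicativity of
  coherence isomorphisms that \<open>iso_CPstar\<close> asks for.\<close>

lemma swap_mult:
  assumes m: "m \<in> hom C (A \<boxtimes> A) A" and n: "n \<in> hom C (B \<boxtimes> B) B" and ob: "A \<in> Ob C" "B \<in> Ob C"
  shows "\<sigma> A B \<cdot> ((m \<otimes> n) \<cdot> middle_swap C A B A B) = ((n \<otimes> m) \<cdot> middle_swap C B A B A) \<cdot> (\<sigma> A B \<otimes> \<sigma> A B)"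
    (is "?l = ?r")
proof -
  have m: "m \<in> Arr C" "Dom C m = A \<boxtimes> A" "Cod C m = A" and n: "n \<in> Arr C" "Dom C n = B \<boxtimes> B" "Cod C n = B"
    using m n by (auto simp: hom_iff)
  interpret compact_labelling C "tyl [A, B, A, B, A, B]" by (rule compact_labelling_tyl) (use ob in auto)
  note s = ob m n good_def
  let ?T = "(Lf 0 \<star> Lf 1) \<star> (Lf 2 \<star> Lf 3)" and ?L = "[(Lf 0 \<star> Lf 2, m, Lf 4), (Lf 1 \<star> Lf 3, n, Lf 5)]"
  have "rep ?T ?L (Lf 5 \<star> Lf 4) ?l" "rep ?T ?L (Lf 5 \<star> Lf 4) ?r"
    by (rule net_fromD, (rule net_rules | (simp add: s; fail))+)+
  then show ?thesis by (rule rep_unique) simp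
qed

lemma assoc_mult:
  assumes m: "m \<in> hom C (A \<boxtimes> A) A" and n: "n \<in> hom C (B \<boxtimes> B) B" and k: "k \<in> hom C (D \<boxtimes> D) D"
    and ob: "A \<in> Ob C" "B \<in> Ob C" "D \<in> Ob C"
  shows "\<alpha> A B D \<cdot> ((((m \<otimes> n) \<cdot> middle_swap C A B A B) \<otimes> k) \<cdot> middle_swap C (A \<boxtimes> B) D (A \<boxtimes> B) D)
    = ((m \<otimes> ((n \<otimes> k) \<cdot> middle_swap C B D B D)) \<cdot> middle_swap C A (B \<boxtimes> D) A (B \<boxtimes> D)) \<cdot> (\<alpha> A B D \<otimes> \<alpha> A B D)"
    (is "?l = ?r")
proof -
  have m: "m \<in> Arr C" "Dom C m = A \<boxtimes> A" "Cod C m = A" and n: "n \<in> Arr C" "Dom C n = B \<boxtimes> B" "Cod C n = B"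
    and k: "k \<in> Arr C" "Dom C k = D \<boxtimes> D" "Cod C k = D"
    using m n k by (auto simp: hom_iff)
  interpret compact_labelling C "tyl [A, B, D, A, B, D, A, B, D]" by (rule compact_labelling_tyl) (use ob in auto)
  note s = ob m n k good_def
  let ?T = "((Lf 0 \<star> Lf 1) \<star> Lf 2) \<star> ((Lf 3 \<star> Lf 4) \<star> Lf 5)" and ?U = "Lf 6 \<star> (Lf 7 \<star> Lf 8)"
    and ?L = "[(Lf 0 \<star> Lf 3, m, Lf 6), (Lf 1 \<star> Lf 4, n, Lf 7), (Lf 2 \<star> Lf 5, k, Lf 8)]"
  have "rep ?T ?L ?U ?l" "rep ?T ?L ?U ?r"
    by (rule net_fromD, (rule net_rules | (simp add: s; fail))+)+
  then show ?thesis by (rule rep_unique) simp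
qed

lemma unit_mult:
  assumes m: "m \<in> hom C (A \<boxtimes> A) A" and ob: "A \<in> Ob C"
  shows "\<l> A \<cdot> ((\<l> \<one> \<otimes> m) \<cdot> middle_swap C \<one> A \<one> A) = m \<cdot> (\<l> A \<otimes> \<l> A)" (is "?l = ?r")
    and "\<r> A \<cdot> ((m \<otimes> \<l> \<one>) \<cdot> middle_swap C A \<one> A \<one>) = m \<cdot> (\<r> A \<otimes> \<r> A)" (is "?l' = ?r'")
proof -
  have m: "m \<in> Arr C" "Dom C m = A \<boxtimes> A" "Cod C m = A" using m by (auto simp: hom_iff)
  interpret compact_labelling C "tyl [A, A, A]" by (rule compact_labelling_tyl) (use ob in auto)
  note s = ob m good_def
  let ?L = "[(Lf 0 \<star> Lf 1, m, Lf 2)]"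
  have "rep ((Emp \<star> Lf 0) \<star> (Emp \<star> Lf 1)) ?L (Lf 2) ?l" "rep ((Emp \<star> Lf 0) \<star> (Emp \<star> Lf 1)) ?L (Lf 2) ?r"
    by (rule net_fromD, (rule net_rules | (simp add: s; fail))+)+
  then show "?l = ?r" by (rule rep_unique) simp
  have "rep ((Lf 0 \<star> Emp) \<star> (Lf 1 \<star> Emp)) ?L (Lf 2) ?l'" "rep ((Lf 0 \<star> Emp) \<star> (Lf 1 \<star> Emp)) ?L (Lf 2) ?r'"
    by (rule net_fromD, (rule net_rules | (simp add: s; fail))+)+
  then show "?l' = ?r'" by (rule rep_unique) simp
qed

definition conj_mult :: "'a \<Rightarrow> 'b \<Rightarrow> 'b" where
  "conj_mult A m = star C m \<cdot> \<sigma> (A\<^sup>\<star>) (A\<^sup>\<star>)"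

text \<open>The unit of \<open>frob_dual\<close> written without the dual of \<open>\<one>\<close>;
  \<open>star_unit\<close> identifies the two forms.\<close>

definition conj_unit :: "'a \<Rightarrow> 'b \<Rightarrow> 'b" where
  "conj_unit A u = \<r> (A\<^sup>\<star>) \<cdot> (\<i> (A\<^sup>\<star>) \<otimes> u\<^sup>\<dagger>) \<cdot> \<eta> A"

lemma conj_mult_unfold:
  assumes "m \<in> hom C (A \<boxtimes> A) A"
  shows "conj_mult A m = \<r> (A\<^sup>\<star>) \<cdot> (\<i> (A\<^sup>\<star>) \<otimes> cap C (A \<boxtimes> A)) \<cdot> (\<i> (A\<^sup>\<star>) \<otimes> (m\<^sup>\<dagger> \<otimes> \<i> (A\<^sup>\<star> \<boxtimes> A\<^sup>\<star>)))
     \<cdot> \<alpha> (A\<^sup>\<star>) A (A\<^sup>\<star> \<boxtimes> A\<^sup>\<star>) \<cdot> (\<eta> A \<otimes> \<i> (A\<^sup>\<star> \<boxtimes> A\<^sup>\<star>)) \<cdot> (\<l> (A\<^sup>\<star> \<boxtimes> A\<^sup>\<star>))\<^sup>\<dagger> \<cdot> \<sigma> (A\<^sup>\<star>) (A\<^sup>\<star>)"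
proof -
  have m: "m \<in> Arr C" "Dom C (m\<^sup>\<dagger>) = A" "Cod C (m\<^sup>\<dagger>) = A \<boxtimes> A" and A: "A \<in> Ob C" using assms by (auto simp: hom_iff)
  show ?thesis
    unfolding conj_mult_def star_def dual_arr_def Let_def m dual_ten[OF A A] ..
qed

end

context compact_labelling
begin

text \<open>The snake equation for \<open>\<one>\<close>: the wire of \<open>\<one>\<close> is the
  empty tree, so its cup and cap form a closed loop with the value of an identity.\<close>

lemma net_unit_object:
  assumes "ty w = \<one>\<^sup>\<star>"
  shows "eqv Emp [(Emp, \<eta> \<one>, Lf w \<star> Emp), (Lf w \<star> Emp, counit C \<one>, Emp)] Emp []"
proof (rule eqvI)
  let ?I = "\<one>"
  have "rep Emp [(Emp, \<eta> \<one>, Lf w \<star> Emp), (Lf w \<star> Emp, counit C \<one>, Emp)] Emp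
    (\<l> ?I \<cdot> (cap C ?I \<otimes> \<i> ?I) \<cdot> (\<alpha> ?I (?I\<^sup>\<star>) ?I)\<^sup>\<dagger> \<cdot> (\<i> ?I \<otimes> \<eta> ?I) \<cdot> (\<r> ?I)\<^sup>\<dagger>)"
    unfolding cap_def by (rule net_fromD, (rule net_rules | (simp add: good_def assms; fail))+)
  then show "rep Emp [(Emp, \<eta> \<one>, Lf w \<star> Emp), (Lf w \<star> Emp, counit C \<one>, Emp)] Emp (\<i> \<one>)"
    by (simp only: snake[OF unit_ob])
  show "rep Emp [] Emp (\<i> \<one>)" by (rule rep_idn) simp_all
qed

text \<open>The cap of \<open>A \<boxtimes> A\<close> is nested and pairs inputs in reverse order;
  the symmetry in \<open>conj_mult\<close> compensates, so that \<open>i\<close> meets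
  \<open>p\<close> and \<open>j\<close> meets \<open>q\<close>.\<close>

lemma rep_conj_mult:
  assumes m: "m \<in> hom C (A \<boxtimes> A) A" and A: "A \<in> Ob C" and t: "ty i = A\<^sup>\<star>" "ty j = A\<^sup>\<star>" "ty s = A\<^sup>\<star>" "ty a = A" "ty p = A" "ty q = A"
    and d: "distinct [i, j, s, a, p, q]"
  shows "rep (Lf i \<star> Lf j) [(Emp, \<eta> A, Lf s \<star> Lf a), (Lf a, m\<^sup>\<dagger>, Lf p \<star> Lf q), (Lf i \<star> Lf p, counit C A, Emp), (Lf j \<star> Lf q, counit C A, Emp)]
      (Lf s) (conj_mult A m)"
    and "rep (Lf s) [(Emp, \<eta> A, Lf i \<star> Lf p), (Emp, \<eta> A, Lf j \<star> Lf q), (Lf p \<star> Lf q, m, Lf a), (Lf s \<star> Lf a, counit C A, Emp)]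
      (Lf i \<star> Lf j) ((conj_mult A m)\<^sup>\<dagger>)"
proof -
  have d': "distinct [q, p, a, s, j, i]" using d by auto
  note m_hom = m
  have m: "m \<in> Arr C" "Dom C m = A \<boxtimes> A" "Cod C m = A" using m by (auto simp: hom_iff)
  show "rep (Lf i \<star> Lf j) [(Emp, \<eta> A, Lf s \<star> Lf a), (Lf a, m\<^sup>\<dagger>, Lf p \<star> Lf q), (Lf i \<star> Lf p, counit C A, Emp), (Lf j \<star> Lf q, counit C A, Emp)]
      (Lf s) (conj_mult A m)"
    unfolding conj_mult_unfold[OF m_hom] cap_def dual_ten[OF A A] counit_ten[OF A A]
    by (rule net_fromD, (rule net_rules | (use m A t d d' in \<open>simp add: good_def; fail\<close>))+)
  have e: "(conj_mult A m)\<^sup>\<dagger> = \<sigma> (A\<^sup>\<star>) (A\<^sup>\<star>) \<cdot> \<l> (A\<^sup>\<star> \<boxtimes> A\<^sup>\<star>) \<cdot> (counit C A \<otimes> \<i> (A\<^sup>\<star> \<boxtimes> A\<^sup>\<star>)) \<cdot> (\<alpha> (A\<^sup>\<star>) A (A\<^sup>\<star> \<boxtimes> A\<^sup>\<star>))\<^sup>\<dagger>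
     \<cdot> (\<i> (A\<^sup>\<star>) \<otimes> (m \<otimes> \<i> (A\<^sup>\<star> \<boxtimes> A\<^sup>\<star>))) \<cdot> (\<i> (A\<^sup>\<star>) \<otimes> (\<sigma> (A\<^sup>\<star> \<boxtimes> A\<^sup>\<star>) (A \<boxtimes> A) \<cdot> \<eta> (A \<boxtimes> A))) \<cdot> (\<r> (A\<^sup>\<star>))\<^sup>\<dagger>"
    unfolding conj_mult_unfold[OF m_hom] cap_def using m A by (simp add: dual_ten)
  show "rep (Lf s) [(Emp, \<eta> A, Lf i \<star> Lf p), (Emp, \<eta> A, Lf j \<star> Lf q), (Lf p \<star> Lf q, m, Lf a), (Lf s \<star> Lf a, counit C A, Emp)]
      (Lf i \<star> Lf j) ((conj_mult A m)\<^sup>\<dagger>)"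
    unfolding e eta_ten[OF A A]
    by (rule net_fromD, (rule net_rules | (use m A t d d' in \<open>simp add: good_def; fail\<close>))+)
qed

end

context compact_dagger_category
begin

lemma conj_mult_simps [simp]:
  assumes "m \<in> hom C (A \<boxtimes> A) A" "A \<in> Ob C"
  shows "conj_mult A m \<in> Arr C" "Dom C (conj_mult A m) = A\<^sup>\<star> \<boxtimes> A\<^sup>\<star>" "Cod C (conj_mult A m) = A\<^sup>\<star>"
proof -
  interpret compact_labelling C "tyl [A\<^sup>\<star>, A\<^sup>\<star>, A\<^sup>\<star>, A, A, A]" by (rule compact_labelling_tyl) (use assms in auto)
  have "rep (Lf 0 \<star> Lf 1) [(Emp, \<eta> A, Lf 2 \<star> Lf 3), (Lf 3, m\<^sup>\<dagger>, Lf 4 \<star> Lf 5), (Lf 0 \<star> Lf 4, counit C A, Emp), (Lf 1 \<star> Lf 5, counit C A, Emp)]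
      (Lf 2) (conj_mult A m)"
    by (rule rep_conj_mult) (use assms in simp_all)
  from repD[OF this] show "conj_mult A m \<in> Arr C" "Dom C (conj_mult A m) = A\<^sup>\<star> \<boxtimes> A\<^sup>\<star>" "Cod C (conj_mult A m) = A\<^sup>\<star>"
    by simp_all
qed

lemma conj_unit_simps [simp]:
  assumes "u \<in> hom C \<one> A" "A \<in> Ob C"
  shows "conj_unit A u \<in> Arr C" "Dom C (conj_unit A u) = \<one>" "Cod C (conj_unit A u) = A\<^sup>\<star>"
  using assms by (simp_all add: conj_unit_def hom_iff)

lemma star_unit:
  assumes u: "u \<in> hom C \<one> A" and A: "A \<in> Ob C"
  shows "star C u \<cdot> \<r> (\<one>\<^sup>\<star>) \<cdot> \<eta> \<one> = conj_unit A u"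
proof -
  have u: "u \<in> Arr C" "Dom C u = \<one>" "Cod C u = A" using u by (auto simp: hom_iff)
  then have ud: "Dom C (u\<^sup>\<dagger>) = A" "Cod C (u\<^sup>\<dagger>) = \<one>" by simp_all
  interpret compact_labelling C "tyl [A\<^sup>\<star>, A, \<one>\<^sup>\<star>]" by (rule compact_labelling_tyl) (use A in auto)
  note s = u A good_def
  have "rep Emp [(Emp, \<eta> A, Lf 0 \<star> Lf 1), (Lf 1, u\<^sup>\<dagger>, Emp), (Emp, \<eta> \<one>, Lf 2 \<star> Emp), (Lf 2 \<star> Emp, counit C \<one>, Emp)]
     (Lf 0) (star C u \<cdot> \<r> (\<one>\<^sup>\<star>) \<cdot> \<eta> \<one>)"
    unfolding star_def dual_arr_def Let_def ud cap_def
    by (rule net_fromD, (rule net_rules | (simp add: s; fail))+)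
  then have 1: "rep Emp [(Emp, \<eta> A, Lf 0 \<star> Lf 1), (Lf 1, u\<^sup>\<dagger>, Emp)] (Lf 0) (star C u \<cdot> \<r> (\<one>\<^sup>\<star>) \<cdot> \<eta> \<one>)"
    by (rule net_step[OF _ net_unit_object[of 2], where La = "[(Emp, \<eta> A, Lf 0 \<star> Lf 1), (Lf 1, u\<^sup>\<dagger>, Emp)]" and Lb = "[]"])
       (simp_all add: s)
  have "rep Emp [(Emp, \<eta> A, Lf 0 \<star> Lf 1), (Lf 1, u\<^sup>\<dagger>, Emp)] (Lf 0) (conj_unit A u)"
    unfolding conj_unit_def by (rule net_fromD, (rule net_rules | (simp add: s; fail))+)
  with 1 show ?thesis by (rule rep_unique) simp
qed

lemma frob_dual_conj:
  assumes "u \<in> hom C \<one> A" "A \<in> Ob C"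
  shows "frob_dual C (A, m, u) = (A\<^sup>\<star>, conj_mult A m, conj_unit A u)"
  using star_unit[OF assms] by (simp add: frob_dual_def conj_mult_def)

text \<open>The axiom \<open>dual_ten\<close> for \<open>CPstar\<close> is an equation between
  Frobenius structures, so multiplications and units must match as well as objects. The networks of
  the two factors do not interact.\<close>

lemma conj_ten:
  assumes m: "m \<in> hom C (A \<boxtimes> A) A" and n: "n \<in> hom C (B \<boxtimes> B) B"
    and u: "u \<in> hom C \<one> A" and v: "v \<in> hom C \<one> B" and ob: "A \<in> Ob C" "B \<in> Ob C"
  shows "conj_mult (A \<boxtimes> B) ((m \<otimes> n) \<cdot> middle_swap C A B A B)
      = (conj_mult B n \<otimes> conj_mult A m) \<cdot> middle_swap C (B\<^sup>\<star>) (A\<^sup>\<star>) (B\<^sup>\<star>) (A\<^sup>\<star>)" (is "?l = ?r")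
    and "conj_unit (A \<boxtimes> B) ((u \<otimes> v) \<cdot> (\<l> \<one>)\<^sup>\<dagger>) = (conj_unit B v \<otimes> conj_unit A u) \<cdot> (\<l> \<one>)\<^sup>\<dagger>" (is "?l' = ?r'")
proof -
  have m': "m \<in> Arr C" "Dom C m = A \<boxtimes> A" "Cod C m = A" and n': "n \<in> Arr C" "Dom C n = B \<boxtimes> B" "Cod C n = B"
    and u: "u \<in> Arr C" "Dom C u = \<one>" "Cod C u = A" and v: "v \<in> Arr C" "Dom C v = \<one>" "Cod C v = B"
    using m n u v by (auto simp: hom_iff)
  interpret compact_labelling C "tyl [B\<^sup>\<star>, A\<^sup>\<star>, B\<^sup>\<star>, A\<^sup>\<star>, B\<^sup>\<star>, B, B, B, A\<^sup>\<star>, A, A, A]"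
    by (rule compact_labelling_tyl) (use ob in auto)
  note s = ob m' n' u v good_def
  let ?M = "(m \<otimes> n) \<cdot> middle_swap C A B A B"
  have M: "?M \<in> hom C ((A \<boxtimes> B) \<boxtimes> (A \<boxtimes> B)) (A \<boxtimes> B)" "?M\<^sup>\<dagger> = middle_swap C A A B B \<cdot> (m\<^sup>\<dagger> \<otimes> n\<^sup>\<dagger>)"
    by (simp_all add: s hom_iff)
  have AB: "A \<boxtimes> B \<in> Ob C" using ob by simp
  let ?T = "(Lf 0 \<star> Lf 1) \<star> (Lf 2 \<star> Lf 3)"
  let ?Lb = "[(Emp, \<eta> B, Lf 4 \<star> Lf 5), (Lf 5, n\<^sup>\<dagger>, Lf 6 \<star> Lf 7), (Lf 0 \<star> Lf 6, counit C B, Emp), (Lf 2 \<star> Lf 7, counit C B, Emp)]"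
  let ?La = "[(Emp, \<eta> A, Lf 8 \<star> Lf 9), (Lf 9, m\<^sup>\<dagger>, Lf 10 \<star> Lf 11), (Lf 1 \<star> Lf 10, counit C A, Emp), (Lf 3 \<star> Lf 11, counit C A, Emp)]"
  let ?N = "[(Emp, \<eta> B, Lf 4 \<star> Lf 5), (Lf 5, n\<^sup>\<dagger>, Lf 6 \<star> Lf 7), (Lf 0 \<star> Lf 6, counit C B, Emp), (Lf 2 \<star> Lf 7, counit C B, Emp),
    (Emp, \<eta> A, Lf 8 \<star> Lf 9), (Lf 9, m\<^sup>\<dagger>, Lf 10 \<star> Lf 11), (Lf 1 \<star> Lf 10, counit C A, Emp), (Lf 3 \<star> Lf 11, counit C A, Emp)]"
  have 1: "rep (Lf 0 \<star> Lf 2) ?Lb (Lf 4) (conj_mult B n)" by (rule rep_conj_mult) (use n in \<open>simp_all add: s\<close>)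
  have 2: "rep (Lf 1 \<star> Lf 3) ?La (Lf 8) (conj_mult A m)" by (rule rep_conj_mult) (use m in \<open>simp_all add: s\<close>)
  have "rep ?T ?N (Lf 4 \<star> Lf 8) ?r"
    by (rule net_fromD, (rule net_rules 1[THEN net_fromI] 2[THEN net_fromI] | (simp add: s; fail))+)
  moreover
  have "rep ?T ?N (Lf 4 \<star> Lf 8) ?l"
    unfolding conj_mult_unfold[OF M(1)] cap_def dual_ten[OF AB AB] dual_ten[OF ob] counit_ten[OF AB AB] counit_ten[OF ob]
      eta_ten[OF ob] M(2)
    by (rule net_fromD, (rule net_rules | (simp add: s; fail))+)
  ultimately show "?l = ?r" by (intro rep_unique) simp_all
  have U: "((u \<otimes> v) \<cdot> (\<l> \<one>)\<^sup>\<dagger>)\<^sup>\<dagger> = \<l> \<one> \<cdot> (u\<^sup>\<dagger> \<otimes> v\<^sup>\<dagger>)" by (simp add: s)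
  let ?L = "[(Emp, \<eta> B, Lf 4 \<star> Lf 5), (Emp, \<eta> A, Lf 8 \<star> Lf 9), (Lf 9, u\<^sup>\<dagger>, Emp), (Lf 5, v\<^sup>\<dagger>, Emp)]"
  have "rep Emp ?L (Lf 4 \<star> Lf 8) ?l'"
    unfolding conj_unit_def U dual_ten[OF ob] eta_ten[OF ob] by (rule net_fromD, (rule net_rules | (simp add: s; fail))+)
  moreover have "rep Emp ?L (Lf 4 \<star> Lf 8) ?r'"
    unfolding conj_unit_def by (rule net_fromD, (rule net_rules | (simp add: s; fail))+)
  ultimately show "?l' = ?r'" by (rule rep_unique) simp
qed

end

context frobenius_structure
begin

lemma mult_hom: "m \<in> hom C (A \<boxtimes> A) A" and unit_hom: "u \<in> hom C \<one> A"
  by (simp_all add: hom_iff)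

lemma conj_simps [simp]:
  "conj_mult A m \<in> Arr C" "Dom C (conj_mult A m) = A\<^sup>\<star> \<boxtimes> A\<^sup>\<star>" "Cod C (conj_mult A m) = A\<^sup>\<star>"
  "conj_unit A u \<in> Arr C" "Dom C (conj_unit A u) = \<one>" "Cod C (conj_unit A u) = A\<^sup>\<star>"
  using mult_hom unit_hom by simp_all

text \<open>Wherever two operations of the conjugate meet, a cup and a cap of \<open>A\<close> meet.
  Yanking them leaves a law of the original structure: associativity becomes coassociativity, the
  unit laws become counit laws, and the Frobenius law is read backwards.\<close>

lemma frobenius_dual: "special_dagger_frobenius C (A\<^sup>\<star>, conj_mult A m, conj_unit A u)"
proof -
  interpret frobenius_labelling C "tyl [A\<^sup>\<star>, A\<^sup>\<star>, A\<^sup>\<star>, A\<^sup>\<star>, A, A, A, A\<^sup>\<star>, A, A, A, A]"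
    by (rule frobenius_labelling_tyl) simp
  note s = good_def mult_hom unit_hom
  let ?S = "conj_mult A m" and ?I = "\<i> (A\<^sup>\<star>)" and ?U = "conj_unit A u" and ?\<alpha> = "\<alpha> (A\<^sup>\<star>) (A\<^sup>\<star>) (A\<^sup>\<star>)"

  let ?T = "(Lf 0 \<star> Lf 1) \<star> Lf 2"
  note b = rep_conj_mult(1)[of m A 0 1 3 4 5 6, THEN net_fromI] rep_conj_mult(1)[of m A 3 2 7 8 9 10, THEN net_fromI]
  let ?h = "(Emp, \<eta> A, Lf 7 \<star> Lf 8)" and ?e0 = "(Lf 0 \<star> Lf 5, counit C A, Emp)" and ?e1 = "(Lf 1 \<star> Lf 6, counit C A, Emp)"
    and ?e2 = "(Lf 2 \<star> Lf 10, counit C A, Emp)"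
  have "rep ?T [(Emp, \<eta> A, Lf 3 \<star> Lf 4), (Lf 4, m\<^sup>\<dagger>, Lf 5 \<star> Lf 6), ?e0, ?e1, ?h, (Lf 8, m\<^sup>\<dagger>, Lf 9 \<star> Lf 10),
     (Lf 3 \<star> Lf 9, counit C A, Emp), ?e2] (Lf 7) (?S \<cdot> (?S \<otimes> ?I))"
    by (rule net_fromD, (rule net_rules b | (simp add: s; fail))+)
  then have "rep ?T [?h, (Lf 8, m\<^sup>\<dagger>, Lf 9 \<star> Lf 10), (Lf 9, m\<^sup>\<dagger>, Lf 5 \<star> Lf 6), ?e0, ?e1, ?e2] (Lf 7) (?S \<cdot> (?S \<otimes> ?I))"
    by (rule net_snake[where s = 3 and j = 4 and i = 9 and La = "[?h, (Lf 8, m\<^sup>\<dagger>, Lf 9 \<star> Lf 10)]"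
      and Lb = "[(Lf 4, m\<^sup>\<dagger>, Lf 5 \<star> Lf 6), ?e0, ?e1, ?e2]"]) (simp_all add: s)
  then have 1: "rep ?T [?h, (Lf 8, m\<^sup>\<dagger>, Lf 5 \<star> Lf 11), (Lf 11, m\<^sup>\<dagger>, Lf 6 \<star> Lf 10), ?e0, ?e1, ?e2] (Lf 7) (?S \<cdot> (?S \<otimes> ?I))"
    by (rule net_step[OF _ net_coassoc[of 5 6 10 9 8 11], where La = "[?h]" and Lb = "[?e0, ?e1, ?e2]"]) (simp_all add: s)
  note b = rep_conj_mult(1)[of m A 1 2 3 4 6 10, THEN net_fromI] rep_conj_mult(1)[of m A 0 3 7 8 5 11, THEN net_fromI]
  have "rep ?T [(Emp, \<eta> A, Lf 3 \<star> Lf 4), (Lf 4, m\<^sup>\<dagger>, Lf 6 \<star> Lf 10), ?e1, ?h, (Lf 8, m\<^sup>\<dagger>, Lf 5 \<star> Lf 11), ?e0,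
     (Lf 3 \<star> Lf 11, counit C A, Emp), ?e2] (Lf 7) (?S \<cdot> (?I \<otimes> ?S) \<cdot> ?\<alpha>)"
    by (rule net_fromD, (rule net_rules b | (simp add: s; fail))+)
  then have "rep ?T [?h, (Lf 8, m\<^sup>\<dagger>, Lf 5 \<star> Lf 11), (Lf 11, m\<^sup>\<dagger>, Lf 6 \<star> Lf 10), ?e0, ?e1, ?e2] (Lf 7) (?S \<cdot> (?I \<otimes> ?S) \<cdot> ?\<alpha>)"
    by (rule net_snake[where s = 3 and j = 4 and i = 11 and La = "[?h, (Lf 8, m\<^sup>\<dagger>, Lf 5 \<star> Lf 11)]"
      and Lb = "[(Lf 4, m\<^sup>\<dagger>, Lf 6 \<star> Lf 10), ?e0, ?e1, ?e2]"]) (simp_all add: s)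
  from rep_unique[OF 1 this] have assoc: "?S \<cdot> (?S \<otimes> ?I) = ?S \<cdot> (?I \<otimes> ?S) \<cdot> ?\<alpha>" by simp

  note b = rep_conj_mult(1)[of m A 1 0 3 5 6 8, THEN net_fromI] rep_conj_mult(1)[of m A 0 1 3 5 6 8, THEN net_fromI]
  let ?h = "(Emp, \<eta> A, Lf 3 \<star> Lf 5)" and ?k = "(Emp, \<eta> A, Lf 1 \<star> Lf 4)" and ?m = "(Lf 5, m\<^sup>\<dagger>, Lf 6 \<star> Lf 8)"
  have "rep (Emp \<star> Lf 0) [?k, (Lf 4, u\<^sup>\<dagger>, Emp), ?h, ?m, (Lf 1 \<star> Lf 6, counit C A, Emp), (Lf 0 \<star> Lf 8, counit C A, Emp)]
    (Lf 3) (?S \<cdot> (?U \<otimes> ?I))"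
    unfolding conj_unit_def by (rule net_fromD, (rule net_rules b | (simp add: s; fail))+)
  then have "rep (Emp \<star> Lf 0) [?h, ?m, (Lf 6, u\<^sup>\<dagger>, Emp), (Lf 0 \<star> Lf 8, counit C A, Emp)] (Lf 3) (?S \<cdot> (?U \<otimes> ?I))"
    by (rule net_snake[where s = 1 and j = 4 and i = 6 and La = "[?h, ?m]"
      and Lb = "[(Lf 4, u\<^sup>\<dagger>, Emp), (Lf 0 \<star> Lf 8, counit C A, Emp)]"]) (simp_all add: s)
  then have "rep (Emp \<star> Lf 0) [?h, (Lf 0 \<star> Lf 5, counit C A, Emp)] (Lf 3) (?S \<cdot> (?U \<otimes> ?I))"
    by (rule net_step_wire[OF _ net_unit(3)[of 5 8 6], where La = "[?h]" and Lb = "[(Lf 0 \<star> Lf 8, counit C A, Emp)]"]) (simp_all add: s)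
  then have 1: "rep (Emp \<star> Lf 0) [] (Lf 0) (?S \<cdot> (?U \<otimes> ?I))"
    by (rule net_snake_dual[where s = 3 and i = 5 and j = 0 and La = "[]" and Lb = "[]"]) (simp_all add: s)
  have unitl: "?S \<cdot> (?U \<otimes> ?I) = \<l> (A\<^sup>\<star>)" by (rule rep_unique[OF 1 rep_lunit]) simp_all
  have "rep (Lf 0 \<star> Emp) [?k, (Lf 4, u\<^sup>\<dagger>, Emp), ?h, ?m, (Lf 1 \<star> Lf 8, counit C A, Emp), (Lf 0 \<star> Lf 6, counit C A, Emp)]
    (Lf 3) (?S \<cdot> (?I \<otimes> ?U))"
    unfolding conj_unit_def by (rule net_fromD, (rule net_rules b | (simp add: s; fail))+)
  then have "rep (Lf 0 \<star> Emp) [?h, ?m, (Lf 8, u\<^sup>\<dagger>, Emp), (Lf 0 \<star> Lf 6, counit C A, Emp)] (Lf 3) (?S \<cdot> (?I \<otimes> ?U))"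
    by (rule net_snake[where s = 1 and j = 4 and i = 8 and La = "[?h, ?m]"
      and Lb = "[(Lf 4, u\<^sup>\<dagger>, Emp), (Lf 0 \<star> Lf 6, counit C A, Emp)]"]) (simp_all add: s)
  then have "rep (Lf 0 \<star> Emp) [?h, (Lf 0 \<star> Lf 5, counit C A, Emp)] (Lf 3) (?S \<cdot> (?I \<otimes> ?U))"
    by (rule net_step_wire[OF _ net_unit(4)[of 5 6 8], where La = "[?h]" and Lb = "[(Lf 0 \<star> Lf 6, counit C A, Emp)]"]) (simp_all add: s)
  then have 1: "rep (Lf 0 \<star> Emp) [] (Lf 0) (?S \<cdot> (?I \<otimes> ?U))"
    by (rule net_snake_dual[where s = 3 and i = 5 and j = 0 and La = "[]" and Lb = "[]"]) (simp_all add: s)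
  have unitr: "?S \<cdot> (?I \<otimes> ?U) = \<r> (A\<^sup>\<star>)" by (rule rep_unique[OF 1 rep_runit]) simp_all

  let ?h = "(Emp, \<eta> A, Lf 7 \<star> Lf 8)" and ?m = "(Lf 8, m\<^sup>\<dagger>, Lf 9 \<star> Lf 10)" and ?e = "(Lf 0 \<star> Lf 6, counit C A, Emp)"
  have "rep (Lf 0) ([(Emp, \<eta> A, Lf 1 \<star> Lf 4), (Emp, \<eta> A, Lf 2 \<star> Lf 5), (Lf 4 \<star> Lf 5, m, Lf 6), ?e]
    @ [?h, ?m, (Lf 1 \<star> Lf 9, counit C A, Emp), (Lf 2 \<star> Lf 10, counit C A, Emp)]) (Lf 7) (?S \<cdot> ?S\<^sup>\<dagger>)"
    by (rule rep_comp[OF rep_conj_mult(2) rep_conj_mult(1)]) (simp_all add: s)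
  then have "rep (Lf 0) [?h, ?m, (Emp, \<eta> A, Lf 2 \<star> Lf 5), (Lf 9 \<star> Lf 5, m, Lf 6), ?e, (Lf 2 \<star> Lf 10, counit C A, Emp)] (Lf 7) (?S \<cdot> ?S\<^sup>\<dagger>)"
    by (rule net_snake[where s = 1 and j = 4 and i = 9 and La = "[?h, ?m]"
      and Lb = "[(Emp, \<eta> A, Lf 2 \<star> Lf 5), (Lf 4 \<star> Lf 5, m, Lf 6), ?e, (Lf 2 \<star> Lf 10, counit C A, Emp)]"]) (simp_all add: s)
  then have "rep (Lf 0) [?h, ?m, (Lf 9 \<star> Lf 10, m, Lf 6), ?e] (Lf 7) (?S \<cdot> ?S\<^sup>\<dagger>)"
    by (rule net_snake[where s = 2 and j = 5 and i = 10 and La = "[?h, ?m]" and Lb = "[(Lf 9 \<star> Lf 5, m, Lf 6), ?e]"]) (simp_all add: s)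
  then have "rep (Lf 0) [?h, (Lf 0 \<star> Lf 8, counit C A, Emp)] (Lf 7) (?S \<cdot> ?S\<^sup>\<dagger>)"
    by (rule net_step_wire[OF _ net_special[of 8 6 9 10], where La = "[?h]" and Lb = "[?e]"]) (simp_all add: s)
  then have 1: "rep (Lf 0) [] (Lf 0) (?S \<cdot> ?S\<^sup>\<dagger>)"
    by (rule net_snake_dual[where s = 7 and i = 8 and j = 0 and La = "[]" and Lb = "[]"]) (simp_all add: s)
  have special: "?S \<cdot> ?S\<^sup>\<dagger> = ?I" by (rule rep_unique[OF 1 rep_idn]) simp_all

  let ?T = "Lf 0 \<star> Lf 1" and ?V = "Lf 7 \<star> Lf 3" and ?F = "(?S \<otimes> ?I) \<cdot> ?\<alpha>\<^sup>\<dagger> \<cdot> (?I \<otimes> ?S\<^sup>\<dagger>)"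
  let ?g = "(Emp, \<eta> A, Lf 3 \<star> Lf 5)" and ?e0 = "(Lf 0 \<star> Lf 9, counit C A, Emp)" and ?e1 = "(Lf 1 \<star> Lf 6, counit C A, Emp)"
  note b = rep_conj_mult(2)[of m A 2 3 1 6 4 5, THEN net_fromI] rep_conj_mult(1)[of m A 0 2 7 8 9 10, THEN net_fromI]
  have "rep ?T [(Emp, \<eta> A, Lf 2 \<star> Lf 4), ?g, (Lf 4 \<star> Lf 5, m, Lf 6), ?e1, ?h, ?m, ?e0, (Lf 2 \<star> Lf 10, counit C A, Emp)] ?V ?F"
    by (rule net_fromD, (rule net_rules b | (simp add: s; fail))+)
  then have "rep ?T [?g, ?h, ?m, (Lf 10 \<star> Lf 5, m, Lf 6), ?e0, ?e1] ?V ?F"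
    by (rule net_snake[where s = 2 and j = 4 and i = 10 and La = "[?g, ?h, ?m]"
      and Lb = "[(Lf 4 \<star> Lf 5, m, Lf 6), ?e0, ?e1]"]) (simp_all add: s)
  then have 1: "rep ?T [?g, ?h, (Lf 5, m\<^sup>\<dagger>, Lf 11 \<star> Lf 6), (Lf 8 \<star> Lf 11, m, Lf 9), ?e0, ?e1] ?V ?F"
    by (rule net_step[OF _ net_frob[of 8 5 11 9 6 10, THEN eqv_sym], where La = "[?g, ?h]" and Lb = "[?e0, ?e1]"]) (simp_all add: s)
  note b = rep_conj_mult(2)[of m A 7 2 0 9 8 4, THEN net_fromI] rep_conj_mult(1)[of m A 2 1 3 5 11 6, THEN net_fromI]
  let ?G = "(?I \<otimes> ?S) \<cdot> ?\<alpha> \<cdot> (?S\<^sup>\<dagger> \<otimes> ?I)"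
  have "rep ?T [?h, (Emp, \<eta> A, Lf 2 \<star> Lf 4), (Lf 8 \<star> Lf 4, m, Lf 9), ?e0, ?g, (Lf 5, m\<^sup>\<dagger>, Lf 11 \<star> Lf 6),
    (Lf 2 \<star> Lf 11, counit C A, Emp), ?e1] ?V ?G"
    by (rule net_fromD, (rule net_rules b | (simp add: s; fail))+)
  then have "rep ?T [?g, ?h, (Lf 5, m\<^sup>\<dagger>, Lf 11 \<star> Lf 6), (Lf 8 \<star> Lf 11, m, Lf 9), ?e0, ?e1] ?V ?G"
    by (rule net_snake[where s = 2 and j = 4 and i = 11 and La = "[?g, ?h, (Lf 5, m\<^sup>\<dagger>, Lf 11 \<star> Lf 6)]"
      and Lb = "[(Lf 8 \<star> Lf 4, m, Lf 9), ?e0, ?e1]"]) (simp_all add: s)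
  from rep_unique[OF 1 this] have frob: "?F = ?G" by simp

  have t: "A\<^sup>\<star> \<in> Ob C" "?S \<in> hom C (A\<^sup>\<star> \<boxtimes> A\<^sup>\<star>) (A\<^sup>\<star>)" "?U \<in> hom C \<one> (A\<^sup>\<star>)"
    by (simp_all add: hom_iff)
  show ?thesis
    unfolding special_dagger_frobenius_def split_conv
    by (intro conjI; fact t assoc unitl unitr special frob)
qed

text \<open>The loop on \<open>\<one>\<close> disappears, and yanking moves the comultiplication
  behind the multiplication. The result is the cup followed by the trace of
  \<open>m\<^sup>\<dagger> \<cdot> m\<close> on one leg, and that trace is
  \<open>kappa \<cdot> kappa\<^sup>\<dagger>\<close>.\<close>

lemma eta_CPstar:
  assumes k: "kappa C (A, m, u) \<cdot> (kappa C (A, m, u))\<^sup>\<dagger> = \<i> A"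
  shows "kappa C (A\<^sup>\<star> \<boxtimes> A, (conj_mult A m \<otimes> m) \<cdot> middle_swap C (A\<^sup>\<star>) A (A\<^sup>\<star>) A, w)
      \<cdot> Dbl C \<one> (A\<^sup>\<star> \<boxtimes> A) ((\<l> (A\<^sup>\<star> \<boxtimes> A))\<^sup>\<dagger> \<cdot> \<eta> A) \<cdot> (kappa C (\<one>, \<l> \<one>, v))\<^sup>\<dagger> = \<eta> A" (is "?l = _")
proof -
  let ?D = "A\<^sup>\<star> \<boxtimes> A" and ?N = "(conj_mult A m \<otimes> m) \<cdot> middle_swap C (A\<^sup>\<star>) A (A\<^sup>\<star>) A" and ?f = "(\<l> (A\<^sup>\<star> \<boxtimes> A))\<^sup>\<dagger> \<cdot> \<eta> A"
  interpret frobenius_labelling C "tyl [\<one>\<^sup>\<star>, A\<^sup>\<star>, A, A\<^sup>\<star>, A\<^sup>\<star>, A, A, A, A, A]"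
    by (rule frobenius_labelling_tyl) simp
  note s = good_def mult_hom unit_hom
  have h: "?f \<in> hom C \<one> (\<one> \<boxtimes> ?D)" "\<l> \<one> \<in> hom C (\<one> \<boxtimes> \<one>) \<one>" "?N \<in> hom C (?D \<boxtimes> ?D) ?D" "?D \<in> Ob C"
    by (simp_all add: hom_iff)
  have e: "?l = trc \<one> ?D (core \<one> ?D ?f (\<l> \<one>) ?N)"
    by (rule kappa_Dbl_kappa) (use h in simp_all)
  have d: "?f\<^sup>\<dagger> = counit C A \<cdot> \<l> ?D" "?N\<^sup>\<dagger> = middle_swap C (A\<^sup>\<star>) (A\<^sup>\<star>) A A \<cdot> ((conj_mult A m)\<^sup>\<dagger> \<otimes> m\<^sup>\<dagger>)" by simp_all
  let ?a = "(Emp, \<eta> \<one>, Lf 0 \<star> Emp)" and ?b = "(Lf 0 \<star> Emp, counit C \<one>, Emp)" and ?c = "(Emp, \<eta> A, Lf 3 \<star> Lf 7)"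
    and ?d = "(Emp, \<eta> A, Lf 4 \<star> Lf 8)" and ?e = "(Lf 7 \<star> Lf 8, m, Lf 9)" and ?g = "(Lf 3 \<star> Lf 5, counit C A, Emp)"
  note b = rep_conj_mult(2)[of m A 3 4 1 9 7 8, THEN net_fromI]
  have "rep Emp [?a, ?b, (Emp, \<eta> A, Lf 1 \<star> Lf 2), ?c, ?d, ?e, (Lf 1 \<star> Lf 9, counit C A, Emp), (Lf 2, m\<^sup>\<dagger>, Lf 5 \<star> Lf 6), ?g]
     (Lf 4 \<star> Lf 6) ?l"
    unfolding e trc_def core_def d by (rule net_fromD, (rule net_rules b | (simp add: s; fail))+)
  then have "rep Emp [(Emp, \<eta> A, Lf 1 \<star> Lf 2), ?c, ?d, ?e, (Lf 1 \<star> Lf 9, counit C A, Emp), (Lf 2, m\<^sup>\<dagger>, Lf 5 \<star> Lf 6), ?g]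
     (Lf 4 \<star> Lf 6) ?l"
    by (rule net_step[OF _ net_unit_object[of 0], where La = "[]" and Lb = "[(Emp, \<eta> A, Lf 1 \<star> Lf 2), ?c, ?d, ?e,
      (Lf 1 \<star> Lf 9, counit C A, Emp), (Lf 2, m\<^sup>\<dagger>, Lf 5 \<star> Lf 6), ?g]"]) (simp_all add: s)
  then have 1: "rep Emp [?c, ?d, ?e, (Lf 9, m\<^sup>\<dagger>, Lf 5 \<star> Lf 6), ?g] (Lf 4 \<star> Lf 6) ?l"
    by (rule net_snake[where s = 1 and j = 2 and i = 9 and La = "[?c, ?d, ?e]"
      and Lb = "[(Lf 2, m\<^sup>\<dagger>, Lf 5 \<star> Lf 6), ?g]"]) (simp_all add: s)
  have "rep Emp [?c, ?d, ?e, (Lf 9, m\<^sup>\<dagger>, Lf 5 \<star> Lf 6), ?g] (Lf 4 \<star> Lf 6) ((\<i> (A\<^sup>\<star>) \<otimes> trc A A (m\<^sup>\<dagger> \<cdot> m)) \<cdot> \<eta> A)"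
    unfolding trc_def by (rule net_fromD, (rule net_rules | (simp add: s; fail))+)
  then have "?l = (\<i> (A\<^sup>\<star>) \<otimes> trc A A (m\<^sup>\<dagger> \<cdot> m)) \<cdot> \<eta> A" using rep_unique[OF 1] by simp
  also have "trc A A (m\<^sup>\<dagger> \<cdot> m) = \<i> A" using kappa_kappa_dag[OF mult_hom frob_simps(1), of u] k by metis
  finally show ?thesis by simp
qed

end

section \<open>Morphisms with an environment\<close>

context
  fixes C :: "('o, 'a) cdc" (structure)
begin

text \<open>Composition, dagger and tensor product of morphisms \<open>A \<rightarrow> X \<boxtimes> B\<close> with an environment \<open>X\<close>.\<close>

definition env_comp :: "'o \<Rightarrow> 'o \<Rightarrow> 'o \<Rightarrow> 'a \<Rightarrow> 'a \<Rightarrow> 'a" where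
  "env_comp X Y E g f = (\<alpha> X Y E)\<^sup>\<dagger> \<cdot> (\<i> X \<otimes> g) \<cdot> f"

definition env_dag :: "'o \<Rightarrow> 'o \<Rightarrow> 'a \<Rightarrow> 'a" where
  "env_dag X B f = (\<i> (X\<^sup>\<star>) \<otimes> f\<^sup>\<dagger>) \<cdot> \<alpha> (X\<^sup>\<star>) X B \<cdot> (\<eta> X \<otimes> \<i> B) \<cdot> (\<l> B)\<^sup>\<dagger>"

definition env_ten :: "'o \<Rightarrow> 'o \<Rightarrow> 'o \<Rightarrow> 'o \<Rightarrow> 'a \<Rightarrow> 'a \<Rightarrow> 'a" where
  "env_ten X B Y E f g = middle_swap C X B Y E \<cdot> (f \<otimes> g)"

definition env_id :: "'o \<Rightarrow> 'a \<Rightarrow> 'a" where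
  "env_id B f = (\<l> B)\<^sup>\<dagger> \<cdot> f"

end

context compact_dagger_category
begin

lemma env_hom:
  "\<lbrakk>f \<in> hom C A (X \<boxtimes> B); g \<in> hom C B (Y \<boxtimes> E); X \<in> Ob C; Y \<in> Ob C; E \<in> Ob C\<rbrakk>
    \<Longrightarrow> env_comp C X Y E g f \<in> hom C A ((X \<boxtimes> Y) \<boxtimes> E)"
  "\<lbrakk>f \<in> hom C A (X \<boxtimes> B); X \<in> Ob C; B \<in> Ob C\<rbrakk> \<Longrightarrow> env_dag C X B f \<in> hom C B (X\<^sup>\<star> \<boxtimes> A)"
  "\<lbrakk>f \<in> hom C A (X \<boxtimes> B); g \<in> hom C A' (Y \<boxtimes> E); X \<in> Ob C; B \<in> Ob C; Y \<in> Ob C; E \<in> Ob C\<rbrakk>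
    \<Longrightarrow> env_ten C X B Y E f g \<in> hom C (A \<boxtimes> A') ((X \<boxtimes> Y) \<boxtimes> (B \<boxtimes> E))"
  "\<lbrakk>f \<in> hom C A B; B \<in> Ob C\<rbrakk> \<Longrightarrow> env_id C B f \<in> hom C A (\<one> \<boxtimes> B)"
  by (simp_all add: hom_iff env_comp_def env_dag_def env_ten_def env_id_def)

lemma Dbl_simps [simp]:
  assumes "f \<in> hom C A (X \<boxtimes> B)" "X \<in> Ob C" "B \<in> Ob C"
  shows "Dbl C X B f \<in> Arr C" "Dom C (Dbl C X B f) = A\<^sup>\<star> \<boxtimes> A" "Cod C (Dbl C X B f) = B\<^sup>\<star> \<boxtimes> B"
proof -
  have "A \<in> Ob C" using assms by (auto simp: hom_iff)
  then show "Dbl C X B f \<in> Arr C" "Dom C (Dbl C X B f) = A\<^sup>\<star> \<boxtimes> A" "Cod C (Dbl C X B f) = B\<^sup>\<star> \<boxtimes> B"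
    unfolding Dbl_straight[OF assms] using assms by (simp_all add: hom_iff)
qed

text \<open>Stated for arbitrary effects on the environments; \<open>gnd_ten\<close> later
  recognises the effect on \<open>X \<boxtimes> Y\<close> as the discarding map.\<close>

lemma effect_comp:
  assumes f: "f \<in> hom C A (X \<boxtimes> B)" and g: "g \<in> hom C B (Y \<boxtimes> E)"
    and e: "e \<in> hom C X \<one>" "e' \<in> hom C Y \<one>" and ob: "X \<in> Ob C" "B \<in> Ob C" "Y \<in> Ob C" "E \<in> Ob C"
  shows "\<l> E \<cdot> ((\<l> \<one> \<cdot> (e \<otimes> e')) \<otimes> \<i> E) \<cdot> env_comp C X Y E g f
    = (\<l> E \<cdot> (e' \<otimes> \<i> E) \<cdot> g) \<cdot> (\<l> B \<cdot> (e \<otimes> \<i> B) \<cdot> f)" (is "?l = ?r")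
proof -
  have A: "A \<in> Ob C" using f by (auto simp: hom_iff)
  have f: "f \<in> Arr C" "Dom C f = A" "Cod C f = X \<boxtimes> B" and g: "g \<in> Arr C" "Dom C g = B" "Cod C g = Y \<boxtimes> E"
    and e: "e \<in> Arr C" "Dom C e = X" "Cod C e = \<one>" "e' \<in> Arr C" "Dom C e' = Y" "Cod C e' = \<one>"
    using f g e by (auto simp: hom_iff)
  interpret compact_labelling C "tyl [A, X, B, Y, E]" by (rule compact_labelling_tyl) (use A ob in auto)
  note s = A ob f g e good_def
  let ?L = "[(Lf 0, f, Lf 1 \<star> Lf 2), (Lf 1, e, Emp), (Lf 2, g, Lf 3 \<star> Lf 4), (Lf 3, e', Emp)]"
  have "rep (Lf 0) ?L (Lf 4) ?l" "rep (Lf 0) ?L (Lf 4) ?r"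
    unfolding env_comp_def by (rule net_fromD, (rule net_rules | (simp add: s; fail))+)+
  then show ?thesis by (rule rep_unique) simp
qed

text \<open>The assumed formula for \<open>e\<close> is the shape of \<open>gnd_dual\<close>: its
  dagger is a cup whose starred leg is closed by \<open>e'\<close>, exactly what
  \<open>env_dag\<close> produces.\<close>

lemma effect_dag:
  assumes f: "f \<in> hom C A (X \<boxtimes> B)" and e: "e' \<in> hom C (X\<^sup>\<star>) \<one>" "e = cap C X \<cdot> (\<i> X \<otimes> e'\<^sup>\<dagger>) \<cdot> (\<r> X)\<^sup>\<dagger>"
    and ob: "X \<in> Ob C" "B \<in> Ob C"
  shows "(\<l> B \<cdot> (e \<otimes> \<i> B) \<cdot> f)\<^sup>\<dagger> = \<l> A \<cdot> (e' \<otimes> \<i> A) \<cdot> env_dag C X B f" (is "?l = ?r")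
proof -
  have A: "A \<in> Ob C" using f by (auto simp: hom_iff)
  have f: "f \<in> Arr C" "Dom C f = A" "Cod C f = X \<boxtimes> B"
    and e': "e' \<in> Arr C" "Dom C e' = X\<^sup>\<star>" "Cod C e' = \<one>"
    using f e by (auto simp: hom_iff)
  interpret compact_labelling C "tyl [B, X\<^sup>\<star>, X, A]" by (rule compact_labelling_tyl) (use A ob in auto)
  note s = A ob f e' good_def
  let ?L = "[(Emp, \<eta> X, Lf 1 \<star> Lf 2), (Lf 1, e', Emp), (Lf 2 \<star> Lf 0, f\<^sup>\<dagger>, Lf 3)]"
  have l: "?l = f\<^sup>\<dagger> \<cdot> ((\<r> X \<cdot> (\<i> X \<otimes> e') \<cdot> (\<sigma> (X\<^sup>\<star>) X \<cdot> \<eta> X)) \<otimes> \<i> B) \<cdot> (\<l> B)\<^sup>\<dagger>"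
    by (simp add: s e(2) cap_def)
  have "rep (Lf 0) ?L (Lf 3) ?l"
    unfolding l by (rule net_fromD, (rule net_rules | (simp add: s; fail))+)
  moreover have "rep (Lf 0) ?L (Lf 3) ?r"
    unfolding env_dag_def by (rule net_fromD, (rule net_rules | (simp add: s; fail))+)
  ultimately show ?thesis by (rule rep_unique) simp
qed

lemma effect_ten:
  assumes f: "f \<in> hom C A (X \<boxtimes> B)" and g: "g \<in> hom C A' (Y \<boxtimes> E)"
    and e: "e \<in> hom C X \<one>" "e' \<in> hom C Y \<one>" and ob: "X \<in> Ob C" "B \<in> Ob C" "Y \<in> Ob C" "E \<in> Ob C"
  shows "\<l> (B \<boxtimes> E) \<cdot> ((\<l> \<one> \<cdot> (e \<otimes> e')) \<otimes> \<i> (B \<boxtimes> E)) \<cdot> env_ten C X B Y E f g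
    = (\<l> B \<cdot> (e \<otimes> \<i> B) \<cdot> f) \<otimes> (\<l> E \<cdot> (e' \<otimes> \<i> E) \<cdot> g)" (is "?l = ?r")
proof -
  have A: "A \<in> Ob C" "A' \<in> Ob C" using f g by (auto simp: hom_iff)
  have f: "f \<in> Arr C" "Dom C f = A" "Cod C f = X \<boxtimes> B" and g: "g \<in> Arr C" "Dom C g = A'" "Cod C g = Y \<boxtimes> E"
    and e: "e \<in> Arr C" "Dom C e = X" "Cod C e = \<one>" "e' \<in> Arr C" "Dom C e' = Y" "Cod C e' = \<one>"
    using f g e by (auto simp: hom_iff)
  interpret compact_labelling C "tyl [A, A', X, B, Y, E]" by (rule compact_labelling_tyl) (use A ob in auto)
  note s = A ob f g e good_def
  let ?L = "[(Lf 0, f, Lf 2 \<star> Lf 3), (Lf 1, g, Lf 4 \<star> Lf 5), (Lf 2, e, Emp), (Lf 4, e', Emp)]"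
  have "rep (Lf 0 \<star> Lf 1) ?L (Lf 3 \<star> Lf 5) ?l" "rep (Lf 0 \<star> Lf 1) ?L (Lf 3 \<star> Lf 5) ?r"
    unfolding env_ten_def by (rule net_fromD, (rule net_rules | (simp add: s; fail))+)+
  then show ?thesis by (rule rep_unique) simp
qed

lemma effect_id:
  assumes f: "f \<in> hom C A B" and B: "B \<in> Ob C"
  shows "\<l> B \<cdot> (\<i> \<one> \<otimes> \<i> B) \<cdot> env_id C B f = f"
  using assms by (simp add: env_id_def hom_iff)

end

context compact_dagger_subcategory
begin

lemma sub_ob: "A \<in> Ob P \<Longrightarrow> A \<in> Ob C"
  using Ob_sub by blast

lemma sub_arr: "f \<in> Arr P \<Longrightarrow> f \<in> Arr C" "f \<in> Arr P \<Longrightarrow> Dom C f = Dom P f" "f \<in> Arr P \<Longrightarrow> Cod C f = Cod P f"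
  using Arr_sub Dom_eq Cod_eq by auto

lemma sub_hom: "f \<in> hom P A B \<Longrightarrow> f \<in> hom C A B"
  by (simp add: C.hom_iff P.hom_iff sub_arr)

lemma sub_ops:
  "\<lbrakk>f \<in> Arr P; g \<in> Arr P; Dom P g = Cod P f\<rbrakk> \<Longrightarrow> Comp C g f = Comp P g f"
  "f \<in> Arr P \<Longrightarrow> Dag C f = Dag P f"
  "\<lbrakk>f \<in> Arr P; g \<in> Arr P\<rbrakk> \<Longrightarrow> TenA C f g = TenA P f g"
  "\<lbrakk>A \<in> Ob P; B \<in> Ob P\<rbrakk> \<Longrightarrow> TenO C A B = TenO P A B"
  "A \<in> Ob P \<Longrightarrow> Dual C A = Dual P A"
  "A \<in> Ob P \<Longrightarrow> Idn C A = Idn P A"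
  "A \<in> Ob P \<Longrightarrow> LUnit C A = LUnit P A"
  "A \<in> Ob P \<Longrightarrow> RUnit C A = RUnit P A"
  "\<lbrakk>A \<in> Ob P; B \<in> Ob P; D \<in> Ob P\<rbrakk> \<Longrightarrow> Assoc C A B D = Assoc P A B D"
  "\<lbrakk>A \<in> Ob P; B \<in> Ob P\<rbrakk> \<Longrightarrow> Swap C A B = Swap P A B"
  "A \<in> Ob P \<Longrightarrow> Eta C A = Eta P A"
  "Unt C = Unt P"
  using Comp_eq[of f "Dom P f" "Cod P f" g "Cod P g"]
  by (simp_all add: Dag_eq TenA_eq TenO_eq Dual_eq Idn_eq LUnit_eq RUnit_eq Assoc_eq Swap_eq Eta_eq Unt_eq P.hom_iff)

lemma env_sub:
  "\<lbrakk>f \<in> hom P A (TenO P X B); g \<in> hom P B (TenO P Y E); X \<in> Ob P; B \<in> Ob P; Y \<in> Ob P; E \<in> Ob P\<rbrakk>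
    \<Longrightarrow> env_comp C X Y E g f = env_comp P X Y E g f"
  "\<lbrakk>f \<in> hom P A (TenO P X B); X \<in> Ob P; B \<in> Ob P\<rbrakk> \<Longrightarrow> env_dag C X B f = env_dag P X B f"
  "\<lbrakk>f \<in> hom P A (TenO P X B); g \<in> hom P A' (TenO P Y E); X \<in> Ob P; B \<in> Ob P; Y \<in> Ob P; E \<in> Ob P\<rbrakk>
    \<Longrightarrow> env_ten C X B Y E f g = env_ten P X B Y E f g"
  "\<lbrakk>f \<in> hom P A B; B \<in> Ob P\<rbrakk> \<Longrightarrow> env_id C B f = env_id P B f"
  \<comment> \<open>The normalising rules are switched off, so that both sides keep the same shape
    while \<open>sub_ops\<close> exchanges the operations.\<close>
  by (simp_all add: env_comp_def env_dag_def env_ten_def env_id_def middle_swap_def P.hom_iff sub_ops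
      del: C.assoc_comp C.interchange C.interchange_assoc P.assoc_comp P.interchange P.interchange_assoc)

end

context environment_structure
begin

lemma discard_comp:
  assumes f: "f \<in> hom P A (X \<boxtimes>\<^bsub>P\<^esub> B)" and g: "g \<in> hom P B (Y \<boxtimes>\<^bsub>P\<^esub> E)"
    and ob: "X \<in> Ob P" "B \<in> Ob P" "Y \<in> Ob P" "E \<in> Ob P"
  shows "discard C gnd (X \<boxtimes>\<^bsub>P\<^esub> Y) E (env_comp P X Y E g f) = discard C gnd Y E g \<cdot> discard C gnd X B f"
  unfolding discard_def env_sub(1)[OF f g ob, symmetric] sub_ops(4)[OF ob(1,3), symmetric] gnd_ten[OF ob(1,3)]
  by (rule C.effect_comp[of _ A]) (use sub_hom[OF f] sub_hom[OF g] sub_ob ob gnd_hom sub_ops in auto)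

lemma discard_dag:
  assumes f: "f \<in> hom P A (X \<boxtimes>\<^bsub>P\<^esub> B)" and ob: "X \<in> Ob P" "B \<in> Ob P"
  shows "(discard C gnd X B f)\<^sup>\<dagger> = discard C gnd (X\<^sup>\<star>\<^bsub>P\<^esub>) A (env_dag P X B f)"
  unfolding discard_def env_sub(2)[OF f ob, symmetric] sub_ops(5)[OF ob(1), symmetric]
  by (rule C.effect_dag[OF _ _ gnd_dual])
     (use sub_hom[OF f] sub_ob ob gnd_hom[of "X\<^sup>\<star>\<^bsub>P\<^esub>"] sub_ops in auto)

lemma discard_ten:
  assumes f: "f \<in> hom P A (X \<boxtimes>\<^bsub>P\<^esub> B)" and g: "g \<in> hom P A' (Y \<boxtimes>\<^bsub>P\<^esub> E)"
    and ob: "X \<in> Ob P" "B \<in> Ob P" "Y \<in> Ob P" "E \<in> Ob P"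
  shows "discard C gnd (X \<boxtimes>\<^bsub>P\<^esub> Y) (B \<boxtimes>\<^bsub>P\<^esub> E) (env_ten P X B Y E f g) = discard C gnd X B f \<otimes> discard C gnd Y E g"
  unfolding discard_def env_sub(3)[OF f g ob, symmetric] sub_ops(4)[OF ob(1,3), symmetric] sub_ops(4)[OF ob(2,4), symmetric]
    gnd_ten[OF ob(1,3)]
  by (rule C.effect_ten[of _ A _ _ _ A']) (use sub_hom[OF f] sub_hom[OF g] sub_ob ob gnd_hom sub_ops in auto)

lemma discard_id:
  assumes f: "f \<in> hom P A B" and ob: "B \<in> Ob P"
  shows "discard C gnd \<one>\<^bsub>P\<^esub> B (env_id P B f) = f"
  unfolding discard_def env_sub(4)[OF f ob, symmetric] sub_ops(12)[symmetric] gnd_unit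
  by (rule C.effect_id[of _ A]) (use sub_hom[OF f] sub_ob ob in auto)

lemma Dbl_discard:
  assumes "f \<in> hom P A (X \<boxtimes>\<^bsub>P\<^esub> B)" "g \<in> hom P A (Y \<boxtimes>\<^bsub>P\<^esub> B)" "X \<in> Ob P" "B \<in> Ob P" "Y \<in> Ob P"
  shows "Dbl P X B f = Dbl P Y B g \<longleftrightarrow> discard C gnd X B f = discard C gnd Y B g"
  by (rule Dbl_eq_iff[of A]) (use assms P.dom_cod_ob(1)[of f] in \<open>auto simp: P.hom_iff sub_ops\<close>)

lemma discard_hom:
  assumes "f \<in> hom P A (X \<boxtimes>\<^bsub>P\<^esub> B)" "X \<in> Ob P" "B \<in> Ob P"
  shows "discard C gnd X B f \<in> hom C A B"
  using assms sub_hom[OF assms(1)] gnd_hom[of X] sub_ob sub_ops(4)[of X B] by (simp add: discard_def C.hom_iff)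

end

section \<open>Symmetry of Frobenius structures and the graph of the functor\<close>

context decoherence_structure
begin

abbreviation "sdf \<equiv> special_dagger_frobenius P"

lemma sdf_structure: "sdf (A, m, u) \<Longrightarrow> frobenius_structure P A m u"
  by (intro frobenius_structure.intro P.compact_dagger_category_axioms) (simp add: frobenius_structure_axioms_def)

lemma t_simps:
  assumes "sdf \<A>"
  shows "t \<A> \<in> Arr C" "Dom C (t \<A>) = fst \<A>" "Cod C (t \<A>) = F \<A>"
  using assms t_hom[of "fst \<A>" "fst (snd \<A>)" "snd (snd \<A>)"] by (auto simp: C.hom_iff)

text \<open>
  In a decoherence structure every special dagger Frobenius structure is symmetric, because
  \<open>(t \<A>)\<^sup>\<dagger> \<cdot> t \<A>\<close> is self-adjoint.
\<close>

lemma frob_laws_strong: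
  assumes sdf: "sdf (A, m, u)"
  shows "(kappa P (A, m, u))\<^sup>\<dagger>\<^bsub>P\<^esub> \<cdot>\<^bsub>P\<^esub> kappa P (A, m, u) = Dbl P A A (m\<^sup>\<dagger>\<^bsub>P\<^esub>)"
    and "kappa P (A, m, u) \<cdot>\<^bsub>P\<^esub> (kappa P (A, m, u))\<^sup>\<dagger>\<^bsub>P\<^esub> = \<i>\<^bsub>P\<^esub> A"
proof -
  interpret Q: frobenius_structure P A m u by (rule sdf_structure[OF sdf])
  let ?T = "t (A, m, u)" and ?m = "m\<^sup>\<dagger>\<^bsub>P\<^esub>"
  have A: "A \<in> Ob P" by simp
  have m: "?m \<in> hom P A (A \<boxtimes>\<^bsub>P\<^esub> A)" by (simp add: P.hom_iff)
  note T = t_simps[OF sdf, simplified]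
  have TT: "?T\<^sup>\<dagger> \<cdot> ?T = discard C gnd A A ?m"
    using t_dag_t[OF sdf] by (simp add: sub_ops)
  have "(?T\<^sup>\<dagger> \<cdot> ?T)\<^sup>\<dagger> = ?T\<^sup>\<dagger> \<cdot> ?T" using T by simp
  then have "discard C gnd (A\<^sup>\<star>\<^bsub>P\<^esub>) A (env_dag P A A ?m) = discard C gnd A A ?m"
    unfolding TT discard_dag[OF m A A] .
  then have "Dbl P (A\<^sup>\<star>\<^bsub>P\<^esub>) A (env_dag P A A ?m) = Dbl P A A ?m"
    using Dbl_discard[OF P.env_hom(2)[OF m A A] m] by simp
  \<comment> \<open>Bending the environment leg of the comultiplication yields the dagger of
    \<open>kappa\<close>; this is the hypothesis of \<open>cup_symmetric\<close>.\<close>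
  moreover have "env_dag P A A ?m = (kappa P (A, m, u))\<^sup>\<dagger>\<^bsub>P\<^esub>"
    by (simp add: env_dag_def kappa_def)
  ultimately have sym: "Swap P A A \<cdot>\<^bsub>P\<^esub> (?m \<cdot>\<^bsub>P\<^esub> u) = ?m \<cdot>\<^bsub>P\<^esub> u"
    using Q.cup_symmetric by simp
  then show "(kappa P (A, m, u))\<^sup>\<dagger>\<^bsub>P\<^esub> \<cdot>\<^bsub>P\<^esub> kappa P (A, m, u) = Dbl P A A ?m"
    by (rule Q.kappa_dag_kappa)
  \<comment> \<open>This makes the dagger of \<open>t\<close> followed by \<open>t\<close> an
    idempotent; the environment axiom transports idempotency to the double.\<close>
  have tt: "?T \<cdot> ?T\<^sup>\<dagger> = \<i> (F (A, m, u))" by (rule t_t_dag[OF sdf])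
  have "(?T\<^sup>\<dagger> \<cdot> ?T) \<cdot> (?T\<^sup>\<dagger> \<cdot> ?T) = ?T\<^sup>\<dagger> \<cdot> (?T \<cdot> ?T\<^sup>\<dagger>) \<cdot> ?T" using T by simp
  also have "\<dots> = ?T\<^sup>\<dagger> \<cdot> ?T" unfolding tt using T by simp
  finally have "discard C gnd (A \<boxtimes>\<^bsub>P\<^esub> A) A (env_comp P A A A ?m ?m) = discard C gnd A A ?m"
    unfolding TT discard_comp[OF m m A A A A] .
  then have "Dbl P (A \<boxtimes>\<^bsub>P\<^esub> A) A (env_comp P A A A ?m ?m) = Dbl P A A ?m"
    using Dbl_discard[OF P.env_hom(1)[OF m m A A A] m] by simp
  then have "Dbl P A A ?m \<cdot>\<^bsub>P\<^esub> Dbl P A A ?m = Dbl P A A ?m"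
    using P.Dbl_comp[OF m m A A A A] by (simp add: env_comp_def)
  with sym show "kappa P (A, m, u) \<cdot>\<^bsub>P\<^esub> (kappa P (A, m, u))\<^sup>\<dagger>\<^bsub>P\<^esub> = \<i>\<^bsub>P\<^esub> A"
    by (rule Q.kappa_kappa_dag_idn)
qed


text \<open>A morphism with environment has two readings: \<open>lower\<close> as an arrow of
  \<open>CPstar P\<close>, \<open>upper\<close> as an arrow of \<open>C\<close>.\<close>

definition lower :: "('o, 'a) frob \<Rightarrow> ('o, 'a) frob \<Rightarrow> 'o \<Rightarrow> 'a \<Rightarrow> 'a" where
  "lower \<A> \<B> X f = kappa P \<B> \<cdot>\<^bsub>P\<^esub> Dbl P X (fst \<B>) f \<cdot>\<^bsub>P\<^esub> (kappa P \<A>)\<^sup>\<dagger>\<^bsub>P\<^esub>"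

definition upper :: "('o, 'a) frob \<Rightarrow> ('o, 'a) frob \<Rightarrow> 'o \<Rightarrow> 'a \<Rightarrow> 'a" where
  "upper \<A> \<B> X f = t \<B> \<cdot> discard C gnd X (fst \<B>) f \<cdot> (t \<A>)\<^sup>\<dagger>"

abbreviation comult :: "('o, 'a) frob \<Rightarrow> 'a" where
  "comult \<A> \<equiv> (fst (snd \<A>))\<^sup>\<dagger>\<^bsub>P\<^esub>"

lemma sdf_simps:
  assumes "sdf \<A>"
  shows "fst \<A> \<in> Ob P" "fst (snd \<A>) \<in> hom P (fst \<A> \<boxtimes>\<^bsub>P\<^esub> fst \<A>) (fst \<A>)" "snd (snd \<A>) \<in> hom P \<one>\<^bsub>P\<^esub> (fst \<A>)"
    "comult \<A> \<in> hom P (fst \<A>) (fst \<A> \<boxtimes>\<^bsub>P\<^esub> fst \<A>)"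
    "kappa P \<A> \<in> Arr P" "Dom P (kappa P \<A>) = (fst \<A>)\<^sup>\<star>\<^bsub>P\<^esub> \<boxtimes>\<^bsub>P\<^esub> fst \<A>" "Cod P (kappa P \<A>) = fst \<A>"
    "(kappa P \<A>)\<^sup>\<dagger>\<^bsub>P\<^esub> \<cdot>\<^bsub>P\<^esub> kappa P \<A> = Dbl P (fst \<A>) (fst \<A>) (comult \<A>)"
    "kappa P \<A> \<cdot>\<^bsub>P\<^esub> (kappa P \<A>)\<^sup>\<dagger>\<^bsub>P\<^esub> = \<i>\<^bsub>P\<^esub> (fst \<A>)"
    "(t \<A>)\<^sup>\<dagger> \<cdot> t \<A> = discard C gnd (fst \<A>) (fst \<A>) (comult \<A>)"
proof -
  obtain A m u where *: "\<A> = (A, m, u)" by (cases \<A>)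
  interpret Q: frobenius_structure P A m u by (rule sdf_structure) (use assms * in simp)
  show "fst \<A> \<in> Ob P" "fst (snd \<A>) \<in> hom P (fst \<A> \<boxtimes>\<^bsub>P\<^esub> fst \<A>) (fst \<A>)" "snd (snd \<A>) \<in> hom P \<one>\<^bsub>P\<^esub> (fst \<A>)"
    "comult \<A> \<in> hom P (fst \<A>) (fst \<A> \<boxtimes>\<^bsub>P\<^esub> fst \<A>)"
    "kappa P \<A> \<in> Arr P" "Dom P (kappa P \<A>) = (fst \<A>)\<^sup>\<star>\<^bsub>P\<^esub> \<boxtimes>\<^bsub>P\<^esub> fst \<A>" "Cod P (kappa P \<A>) = fst \<A>"
    by (simp_all add: * P.hom_iff)
  show "(kappa P \<A>)\<^sup>\<dagger>\<^bsub>P\<^esub> \<cdot>\<^bsub>P\<^esub> kappa P \<A> = Dbl P (fst \<A>) (fst \<A>) (comult \<A>)"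
    "kappa P \<A> \<cdot>\<^bsub>P\<^esub> (kappa P \<A>)\<^sup>\<dagger>\<^bsub>P\<^esub> = \<i>\<^bsub>P\<^esub> (fst \<A>)"
    using frob_laws_strong[of A m u] assms by (simp_all add: *)
  show "(t \<A>)\<^sup>\<dagger> \<cdot> t \<A> = discard C gnd (fst \<A>) (fst \<A>) (comult \<A>)"
    using t_dag_t[of A m u] assms by (simp add: * sub_ops)
qed

lemma lower_hom:
  assumes "sdf \<A>" "sdf \<B>" "f \<in> hom P (fst \<A>) (X \<boxtimes>\<^bsub>P\<^esub> fst \<B>)" "X \<in> Ob P"
  shows "lower \<A> \<B> X f \<in> hom P (fst \<A>) (fst \<B>)"
  using assms sdf_simps[OF assms(1)] sdf_simps[OF assms(2)] by (simp add: lower_def P.hom_iff)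

lemma upper_hom:
  assumes "sdf \<A>" "sdf \<B>" "f \<in> hom P (fst \<A>) (X \<boxtimes>\<^bsub>P\<^esub> fst \<B>)" "X \<in> Ob P"
  shows "upper \<A> \<B> X f \<in> hom C (F \<A>) (F \<B>)"
  using discard_hom[OF assms(3,4)] t_simps[OF assms(1)] t_simps[OF assms(2)] sdf_simps[OF assms(2)]
  by (simp add: upper_def C.hom_iff)

text \<open>Between two composed arrows stands \<open>kappa\<^sup>\<dagger> \<cdot> kappa\<close> in
  the lower reading and \<open>t\<^sup>\<dagger> \<cdot> t\<close> in the upper one. Both come from
  the comultiplication of \<open>\<B>\<close>, so one morphism \<open>k\<close> absorbs the middle
  factor for both readings.\<close>

lemma through_comp:
  assumes sdf: "sdf \<A>" "sdf \<B>" "sdf \<D>"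
    and f: "f \<in> hom P (fst \<A>) (X \<boxtimes>\<^bsub>P\<^esub> fst \<B>)" "X \<in> Ob P" and g: "g \<in> hom P (fst \<B>) (Y \<boxtimes>\<^bsub>P\<^esub> fst \<D>)" "Y \<in> Ob P"
  obtains Z k where "k \<in> hom P (fst \<A>) (Z \<boxtimes>\<^bsub>P\<^esub> fst \<D>)" "Z \<in> Ob P"
    "Dbl P Z (fst \<D>) k = Dbl P Y (fst \<D>) g \<cdot>\<^bsub>P\<^esub> Dbl P (fst \<B>) (fst \<B>) (comult \<B>) \<cdot>\<^bsub>P\<^esub> Dbl P X (fst \<B>) f"
    "discard C gnd Z (fst \<D>) k
      = discard C gnd Y (fst \<D>) g \<cdot> discard C gnd (fst \<B>) (fst \<B>) (comult \<B>) \<cdot> discard C gnd X (fst \<B>) f"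
proof
  let ?B = "fst \<B>" and ?D = "fst \<D>"
  note B = sdf_simps[OF sdf(2)] and D = sdf_simps[OF sdf(3)]
  let ?j = "env_comp P ?B Y ?D g (comult \<B>)" and ?Z = "X \<boxtimes>\<^bsub>P\<^esub> (?B \<boxtimes>\<^bsub>P\<^esub> Y)"
  have j: "?j \<in> hom P ?B ((?B \<boxtimes>\<^bsub>P\<^esub> Y) \<boxtimes>\<^bsub>P\<^esub> ?D)" by (rule P.env_hom(1)) (use B D g in auto)
  have ob: "?B \<boxtimes>\<^bsub>P\<^esub> Y \<in> Ob P" using B g by simp
  show "env_comp P X (?B \<boxtimes>\<^bsub>P\<^esub> Y) ?D ?j f \<in> hom P (fst \<A>) (?Z \<boxtimes>\<^bsub>P\<^esub> ?D)"
    by (rule P.env_hom(1)[OF f(1) j]) (use f ob D in auto)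
  show "?Z \<in> Ob P" using f ob by simp
  show "Dbl P ?Z ?D (env_comp P X (?B \<boxtimes>\<^bsub>P\<^esub> Y) ?D ?j f)
    = Dbl P Y ?D g \<cdot>\<^bsub>P\<^esub> Dbl P ?B ?B (comult \<B>) \<cdot>\<^bsub>P\<^esub> Dbl P X ?B f"
    using P.Dbl_comp[OF f(1) j f(2) B(1) ob D(1)] P.Dbl_comp[OF B(4) g(1) B(1) B(1) g(2) D(1)]
    by (simp add: env_comp_def)
  show "discard C gnd ?Z ?D (env_comp P X (?B \<boxtimes>\<^bsub>P\<^esub> Y) ?D ?j f)
    = discard C gnd Y ?D g \<cdot> discard C gnd ?B ?B (comult \<B>) \<cdot> discard C gnd X ?B f"
    using discard_comp[OF f(1) j f(2) B(1) ob D(1)] discard_comp[OF B(4) g(1) B(1) B(1) g(2) D(1)] by simp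
qed

text \<open>Sandwiching by \<open>kappa\<close> makes the lower reading a double, sandwiching by
  \<open>t\<close> makes the upper reading a discarded morphism, and the underlying \<open>k\<close>
  is the same. \<open>Dbl_discard\<close> then compares two such morphisms.\<close>

lemma lower_upper_iff:
  assumes sdf: "sdf \<A>" "sdf \<B>"
    and f: "f \<in> hom P (fst \<A>) (X \<boxtimes>\<^bsub>P\<^esub> fst \<B>)" "X \<in> Ob P" and g: "g \<in> hom P (fst \<A>) (Y \<boxtimes>\<^bsub>P\<^esub> fst \<B>)" "Y \<in> Ob P"
  shows "lower \<A> \<B> X f = lower \<A> \<B> Y g \<longleftrightarrow> upper \<A> \<B> X f = upper \<A> \<B> Y g"
proof -
  let ?A = "fst \<A>" and ?B = "fst \<B>"
  note A = sdf_simps[OF sdf(1)] and B = sdf_simps[OF sdf(2)]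
  have ex: "\<exists>Z k. Z \<in> Ob P \<and> k \<in> hom P ?A (Z \<boxtimes>\<^bsub>P\<^esub> ?B)
    \<and> Dbl P Z ?B k = (kappa P \<B>)\<^sup>\<dagger>\<^bsub>P\<^esub> \<cdot>\<^bsub>P\<^esub> lower \<A> \<B> X f \<cdot>\<^bsub>P\<^esub> kappa P \<A>
    \<and> discard C gnd Z ?B k = (t \<B>)\<^sup>\<dagger> \<cdot> upper \<A> \<B> X f \<cdot> t \<A>"
    if f: "f \<in> hom P ?A (X \<boxtimes>\<^bsub>P\<^esub> ?B)" "X \<in> Ob P" for X f
  proof -
    obtain Z k where k: "k \<in> hom P ?A (Z \<boxtimes>\<^bsub>P\<^esub> ?B)" "Z \<in> Ob P"
      "Dbl P Z ?B k = Dbl P ?B ?B (comult \<B>) \<cdot>\<^bsub>P\<^esub> Dbl P X ?B f \<cdot>\<^bsub>P\<^esub> Dbl P ?A ?A (comult \<A>)"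
      "discard C gnd Z ?B k
        = discard C gnd ?B ?B (comult \<B>) \<cdot> discard C gnd X ?B f \<cdot> discard C gnd ?A ?A (comult \<A>)"
    proof -
      let ?j = "env_comp P X ?B ?B (comult \<B>) f"
      have j: "?j \<in> hom P ?A ((X \<boxtimes>\<^bsub>P\<^esub> ?B) \<boxtimes>\<^bsub>P\<^esub> ?B)" by (rule P.env_hom(1)) (use B f in auto)
      have ob: "X \<boxtimes>\<^bsub>P\<^esub> ?B \<in> Ob P" using B f by simp
      show ?thesis
      proof (rule that)
        show "env_comp P ?A (X \<boxtimes>\<^bsub>P\<^esub> ?B) ?B ?j (comult \<A>) \<in> hom P ?A ((?A \<boxtimes>\<^bsub>P\<^esub> (X \<boxtimes>\<^bsub>P\<^esub> ?B)) \<boxtimes>\<^bsub>P\<^esub> ?B)"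
          by (rule P.env_hom(1)[OF A(4) j]) (use A B ob in auto)
        show "?A \<boxtimes>\<^bsub>P\<^esub> (X \<boxtimes>\<^bsub>P\<^esub> ?B) \<in> Ob P" using A ob by simp
        show "Dbl P (?A \<boxtimes>\<^bsub>P\<^esub> (X \<boxtimes>\<^bsub>P\<^esub> ?B)) ?B (env_comp P ?A (X \<boxtimes>\<^bsub>P\<^esub> ?B) ?B ?j (comult \<A>))
          = Dbl P ?B ?B (comult \<B>) \<cdot>\<^bsub>P\<^esub> Dbl P X ?B f \<cdot>\<^bsub>P\<^esub> Dbl P ?A ?A (comult \<A>)"
          using P.Dbl_comp[OF A(4) j A(1,1) ob B(1)] P.Dbl_comp[OF f(1) B(4) f(2) B(1,1,1)] by (simp add: env_comp_def)
        show "discard C gnd (?A \<boxtimes>\<^bsub>P\<^esub> (X \<boxtimes>\<^bsub>P\<^esub> ?B)) ?B (env_comp P ?A (X \<boxtimes>\<^bsub>P\<^esub> ?B) ?B ?j (comult \<A>))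
          = discard C gnd ?B ?B (comult \<B>) \<cdot> discard C gnd X ?B f \<cdot> discard C gnd ?A ?A (comult \<A>)"
          using discard_comp[OF A(4) j A(1,1) ob B(1)] discard_comp[OF f(1) B(4) f(2) B(1,1,1)] by simp
      qed
    qed
    have "Dbl P Z ?B k = (kappa P \<B>)\<^sup>\<dagger>\<^bsub>P\<^esub> \<cdot>\<^bsub>P\<^esub> lower \<A> \<B> X f \<cdot>\<^bsub>P\<^esub> kappa P \<A>"
      unfolding k(3) A(8)[symmetric] B(8)[symmetric] lower_def using A(1-7) B(1-7) f by (simp add: P.hom_iff)
    moreover have "discard C gnd Z ?B k = (t \<B>)\<^sup>\<dagger> \<cdot> upper \<A> \<B> X f \<cdot> t \<A>"
      unfolding k(4) A(10)[symmetric] B(10)[symmetric] upper_def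
      using t_simps[OF sdf(1)] t_simps[OF sdf(2)] discard_hom[OF f B(1)] by (simp add: C.hom_iff)
    ultimately show ?thesis using k by blast
  qed
  obtain Z k where k: "Z \<in> Ob P" "k \<in> hom P ?A (Z \<boxtimes>\<^bsub>P\<^esub> ?B)"
    "Dbl P Z ?B k = (kappa P \<B>)\<^sup>\<dagger>\<^bsub>P\<^esub> \<cdot>\<^bsub>P\<^esub> lower \<A> \<B> X f \<cdot>\<^bsub>P\<^esub> kappa P \<A>"
    "discard C gnd Z ?B k = (t \<B>)\<^sup>\<dagger> \<cdot> upper \<A> \<B> X f \<cdot> t \<A>"
    using ex[OF f] by blast
  obtain W l where l: "W \<in> Ob P" "l \<in> hom P ?A (W \<boxtimes>\<^bsub>P\<^esub> ?B)"
    "Dbl P W ?B l = (kappa P \<B>)\<^sup>\<dagger>\<^bsub>P\<^esub> \<cdot>\<^bsub>P\<^esub> lower \<A> \<B> Y g \<cdot>\<^bsub>P\<^esub> kappa P \<A>"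
    "discard C gnd W ?B l = (t \<B>)\<^sup>\<dagger> \<cdot> upper \<A> \<B> Y g \<cdot> t \<A>"
    using ex[OF g] by blast
  have kl: "Dbl P Z ?B k = Dbl P W ?B l \<longleftrightarrow> discard C gnd Z ?B k = discard C gnd W ?B l"
    by (rule Dbl_discard) (use k l B in auto)
  \<comment> \<open>Sandwiching loses nothing, because \<open>kappa\<close> is a coisometry;
    \<open>up\<close> is the same fact for \<open>t\<close>.\<close>
  have lo: "h = kappa P \<B> \<cdot>\<^bsub>P\<^esub> ((kappa P \<B>)\<^sup>\<dagger>\<^bsub>P\<^esub> \<cdot>\<^bsub>P\<^esub> h \<cdot>\<^bsub>P\<^esub> kappa P \<A>) \<cdot>\<^bsub>P\<^esub> (kappa P \<A>)\<^sup>\<dagger>\<^bsub>P\<^esub>"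
    if "h \<in> hom P ?A ?B" for h
  proof -
    have "kappa P \<B> \<cdot>\<^bsub>P\<^esub> ((kappa P \<B>)\<^sup>\<dagger>\<^bsub>P\<^esub> \<cdot>\<^bsub>P\<^esub> h \<cdot>\<^bsub>P\<^esub> kappa P \<A>) \<cdot>\<^bsub>P\<^esub> (kappa P \<A>)\<^sup>\<dagger>\<^bsub>P\<^esub>
      = (kappa P \<B> \<cdot>\<^bsub>P\<^esub> (kappa P \<B>)\<^sup>\<dagger>\<^bsub>P\<^esub>) \<cdot>\<^bsub>P\<^esub> h \<cdot>\<^bsub>P\<^esub> (kappa P \<A> \<cdot>\<^bsub>P\<^esub> (kappa P \<A>)\<^sup>\<dagger>\<^bsub>P\<^esub>)"
      using A(1-7) B(1-7) that by (simp add: P.hom_iff)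
    also have "\<dots> = h" unfolding A(9) B(9) using A(1) B(1) that by (simp add: P.hom_iff)
    finally show ?thesis by simp
  qed
  have up: "h = t \<B> \<cdot> ((t \<B>)\<^sup>\<dagger> \<cdot> h \<cdot> t \<A>) \<cdot> (t \<A>)\<^sup>\<dagger>" if "h \<in> hom C (F \<A>) (F \<B>)" for h
  proof -
    have "t \<B> \<cdot> ((t \<B>)\<^sup>\<dagger> \<cdot> h \<cdot> t \<A>) \<cdot> (t \<A>)\<^sup>\<dagger> = (t \<B> \<cdot> (t \<B>)\<^sup>\<dagger>) \<cdot> h \<cdot> (t \<A> \<cdot> (t \<A>)\<^sup>\<dagger>)"
      using t_simps[OF sdf(1)] t_simps[OF sdf(2)] that by (simp add: C.hom_iff)
    also have "\<dots> = h" using t_t_dag sdf F_ob that by (simp add: C.hom_iff)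
    finally show ?thesis by simp
  qed
  have "Dbl P Z ?B k = Dbl P W ?B l \<longleftrightarrow> lower \<A> \<B> X f = lower \<A> \<B> Y g"
    unfolding k(3) l(3) using lo[OF lower_hom[OF sdf f]] lo[OF lower_hom[OF sdf g]] by metis
  moreover have "discard C gnd Z ?B k = discard C gnd W ?B l \<longleftrightarrow> upper \<A> \<B> X f = upper \<A> \<B> Y g"
    unfolding k(4) l(4) using up[OF upper_hom[OF sdf f]] up[OF upper_hom[OF sdf g]] by metis
  ultimately show ?thesis using kl by simp
qed

text \<open>The graph of the functor: \<open>h\<close> is sent to \<open>h'\<close> if both arise from the same morphism with environment.\<close>

definition rel :: "('o, 'a) frob \<Rightarrow> ('o, 'a) frob \<Rightarrow> 'a \<Rightarrow> 'a \<Rightarrow> bool" where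
  "rel \<A> \<B> h h' \<longleftrightarrow> sdf \<A> \<and> sdf \<B> \<and> (\<exists>X f. X \<in> Ob P \<and> f \<in> hom P (fst \<A>) (X \<boxtimes>\<^bsub>P\<^esub> fst \<B>)
     \<and> h = lower \<A> \<B> X f \<and> h' = upper \<A> \<B> X f)"

lemma relI: "\<lbrakk>sdf \<A>; sdf \<B>; X \<in> Ob P; f \<in> hom P (fst \<A>) (X \<boxtimes>\<^bsub>P\<^esub> fst \<B>);
    h = lower \<A> \<B> X f; h' = upper \<A> \<B> X f\<rbrakk> \<Longrightarrow> rel \<A> \<B> h h'"
  by (auto simp: rel_def)

lemma rel_hom: "rel \<A> \<B> h h' \<Longrightarrow> h \<in> hom P (fst \<A>) (fst \<B>) \<and> h' \<in> hom C (F \<A>) (F \<B>)"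
  unfolding rel_def using lower_hom upper_hom by blast

text \<open>For fixed endpoints the relation is the graph of an injective partial map; the two
  directions are used for well-definedness and injectivity of \<open>lift\<close>.\<close>

lemma rel_unique: "rel \<A> \<B> h h' \<Longrightarrow> rel \<A> \<B> k k' \<Longrightarrow> h = k \<longleftrightarrow> h' = k'"
  unfolding rel_def by (elim conjE exE) (simp add: lower_upper_iff)

lemma rel_comp:
  assumes "rel \<A> \<B> h h'" "rel \<B> \<D> k k'"
  shows "rel \<A> \<D> (k \<cdot>\<^bsub>P\<^esub> h) (k' \<cdot> h')"
proof -
  obtain X f where f: "sdf \<A>" "sdf \<B>" "X \<in> Ob P" "f \<in> hom P (fst \<A>) (X \<boxtimes>\<^bsub>P\<^esub> fst \<B>)"
    "h = lower \<A> \<B> X f" "h' = upper \<A> \<B> X f" using assms by (auto simp: rel_def)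
  obtain Y g where g: "sdf \<D>" "Y \<in> Ob P" "g \<in> hom P (fst \<B>) (Y \<boxtimes>\<^bsub>P\<^esub> fst \<D>)"
    "k = lower \<B> \<D> Y g" "k' = upper \<B> \<D> Y g" using assms by (auto simp: rel_def)
  note A = sdf_simps[OF f(1)] and B = sdf_simps[OF f(2)] and D = sdf_simps[OF g(1)]
  obtain Z l where l: "l \<in> hom P (fst \<A>) (Z \<boxtimes>\<^bsub>P\<^esub> fst \<D>)" "Z \<in> Ob P"
    "Dbl P Z (fst \<D>) l = Dbl P Y (fst \<D>) g \<cdot>\<^bsub>P\<^esub> Dbl P (fst \<B>) (fst \<B>) (comult \<B>) \<cdot>\<^bsub>P\<^esub> Dbl P X (fst \<B>) f"
    "discard C gnd Z (fst \<D>) l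
      = discard C gnd Y (fst \<D>) g \<cdot> discard C gnd (fst \<B>) (fst \<B>) (comult \<B>) \<cdot> discard C gnd X (fst \<B>) f"
    using through_comp[OF f(1,2) g(1) f(4,3) g(3,2)] by blast
  show ?thesis
  proof (rule relI[OF f(1) g(1) l(2,1)])
    show "k \<cdot>\<^bsub>P\<^esub> h = lower \<A> \<D> Z l"
      unfolding lower_def l(3) B(8)[symmetric] f(5) g(4) using A(1-7) B(1-7) D(1-7) f(3,4) g(2,3)
      by (simp add: P.hom_iff)
    show "k' \<cdot> h' = upper \<A> \<D> Z l"
      unfolding upper_def l(4) B(10)[symmetric] f(6) g(5)
      using t_simps[OF f(1)] t_simps[OF f(2)] t_simps[OF g(1)] discard_hom[OF f(4,3) B(1)] discard_hom[OF g(3,2) D(1)]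
      by (simp add: C.hom_iff)
  qed
qed

lemma rel_dag:
  assumes "rel \<A> \<B> h h'"
  shows "rel \<B> \<A> (h\<^sup>\<dagger>\<^bsub>P\<^esub>) (h'\<^sup>\<dagger>)"
proof -
  obtain X f where f: "sdf \<A>" "sdf \<B>" "X \<in> Ob P" "f \<in> hom P (fst \<A>) (X \<boxtimes>\<^bsub>P\<^esub> fst \<B>)"
    "h = lower \<A> \<B> X f" "h' = upper \<A> \<B> X f" using assms by (auto simp: rel_def)
  note A = sdf_simps[OF f(1)] and B = sdf_simps[OF f(2)]
  have d: "Dbl P (X\<^sup>\<star>\<^bsub>P\<^esub>) (fst \<A>) (env_dag P X (fst \<B>) f) = (Dbl P X (fst \<B>) f)\<^sup>\<dagger>\<^bsub>P\<^esub>"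
    using P.Dbl_dag[OF f(4,3) B(1)] by (simp add: env_dag_def)
  show ?thesis
  proof (rule relI[OF f(2,1) _ P.env_hom(2)[OF f(4,3) B(1)]])
    show "h\<^sup>\<dagger>\<^bsub>P\<^esub> = lower \<B> \<A> (X\<^sup>\<star>\<^bsub>P\<^esub>) (env_dag P X (fst \<B>) f)"
      unfolding lower_def d f(5) using A(1-7) B(1-7) f(3,4) by (simp add: P.hom_iff)
    show "h'\<^sup>\<dagger> = upper \<B> \<A> (X\<^sup>\<star>\<^bsub>P\<^esub>) (env_dag P X (fst \<B>) f)"
      unfolding upper_def discard_dag[OF f(4,3) B(1), symmetric] f(6)
      using t_simps[OF f(1)] t_simps[OF f(2)] discard_hom[OF f(4,3) B(1)] by (simp add: C.hom_iff)
  qed (use f in simp)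
qed

lemma sdf_tensor:
  assumes "sdf \<A>" "sdf \<B>" shows "sdf (frob_tensor P \<A> \<B>)"
proof -
  obtain A m u B n v where *: "\<A> = (A, m, u)" "\<B> = (B, n, v)" by (cases \<A>; cases \<B>)
  interpret Q: frobenius_pair P A m u B n v
    by (intro frobenius_pair.intro sdf_structure) (use assms * in simp_all)
  show ?thesis using Q.frobenius_tensor by (simp add: frob_tensor_def *)
qed

lemma frob_tensor_simps [simp]:
  "fst (frob_tensor P \<A> \<B>) = fst \<A> \<boxtimes>\<^bsub>P\<^esub> fst \<B>"
  "fst (snd (frob_tensor P \<A> \<B>))
    = (fst (snd \<A>) \<otimes>\<^bsub>P\<^esub> fst (snd \<B>)) \<cdot>\<^bsub>P\<^esub> middle_swap P (fst \<A>) (fst \<B>) (fst \<A>) (fst \<B>)"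
  by (simp_all add: frob_tensor_def split: prod.split)

lemma frob_unit_simps [simp]: "fst (frob_unit P) = \<one>\<^bsub>P\<^esub>" "fst (snd (frob_unit P)) = \<l>\<^bsub>P\<^esub> \<one>\<^bsub>P\<^esub>"
  by (simp_all add: frob_unit_def)

lemma lower_core:
  assumes "sdf \<A>" "sdf \<B>" "f \<in> hom P (fst \<A>) (X \<boxtimes>\<^bsub>P\<^esub> fst \<B>)" "X \<in> Ob P"
  shows "lower \<A> \<B> X f = P.trc (fst \<A>) (fst \<B>) (P.core X (fst \<B>) f (fst (snd \<A>)) (fst (snd \<B>)))"
  using P.kappa_Dbl_kappa[OF assms(3) sdf_simps(2)[OF assms(1)] sdf_simps(2)[OF assms(2)] assms(4)
    sdf_simps(1)[OF assms(1)] sdf_simps(1)[OF assms(2)], of "snd (snd \<B>)" "snd (snd \<A>)"]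
  by (simp add: lower_def)

text \<open>The lower readings are compared in trace form by \<open>core_ten\<close> and
  \<open>trc_ten\<close>, the upper ones by \<open>discard_ten\<close> and
  \<open>t_ten\<close>.\<close>

lemma rel_ten:
  assumes "rel \<A> \<B> h h'" "rel \<A>' \<B>' k k'"
  shows "rel (frob_tensor P \<A> \<A>') (frob_tensor P \<B> \<B>') (h \<otimes>\<^bsub>P\<^esub> k) (h' \<otimes> k')"
proof -
  obtain X f where f: "sdf \<A>" "sdf \<B>" "X \<in> Ob P" "f \<in> hom P (fst \<A>) (X \<boxtimes>\<^bsub>P\<^esub> fst \<B>)"
    "h = lower \<A> \<B> X f" "h' = upper \<A> \<B> X f" using assms by (auto simp: rel_def)
  obtain Y g where g: "sdf \<A>'" "sdf \<B>'" "Y \<in> Ob P" "g \<in> hom P (fst \<A>') (Y \<boxtimes>\<^bsub>P\<^esub> fst \<B>')"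
    "k = lower \<A>' \<B>' Y g" "k' = upper \<A>' \<B>' Y g" using assms by (auto simp: rel_def)
  note A = sdf_simps[OF f(1)] and B = sdf_simps[OF f(2)] and A' = sdf_simps[OF g(1)] and B' = sdf_simps[OF g(2)]
  have F: "env_ten P X (fst \<B>) Y (fst \<B>') f g
      \<in> hom P (fst (frob_tensor P \<A> \<A>')) ((X \<boxtimes>\<^bsub>P\<^esub> Y) \<boxtimes>\<^bsub>P\<^esub> fst (frob_tensor P \<B> \<B>'))"
    using P.env_hom(3)[OF f(4) g(4)] B B' f g by simp
  note s = sdf_tensor[OF f(1) g(1)] sdf_tensor[OF f(2) g(2)]
  show ?thesis
  proof (rule relI[OF s _ F])
    show XY: "X \<boxtimes>\<^bsub>P\<^esub> Y \<in> Ob P" using f g by simp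
    show "h \<otimes>\<^bsub>P\<^esub> k = lower (frob_tensor P \<A> \<A>') (frob_tensor P \<B> \<B>') (X \<boxtimes>\<^bsub>P\<^esub> Y) (env_ten P X (fst \<B>) Y (fst \<B>') f g)"
      unfolding lower_core[OF s F XY] f(5) g(5) lower_core[OF f(1,2,4,3)] lower_core[OF g(1,2,4,3)]
      using P.core_ten[OF f(4) g(4) A(2) A'(2) B(2) B'(2) A(1) B(1) f(3) A'(1) B'(1) g(3)]
        P.trc_ten[OF P.core_hom[OF f(4) A(2) B(2) f(3) B(1)] P.core_hom[OF g(4) A'(2) B'(2) g(3) B'(1)] A(1) B(1) A'(1) B'(1)]
      by (simp add: env_ten_def)
    have d: "discard C gnd (X \<boxtimes>\<^bsub>P\<^esub> Y) (fst (frob_tensor P \<B> \<B>')) (env_ten P X (fst \<B>) Y (fst \<B>') f g)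
      = discard C gnd X (fst \<B>) f \<otimes> discard C gnd Y (fst \<B>') g"
      using discard_ten[OF f(4) g(4) f(3) B(1) g(3) B'(1)] by simp
    show "h' \<otimes> k' = upper (frob_tensor P \<A> \<A>') (frob_tensor P \<B> \<B>') (X \<boxtimes>\<^bsub>P\<^esub> Y) (env_ten P X (fst \<B>) Y (fst \<B>') f g)"
      unfolding upper_def d f(6) g(6) t_ten[OF f(1) g(1)] t_ten[OF f(2) g(2)]
      using t_simps[OF f(1)] t_simps[OF f(2)] t_simps[OF g(1)] t_simps[OF g(2)]
        discard_hom[OF f(4,3) B(1)] discard_hom[OF g(4,3) B'(1)] by (simp add: C.hom_iff)
  qed
qed

text \<open>With the environment \<open>\<one>\<close>, the lower reading is \<open>g\<close> by
  \<open>iso_CPstar\<close>, and discarding returns \<open>g\<close> in the upper reading.\<close>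

lemma rel_iso:
  assumes sdf: "sdf \<A>" "sdf \<B>" and g: "g \<in> hom P (fst \<A>) (fst \<B>)" "unitary P g"
    "g \<cdot>\<^bsub>P\<^esub> fst (snd \<A>) = fst (snd \<B>) \<cdot>\<^bsub>P\<^esub> (g \<otimes>\<^bsub>P\<^esub> g)"
  shows "rel \<A> \<B> g (t \<B> \<cdot> g \<cdot> (t \<A>)\<^sup>\<dagger>)"
proof -
  note A = sdf_simps[OF sdf(1)] and B = sdf_simps[OF sdf(2)]
  interpret Q: frobenius_structure P "fst \<A>" "fst (snd \<A>)" "snd (snd \<A>)"
    by (rule sdf_structure) (use sdf in simp)
  show ?thesis
  proof (rule relI[OF sdf _ P.env_hom(4)[OF g(1) B(1)]])
    show "g = lower \<A> \<B> \<one>\<^bsub>P\<^esub> (env_id P (fst \<B>) g)"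
      using Q.iso_CPstar[OF B(2) g, of "snd (snd \<B>)"] A(9) by (simp add: lower_def env_id_def)
    show "t \<B> \<cdot> g \<cdot> (t \<A>)\<^sup>\<dagger> = upper \<A> \<B> \<one>\<^bsub>P\<^esub> (env_id P (fst \<B>) g)"
      by (simp add: upper_def discard_id[OF g(1) B(1)])
  qed simp
qed

lemma rel_idn:
  assumes "sdf \<A>" shows "rel \<A> \<A> (\<i>\<^bsub>P\<^esub> (fst \<A>)) (\<i> (F \<A>))"
proof -
  note A = sdf_simps[OF assms]
  have "rel \<A> \<A> (\<i>\<^bsub>P\<^esub> (fst \<A>)) (t \<A> \<cdot> \<i>\<^bsub>P\<^esub> (fst \<A>) \<cdot> (t \<A>)\<^sup>\<dagger>)"
    by (rule rel_iso[OF assms assms]) (use A(1,2) P.unitary_idn in \<open>auto simp: P.hom_iff\<close>)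
  moreover have "t \<A> \<cdot> \<i>\<^bsub>P\<^esub> (fst \<A>) \<cdot> (t \<A>)\<^sup>\<dagger> = \<i> (F \<A>)"
    using t_simps[OF assms] sub_ob[OF A(1)] t_t_dag[OF assms] by (simp add: sub_ops(6)[OF A(1), symmetric])
  ultimately show ?thesis by simp
qed

end

section \<open>The isomorphism\<close>

text \<open>Tensor products are preserved on the nose, as \<open>F_ten\<close> and
  \<open>F_unit\<close> provide for objects, so the structure maps of the monoidal functor are
  identities.\<close>

locale strict_functor =
  K: compact_dagger_category K + D: compact_dagger_category D
  for K :: "('o, 'a) cdc" and D :: "('p, 'b) cdc" +
  fixes Fo :: "'o \<Rightarrow> 'p" and Fa :: "'a \<Rightarrow> 'b"
  assumes Fo_ob: "A \<in> Ob K \<Longrightarrow> Fo A \<in> Ob D"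
    and Fa_arr: "f \<in> Arr K \<Longrightarrow> Fa f \<in> Arr D"
    and Fa_dom: "f \<in> Arr K \<Longrightarrow> Dom D (Fa f) = Fo (Dom K f)"
    and Fa_cod: "f \<in> Arr K \<Longrightarrow> Cod D (Fa f) = Fo (Cod K f)"
    and Fa_idn: "A \<in> Ob K \<Longrightarrow> Fa (Idn K A) = Idn D (Fo A)"
    and Fa_comp: "\<lbrakk>f \<in> Arr K; g \<in> Arr K; Dom K g = Cod K f\<rbrakk> \<Longrightarrow> Fa (Comp K g f) = Comp D (Fa g) (Fa f)"
    and Fa_dag: "f \<in> Arr K \<Longrightarrow> Fa (Dag K f) = Dag D (Fa f)"
    and Fo_ten: "\<lbrakk>A \<in> Ob K; B \<in> Ob K\<rbrakk> \<Longrightarrow> Fo (TenO K A B) = TenO D (Fo A) (Fo B)"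
    and Fa_ten: "\<lbrakk>f \<in> Arr K; g \<in> Arr K\<rbrakk> \<Longrightarrow> Fa (TenA K f g) = TenA D (Fa f) (Fa g)"
    and Fo_unit: "Fo (Unt K) = Unt D"
    and Fa_assoc: "\<lbrakk>A \<in> Ob K; B \<in> Ob K; E \<in> Ob K\<rbrakk> \<Longrightarrow> Fa (Assoc K A B E) = Assoc D (Fo A) (Fo B) (Fo E)"
    and Fa_lunit: "A \<in> Ob K \<Longrightarrow> Fa (LUnit K A) = LUnit D (Fo A)"
    and Fa_runit: "A \<in> Ob K \<Longrightarrow> Fa (RUnit K A) = RUnit D (Fo A)"
    and Fa_swap: "\<lbrakk>A \<in> Ob K; B \<in> Ob K\<rbrakk> \<Longrightarrow> Fa (Swap K A B) = Swap D (Fo A) (Fo B)"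
begin

lemmas Fs = Fo_ob Fa_arr Fa_dom Fa_cod Fa_idn Fa_comp Fa_dag Fo_ten Fa_ten Fo_unit Fa_assoc Fa_lunit Fa_runit Fa_swap

definition as_functor :: "('o, 'a, 'p, 'b) monoidal_functor" where
  "as_functor = \<lparr>fob = Fo, farr = Fa, fmul = (\<lambda>A B. Idn D (Fo (TenO K A B))), funit = Idn D (Unt D)\<rparr>"

lemma as_functor_simps [simp]:
  "fob as_functor = Fo" "farr as_functor = Fa" "fmul as_functor A B = Idn D (Fo (TenO K A B))" "funit as_functor = Idn D (Unt D)"
  by (simp_all add: as_functor_def)

lemma monoidal_dagger_functor: "monoidal_dagger_functor K D as_functor"
  by unfold_locales
    (auto simp: Fs K.hom_iff D.hom_iff D.unitary_idn)

text \<open>To compute the inverse at an arrow it suffices to exhibit an arrow of \<open>K\<close>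
  with that image; the laws of the given functor provide it.\<close>

lemma strict_inverse:
  assumes o: "bij_betw Fo (Ob K) (Ob D)" and a: "bij_betw Fa (Arr K) (Arr D)"
  shows "strict_functor D K (inv_into (Ob K) Fo) (inv_into (Arr K) Fa)"
proof -
  let ?o = "inv_into (Ob K) Fo" and ?a = "inv_into (Arr K) Fa"
  have o1: "?o A \<in> Ob K" "Fo (?o A) = A" if "A \<in> Ob D" for A
    using o that by (auto simp: bij_betw_def inv_into_into f_inv_into_f)
  have o2: "?o (Fo A) = A" if "A \<in> Ob K" for A using o that by (simp add: bij_betw_inv_into_left)
  have a1: "?a f \<in> Arr K" "Fa (?a f) = f" if "f \<in> Arr D" for f
    using a that by (auto simp: bij_betw_def inv_into_into f_inv_into_f)
  have a2: "?a (Fa f) = f" if "f \<in> Arr K" for f using a that by (simp add: bij_betw_inv_into_left)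
  have eq: "?a g = f" if "f \<in> Arr K" "Fa f = g" for f g using a2 that by auto
  have eqo: "?o B = A" if "A \<in> Ob K" "Fo A = B" for A B using o2 that by auto
  have d: "Dom K (?a f) = ?o (Dom D f)" "Cod K (?a f) = ?o (Cod D f)" if "f \<in> Arr D" for f
    using Fa_dom[OF a1(1)[OF that]] Fa_cod[OF a1(1)[OF that]] a1[OF that] o2[of "Dom K (?a f)"] o2[of "Cod K (?a f)"]
    by auto
  show ?thesis
    by unfold_locales (auto intro!: eq eqo simp: o1 a1 d Fs)
qed

theorem isomorphism:
  assumes o: "bij_betw Fo (Ob K) (Ob D)" and a: "bij_betw Fa (Arr K) (Arr D)"
  shows "\<exists>G. compact_dagger_isomorphism K D G"
proof -
  interpret I: strict_functor D K "inv_into (Ob K) Fo" "inv_into (Arr K) Fa"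
    by (rule strict_inverse[OF o a])
  have l: "inv_into (Ob K) Fo (Fo A) = A" if "A \<in> Ob K" for A using o that by (simp add: bij_betw_inv_into_left)
  have r: "Fo (inv_into (Ob K) Fo A) = A" if "A \<in> Ob D" for A using o that by (simp add: bij_betw_inv_into_right)
  have la: "inv_into (Arr K) Fa (Fa f) = f" if "f \<in> Arr K" for f using a that by (simp add: bij_betw_inv_into_left)
  have ra: "Fa (inv_into (Arr K) Fa f) = f" if "f \<in> Arr D" for f using a that by (simp add: bij_betw_inv_into_right)
  have "is_inverse_functor K D as_functor I.as_functor"
    unfolding is_inverse_functor_def by (simp add: l la Fs I.Fs)
  moreover have "is_inverse_functor D K I.as_functor as_functor"
    unfolding is_inverse_functor_def by (simp add: r ra Fs I.Fs)
  ultimately show ?thesis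
    unfolding compact_dagger_isomorphism_def using monoidal_dagger_functor I.monoidal_dagger_functor by blast
qed

end

section \<open>\<open>CPstar P\<close> as a compact dagger category and its functor to
  \<open>C\<close>\<close>

context decoherence_structure
begin

lemma frob_unit_sdf: "sdf (frob_unit P)"
  by (rule P.frob_unit_frobenius)

lemma frob_dual_unfold:
  assumes "sdf \<A>"
  shows "frob_dual P \<A> = ((fst \<A>)\<^sup>\<star>\<^bsub>P\<^esub>, P.conj_mult (fst \<A>) (fst (snd \<A>)), P.conj_unit (fst \<A>) (snd (snd \<A>)))"
  using P.frob_dual_conj[OF sdf_simps(3,1)[OF assms], of "fst (snd \<A>)"] by simp

lemma frob_dual_fst [simp]: "fst (frob_dual P \<A>) = (fst \<A>)\<^sup>\<star>\<^bsub>P\<^esub>"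
  by (simp add: frob_dual_def split: prod.split)

lemma sdf_dual:
  assumes "sdf \<A>" shows "sdf (frob_dual P \<A>)"
proof -
  interpret Q: frobenius_structure P "fst \<A>" "fst (snd \<A>)" "snd (snd \<A>)"
    by (rule sdf_structure) (use assms in simp)
  show ?thesis unfolding frob_dual_unfold[OF assms] by (rule Q.frobenius_dual)
qed

lemma frob_dual_tensor:
  assumes "sdf \<A>" "sdf \<B>"
  shows "frob_dual P (frob_tensor P \<A> \<B>) = frob_tensor P (frob_dual P \<B>) (frob_dual P \<A>)"
proof -
  note A = sdf_simps[OF assms(1)] and B = sdf_simps[OF assms(2)]
  show ?thesis
    unfolding frob_dual_unfold[OF sdf_tensor[OF assms]] frob_dual_unfold[OF assms(1)] frob_dual_unfold[OF assms(2)]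
    using P.conj_ten[OF A(2) B(2) A(3) B(3) A(1) B(1)] P.dual_ten[OF A(1) B(1)]
    by (cases \<A>; cases \<B>) (simp add: frob_tensor_def)
qed

lemma t_cancel:
  assumes "sdf \<A>" "f \<in> Arr C" "Dom C f = F \<A>"
  shows "f \<cdot> t \<A> \<cdot> (t \<A>)\<^sup>\<dagger> = f"
  using assms t_simps[OF assms(1)] t_t_dag[OF assms(1)] by simp

text \<open>By \<open>rel_iso\<close> the associator of \<open>P\<close> is sent to itself between
  \<open>t\<close> and \<open>t\<^sup>\<dagger>\<close>. Naturality moves it past the maps
  \<open>t\<close> of the three factors, which then cancel against their daggers.\<close>

lemma rel_assoc:
  assumes sdf: "sdf \<A>" "sdf \<B>" "sdf \<D>"
  shows "rel (frob_tensor P (frob_tensor P \<A> \<B>) \<D>) (frob_tensor P \<A> (frob_tensor P \<B> \<D>))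
    (\<alpha>\<^bsub>P\<^esub> (fst \<A>) (fst \<B>) (fst \<D>)) (\<alpha> (F \<A>) (F \<B>) (F \<D>))"
proof -
  let ?S = "frob_tensor P (frob_tensor P \<A> \<B>) \<D>" and ?T = "frob_tensor P \<A> (frob_tensor P \<B> \<D>)"
  note A = sdf_simps[OF sdf(1)] and B = sdf_simps[OF sdf(2)] and D = sdf_simps[OF sdf(3)]
  note s = sdf_tensor[OF sdf(1,2)] sdf_tensor[OF sdf(2,3)]
  note s' = sdf_tensor[OF s(1) sdf(3)] sdf_tensor[OF sdf(1) s(2)]
  have "rel ?S ?T (\<alpha>\<^bsub>P\<^esub> (fst \<A>) (fst \<B>) (fst \<D>)) (t ?T \<cdot> \<alpha>\<^bsub>P\<^esub> (fst \<A>) (fst \<B>) (fst \<D>) \<cdot> (t ?S)\<^sup>\<dagger>)"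
    by (rule rel_iso[OF s']) (use A(1,2) B(1,2) D(1,2) P.assoc_hom P.assoc_unitary P.assoc_mult in simp_all)
  moreover have "t ?T \<cdot> \<alpha>\<^bsub>P\<^esub> (fst \<A>) (fst \<B>) (fst \<D>) = \<alpha> (F \<A>) (F \<B>) (F \<D>) \<cdot> t ?S"
    using C.naturality(1)[OF t_simps(1)[OF sdf(1)] t_simps(1)[OF sdf(2)] t_simps(1)[OF sdf(3)]]
    by (simp add: t_ten sdf s t_simps[OF sdf(1)] t_simps[OF sdf(2)] t_simps[OF sdf(3)] Assoc_eq A(1) B(1) D(1))
  ultimately show ?thesis
    using t_cancel[OF s'(1), of "\<alpha> (F \<A>) (F \<B>) (F \<D>)"] F_ob F_ten sdf s by simp
qed

lemma rel_swap:
  assumes sdf: "sdf \<A>" "sdf \<B>"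
  shows "rel (frob_tensor P \<A> \<B>) (frob_tensor P \<B> \<A>) (\<sigma>\<^bsub>P\<^esub> (fst \<A>) (fst \<B>)) (\<sigma> (F \<A>) (F \<B>))"
proof -
  let ?S = "frob_tensor P \<A> \<B>" and ?T = "frob_tensor P \<B> \<A>"
  note A = sdf_simps[OF sdf(1)] and B = sdf_simps[OF sdf(2)]
  note s = sdf_tensor[OF sdf(1,2)] sdf_tensor[OF sdf(2,1)]
  have "rel ?S ?T (\<sigma>\<^bsub>P\<^esub> (fst \<A>) (fst \<B>)) (t ?T \<cdot> \<sigma>\<^bsub>P\<^esub> (fst \<A>) (fst \<B>) \<cdot> (t ?S)\<^sup>\<dagger>)"
    by (rule rel_iso[OF s]) (use A(1,2) B(1,2) P.swap_hom P.swap_unitary P.swap_mult in simp_all)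
  moreover have "t ?T \<cdot> \<sigma>\<^bsub>P\<^esub> (fst \<A>) (fst \<B>) = \<sigma> (F \<A>) (F \<B>) \<cdot> t ?S"
    using C.naturality(4)[OF t_simps(1)[OF sdf(1)] t_simps(1)[OF sdf(2)]]
    by (simp add: t_ten sdf s t_simps[OF sdf(1)] t_simps[OF sdf(2)] Swap_eq A(1) B(1))
  ultimately show ?thesis
    using t_cancel[OF s(1), of "\<sigma> (F \<A>) (F \<B>)"] F_ob F_ten sdf s by simp
qed

lemma rel_units:
  assumes sdf: "sdf \<A>"
  shows "rel (frob_tensor P (frob_unit P) \<A>) \<A> (\<l>\<^bsub>P\<^esub> (fst \<A>)) (\<l> (F \<A>))"
    and "rel (frob_tensor P \<A> (frob_unit P)) \<A> (\<r>\<^bsub>P\<^esub> (fst \<A>)) (\<r> (F \<A>))"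
proof -
  let ?S = "frob_tensor P (frob_unit P) \<A>" and ?T = "frob_tensor P \<A> (frob_unit P)"
  note A = sdf_simps[OF sdf] and u = frob_unit_sdf
  note s = sdf_tensor[OF u sdf] sdf_tensor[OF sdf u]
  have "rel ?S \<A> (\<l>\<^bsub>P\<^esub> (fst \<A>)) (t \<A> \<cdot> \<l>\<^bsub>P\<^esub> (fst \<A>) \<cdot> (t ?S)\<^sup>\<dagger>)"
    by (rule rel_iso[OF s(1) sdf]) (use A(1,2) P.lunit_hom P.lunit_unitary P.unit_mult in simp_all)
  moreover have "t \<A> \<cdot> \<l>\<^bsub>P\<^esub> (fst \<A>) = \<l> (F \<A>) \<cdot> t ?S"
    using C.naturality(2)[OF t_simps(1)[OF sdf]]
    by (simp add: t_ten sdf u t_unit t_simps[OF sdf] LUnit_eq A(1))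
  ultimately show "rel ?S \<A> (\<l>\<^bsub>P\<^esub> (fst \<A>)) (\<l> (F \<A>))"
    using t_cancel[OF s(1), of "\<l> (F \<A>)"] F_ob F_ten F_unit sdf u by simp
  have "rel ?T \<A> (\<r>\<^bsub>P\<^esub> (fst \<A>)) (t \<A> \<cdot> \<r>\<^bsub>P\<^esub> (fst \<A>) \<cdot> (t ?T)\<^sup>\<dagger>)"
    by (rule rel_iso[OF s(2) sdf]) (use A(1,2) P.runit_hom P.runit_unitary P.unit_mult in simp_all)
  moreover have "t \<A> \<cdot> \<r>\<^bsub>P\<^esub> (fst \<A>) = \<r> (F \<A>) \<cdot> t ?T"
    using C.naturality(3)[OF t_simps(1)[OF sdf]]
    by (simp add: t_ten sdf u t_unit t_simps[OF sdf] RUnit_eq A(1))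
  ultimately show "rel ?T \<A> (\<r>\<^bsub>P\<^esub> (fst \<A>)) (\<r> (F \<A>))"
    using t_cancel[OF s(2), of "\<r> (F \<A>)"] F_ob F_ten F_unit sdf u by simp
qed

text \<open>What is needed is that the unit is an arrow of \<open>CPstar P\<close>, so its image in
  \<open>C\<close> is left existential.\<close>

lemma rel_eta:
  assumes sdf: "sdf \<A>"
  shows "\<exists>h'. rel (frob_unit P) (frob_tensor P (frob_dual P \<A>) \<A>) (\<eta>\<^bsub>P\<^esub> (fst \<A>)) h'"
proof -
  let ?D = "frob_tensor P (frob_dual P \<A>) \<A>" and ?f = "env_id P ((fst \<A>)\<^sup>\<star>\<^bsub>P\<^esub> \<boxtimes>\<^bsub>P\<^esub> fst \<A>) (\<eta>\<^bsub>P\<^esub> (fst \<A>))"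
  note A = sdf_simps[OF sdf]
  interpret Q: frobenius_structure P "fst \<A>" "fst (snd \<A>)" "snd (snd \<A>)"
    by (rule sdf_structure) (use sdf in simp)
  have e: "\<eta>\<^bsub>P\<^esub> (fst \<A>) \<in> hom P \<one>\<^bsub>P\<^esub> ((fst \<A>)\<^sup>\<star>\<^bsub>P\<^esub> \<boxtimes>\<^bsub>P\<^esub> fst \<A>)" using A(1) by (simp add: P.hom_iff)
  have f: "?f \<in> hom P (fst (frob_unit P)) (\<one>\<^bsub>P\<^esub> \<boxtimes>\<^bsub>P\<^esub> fst ?D)"
    using P.env_hom(4)[OF e] A(1) by simp
  have D: "?D = (fst ?D, (P.conj_mult (fst \<A>) (fst (snd \<A>)) \<otimes>\<^bsub>P\<^esub> fst (snd \<A>)) \<cdot>\<^bsub>P\<^esub>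
      middle_swap P ((fst \<A>)\<^sup>\<star>\<^bsub>P\<^esub>) (fst \<A>) ((fst \<A>)\<^sup>\<star>\<^bsub>P\<^esub>) (fst \<A>), snd (snd ?D))"
    by (rule prod_eqI, simp, rule prod_eqI) (simp_all add: frob_dual_unfold[OF sdf])
  have "lower (frob_unit P) ?D \<one>\<^bsub>P\<^esub> ?f = \<eta>\<^bsub>P\<^esub> (fst \<A>)"
    unfolding lower_def
    using Q.eta_CPstar[of "snd (snd ?D)" "\<i>\<^bsub>P\<^esub> \<one>\<^bsub>P\<^esub>"] A(9) D by (simp add: env_id_def frob_unit_def)
  then have "rel (frob_unit P) ?D (\<eta>\<^bsub>P\<^esub> (fst \<A>)) (upper (frob_unit P) ?D \<one>\<^bsub>P\<^esub> ?f)"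
    by (intro relI[OF frob_unit_sdf sdf_tensor[OF sdf_dual[OF sdf] sdf] _ f]) simp_all
  then show ?thesis by blast
qed

text \<open>Being an arrow of \<open>CPstar P\<close>, phrased through \<open>rel\<close>: each
  lemma on \<open>rel\<close> for an operation then yields closure under it here, and most of them
  also yield its preservation by \<open>lift\<close>.\<close>

definition cp :: "('o, 'a) frob \<Rightarrow> ('o, 'a) frob \<Rightarrow> 'a \<Rightarrow> bool" where
  "cp \<A> \<B> h \<longleftrightarrow> (\<exists>h'. rel \<A> \<B> h h')"

lemma cp_sdf: "cp \<A> \<B> h \<Longrightarrow> sdf \<A> \<and> sdf \<B>"
  unfolding cp_def rel_def by blast

lemma cp_hom: "cp \<A> \<B> h \<Longrightarrow> h \<in> hom P (fst \<A>) (fst \<B>)"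
  unfolding cp_def using rel_hom by blast

lemma cp_intros:
  "sdf \<A> \<Longrightarrow> cp \<A> \<A> (\<i>\<^bsub>P\<^esub> (fst \<A>))"
  "cp \<A> \<B> h \<Longrightarrow> cp \<B> \<D> k \<Longrightarrow> cp \<A> \<D> (k \<cdot>\<^bsub>P\<^esub> h)"
  "cp \<A> \<B> h \<Longrightarrow> cp \<B> \<A> (h\<^sup>\<dagger>\<^bsub>P\<^esub>)"
  "cp \<A> \<B> h \<Longrightarrow> cp \<A>' \<B>' k \<Longrightarrow> cp (frob_tensor P \<A> \<A>') (frob_tensor P \<B> \<B>') (h \<otimes>\<^bsub>P\<^esub> k)"
  "sdf \<A> \<Longrightarrow> sdf \<B> \<Longrightarrow> sdf \<D> \<Longrightarrow> cp (frob_tensor P (frob_tensor P \<A> \<B>) \<D>) (frob_tensor P \<A> (frob_tensor P \<B> \<D>))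
    (\<alpha>\<^bsub>P\<^esub> (fst \<A>) (fst \<B>) (fst \<D>))"
  "sdf \<A> \<Longrightarrow> cp (frob_tensor P (frob_unit P) \<A>) \<A> (\<l>\<^bsub>P\<^esub> (fst \<A>))"
  "sdf \<A> \<Longrightarrow> cp (frob_tensor P \<A> (frob_unit P)) \<A> (\<r>\<^bsub>P\<^esub> (fst \<A>))"
  "sdf \<A> \<Longrightarrow> sdf \<B> \<Longrightarrow> cp (frob_tensor P \<A> \<B>) (frob_tensor P \<B> \<A>) (\<sigma>\<^bsub>P\<^esub> (fst \<A>) (fst \<B>))"
  "sdf \<A> \<Longrightarrow> cp (frob_unit P) (frob_tensor P (frob_dual P \<A>) \<A>) (\<eta>\<^bsub>P\<^esub> (fst \<A>))"
  unfolding cp_def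
  subgoal by (rule exI) (rule rel_idn)
  subgoal by (elim exE) (rule exI, rule rel_comp)
  subgoal by (elim exE) (rule exI, rule rel_dag)
  subgoal by (elim exE) (rule exI, rule rel_ten)
  subgoal by (rule exI) (rule rel_assoc)
  subgoal by (rule exI) (rule rel_units)
  subgoal by (rule exI) (rule rel_units)
  subgoal by (rule exI) (rule rel_swap)
  subgoal by (rule rel_eta)
  done

abbreviation "K \<equiv> CPstar P"

lemma K_simps:
  "Ob K = Collect sdf" "Dom K (\<A>, h, \<B>) = \<A>" "Cod K (\<A>, h, \<B>) = \<B>"
  "Idn K \<A> = (\<A>, \<i>\<^bsub>P\<^esub> (fst \<A>), \<A>)" "Comp K (\<B>', k, \<D>) (\<A>, h, \<B>) = (\<A>, k \<cdot>\<^bsub>P\<^esub> h, \<D>)"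
  "Dag K (\<A>, h, \<B>) = (\<B>, h\<^sup>\<dagger>\<^bsub>P\<^esub>, \<A>)" "TenO K \<A> \<B> = frob_tensor P \<A> \<B>"
  "TenA K (\<A>, h, \<B>) (\<A>', h', \<B>') = (frob_tensor P \<A> \<A>', h \<otimes>\<^bsub>P\<^esub> h', frob_tensor P \<B> \<B>')"
  "Unt K = frob_unit P"
  "Assoc K \<A> \<B> \<D> = (frob_tensor P (frob_tensor P \<A> \<B>) \<D>, \<alpha>\<^bsub>P\<^esub> (fst \<A>) (fst \<B>) (fst \<D>), frob_tensor P \<A> (frob_tensor P \<B> \<D>))"
  "LUnit K \<A> = (frob_tensor P (frob_unit P) \<A>, \<l>\<^bsub>P\<^esub> (fst \<A>), \<A>)"
  "RUnit K \<A> = (frob_tensor P \<A> (frob_unit P), \<r>\<^bsub>P\<^esub> (fst \<A>), \<A>)"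
  "Swap K \<A> \<B> = (frob_tensor P \<A> \<B>, \<sigma>\<^bsub>P\<^esub> (fst \<A>) (fst \<B>), frob_tensor P \<B> \<A>)"
  "Dual K \<A> = frob_dual P \<A>"
  "Eta K \<A> = (frob_unit P, \<eta>\<^bsub>P\<^esub> (fst \<A>), frob_tensor P (frob_dual P \<A>) \<A>)"
  by (simp_all add: CPstar_def)

lemma K_arr_triple: "(\<A>, h, \<B>) \<in> Arr K \<longleftrightarrow> cp \<A> \<B> h"
  by (simp add: CPstar_def cp_def rel_def lower_def del: split_paired_Ex) blast

lemma K_arr: "a \<in> Arr K \<longleftrightarrow> (\<exists>\<A> h \<B>. a = (\<A>, h, \<B>) \<and> cp \<A> \<B> h)"
  by (cases a) (simp add: K_arr_triple del: split_paired_Ex)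

lemma K_hom: "a \<in> hom K \<A> \<B> \<longleftrightarrow> (\<exists>h. a = (\<A>, h, \<B>) \<and> cp \<A> \<B> h)"
  by (cases a) (auto simp: hom_def K_arr_triple K_simps)

lemma K_dagger_category: "dagger_category K"
proof
  fix f assume "f \<in> Arr K"
  then obtain \<A> h \<B> where f: "f = (\<A>, h, \<B>)" "cp \<A> \<B> h" by (auto simp: K_arr)
  note s = cp_sdf[OF f(2)] and h = cp_hom[OF f(2)]
  show "Dom K f \<in> Ob K" "Cod K f \<in> Ob K" using s by (simp_all add: f K_simps)
  show "Dag K (Dag K f) = f" using h by (simp add: f K_simps P.hom_iff)
next
  fix \<A> assume "\<A> \<in> Ob K"
  then have A: "sdf \<A>" by (simp add: K_simps)
  show "Idn K \<A> \<in> hom K \<A> \<A>" using A cp_intros(1) by (simp add: K_simps K_hom)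
  show "Dag K (Idn K \<A>) = Idn K \<A>" using sdf_simps(1)[OF A] by (simp add: K_simps)
next
  fix f \<A> \<B> assume "f \<in> hom K \<A> \<B>"
  then obtain h where f: "f = (\<A>, h, \<B>)" "cp \<A> \<B> h" by (auto simp: K_hom)
  note h = cp_hom[OF f(2)]
  show "Dag K f \<in> hom K \<B> \<A>" using cp_intros(3)[OF f(2)] by (simp add: f K_simps K_hom)
  show "Comp K f (Idn K \<A>) = f" "Comp K (Idn K \<B>) f = f" using h by (simp_all add: f K_simps P.hom_iff)
  fix g \<D> assume "g \<in> hom K \<B> \<D>"
  then obtain k where g: "g = (\<B>, k, \<D>)" "cp \<B> \<D> k" by (auto simp: K_hom)
  note k = cp_hom[OF g(2)]
  show "Comp K g f \<in> hom K \<A> \<D>" using cp_intros(2)[OF f(2) g(2)] by (simp add: f g K_simps K_hom)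
  show "Dag K (Comp K g f) = Comp K (Dag K f) (Dag K g)" using h k by (simp add: f g K_simps P.hom_iff)
  fix e \<E> assume "e \<in> hom K \<D> \<E>"
  then obtain l where e: "e = (\<D>, l, \<E>)" "cp \<D> \<E> l" by (auto simp: K_hom)
  show "Comp K (Comp K e g) f = Comp K e (Comp K g f)"
    using h k cp_hom[OF e(2)] by (simp add: f g e K_simps P.hom_iff)
qed

lemma K_symmetric_monoidal: "symmetric_monoidal_dagger_category K"
proof (intro symmetric_monoidal_dagger_category.intro K_dagger_category
    symmetric_monoidal_dagger_category_axioms.intro)
  show "Unt K \<in> Ob K" using frob_unit_sdf by (simp add: K_simps)
next
  fix \<A> assume "\<A> \<in> Ob K"
  then have A: "sdf \<A>" by (simp add: K_simps)
  note a = sdf_simps(1)[OF A]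
  show "LUnit K \<A> \<in> hom K (TenO K (Unt K) \<A>) \<A>" "RUnit K \<A> \<in> hom K (TenO K \<A> (Unt K)) \<A>"
    using cp_intros(6,7)[OF A] by (simp_all add: K_simps K_hom)
  show "unitary K (LUnit K \<A>)" "unitary K (RUnit K \<A>)"
    unfolding unitary_def using cp_intros(6,7)[OF A] a by (simp_all add: K_simps K_arr)
next
  fix \<A> \<B> assume "\<A> \<in> Ob K" "\<B> \<in> Ob K"
  then have A: "sdf \<A>" "sdf \<B>" by (simp_all add: K_simps)
  note a = sdf_simps(1)[OF A(1)] sdf_simps(1)[OF A(2)]
  show "TenO K \<A> \<B> \<in> Ob K" using sdf_tensor A by (simp add: K_simps)
  show "TenA K (Idn K \<A>) (Idn K \<B>) = Idn K (TenO K \<A> \<B>)" using a by (simp add: K_simps)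
  show "Swap K \<A> \<B> \<in> hom K (TenO K \<A> \<B>) (TenO K \<B> \<A>)" using cp_intros(8)[OF A] by (simp add: K_simps K_hom)
  show "unitary K (Swap K \<A> \<B>)" unfolding unitary_def using cp_intros(8)[OF A] a by (simp add: K_simps K_arr)
  show "Comp K (Swap K \<B> \<A>) (Swap K \<A> \<B>) = Idn K (TenO K \<A> \<B>)" using a by (simp add: K_simps)
  show "Comp K (TenA K (Idn K \<A>) (LUnit K \<B>)) (Assoc K \<A> (Unt K) \<B>) = TenA K (RUnit K \<A>) (Idn K \<B>)"
    using P.triangle a by (simp add: K_simps)
  fix \<D> assume "\<D> \<in> Ob K"
  then have D: "sdf \<D>" by (simp add: K_simps)
  note d = sdf_simps(1)[OF D]
  show "Assoc K \<A> \<B> \<D> \<in> hom K (TenO K (TenO K \<A> \<B>) \<D>) (TenO K \<A> (TenO K \<B> \<D>))"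
    using cp_intros(5)[OF A D] by (simp add: K_simps K_hom)
  show "unitary K (Assoc K \<A> \<B> \<D>)" unfolding unitary_def using cp_intros(5)[OF A D] a d by (simp add: K_simps K_arr)
  show "Comp K (Comp K (Assoc K \<B> \<D> \<A>) (Swap K \<A> (TenO K \<B> \<D>))) (Assoc K \<A> \<B> \<D>)
      = Comp K (Comp K (TenA K (Idn K \<B>) (Swap K \<A> \<D>)) (Assoc K \<B> \<A> \<D>)) (TenA K (Swap K \<A> \<B>) (Idn K \<D>))"
    using P.hexagon[OF a d] by (simp add: K_simps del: P.assoc_comp)
  fix \<E> assume "\<E> \<in> Ob K"
  then have e: "fst \<E> \<in> Ob P" using sdf_simps(1) by (simp add: K_simps)
  show "Comp K (Comp K (TenA K (Idn K \<A>) (Assoc K \<B> \<D> \<E>)) (Assoc K \<A> (TenO K \<B> \<D>) \<E>)) (TenA K (Assoc K \<A> \<B> \<D>) (Idn K \<E>))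
     = Comp K (Assoc K \<A> \<B> (TenO K \<D> \<E>)) (Assoc K (TenO K \<A> \<B>) \<D> \<E>)"
    using P.pentagon[OF a d e] by (simp add: K_simps del: P.assoc_comp)
next
  fix f \<A> \<B> assume "f \<in> hom K \<A> \<B>"
  then obtain h where f: "f = (\<A>, h, \<B>)" "cp \<A> \<B> h" by (auto simp: K_hom)
  note h = cp_hom[OF f(2)]
  show "Comp K (LUnit K \<B>) (TenA K (Idn K (Unt K)) f) = Comp K f (LUnit K \<A>)"
    "Comp K (RUnit K \<B>) (TenA K f (Idn K (Unt K))) = Comp K f (RUnit K \<A>)"
    using P.lunit_natural[OF h] P.runit_natural[OF h] by (simp_all add: f K_simps)
  fix g \<A>' \<B>' assume "g \<in> hom K \<A>' \<B>'"
  then obtain k where g: "g = (\<A>', k, \<B>')" "cp \<A>' \<B>' k" by (auto simp: K_hom)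
  note k = cp_hom[OF g(2)]
  show "TenA K f g \<in> hom K (TenO K \<A> \<A>') (TenO K \<B> \<B>')"
    using cp_intros(4)[OF f(2) g(2)] by (simp add: f g K_simps K_hom)
  show "Comp K (Swap K \<B> \<B>') (TenA K f g) = Comp K (TenA K g f) (Swap K \<A> \<A>')"
    using P.swap_natural[OF h k] by (simp add: f g K_simps)
  fix e \<D> \<E> assume "e \<in> hom K \<D> \<E>"
  then obtain l where e: "e = (\<D>, l, \<E>)" "cp \<D> \<E> l" by (auto simp: K_hom)
  show "Comp K (Assoc K \<B> \<B>' \<E>) (TenA K (TenA K f g) e) = Comp K (TenA K f (TenA K g e)) (Assoc K \<A> \<A>' \<D>)"
    using P.assoc_natural[OF h k cp_hom[OF e(2)]] by (simp add: f g e K_simps)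
next
  fix f g assume "f \<in> Arr K" "g \<in> Arr K"
  then obtain \<A> h \<B> \<A>' k \<B>' where f: "f = (\<A>, h, \<B>)" "cp \<A> \<B> h" and g: "g = (\<A>', k, \<B>')" "cp \<A>' \<B>' k"
    by (auto simp: K_arr)
  show "Dag K (TenA K f g) = TenA K (Dag K f) (Dag K g)"
    using cp_hom[OF f(2)] cp_hom[OF g(2)] by (simp add: f g K_simps P.hom_iff)
next
  fix f g f' g' \<A> \<B> \<D> \<A>' \<B>' \<D>'
  assume "f \<in> hom K \<A> \<B>" "g \<in> hom K \<B> \<D>" "f' \<in> hom K \<A>' \<B>'" "g' \<in> hom K \<B>' \<D>'"
  then show "TenA K (Comp K g f) (Comp K g' f') = Comp K (TenA K g g') (TenA K f f')"
    by (auto simp: K_hom K_simps dest!: cp_hom intro!: P.ten_comp)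
qed

lemma K_compact: "compact_dagger_category K"
proof (intro compact_dagger_category.intro K_symmetric_monoidal compact_dagger_category_axioms.intro)
  fix \<A> assume "\<A> \<in> Ob K"
  then have A: "sdf \<A>" by (simp add: K_simps)
  note a = sdf_simps(1)[OF A]
  show "Dual K \<A> \<in> Ob K" using sdf_dual[OF A] by (simp add: K_simps)
  show "Eta K \<A> \<in> hom K (Unt K) (TenO K (Dual K \<A>) \<A>)" using cp_intros(9)[OF A] by (simp add: K_simps K_hom)
  show "Comp K (Comp K (Comp K (Comp K (LUnit K \<A>) (TenA K (cap K \<A>) (Idn K \<A>))) (Dag K (Assoc K \<A> (Dual K \<A>) \<A>)))
      (TenA K (Idn K \<A>) (Eta K \<A>))) (Dag K (RUnit K \<A>)) = Idn K \<A>"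
    using P.snake[OF a] unfolding cap_def counit_def K_simps frob_tensor_simps frob_unit_simps frob_dual_fst by simp
  show "Comp K (Comp K (Comp K (Comp K (RUnit K (Dual K \<A>)) (TenA K (Idn K (Dual K \<A>)) (cap K \<A>))) (Assoc K (Dual K \<A>) \<A> (Dual K \<A>)))
      (TenA K (Eta K \<A>) (Idn K (Dual K \<A>)))) (Dag K (LUnit K (Dual K \<A>))) = Idn K (Dual K \<A>)"
    using P.snake_dual[OF a] unfolding cap_def counit_def K_simps frob_tensor_simps frob_unit_simps frob_dual_fst by simp
next
  fix \<A> \<B> assume "\<A> \<in> Ob K" "\<B> \<in> Ob K"
  then have A: "sdf \<A>" "sdf \<B>" by (simp_all add: K_simps)
  note a = sdf_simps(1)[OF A(1)] sdf_simps(1)[OF A(2)]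
  show 1: "Dual K (TenO K \<A> \<B>) = TenO K (Dual K \<B>) (Dual K \<A>)"
    using frob_dual_tensor[OF A] by (simp add: K_simps)
  show "Eta K (TenO K \<A> \<B>) = Comp K (Comp K (Comp K (Comp K (Dag K (Assoc K (Dual K \<B>) (Dual K \<A>) (TenO K \<A> \<B>)))
      (TenA K (Idn K (Dual K \<B>)) (Assoc K (Dual K \<A>) \<A> \<B>))) (TenA K (Idn K (Dual K \<B>)) (TenA K (Eta K \<A>) (Idn K \<B>))))
      (TenA K (Idn K (Dual K \<B>)) (Dag K (LUnit K \<B>)))) (Eta K \<B>)"
    unfolding K_simps frob_tensor_simps frob_unit_simps frob_dual_fst P.eta_ten[OF a] frob_dual_tensor[OF A] ..
qed

text \<open>The description is legitimate on arrows of \<open>CPstar P\<close> by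
  \<open>rel_unique\<close>, which needs both endpoints; they are part of the argument.\<close>

definition lift :: "('o, 'a) frob \<times> 'a \<times> ('o, 'a) frob \<Rightarrow> 'a" where
  "lift = (\<lambda>(\<A>, h, \<B>). THE h'. rel \<A> \<B> h h')"

lemma lift_eq: "rel \<A> \<B> h h' \<Longrightarrow> lift (\<A>, h, \<B>) = h'"
  unfolding lift_def split_conv by (rule the_equality) (use rel_unique in blast)+

lemma rel_lift: "cp \<A> \<B> h \<Longrightarrow> rel \<A> \<B> h (lift (\<A>, h, \<B>))"
  unfolding cp_def by (elim exE) (simp add: lift_eq)

lemma strict_functor_lift: "strict_functor K C F lift"
proof (intro strict_functor.intro K_compact C.compact_dagger_category_axioms strict_functor_axioms.intro)
  fix f assume "f \<in> Arr K"
  then obtain \<A> h \<B> where f: "f = (\<A>, h, \<B>)" "cp \<A> \<B> h" by (auto simp: K_arr)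
  note r = rel_lift[OF f(2)]
  show "lift f \<in> Arr C" "Dom C (lift f) = F (Dom K f)" "Cod C (lift f) = F (Cod K f)"
    using rel_hom[OF r] by (simp_all add: f K_simps C.hom_iff)
  show "lift (Dag K f) = (lift f)\<^sup>\<dagger>" using lift_eq[OF rel_dag[OF r]] by (simp add: f K_simps)
  fix g assume "g \<in> Arr K"
  then obtain \<A>' k \<B>' where g: "g = (\<A>', k, \<B>')" "cp \<A>' \<B>' k" by (auto simp: K_arr)
  note q = rel_lift[OF g(2)]
  show "lift (TenA K f g) = lift f \<otimes> lift g" using lift_eq[OF rel_ten[OF r q]] by (simp add: f g K_simps)
  assume "Dom K g = Cod K f"
  then have "\<A>' = \<B>" by (simp add: f g K_simps)
  then show "lift (Comp K g f) = lift g \<cdot> lift f" using lift_eq[OF rel_comp[OF r, of \<B>' k "lift g"]] q by (simp add: f g K_simps)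
qed (use F_ob F_ten F_unit lift_eq[OF rel_idn] lift_eq[OF rel_assoc] lift_eq[OF rel_units(1)] lift_eq[OF rel_units(2)]
    lift_eq[OF rel_swap] in \<open>simp_all add: K_simps\<close>)

end

section \<open>Purification and injectivity on objects make the functor bijective\<close>

theorem corollary8:
  fixes C P :: "('o, 'a) cdc"
    and gnd :: "'o \<Rightarrow> 'a"
    and F :: "('o, 'a) frob \<Rightarrow> 'o"
    and t :: "('o, 'a) frob \<Rightarrow> 'a"
  assumes "compact_dagger_category C"
    and "compact_dagger_subcategory C P"
    and "decoherence_structure_with_purification C P gnd F t"
    and "inj_on F {\<A>. special_dagger_frobenius P \<A>}"
  shows "\<exists>G. compact_dagger_isomorphism (CPstar P) C G"
proof -
  interpret decoherence_structure_with_purification C P gnd F t by (rule assms(3))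
  interpret S: strict_functor "CPstar P" C F lift by (rule strict_functor_lift)
  \<comment> \<open>Purification presents \<open>f\<close> as the upper reading of some
    \<open>g\<close>; the lower reading of the same \<open>g\<close> is a preimage.\<close>
  have pur: "\<exists>\<A> h \<B>. rel \<A> \<B> h f" if f: "f \<in> Arr C" for f
  proof -
    obtain \<A> \<B> X g where g: "sdf \<A>" "sdf \<B>" "X \<in> Ob P" "g \<in> hom P (fst \<A>) (TenO C X (fst \<B>))"
      "f = Comp C (Comp C (t \<B>) (discard C gnd X (fst \<B>) g)) (Dag C (t \<A>))"
      using purification[OF f] by blast
    then have "rel \<A> \<B> (lower \<A> \<B> X g) f"
      by (intro relI[of _ _ X g]) (simp_all add: sub_ops sdf_simps upper_def)
    then show ?thesis by blast
  qed
  have "bij_betw F (Ob (CPstar P)) (Ob C)"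
    unfolding bij_betw_def
  proof (intro conjI equalityI subsetI)
    show "inj_on F (Ob (CPstar P))" using assms(4) by (simp add: K_simps)
    show "A \<in> Ob C" if "A \<in> F ` Ob (CPstar P)" for A using that S.Fo_ob by blast
    show "A \<in> F ` Ob (CPstar P)" if A: "A \<in> Ob C" for A
    proof -
      \<comment> \<open>Purifying the identity of \<open>A\<close> yields a structure whose image
        under \<open>F\<close> is the domain of that identity.\<close>
      obtain \<A> h \<B> where r: "rel \<A> \<B> h (Idn C A)" using pur[of "Idn C A"] A by auto
      then have "F \<A> = A" "sdf \<A>" using rel_hom[OF r] A by (auto simp: C.hom_iff rel_def)
      then show ?thesis by (auto simp: K_simps)
    qed
  qed
  moreover have "bij_betw lift (Arr (CPstar P)) (Arr C)"
    unfolding bij_betw_def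
  proof (intro conjI equalityI subsetI inj_onI)
    fix f g assume "f \<in> Arr (CPstar P)" "g \<in> Arr (CPstar P)" and e: "lift f = lift g"
    then obtain \<A> h \<B> \<A>' k \<B>' where f: "f = (\<A>, h, \<B>)" "cp \<A> \<B> h" and g: "g = (\<A>', k, \<B>')" "cp \<A>' \<B>' k"
      by (auto simp: K_arr)
    have r: "rel \<A> \<B> h (lift f)" "rel \<A>' \<B>' k (lift f)"
      using rel_lift[OF f(2)] rel_lift[OF g(2)] e by (simp_all add: f g)
    have "F \<A> = F \<A>'" "F \<B> = F \<B>'" using rel_hom[OF r(1)] rel_hom[OF r(2)] by (auto simp: C.hom_iff)
    \<comment> \<open>The images determine the endpoints only through \<open>F\<close>. Injectivity
      of \<open>F\<close> recovers the structures, after which \<open>rel_unique\<close> compares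
      arrows with common endpoints.\<close>
    then have "\<A> = \<A>'" "\<B> = \<B>'"
      using assms(4) cp_sdf[OF f(2)] cp_sdf[OF g(2)] by (auto dest: inj_onD)
    then show "f = g" using rel_unique[OF r(1), of k "lift f"] r(2) by (simp add: f g)
  next
    show "f \<in> Arr C" if "f \<in> lift ` Arr (CPstar P)" for f using that S.Fa_arr by blast
  next
    fix f assume "f \<in> Arr C"
    then obtain \<A> h \<B> where r: "rel \<A> \<B> h f" using pur by blast
    then have "(\<A>, h, \<B>) \<in> Arr (CPstar P)" by (auto simp: K_arr cp_def)
    with lift_eq[OF r] show "f \<in> lift ` Arr (CPstar P)" by force
  qed
  ultimately show ?thesis by (rule S.isomorphism)
qed

end
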